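(* Let $\varepsilon>0$ and let $f(Z)=\sum_\alpha c_\alpha Z^\alpha$ be a matrix monotone function whose power series converges absolutely and uniformly on $B_{\mathbb C}(0,1+\varepsilon)\subseteq\mathcal M(\mathbb R^d)$. For $i=1,\dots,d$ let $\mathcal H_i$ be the Hilbert space equipped with the inner product $$\langle\alpha\otimes v,\beta\otimes w\rangle_{\mathcal H_i}=w^*c_{\beta^*x_i\alpha}v ,$$ where $\alpha,\beta$ range over all words and $v,w$ over $\mathcal K$. Let $\mathcal H=\bigoplus_i\mathcal H_i$ and let $P_i$ be the projection onto $\mathcal H_i$. Note that $$\langle\alpha\otimes v,\beta\otimes w\rangle_{\mathcal H}=\sum_iw^*c_{\beta^*x_i\alpha}v .$$ Define $A:\mathcal H\to\mathcal H$ by $$A(\alpha\otimes v)=\sum_i(x_i\alpha)\otimes v .$$ Let $Q$ be the map taking $k\in\mathcal K$ to $1\otimes k\in\mathcal H$. Then the operator $A$ is a bounded self-adjoint contraction on $\mathcal H$, and $$f(Z)=a_0+Q^*\Big(A-\sum_iP_iZ_i^{-1}\Big)^{-1}Q ,$$ where $a_0=c_1$ is the constant coefficient of $f$.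
   Context: $\mathbb R^d$ is the real operator system of real diagonal $d\times d$ matrices, so $\mathcal M(\mathbb R^d)$ is the set of $d$-tuples $Z=(Z_1,\dots,Z_d)$ of complex matrices of equal size $n$ ($n$ arbitrary), with norm $\|Z\|=\max_i\|Z_i\|$, and $\mathcal S(\mathbb R^d)$ is the subset of tuples of Hermitian matrices, ordered componentwise. $B_{\mathbb C}(0,r)=\{Z\in\mathcal M(\mathbb R^d):\|Z\|<r\}$ (all sizes), and $B_{\mathbb R}(0,r)=B_{\mathbb C}(0,r)\cap\mathcal S(\mathbb R^d)$. The function $f$ takes values, on Hermitian arguments, in Hermitian matrices over a real operator system $R_2\subseteq\mathcal B(\mathcal K)$, where $\mathcal K$ is a Hilbert space (a real operator system is a real subspace of self-adjoint elements containing $1$). Sums over $\alpha$ run over all words in noncommuting letters $x_1,\dots,x_d$; the empty word is denoted $1$; $c_\alpha\in\mathcal B(\mathcal K)$; $c_\alpha Z^\alpha$ means $c_\alpha\otimes Z^\alpha$. $\beta^*$ denotes the word $\beta$ reversed. Matrix monotone means: for Hermitian tuples $X\le Y$ of the same size in the real domain $B_{\mathbb R}(0,1+\varepsilon)$, $f(X)\le f(Y)$. The Hilbert spaces $\mathcal H_i$ are obtained from the span of the symbols $\alpha\otimes v$ with the given positive semidefinite form, after quotienting by null vectors and completing. In $\mathcal H$, the symbol $\alpha\otimes v$ denotes the element whose component in each $\mathcal H_i$ is $\alpha\otimes v$. Tensor products with the identity are suppressed: $P_iZ_i^{-1}$ means $P_i\otimes Z_i^{-1}$, $A$ means $A\otimes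 I$, $Q$ means $Q\otimes I$, and $a_0$ means $a_0\otimes I$. The realization formula is read for $Z$ in the ball with all $Z_i$ invertible.
   Formalization: Proved as f(Z)=a_0−Q^*(A−Σ P_i Z_i^{-1})^{-1}Q (the printed plus sign fails for f(Z)=Z), with A fixed by A(P_i(α⊗v))=(x_iα)⊗v, since the vectors α⊗v need not span a dense subspace of H and the printed equation then does not determine A. *)

theory Defs
  imports
    "HOL-Analysis.Infinite_Sum"
    "HOL-Library.FuncSet"
    "Jordan_Normal_Form.Gauss_Jordan_Elimination"
    "Jordan_Normal_Form.Schur_Decomposition"
begin

section \<open>Complex (semi-)inner product spaces with explicit carriers\<close>

text \<open>A space extends the module record of HOL-Algebra; as usual for modules, the fields
  \<open>mult\<close> and \<open>one\<close> are irrelevant. The form \<open>ip\<close> is linear in its first argument and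
  conjugate linear in the second, so \<open>ip K (T v) w\<close> is what is written \<open>w\<^sup>* T v\<close>.\<close>

record 'a hspace = "(complex, 'a) module" +
  ip :: "'a \<Rightarrow> 'a \<Rightarrow> complex"

definition hnorm :: "'a hspace \<Rightarrow> 'a \<Rightarrow> real" where
  "hnorm H x = sqrt (Re (ip H x x))"

definition hcauchy :: "'a hspace \<Rightarrow> (nat \<Rightarrow> 'a) \<Rightarrow> bool" where
  "hcauchy H s \<longleftrightarrow> range s \<subseteq> carrier H \<and>
     (\<forall>e>0. \<exists>N. \<forall>m\<ge>N. \<forall>n\<ge>N. hnorm H (s m \<ominus>\<^bsub>H\<^esub> s n) < e)"

locale semi_inner_space = Module.module "class_ring :: complex ring" H for H :: "'a hspace" +
  assumes ip_add: "x \<in> carrier H \<Longrightarrow> y \<in> carrier H \<Longrightarrow> z \<in> carrier H \<Longrightarrow>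
      ip H (x \<oplus>\<^bsub>H\<^esub> y) z = ip H x z + ip H y z"
    and ip_smult: "x \<in> carrier H \<Longrightarrow> z \<in> carrier H \<Longrightarrow> ip H (a \<odot>\<^bsub>H\<^esub> x) z = a * ip H x z"
    and ip_cnj: "x \<in> carrier H \<Longrightarrow> y \<in> carrier H \<Longrightarrow> ip H y x = cnj (ip H x y)"
    and ip_nonneg: "x \<in> carrier H \<Longrightarrow> 0 \<le> Re (ip H x x)"

locale hilbert_space = semi_inner_space +
  assumes ip_definite: "x \<in> carrier H \<Longrightarrow> ip H x x = 0 \<Longrightarrow> x = \<zero>\<^bsub>H\<^esub>"
    and complete: "hcauchy H s \<Longrightarrow>
      \<exists>x\<in>carrier H. (\<lambda>n. hnorm H (s n \<ominus>\<^bsub>H\<^esub> x)) \<longlonglongrightarrow> 0"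

definition hcomplex :: "complex hspace" where
  "hcomplex = \<lparr>carrier = UNIV, mult = (*), one = 1, zero = 0, add = (+), module.smult = (*),
     ip = (\<lambda>z w. z * cnj w)\<rparr>"

text \<open>Direct sum over a finite index set.\<close>

definition hsum :: "'i set \<Rightarrow> ('i \<Rightarrow> 'a hspace) \<Rightarrow> ('i \<Rightarrow> 'a) hspace" where
  "hsum I Hs = \<lparr>carrier = (\<Pi>\<^sub>E i\<in>I. carrier (Hs i)), mult = undefined, one = undefined,
     zero = (\<lambda>i\<in>I. \<zero>\<^bsub>Hs i\<^esub>), add = (\<lambda>x y. \<lambda>i\<in>I. x i \<oplus>\<^bsub>Hs i\<^esub> y i),
     module.smult = (\<lambda>a x. \<lambda>i\<in>I. a \<odot>\<^bsub>Hs i\<^esub> x i),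
     ip = (\<lambda>x y. \<Sum>i\<in>I. ip (Hs i) (x i) (y i))\<rparr>"

definition hproj :: "'i set \<Rightarrow> ('i \<Rightarrow> 'a hspace) \<Rightarrow> 'i \<Rightarrow> ('i \<Rightarrow> 'a) \<Rightarrow> ('i \<Rightarrow> 'a)" where
  "hproj I Hs i = (\<lambda>x\<in>carrier (hsum I Hs). \<lambda>j\<in>I. if j = i then x j else \<zero>\<^bsub>Hs j\<^esub>)"

text \<open>\<open>amp n H\<close> is \<open>H \<otimes> \<complex>\<^sup>n\<close>, realised as the sum of \<open>n\<close> copies of \<open>H\<close>.\<close>

definition amp :: "nat \<Rightarrow> 'a hspace \<Rightarrow> (nat \<Rightarrow> 'a) hspace" where
  "amp n H = hsum {..<n} (\<lambda>_. H)"

text \<open>Hausdorff completion: Cauchy sequences modulo sequences whose difference tends to \<open>0\<close> in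
  seminorm. This divides out the null vectors and completes in one step.\<close>

definition hclass :: "'a hspace \<Rightarrow> (nat \<Rightarrow> 'a) \<Rightarrow> (nat \<Rightarrow> 'a) set" where
  "hclass V s = {t. hcauchy V t \<and> (\<lambda>n. hnorm V (s n \<ominus>\<^bsub>V\<^esub> t n)) \<longlonglongrightarrow> 0}"

definition hrep :: "(nat \<Rightarrow> 'a) set \<Rightarrow> nat \<Rightarrow> 'a" where
  "hrep X = (SOME s. s \<in> X)"

definition hcompletion :: "'a hspace \<Rightarrow> (nat \<Rightarrow> 'a) set hspace" where
  "hcompletion V = \<lparr>carrier = hclass V ` {s. hcauchy V s}, mult = undefined, one = undefined,
     zero = hclass V (\<lambda>_. \<zero>\<^bsub>V\<^esub>),
     add = (\<lambda>X Y. hclass V (\<lambda>n. hrep X n \<oplus>\<^bsub>V\<^esub> hrep Y n)),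
     module.smult = (\<lambda>a X. hclass V (\<lambda>n. a \<odot>\<^bsub>V\<^esub> hrep X n)),
     ip = (\<lambda>X Y. lim (\<lambda>n. ip V (hrep X n) (hrep Y n)))\<rparr>"

definition hembed :: "'a hspace \<Rightarrow> 'a \<Rightarrow> (nat \<Rightarrow> 'a) set" where
  "hembed V x = hclass V (\<lambda>_. x)"


section \<open>Operators\<close>

text \<open>Operators are extensional functions, so two of them are equal iff they agree on the carrier.\<close>

definition bounded_ops :: "'a hspace \<Rightarrow> 'b hspace \<Rightarrow> ('a \<Rightarrow> 'b) set" where
  "bounded_ops H L = {T \<in> carrier H \<rightarrow>\<^sub>E carrier L.
     (\<forall>x\<in>carrier H. \<forall>y\<in>carrier H. T (x \<oplus>\<^bsub>H\<^esub> y) = T x \<oplus>\<^bsub>L\<^esub> T y) \<and>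
     (\<forall>a. \<forall>x\<in>carrier H. T (a \<odot>\<^bsub>H\<^esub> x) = a \<odot>\<^bsub>L\<^esub> T x) \<and>
     (\<exists>C. \<forall>x\<in>carrier H. hnorm L (T x) \<le> C * hnorm H x)}"

definition opnorm :: "'a hspace \<Rightarrow> 'b hspace \<Rightarrow> ('a \<Rightarrow> 'b) \<Rightarrow> real" where
  "opnorm H L T = Inf {C. 0 \<le> C \<and> (\<forall>x\<in>carrier H. hnorm L (T x) \<le> C * hnorm H x)}"

definition self_adjoint :: "'a hspace \<Rightarrow> ('a \<Rightarrow> 'a) \<Rightarrow> bool" where
  "self_adjoint H T \<longleftrightarrow> (\<forall>x\<in>carrier H. \<forall>y\<in>carrier H. ip H (T x) y = ip H x (T y))"

definition hadjoint :: "'a hspace \<Rightarrow> 'b hspace \<Rightarrow> ('a \<Rightarrow> 'b) \<Rightarrow> 'b \<Rightarrow> 'a" where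
  "hadjoint H L T = (\<lambda>y\<in>carrier L.
     THE z. z \<in> carrier H \<and> (\<forall>x\<in>carrier H. ip L (T x) y = ip H x z))"

definition op_le :: "'a hspace \<Rightarrow> ('a \<Rightarrow> 'a) \<Rightarrow> ('a \<Rightarrow> 'a) \<Rightarrow> bool" where
  "op_le H S T \<longleftrightarrow> (\<forall>x\<in>carrier H.
     Im (ip H (T x \<ominus>\<^bsub>H\<^esub> S x) x) = 0 \<and> 0 \<le> Re (ip H (T x \<ominus>\<^bsub>H\<^esub> S x) x))"

definition op_inverse :: "'a hspace \<Rightarrow> ('a \<Rightarrow> 'a) \<Rightarrow> 'a \<Rightarrow> 'a" where
  "op_inverse H T = restrict (inv_into (carrier H) T) (carrier H)"

definition op_invertible :: "'a hspace \<Rightarrow> ('a \<Rightarrow> 'a) \<Rightarrow> bool" where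
  "op_invertible H T \<longleftrightarrow> T \<in> bounded_ops H H \<and> bij_betw T (carrier H) (carrier H) \<and>
     op_inverse H T \<in> bounded_ops H H"

text \<open>\<open>tensor H L n T M\<close> is \<open>T \<otimes> M : H \<otimes> \<complex>\<^sup>n \<rightarrow> L \<otimes> \<complex>\<^sup>n\<close> for an \<open>n \<times> n\<close> matrix \<open>M\<close>.\<close>

definition tensor :: "'a hspace \<Rightarrow> 'b hspace \<Rightarrow> nat \<Rightarrow> ('a \<Rightarrow> 'b) \<Rightarrow> complex mat \<Rightarrow>
    (nat \<Rightarrow> 'a) \<Rightarrow> (nat \<Rightarrow> 'b)" where
  "tensor H L n T M = (\<lambda>\<xi>\<in>carrier (amp n H). \<lambda>i\<in>{..<n}.
     finsum L (\<lambda>j. M $$ (i, j) \<odot>\<^bsub>L\<^esub> T (\<xi> j)) {..<n})"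


section \<open>Real operator systems and matrices over them\<close>

definition real_operator_system :: "'k hspace \<Rightarrow> ('k \<Rightarrow> 'k) set \<Rightarrow> bool" where
  "real_operator_system K R \<longleftrightarrow>
     R \<subseteq> {T \<in> bounded_ops K K. self_adjoint K T} \<and>
     (\<lambda>x\<in>carrier K. x) \<in> R \<and>
     (\<forall>S\<in>R. \<forall>T\<in>R. (\<lambda>x\<in>carrier K. S x \<oplus>\<^bsub>K\<^esub> T x) \<in> R) \<and>
     (\<forall>a::real. \<forall>T\<in>R. (\<lambda>x\<in>carrier K. complex_of_real a \<odot>\<^bsub>K\<^esub> T x) \<in> R)"

definition block_entry :: "'k hspace \<Rightarrow> nat \<Rightarrow> ((nat \<Rightarrow> 'k) \<Rightarrow> (nat \<Rightarrow> 'k)) \<Rightarrow>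
    nat \<Rightarrow> nat \<Rightarrow> 'k \<Rightarrow> 'k" where
  "block_entry K n T i j = (\<lambda>v\<in>carrier K. T (\<lambda>l\<in>{..<n}. if l = j then v else \<zero>\<^bsub>K\<^esub>) i)"

text \<open>Hermitian \<open>n \<times> n\<close> matrices over \<open>R\<close>: the self-adjoint elements of
  \<open>M\<^sub>n(\<complex>) \<otimes>\<^bsub>\<real>\<^esub> R\<close>, that is, those whose entries lie in the complex span \<open>R + \<i>R\<close>.\<close>

definition hermitian_over :: "'k hspace \<Rightarrow> ('k \<Rightarrow> 'k) set \<Rightarrow> nat \<Rightarrow>
    ((nat \<Rightarrow> 'k) \<Rightarrow> (nat \<Rightarrow> 'k)) set" where
  "hermitian_over K R n = {T \<in> bounded_ops (amp n K) (amp n K). self_adjoint (amp n K) T \<and>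
     (\<forall>i<n. \<forall>j<n. \<exists>S\<in>R. \<exists>S'\<in>R.
        block_entry K n T i j = (\<lambda>v\<in>carrier K. S v \<oplus>\<^bsub>K\<^esub> (\<i> \<odot>\<^bsub>K\<^esub> S' v)))}"


section \<open>Tuples of matrices, indexed by a finite type of letters\<close>

definition mat_op :: "nat \<Rightarrow> complex mat \<Rightarrow> (nat \<Rightarrow> complex) \<Rightarrow> (nat \<Rightarrow> complex)" where
  "mat_op n M = tensor hcomplex hcomplex n (\<lambda>z. z) M"

definition mat_norm :: "nat \<Rightarrow> complex mat \<Rightarrow> real" where
  "mat_norm n M = opnorm (amp n hcomplex) (amp n hcomplex) (mat_op n M)"

definition mat_le :: "nat \<Rightarrow> complex mat \<Rightarrow> complex mat \<Rightarrow> bool" where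
  "mat_le n X Y \<longleftrightarrow> op_le (amp n hcomplex) (mat_op n X) (mat_op n Y)"

definition tuple_norm :: "nat \<Rightarrow> ('d::finite \<Rightarrow> complex mat) \<Rightarrow> real" where
  "tuple_norm n Z = Max (range (\<lambda>i. mat_norm n (Z i)))"

text \<open>The level-\<open>n\<close> parts of \<open>B\<^sub>\<complex>(0,r)\<close> and \<open>B\<^sub>\<real>(0,r)\<close>.\<close>

definition ball_C :: "nat \<Rightarrow> real \<Rightarrow> ('d::finite \<Rightarrow> complex mat) set" where
  "ball_C n r = {Z. (\<forall>i. Z i \<in> carrier_mat n n) \<and> tuple_norm n Z < r}"

definition ball_R :: "nat \<Rightarrow> real \<Rightarrow> ('d::finite \<Rightarrow> complex mat) set" where
  "ball_R n r = {Z \<in> ball_C n r. \<forall>i. mat_adjoint (Z i) = Z i}"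


section \<open>Power series and matrix monotonicity\<close>

text \<open>Words are lists of letters: the empty word is \<open>[]\<close> and \<open>\<beta>\<^sup>*\<close> is \<open>rev \<beta>\<close>.\<close>

definition word_pow :: "nat \<Rightarrow> ('d \<Rightarrow> complex mat) \<Rightarrow> 'd list \<Rightarrow> complex mat" where
  "word_pow n Z \<alpha> = foldr (\<lambda>i M. Z i * M) \<alpha> (1\<^sub>m n)"

text \<open>A function \<open>f\<close> is given by its restrictions \<open>f n\<close> to tuples of \<open>n \<times> n\<close> matrices.
  Convergence is uniform over all sizes \<open>n\<close> simultaneously.\<close>

definition power_series_on_ball :: "'k hspace \<Rightarrow> real \<Rightarrow> ('d::finite list \<Rightarrow> 'k \<Rightarrow> 'k) \<Rightarrow>
    (nat \<Rightarrow> ('d \<Rightarrow> complex mat) \<Rightarrow> (nat \<Rightarrow> 'k) \<Rightarrow> (nat \<Rightarrow> 'k)) \<Rightarrow> bool" where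
  "power_series_on_ball K r c f \<longleftrightarrow>
     (\<forall>n. \<forall>Z\<in>ball_C n r. f n Z \<in> bounded_ops (amp n K) (amp n K)) \<and>
     (\<forall>n. \<forall>Z\<in>ball_C n r.
        (\<lambda>\<alpha>. opnorm (amp n K) (amp n K) (tensor K K n (c \<alpha>) (word_pow n Z \<alpha>))) summable_on UNIV) \<and>
     (\<forall>e>0. \<forall>\<^sub>F F in finite_subsets_at_top UNIV. \<forall>n. \<forall>Z\<in>ball_C n r.
        opnorm (amp n K) (amp n K)
          (\<lambda>\<xi>\<in>carrier (amp n K). f n Z \<xi> \<ominus>\<^bsub>amp n K\<^esub>
             finsum (amp n K) (\<lambda>\<alpha>. tensor K K n (c \<alpha>) (word_pow n Z \<alpha>) \<xi>) F) < e)"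

definition matrix_monotone :: "'k hspace \<Rightarrow> real \<Rightarrow>
    (nat \<Rightarrow> ('d::finite \<Rightarrow> complex mat) \<Rightarrow> (nat \<Rightarrow> 'k) \<Rightarrow> (nat \<Rightarrow> 'k)) \<Rightarrow> bool" where
  "matrix_monotone K r f \<longleftrightarrow> (\<forall>n. \<forall>X\<in>ball_R n r. \<forall>Y\<in>ball_R n r.
     (\<forall>i. mat_le n (X i) (Y i)) \<longrightarrow> op_le (amp n K) (f n X) (f n Y))"


section \<open>The spaces and operators of the realization\<close>

text \<open>The span of the symbols \<open>\<alpha> \<otimes> v\<close>: finitely supported \<open>K\<close>-valued functions on words, with
  the sesquilinear form determined by
  \<open>\<langle>\<alpha> \<otimes> v, \<beta> \<otimes> w\<rangle> = w\<^sup>* c(\<beta>\<^sup>* x\<^sub>i \<alpha>) v\<close>. That this form is positive semidefinite is part of the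
  theorem, not of the definition.\<close>

definition word_space :: "'k hspace \<Rightarrow> ('d list \<Rightarrow> 'k \<Rightarrow> 'k) \<Rightarrow> 'd \<Rightarrow> ('d list \<Rightarrow> 'k) hspace" where
  "word_space K c i = \<lparr>
     carrier = {u. range u \<subseteq> carrier K \<and> finite {\<alpha>. u \<alpha> \<noteq> \<zero>\<^bsub>K\<^esub>}},
     mult = undefined, one = undefined,
     zero = (\<lambda>_. \<zero>\<^bsub>K\<^esub>), add = (\<lambda>u w \<alpha>. u \<alpha> \<oplus>\<^bsub>K\<^esub> w \<alpha>), module.smult = (\<lambda>a u \<alpha>. a \<odot>\<^bsub>K\<^esub> u \<alpha>),
     ip = (\<lambda>u w. \<Sum>\<alpha> | u \<alpha> \<noteq> \<zero>\<^bsub>K\<^esub>. \<Sum>\<beta> | w \<beta> \<noteq> \<zero>\<^bsub>K\<^esub>.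
             ip K (c (rev \<beta> @ [i] @ \<alpha>) (u \<alpha>)) (w \<beta>))\<rparr>"

definition H_comp :: "'k hspace \<Rightarrow> ('d list \<Rightarrow> 'k \<Rightarrow> 'k) \<Rightarrow> 'd \<Rightarrow> (nat \<Rightarrow> 'd list \<Rightarrow> 'k) set hspace" where
  "H_comp K c i = hcompletion (word_space K c i)"

definition H_space :: "'k hspace \<Rightarrow> ('d::finite list \<Rightarrow> 'k \<Rightarrow> 'k) \<Rightarrow>
    ('d \<Rightarrow> (nat \<Rightarrow> 'd list \<Rightarrow> 'k) set) hspace" where
  "H_space K c = hsum UNIV (H_comp K c)"

definition H_proj :: "'k hspace \<Rightarrow> ('d::finite list \<Rightarrow> 'k \<Rightarrow> 'k) \<Rightarrow> 'd \<Rightarrow>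
    ('d \<Rightarrow> (nat \<Rightarrow> 'd list \<Rightarrow> 'k) set) \<Rightarrow> ('d \<Rightarrow> (nat \<Rightarrow> 'd list \<Rightarrow> 'k) set)" where
  "H_proj K c = hproj UNIV (H_comp K c)"

text \<open>The element \<open>\<alpha> \<otimes> v\<close> of the direct sum: every component is the class of \<open>\<alpha> \<otimes> v\<close>.\<close>

definition H_symbol :: "'k hspace \<Rightarrow> ('d::finite list \<Rightarrow> 'k \<Rightarrow> 'k) \<Rightarrow> 'd list \<Rightarrow> 'k \<Rightarrow>
    ('d \<Rightarrow> (nat \<Rightarrow> 'd list \<Rightarrow> 'k) set)" where
  "H_symbol K c \<alpha> v = (\<lambda>i. hembed (word_space K c i) ((\<lambda>_. \<zero>\<^bsub>K\<^esub>)(\<alpha> := v)))"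

text \<open>The operator \<open>A\<close>. The elements \<open>\<alpha> \<otimes> v\<close> alone need not span a dense subspace of the direct
  sum, but their components \<open>P\<^sub>i(\<alpha> \<otimes> v)\<close> do. The \<open>i\<close>-th summand of \<open>A(\<alpha> \<otimes> v) = \<Sum>\<^sub>i (x\<^sub>i \<alpha>) \<otimes> v\<close> is
  the image of the \<open>i\<close>-th component of \<open>\<alpha> \<otimes> v\<close>.\<close>

definition is_A :: "'k hspace \<Rightarrow> ('d::finite list \<Rightarrow> 'k \<Rightarrow> 'k) \<Rightarrow>
    (('d \<Rightarrow> (nat \<Rightarrow> 'd list \<Rightarrow> 'k) set) \<Rightarrow> ('d \<Rightarrow> (nat \<Rightarrow> 'd list \<Rightarrow> 'k) set)) \<Rightarrow> bool" where
  "is_A K c A \<longleftrightarrow> A \<in> bounded_ops (H_space K c) (H_space K c) \<and>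
     (\<forall>i \<alpha>. \<forall>v\<in>carrier K. A (H_proj K c i (H_symbol K c \<alpha> v)) = H_symbol K c (i # \<alpha>) v)"

definition Q_op :: "'k hspace \<Rightarrow> ('d::finite list \<Rightarrow> 'k \<Rightarrow> 'k) \<Rightarrow> 'k \<Rightarrow>
    ('d \<Rightarrow> (nat \<Rightarrow> 'd list \<Rightarrow> 'k) set)" where
  "Q_op K c = (\<lambda>k\<in>carrier K. H_symbol K c [] k)"

definition Q_amp :: "nat \<Rightarrow> 'k hspace \<Rightarrow> ('d::finite list \<Rightarrow> 'k \<Rightarrow> 'k) \<Rightarrow> (nat \<Rightarrow> 'k) \<Rightarrow>
    (nat \<Rightarrow> 'd \<Rightarrow> (nat \<Rightarrow> 'd list \<Rightarrow> 'k) set)" where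
  "Q_amp n K c = tensor K (H_space K c) n (Q_op K c) (1\<^sub>m n)"

text \<open>The operator \<open>A \<otimes> I - \<Sum>\<^sub>i P\<^sub>i \<otimes> Z\<^sub>i\<^sup>-\<^sup>1\<close>, for invertible \<open>Z\<^sub>i\<close>.

  Sign convention: with the inner products and the operator \<open>A\<close> above, the realization reads
  \<open>f(Z) = a\<^sub>0 - Q\<^sup>* (A - \<Sum>\<^sub>i P\<^sub>i Z\<^sub>i\<^sup>-\<^sup>1)\<^sup>-\<^sup>1 Q\<close>. The minus sign is necessary: for \<open>f(Z) = Z\<close> in one
  variable the space is \<open>\<complex>\<close>, \<open>A = 0\<close>, \<open>P = Q = 1\<close>, and \<open>Q\<^sup>* (A - P Z\<^sup>-\<^sup>1)\<^sup>-\<^sup>1 Q = -Z\<close>.\<close>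

definition pencil :: "nat \<Rightarrow> 'k hspace \<Rightarrow> ('d::finite list \<Rightarrow> 'k \<Rightarrow> 'k) \<Rightarrow>
    (('d \<Rightarrow> (nat \<Rightarrow> 'd list \<Rightarrow> 'k) set) \<Rightarrow> ('d \<Rightarrow> (nat \<Rightarrow> 'd list \<Rightarrow> 'k) set)) \<Rightarrow>
    ('d \<Rightarrow> complex mat) \<Rightarrow>
    (nat \<Rightarrow> 'd \<Rightarrow> (nat \<Rightarrow> 'd list \<Rightarrow> 'k) set) \<Rightarrow> (nat \<Rightarrow> 'd \<Rightarrow> (nat \<Rightarrow> 'd list \<Rightarrow> 'k) set)" where
  "pencil n K c A Z = (let H = H_space K c in
     (\<lambda>\<xi>\<in>carrier (amp n H). tensor H H n A (1\<^sub>m n) \<xi> \<ominus>\<^bsub>amp n H\<^esub>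
       finsum (amp n H) (\<lambda>i. tensor H H n (H_proj K c i) (the (mat_inverse (Z i))) \<xi>) UNIV))"

end

theory Submission
  imports Defs
begin

text \<open>Scalar tuples show that \<open>\<Sum>\<alpha>. \<parallel>c \<alpha>\<parallel> s ^ length \<alpha>\<close> is finite for every \<open>s\<close> below the radius
  \<open>r = 1 + \<epsilon>\<close> (\<open>coefficient_norms_summable\<close>). This bound makes all
  limits below legitimate.

  Positivity of the forms is read off from monotonicity at small arguments. Let \<open>L\<^sub>j\<close> prepend the
  letter \<open>j\<close> to words, compressed to the words of length at most \<open>N\<close>, let
  \<open>X\<^sub>j = t (L\<^sub>j + L\<^sub>j\<^sup>*)\<close>, and let \<open>Y\<close> be \<open>X\<close> with \<open>t\<close> times the projection onto the empty word added to
  the \<open>i\<close>-th coordinate. Then \<open>X \<le> Y\<close>, so \<open>f(Y) - f(X)\<close> is positive. In \<open>Y\<^sup>w - X\<^sup>w\<close> every term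
  passes through the empty word at an occurrence of \<open>x\<^sub>i\<close> in \<open>w\<close>. Test the difference on a vector whose
  component at the word \<open>a\<close> is \<open>v a\<close> divided by \<open>t ^ length a\<close>. As \<open>t\<close> tends to \<open>0\<close>, only the shortest
  paths from \<open>a\<close> down to the empty word and up again to \<open>b\<close> survive, and they belong to the single word
  \<open>a x\<^sub>i b\<^sup>*\<close>. The difference divided by \<open>t\<close> thus tends to \<open>\<Sum>a b. \<langle>c (a x\<^sub>i b\<^sup>*) v b, v a\<rangle>\<close>, which
  is therefore nonnegative (\<open>monotone_form_nonneg\<close>). This is the form of \<open>\<H>\<^sub>i\<close> up to reversing
  words. Being real on the diagonal, it is Hermitian by polarization.

  Contractivity of \<open>A\<close> comes from the growth of its powers. On the span of the
  symbols, \<open>A\<close> is the map \<open>shift\<close>. It is symmetric because the word \<open>\<gamma>\<^sup>* x\<^sub>j x\<^sub>i \<alpha>\<close> is both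
  \<open>\<gamma>\<^sup>* x\<^sub>j (x\<^sub>i \<alpha>)\<close> and \<open>(x\<^sub>j \<gamma>)\<^sup>* x\<^sub>i \<alpha>\<close>. The words in
  \<open>\<langle>A\<^sup>m u, u\<rangle>\<close> have length greater than \<open>m\<close>, so summability gives \<open>\<bar>\<langle>A\<^sup>m u, u\<rangle>\<bar> \<le> C / s ^ m\<close>
  for every \<open>s\<close> with \<open>1 < s < r\<close>. For a symmetric operator such a bound forces
  \<open>\<parallel>A u\<parallel> \<le> \<parallel>u\<parallel> / s\<close> by repeated use of the Cauchy-Schwarz inequality (\<open>symmetric_power_bound\<close>,
  \<open>shift_contraction\<close>). Hence \<open>A\<close> extends to the completion (\<open>dense_extension\<close>), is self-adjoint, and has
  norm at most \<open>1 / s\<close> for every such \<open>s\<close>.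

  For the realization, write \<open>Z\<close> for \<open>\<Sum>i. P\<^sub>i \<otimes> Z\<^sub>i\<close>, an operator of norm at most \<open>max \<parallel>Z\<^sub>i\<parallel> < r\<close> with
  inverse \<open>\<Sum>i. P\<^sub>i \<otimes> Z\<^sub>i\<^sup>-\<^sup>1\<close>. Then \<open>A - Z\<^sup>-\<^sup>1 = - Z\<^sup>-\<^sup>1 (1 - Z A)\<close> and \<open>\<parallel>Z A\<parallel> < 1\<close>, so the pencil is
  inverted by a Neumann series (\<open>pencil_inverse\<close>):
  \<open>- Q\<^sup>* (A - Z\<^sup>-\<^sup>1)\<^sup>-\<^sup>1 Q = \<Sum>m. Q\<^sup>* (Z A)\<^sup>m Z Q\<close>. The partial sums are explicit combinations of symbols
  (\<open>series_partial_step\<close>), and pairing them with \<open>Q \<eta>\<close> gives the partial sums of \<open>f(Z) - c\<^sub>1\<close> by word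
  length (\<open>Q_partial_ip\<close>, \<open>realization_formula\<close>).\<close>

section \<open>Semi-inner product spaces\<close>

text \<open>Additive inverses need no separate axiom: \<open>(-1) x\<close> is one, because \<open>0 x = 0\<close> is among the
  premises.\<close>

lemma semi_inner_spaceI:
  fixes H :: "'a hspace"
  assumes add: "\<And>x y. x \<in> carrier H \<Longrightarrow> y \<in> carrier H \<Longrightarrow> x \<oplus>\<^bsub>H\<^esub> y \<in> carrier H"
    and zero: "\<zero>\<^bsub>H\<^esub> \<in> carrier H"
    and assoc: "\<And>x y z. x \<in> carrier H \<Longrightarrow> y \<in> carrier H \<Longrightarrow> z \<in> carrier H \<Longrightarrow>
      (x \<oplus>\<^bsub>H\<^esub> y) \<oplus>\<^bsub>H\<^esub> z = x \<oplus>\<^bsub>H\<^esub> (y \<oplus>\<^bsub>H\<^esub> z)"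
    and comm: "\<And>x y. x \<in> carrier H \<Longrightarrow> y \<in> carrier H \<Longrightarrow> x \<oplus>\<^bsub>H\<^esub> y = y \<oplus>\<^bsub>H\<^esub> x"
    and l_zero: "\<And>x. x \<in> carrier H \<Longrightarrow> \<zero>\<^bsub>H\<^esub> \<oplus>\<^bsub>H\<^esub> x = x"
    and smult: "\<And>a x. x \<in> carrier H \<Longrightarrow> a \<odot>\<^bsub>H\<^esub> x \<in> carrier H"
    and l_distr: "\<And>a b x. x \<in> carrier H \<Longrightarrow> (a + b) \<odot>\<^bsub>H\<^esub> x = a \<odot>\<^bsub>H\<^esub> x \<oplus>\<^bsub>H\<^esub> b \<odot>\<^bsub>H\<^esub> x"
    and r_distr: "\<And>a x y. x \<in> carrier H \<Longrightarrow> y \<in> carrier H \<Longrightarrow>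
      a \<odot>\<^bsub>H\<^esub> (x \<oplus>\<^bsub>H\<^esub> y) = a \<odot>\<^bsub>H\<^esub> x \<oplus>\<^bsub>H\<^esub> a \<odot>\<^bsub>H\<^esub> y"
    and sassoc: "\<And>a b x. x \<in> carrier H \<Longrightarrow> (a * b) \<odot>\<^bsub>H\<^esub> x = a \<odot>\<^bsub>H\<^esub> (b \<odot>\<^bsub>H\<^esub> x)"
    and one: "\<And>x. x \<in> carrier H \<Longrightarrow> 1 \<odot>\<^bsub>H\<^esub> x = x"
    and null: "\<And>x. x \<in> carrier H \<Longrightarrow> 0 \<odot>\<^bsub>H\<^esub> x = \<zero>\<^bsub>H\<^esub>"
    and ip: "\<And>x y z. x \<in> carrier H \<Longrightarrow> y \<in> carrier H \<Longrightarrow> z \<in> carrier H \<Longrightarrow>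
      ip H (x \<oplus>\<^bsub>H\<^esub> y) z = ip H x z + ip H y z"
      "\<And>x z a. x \<in> carrier H \<Longrightarrow> z \<in> carrier H \<Longrightarrow> ip H (a \<odot>\<^bsub>H\<^esub> x) z = a * ip H x z"
      "\<And>x y. x \<in> carrier H \<Longrightarrow> y \<in> carrier H \<Longrightarrow> ip H y x = cnj (ip H x y)"
      "\<And>x. x \<in> carrier H \<Longrightarrow> 0 \<le> Re (ip H x x)"
  shows "semi_inner_space H"
proof -
  have ag: "abelian_group H"
  proof (rule abelian_groupI)
    fix x assume x: "x \<in> carrier H"
    have "(-1) \<odot>\<^bsub>H\<^esub> x \<oplus>\<^bsub>H\<^esub> x = ((-1) + 1) \<odot>\<^bsub>H\<^esub> x"
      using l_distr[OF x, of "-1" 1] one[OF x] by simp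
    then have "(-1) \<odot>\<^bsub>H\<^esub> x \<oplus>\<^bsub>H\<^esub> x = \<zero>\<^bsub>H\<^esub>" using null[OF x] by simp
    then show "\<exists>y\<in>carrier H. y \<oplus>\<^bsub>H\<^esub> x = \<zero>\<^bsub>H\<^esub>" using smult[OF x] by blast
  qed (fact add zero assoc comm l_zero)+
  have "Module.module (class_ring :: complex ring) H"
    by (rule moduleI[OF class_cring.is_cring ag], unfold class_ring_simps)
      (assumption | rule smult l_distr r_distr sassoc one)+
  then show ?thesis using ip
    by (intro semi_inner_space.intro semi_inner_space_axioms.intro) blast+
qed

context semi_inner_space
begin

lemma scale_closed [simp, intro]: "x \<in> carrier H \<Longrightarrow> a \<odot>\<^bsub>H\<^esub> x \<in> carrier H"
  using smult_closed[of a x] by (simp add: class_ring_simps)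

lemma scale_add_left: "x \<in> carrier H \<Longrightarrow> (a + b) \<odot>\<^bsub>H\<^esub> x = a \<odot>\<^bsub>H\<^esub> x \<oplus>\<^bsub>H\<^esub> b \<odot>\<^bsub>H\<^esub> x"
  using smult_l_distr[of a b x] by (simp add: class_ring_simps)

lemma scale_add_right: "x \<in> carrier H \<Longrightarrow> y \<in> carrier H \<Longrightarrow>
    a \<odot>\<^bsub>H\<^esub> (x \<oplus>\<^bsub>H\<^esub> y) = a \<odot>\<^bsub>H\<^esub> x \<oplus>\<^bsub>H\<^esub> a \<odot>\<^bsub>H\<^esub> y"
  using smult_r_distr[of a x y] by (simp add: class_ring_simps)

lemma scale_scale: "x \<in> carrier H \<Longrightarrow> a \<odot>\<^bsub>H\<^esub> (b \<odot>\<^bsub>H\<^esub> x) = (a * b) \<odot>\<^bsub>H\<^esub> x"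
  using smult_assoc1[of a b x] by (simp add: class_ring_simps)

lemma scale_one [simp]: "x \<in> carrier H \<Longrightarrow> 1 \<odot>\<^bsub>H\<^esub> x = x"
  using smult_one[of x] by (simp add: class_ring_simps)

lemma scale_zero_left [simp]: "x \<in> carrier H \<Longrightarrow> 0 \<odot>\<^bsub>H\<^esub> x = \<zero>\<^bsub>H\<^esub>"
  using smult_l_null[of x] by (simp add: class_ring_simps)

lemma scale_zero_right [simp]: "a \<odot>\<^bsub>H\<^esub> \<zero>\<^bsub>H\<^esub> = \<zero>\<^bsub>H\<^esub>"
  using smult_r_null[of a] by (simp add: class_ring_simps)

lemma uminus_eq_scale: "x \<in> carrier H \<Longrightarrow> \<ominus>\<^bsub>H\<^esub> x = (-1) \<odot>\<^bsub>H\<^esub> x"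
proof -
  assume x: "x \<in> carrier H"
  have "(-1) \<odot>\<^bsub>H\<^esub> x \<oplus>\<^bsub>H\<^esub> x = ((-1) + 1) \<odot>\<^bsub>H\<^esub> x"
    using x scale_add_left[of x "-1" 1] by (simp del: add.left_inverse)
  then show ?thesis using x by (intro minus_equality) auto
qed

lemma minus_eq_scale: "x \<in> carrier H \<Longrightarrow> y \<in> carrier H \<Longrightarrow> x \<ominus>\<^bsub>H\<^esub> y = x \<oplus>\<^bsub>H\<^esub> (-1) \<odot>\<^bsub>H\<^esub> y"
  by (simp add: a_minus_def uminus_eq_scale)

lemma ip_add_right: "x \<in> carrier H \<Longrightarrow> y \<in> carrier H \<Longrightarrow> z \<in> carrier H \<Longrightarrow>
    ip H x (y \<oplus>\<^bsub>H\<^esub> z) = ip H x y + ip H x z"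
  by (subst (1 2 3) ip_cnj) (auto simp: ip_add)

lemma ip_smult_right: "x \<in> carrier H \<Longrightarrow> y \<in> carrier H \<Longrightarrow> ip H x (a \<odot>\<^bsub>H\<^esub> y) = cnj a * ip H x y"
  by (subst (1 2) ip_cnj) (auto simp: ip_smult)

lemma ip_zero_left [simp]: "z \<in> carrier H \<Longrightarrow> ip H \<zero>\<^bsub>H\<^esub> z = 0"
  using ip_smult[of "\<zero>\<^bsub>H\<^esub>" z 0] by simp

lemma ip_zero_right [simp]: "z \<in> carrier H \<Longrightarrow> ip H z \<zero>\<^bsub>H\<^esub> = 0"
  using ip_smult_right[of z "\<zero>\<^bsub>H\<^esub>" 0] by simp

lemma ip_uminus_left: "x \<in> carrier H \<Longrightarrow> z \<in> carrier H \<Longrightarrow> ip H (\<ominus>\<^bsub>H\<^esub> x) z = - ip H x z"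
  by (simp add: uminus_eq_scale ip_smult)

lemma ip_uminus_right: "x \<in> carrier H \<Longrightarrow> z \<in> carrier H \<Longrightarrow> ip H z (\<ominus>\<^bsub>H\<^esub> x) = - ip H z x"
  by (simp add: uminus_eq_scale ip_smult_right)

lemma ip_minus_left: "x \<in> carrier H \<Longrightarrow> y \<in> carrier H \<Longrightarrow> z \<in> carrier H \<Longrightarrow>
    ip H (x \<ominus>\<^bsub>H\<^esub> y) z = ip H x z - ip H y z"
  by (simp add: a_minus_def ip_add ip_uminus_left)

lemma ip_minus_right: "x \<in> carrier H \<Longrightarrow> y \<in> carrier H \<Longrightarrow> z \<in> carrier H \<Longrightarrow>
    ip H z (x \<ominus>\<^bsub>H\<^esub> y) = ip H z x - ip H z y"
  by (simp add: a_minus_def ip_add_right ip_uminus_right)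

lemmas ip_linear = ip_add ip_add_right ip_smult ip_smult_right ip_uminus_left ip_uminus_right
  ip_minus_left ip_minus_right

lemma ip_finsum_left:
  assumes "finite A" "\<And>a. a \<in> A \<Longrightarrow> g a \<in> carrier H" "z \<in> carrier H"
  shows "ip H (finsum H g A) z = (\<Sum>a\<in>A. ip H (g a) z)"
  using assms
proof (induction A rule: finite_induct)
  case (insert a F)
  then have "finsum H g (insert a F) = g a \<oplus>\<^bsub>H\<^esub> finsum H g F"
    by (intro finsum_insert) auto
  then show ?case using insert by (simp add: ip_add finsum_closed Pi_def)
qed simp

lemma ip_finsum_right:
  assumes "finite A" "\<And>a. a \<in> A \<Longrightarrow> g a \<in> carrier H" "z \<in> carrier H"
  shows "ip H z (finsum H g A) = (\<Sum>a\<in>A. ip H z (g a))"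
proof -
  have fc: "finsum H g A \<in> carrier H" using assms by (intro finsum_closed) auto
  have "ip H z (finsum H g A) = cnj (\<Sum>a\<in>A. ip H (g a) z)"
    by (simp only: ip_cnj[OF fc assms(3)] ip_finsum_left[OF assms])
  also have "\<dots> = (\<Sum>a\<in>A. cnj (ip H (g a) z))" by simp
  also have "\<dots> = (\<Sum>a\<in>A. ip H z (g a))"
    by (intro sum.cong refl ip_cnj[symmetric] assms)
  finally show ?thesis .
qed

lemma ip_self_Im: "x \<in> carrier H \<Longrightarrow> Im (ip H x x) = 0"
  using arg_cong[OF ip_cnj[of x x], of Im] by simp

lemma hnorm_sq: "x \<in> carrier H \<Longrightarrow> (hnorm H x)\<^sup>2 = Re (ip H x x)"
  by (simp add: hnorm_def ip_nonneg)

lemma ip_self: "x \<in> carrier H \<Longrightarrow> ip H x x = complex_of_real ((hnorm H x)\<^sup>2)"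
  by (simp add: complex_eq_iff hnorm_sq ip_self_Im del: of_real_power)

lemma hnorm_nonneg [simp]: "x \<in> carrier H \<Longrightarrow> 0 \<le> hnorm H x"
  by (simp add: hnorm_def ip_nonneg)

lemma hnorm_zero [simp]: "hnorm H \<zero>\<^bsub>H\<^esub> = 0"
  by (simp add: hnorm_def)

lemma hnorm_smult: "x \<in> carrier H \<Longrightarrow> hnorm H (a \<odot>\<^bsub>H\<^esub> x) = cmod a * hnorm H x"
proof -
  assume x: "x \<in> carrier H"
  have "ip H (a \<odot>\<^bsub>H\<^esub> x) (a \<odot>\<^bsub>H\<^esub> x) = (a * cnj a) * ip H x x"
    using x by (simp add: ip_smult ip_smult_right)
  also have "\<dots> = complex_of_real ((cmod a * hnorm H x)\<^sup>2)"
    using x by (simp add: ip_self power_mult_distrib complex_mult_cnj cmod_power2)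
  finally have "(hnorm H (a \<odot>\<^bsub>H\<^esub> x))\<^sup>2 = (cmod a * hnorm H x)\<^sup>2"
    using hnorm_sq[of "a \<odot>\<^bsub>H\<^esub> x"] x by (simp only: scale_closed Re_complex_of_real)
  then show ?thesis by (rule power2_eq_imp_eq) (use x in auto)
qed

lemma cauchy_schwarz:
  assumes x: "x \<in> carrier H" and y: "y \<in> carrier H"
  shows "cmod (ip H x y) \<le> hnorm H x * hnorm H y"
proof -
  let ?c = "ip H x y" and ?a = "(hnorm H x)\<^sup>2" and ?b = "(hnorm H y)\<^sup>2"
  have key: "0 \<le> ?a - 2 * s * (cmod ?c)\<^sup>2 + s\<^sup>2 * (cmod ?c)\<^sup>2 * ?b" for s :: real
  proof -
    let ?z = "x \<ominus>\<^bsub>H\<^esub> (complex_of_real s * ?c) \<odot>\<^bsub>H\<^esub> y"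
    have "ip H ?z ?z = ip H x x - complex_of_real s * (2 * (?c * cnj ?c))
        + (complex_of_real s)\<^sup>2 * (?c * cnj ?c) * ip H y y"
      using x y by (simp add: ip_linear ip_cnj[OF x y] algebra_simps power2_eq_square)
    also have "\<dots> = complex_of_real (?a - 2 * s * (cmod ?c)\<^sup>2 + s\<^sup>2 * (cmod ?c)\<^sup>2 * ?b)"
      using x y by (simp add: ip_self complex_norm_square[symmetric])
    finally show ?thesis using ip_nonneg[of ?z] x y by (simp del: of_real_power)
  qed
  have "(cmod ?c)\<^sup>2 \<le> ?a * ?b"
  proof (cases "?b = 0")
    case True
    show ?thesis
    proof (cases "?c = 0")
      case False
      then have "2 * ((?a + 1) / (2 * (cmod ?c)\<^sup>2)) * (cmod ?c)\<^sup>2 = ?a + 1" by simp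
      then show ?thesis using key[of "(?a + 1) / (2 * (cmod ?c)\<^sup>2)"] True by simp
    qed simp
  next
    case False
    then have "?b > 0" by (simp add: zero_less_power2)
    then have "(1 / ?b)\<^sup>2 * (cmod ?c)\<^sup>2 * ?b = (1 / ?b) * (cmod ?c)\<^sup>2"
      by (simp add: power2_eq_square)
    then have "0 \<le> ?a - (cmod ?c)\<^sup>2 / ?b" using key[of "1 / ?b"] by simp
    then show ?thesis using \<open>?b > 0\<close> by (simp add: field_simps)
  qed
  then have "(cmod ?c)\<^sup>2 \<le> (hnorm H x * hnorm H y)\<^sup>2" by (simp add: power_mult_distrib)
  then show ?thesis using x y by (simp add: power2_le_iff_abs_le)
qed

lemma hnorm_add_le:
  assumes x: "x \<in> carrier H" and y: "y \<in> carrier H"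
  shows "hnorm H (x \<oplus>\<^bsub>H\<^esub> y) \<le> hnorm H x + hnorm H y"
proof -
  have "(hnorm H (x \<oplus>\<^bsub>H\<^esub> y))\<^sup>2 = (hnorm H x)\<^sup>2 + (hnorm H y)\<^sup>2 + 2 * Re (ip H x y)"
    using x y by (simp add: hnorm_sq ip_linear ip_cnj[OF x y])
  also have "\<dots> \<le> (hnorm H x + hnorm H y)\<^sup>2"
    using cauchy_schwarz[OF x y] complex_Re_le_cmod[of "ip H x y"]
    by (simp add: power2_eq_square algebra_simps)
  finally show ?thesis using x y by (simp add: power2_le_iff_abs_le)
qed

lemma hnorm_uminus [simp]: "x \<in> carrier H \<Longrightarrow> hnorm H (\<ominus>\<^bsub>H\<^esub> x) = hnorm H x"
  by (simp add: uminus_eq_scale hnorm_smult)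

lemma hnorm_minus_le: "x \<in> carrier H \<Longrightarrow> y \<in> carrier H \<Longrightarrow> hnorm H (x \<ominus>\<^bsub>H\<^esub> y) \<le> hnorm H x + hnorm H y"
  using hnorm_add_le[of x "\<ominus>\<^bsub>H\<^esub> y"] by (simp add: a_minus_def)

lemma hnorm_minus_commute: "x \<in> carrier H \<Longrightarrow> y \<in> carrier H \<Longrightarrow> hnorm H (x \<ominus>\<^bsub>H\<^esub> y) = hnorm H (y \<ominus>\<^bsub>H\<^esub> x)"
  by (simp add: hnorm_def ip_linear)

lemma hnorm_minus_triangle:
  assumes "x \<in> carrier H" "y \<in> carrier H" "z \<in> carrier H"
  shows "hnorm H (x \<ominus>\<^bsub>H\<^esub> z) \<le> hnorm H (x \<ominus>\<^bsub>H\<^esub> y) + hnorm H (y \<ominus>\<^bsub>H\<^esub> z)"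
proof -
  have "hnorm H (x \<ominus>\<^bsub>H\<^esub> z) = hnorm H ((x \<ominus>\<^bsub>H\<^esub> y) \<oplus>\<^bsub>H\<^esub> (y \<ominus>\<^bsub>H\<^esub> z))"
    using assms by (simp add: hnorm_def ip_linear)
  then show ?thesis using hnorm_add_le[of "x \<ominus>\<^bsub>H\<^esub> y" "y \<ominus>\<^bsub>H\<^esub> z"] assms by simp
qed

lemma hnorm_minus_zero: "x \<in> carrier H \<Longrightarrow> hnorm H (x \<ominus>\<^bsub>H\<^esub> \<zero>\<^bsub>H\<^esub>) = hnorm H x"
  by (simp add: hnorm_def ip_linear)

lemma hnorm_abs_diff_le:
  assumes "x \<in> carrier H" "y \<in> carrier H"
  shows "\<bar>hnorm H x - hnorm H y\<bar> \<le> hnorm H (x \<ominus>\<^bsub>H\<^esub> y)"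
  using hnorm_minus_triangle[OF assms zero_closed]
    hnorm_minus_triangle[OF assms(2,1) zero_closed]
    hnorm_minus_commute[OF assms] hnorm_minus_zero[OF assms(1)] hnorm_minus_zero[OF assms(2)]
  by linarith

lemma hnorm_diff_add_le:
  assumes "x \<in> carrier H" "x' \<in> carrier H" "y \<in> carrier H" "y' \<in> carrier H"
  shows "hnorm H ((x \<oplus>\<^bsub>H\<^esub> y) \<ominus>\<^bsub>H\<^esub> (x' \<oplus>\<^bsub>H\<^esub> y')) \<le> hnorm H (x \<ominus>\<^bsub>H\<^esub> x') + hnorm H (y \<ominus>\<^bsub>H\<^esub> y')"
proof -
  have "hnorm H ((x \<oplus>\<^bsub>H\<^esub> y) \<ominus>\<^bsub>H\<^esub> (x' \<oplus>\<^bsub>H\<^esub> y')) = hnorm H ((x \<ominus>\<^bsub>H\<^esub> x') \<oplus>\<^bsub>H\<^esub> (y \<ominus>\<^bsub>H\<^esub> y'))"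
    using assms by (simp add: hnorm_def ip_linear algebra_simps)
  then show ?thesis using hnorm_add_le[of "x \<ominus>\<^bsub>H\<^esub> x'" "y \<ominus>\<^bsub>H\<^esub> y'"] assms by simp
qed

lemma hnorm_diff_smult:
  assumes "x \<in> carrier H" "y \<in> carrier H"
  shows "hnorm H (a \<odot>\<^bsub>H\<^esub> x \<ominus>\<^bsub>H\<^esub> a \<odot>\<^bsub>H\<^esub> y) = cmod a * hnorm H (x \<ominus>\<^bsub>H\<^esub> y)"
proof -
  have "hnorm H (a \<odot>\<^bsub>H\<^esub> x \<ominus>\<^bsub>H\<^esub> a \<odot>\<^bsub>H\<^esub> y) = hnorm H (a \<odot>\<^bsub>H\<^esub> (x \<ominus>\<^bsub>H\<^esub> y))"
    using assms by (simp add: hnorm_def ip_linear algebra_simps)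
  then show ?thesis using hnorm_smult[of "x \<ominus>\<^bsub>H\<^esub> y" a] assms by simp
qed

lemma hnorm_finsum_le:
  assumes "finite A" "\<And>a. a \<in> A \<Longrightarrow> g a \<in> carrier H"
  shows "hnorm H (finsum H g A) \<le> (\<Sum>a\<in>A. hnorm H (g a))"
  using assms
proof (induction A rule: finite_induct)
  case (insert a F)
  then have "finsum H g (insert a F) = g a \<oplus>\<^bsub>H\<^esub> finsum H g F"
    by (intro finsum_insert) auto
  moreover have "finsum H g F \<in> carrier H" using insert by (intro finsum_closed) auto
  ultimately show ?case
    using hnorm_add_le[of "g a" "finsum H g F"] insert by fastforce
qed simp

lemma ip_diff_le:
  assumes "x \<in> carrier H" "x' \<in> carrier H" "y \<in> carrier H" "y' \<in> carrier H"
  shows "cmod (ip H x y - ip H x' y') \<le>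
    hnorm H (x \<ominus>\<^bsub>H\<^esub> x') * hnorm H y + hnorm H x' * hnorm H (y \<ominus>\<^bsub>H\<^esub> y')"
proof -
  have eq: "ip H x y - ip H x' y' = ip H (x \<ominus>\<^bsub>H\<^esub> x') y + ip H x' (y \<ominus>\<^bsub>H\<^esub> y')"
    using assms by (simp add: ip_linear)
  show ?thesis unfolding eq
    using norm_triangle_ineq[of "ip H (x \<ominus>\<^bsub>H\<^esub> x') y" "ip H x' (y \<ominus>\<^bsub>H\<^esub> y')"]
      cauchy_schwarz[OF minus_closed[OF assms(1,2)] assms(3)]
      cauchy_schwarz[OF assms(2) minus_closed[OF assms(3,4)]] by linarith
qed

lemma ip_tendsto:
  assumes s: "\<And>n. s n \<in> carrier H" and t: "\<And>n. t n \<in> carrier H"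
    and x: "x \<in> carrier H" and y: "y \<in> carrier H"
    and sx: "(\<lambda>n. hnorm H (s n \<ominus>\<^bsub>H\<^esub> x)) \<longlonglongrightarrow> 0" and ty: "(\<lambda>n. hnorm H (t n \<ominus>\<^bsub>H\<^esub> y)) \<longlonglongrightarrow> 0"
  shows "(\<lambda>n. ip H (s n) (t n)) \<longlonglongrightarrow> ip H x y"
proof -
  have bound: "cmod (ip H (s n) (t n) - ip H x y) \<le>
      hnorm H (s n \<ominus>\<^bsub>H\<^esub> x) * (hnorm H y + hnorm H (t n \<ominus>\<^bsub>H\<^esub> y)) + hnorm H x * hnorm H (t n \<ominus>\<^bsub>H\<^esub> y)" for n
  proof -
    have "hnorm H (t n) \<le> hnorm H y + hnorm H (t n \<ominus>\<^bsub>H\<^esub> y)"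
      using hnorm_abs_diff_le[OF t y, of n] by linarith
    then have "hnorm H (s n \<ominus>\<^bsub>H\<^esub> x) * hnorm H (t n) \<le>
        hnorm H (s n \<ominus>\<^bsub>H\<^esub> x) * (hnorm H y + hnorm H (t n \<ominus>\<^bsub>H\<^esub> y))"
      by (rule mult_left_mono) (simp add: s x)
    then show ?thesis using ip_diff_le[OF s[of n] x t[of n] y] by linarith
  qed
  have "(\<lambda>n. hnorm H (s n \<ominus>\<^bsub>H\<^esub> x) * (hnorm H y + hnorm H (t n \<ominus>\<^bsub>H\<^esub> y)) + hnorm H x * hnorm H (t n \<ominus>\<^bsub>H\<^esub> y))
      \<longlonglongrightarrow> 0 * (hnorm H y + 0) + hnorm H x * 0"
    by (intro tendsto_intros sx ty)
  then have lim: "(\<lambda>n. hnorm H (s n \<ominus>\<^bsub>H\<^esub> x) * (hnorm H y + hnorm H (t n \<ominus>\<^bsub>H\<^esub> y))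
      + hnorm H x * hnorm H (t n \<ominus>\<^bsub>H\<^esub> y)) \<longlonglongrightarrow> 0" by simp
  show ?thesis
    by (rule LIM_zero_cancel, rule metric_tendsto_imp_tendsto[OF lim], rule always_eventually)
      (use bound abs_ge_self order_trans in \<open>fastforce simp: dist_norm\<close>)
qed

lemma hnorm_tendsto:
  assumes s: "\<And>n. s n \<in> carrier H" and x: "x \<in> carrier H"
    and sx: "(\<lambda>n. hnorm H (s n \<ominus>\<^bsub>H\<^esub> x)) \<longlonglongrightarrow> 0"
  shows "(\<lambda>n. hnorm H (s n)) \<longlonglongrightarrow> hnorm H x"
  unfolding hnorm_def by (intro tendsto_intros ip_tendsto s x sx)

lemma hcauchyI:
  assumes s: "\<And>n. s n \<in> carrier H" and x: "x \<in> carrier H"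
    and sx: "(\<lambda>n. hnorm H (s n \<ominus>\<^bsub>H\<^esub> x)) \<longlonglongrightarrow> 0"
  shows "hcauchy H s"
  unfolding hcauchy_def
proof (intro conjI allI impI)
  fix e :: real assume "e > 0"
  then have "e / 2 > 0" by simp
  then obtain N where N: "\<And>n. n \<ge> N \<Longrightarrow> hnorm H (s n \<ominus>\<^bsub>H\<^esub> x) < e / 2"
    using LIMSEQ_D[OF sx, of "e / 2"] s x by fastforce
  show "\<exists>N. \<forall>m\<ge>N. \<forall>n\<ge>N. hnorm H (s m \<ominus>\<^bsub>H\<^esub> s n) < e"
  proof (intro exI[of _ N] allI impI)
    fix m n assume "m \<ge> N" "n \<ge> N"
    then show "hnorm H (s m \<ominus>\<^bsub>H\<^esub> s n) < e"
      using N[of m] N[of n] hnorm_minus_triangle[OF s x s, of m n] hnorm_minus_commute[OF s x, of n]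
      by linarith
  qed
qed (use s in auto)

lemma hcauchy_carrier: "hcauchy H s \<Longrightarrow> s n \<in> carrier H"
  by (auto simp: hcauchy_def)

end

context hilbert_space
begin

lemma hnorm_eq_zero: "x \<in> carrier H \<Longrightarrow> hnorm H x = 0 \<Longrightarrow> x = \<zero>\<^bsub>H\<^esub>"
  using ip_definite[of x] ip_self[of x] by simp

lemma eqI_hnorm: "x \<in> carrier H \<Longrightarrow> y \<in> carrier H \<Longrightarrow> hnorm H (x \<ominus>\<^bsub>H\<^esub> y) = 0 \<Longrightarrow> x = y"
  using hnorm_eq_zero[of "x \<ominus>\<^bsub>H\<^esub> y"] minus_equality[of x "\<ominus>\<^bsub>H\<^esub> y"]
  by (simp add: a_minus_def)

lemma eqI_ip:
  assumes "x \<in> carrier H" "y \<in> carrier H" "\<And>z. z \<in> carrier H \<Longrightarrow> ip H x z = ip H y z"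
  shows "x = y"
  using assms by (intro eqI_hnorm) (auto simp: hnorm_def ip_minus_left)

lemma limit_unique:
  assumes s: "\<And>n. s n \<in> carrier H" and x: "x \<in> carrier H" and y: "y \<in> carrier H"
    and sx: "(\<lambda>n. hnorm H (s n \<ominus>\<^bsub>H\<^esub> x)) \<longlonglongrightarrow> 0" and sy: "(\<lambda>n. hnorm H (s n \<ominus>\<^bsub>H\<^esub> y)) \<longlonglongrightarrow> 0"
  shows "x = y"
proof (rule eqI_ip[OF x y])
  fix z assume z: "z \<in> carrier H"
  have zz: "(\<lambda>n::nat. hnorm H (z \<ominus>\<^bsub>H\<^esub> z)) \<longlonglongrightarrow> 0" using z by (simp add: hnorm_def ip_linear)
  show "ip H x z = ip H y z"
    using ip_tendsto[OF s z x z sx zz] ip_tendsto[OF s z y z sy zz] z LIMSEQ_unique by blast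
qed

end

section \<open>Finite direct sums\<close>

lemma hsum_simps [simp]:
  "carrier (hsum I Hs) = (\<Pi>\<^sub>E i\<in>I. carrier (Hs i))"
  "\<zero>\<^bsub>hsum I Hs\<^esub> = (\<lambda>i\<in>I. \<zero>\<^bsub>Hs i\<^esub>)"
  "x \<oplus>\<^bsub>hsum I Hs\<^esub> y = (\<lambda>i\<in>I. x i \<oplus>\<^bsub>Hs i\<^esub> y i)"
  "a \<odot>\<^bsub>hsum I Hs\<^esub> x = (\<lambda>i\<in>I. a \<odot>\<^bsub>Hs i\<^esub> x i)"
  "ip (hsum I Hs) x y = (\<Sum>i\<in>I. ip (Hs i) (x i) (y i))"
  by (simp_all add: hsum_def)

lemma semi_inner_space_hsum:
  assumes "\<And>i. i \<in> I \<Longrightarrow> semi_inner_space (Hs i)"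
  shows "semi_inner_space (hsum I Hs)"
proof -
  have mon: "abelian_monoid (Hs i)" if "i \<in> I" for i
    using assms[OF that] by (simp add: semi_inner_space_def module_def abelian_group_def)
  note am = abelian_monoid.a_closed[OF mon] abelian_monoid.zero_closed[OF mon]
    abelian_monoid.a_assoc[OF mon] abelian_monoid.l_zero[OF mon]
  show ?thesis
  proof (rule semi_inner_spaceI, unfold hsum_simps)
    fix x y assume xy: "x \<in> (\<Pi>\<^sub>E i\<in>I. carrier (Hs i))" "y \<in> (\<Pi>\<^sub>E i\<in>I. carrier (Hs i))"
    note m = PiE_mem[OF xy(1)] PiE_mem[OF xy(2)]
    show "(\<lambda>i\<in>I. x i \<oplus>\<^bsub>Hs i\<^esub> y i) \<in> (\<Pi>\<^sub>E i\<in>I. carrier (Hs i))"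
      by (simp add: m am)
    show "(\<lambda>i\<in>I. x i \<oplus>\<^bsub>Hs i\<^esub> y i) = (\<lambda>i\<in>I. y i \<oplus>\<^bsub>Hs i\<^esub> x i)"
      by (intro restrict_ext abelian_monoid.a_comm[OF mon] m)
    show "(\<lambda>i\<in>I. a \<odot>\<^bsub>Hs i\<^esub> (\<lambda>i\<in>I. x i \<oplus>\<^bsub>Hs i\<^esub> y i) i) =
        (\<lambda>i\<in>I. (\<lambda>i\<in>I. a \<odot>\<^bsub>Hs i\<^esub> x i) i \<oplus>\<^bsub>Hs i\<^esub> (\<lambda>i\<in>I. a \<odot>\<^bsub>Hs i\<^esub> y i) i)" for a
      by (intro restrict_ext) (simp add: m semi_inner_space.scale_add_right[OF assms])
    show "(\<Sum>i\<in>I. ip (Hs i) (y i) (x i)) = cnj (\<Sum>i\<in>I. ip (Hs i) (x i) (y i))"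
      unfolding cnj_sum using xy by (intro sum.cong refl semi_inner_space.ip_cnj[OF assms]) auto
  next
    show "(\<lambda>i\<in>I. \<zero>\<^bsub>Hs i\<^esub>) \<in> (\<Pi>\<^sub>E i\<in>I. carrier (Hs i))"
      by (simp add: am)
  next
    fix x y z assume xyz: "x \<in> (\<Pi>\<^sub>E i\<in>I. carrier (Hs i))" "y \<in> (\<Pi>\<^sub>E i\<in>I. carrier (Hs i))"
      "z \<in> (\<Pi>\<^sub>E i\<in>I. carrier (Hs i))"
    note m = PiE_mem[OF xyz(1)] PiE_mem[OF xyz(2)] PiE_mem[OF xyz(3)]
    show "(\<lambda>i\<in>I. (\<lambda>i\<in>I. x i \<oplus>\<^bsub>Hs i\<^esub> y i) i \<oplus>\<^bsub>Hs i\<^esub> z i) =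
        (\<lambda>i\<in>I. x i \<oplus>\<^bsub>Hs i\<^esub> (\<lambda>i\<in>I. y i \<oplus>\<^bsub>Hs i\<^esub> z i) i)"
      by (intro restrict_ext) (simp add: m am)
    show "(\<Sum>i\<in>I. ip (Hs i) ((\<lambda>i\<in>I. x i \<oplus>\<^bsub>Hs i\<^esub> y i) i) (z i)) =
        (\<Sum>i\<in>I. ip (Hs i) (x i) (z i)) + (\<Sum>i\<in>I. ip (Hs i) (y i) (z i))"
      unfolding sum.distrib[symmetric]
      by (intro sum.cong refl) (simp add: m semi_inner_space.ip_add[OF assms])
  next
    fix x assume x: "x \<in> (\<Pi>\<^sub>E i\<in>I. carrier (Hs i))"
    note m = PiE_mem[OF x]
    have l: "(\<lambda>i\<in>I. x i) = x" using x by (simp add: PiE_restrict)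
    show "(\<lambda>i\<in>I. (\<lambda>i\<in>I. \<zero>\<^bsub>Hs i\<^esub>) i \<oplus>\<^bsub>Hs i\<^esub> x i) = x"
      by (subst (2) l[symmetric], rule restrict_ext)
        (simp add: m am)
    show "(\<lambda>i\<in>I. 1 \<odot>\<^bsub>Hs i\<^esub> x i) = x"
      by (subst (2) l[symmetric], rule restrict_ext)
        (simp add: m semi_inner_space.scale_one[OF assms])
    show "(\<lambda>i\<in>I. 0 \<odot>\<^bsub>Hs i\<^esub> x i) = (\<lambda>i\<in>I. \<zero>\<^bsub>Hs i\<^esub>)"
      by (intro restrict_ext) (simp add: m semi_inner_space.scale_zero_left[OF assms])
    show "(\<lambda>i\<in>I. a \<odot>\<^bsub>Hs i\<^esub> x i) \<in> (\<Pi>\<^sub>E i\<in>I. carrier (Hs i))" for a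
      using x semi_inner_space.scale_closed[OF assms] by auto
    show "(\<lambda>i\<in>I. (a + b) \<odot>\<^bsub>Hs i\<^esub> x i) =
        (\<lambda>i\<in>I. (\<lambda>i\<in>I. a \<odot>\<^bsub>Hs i\<^esub> x i) i \<oplus>\<^bsub>Hs i\<^esub> (\<lambda>i\<in>I. b \<odot>\<^bsub>Hs i\<^esub> x i) i)" for a b
      by (intro restrict_ext) (simp add: m semi_inner_space.scale_add_left[OF assms])
    show "(\<lambda>i\<in>I. (a * b) \<odot>\<^bsub>Hs i\<^esub> x i) = (\<lambda>i\<in>I. a \<odot>\<^bsub>Hs i\<^esub> (\<lambda>i\<in>I. b \<odot>\<^bsub>Hs i\<^esub> x i) i)" for a b
      by (intro restrict_ext) (simp add: m semi_inner_space.scale_scale[OF assms])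
    show "0 \<le> Re (\<Sum>i\<in>I. ip (Hs i) (x i) (x i))"
      unfolding Re_sum using x by (intro sum_nonneg semi_inner_space.ip_nonneg[OF assms]) auto
  next
    fix x z a assume xz: "x \<in> (\<Pi>\<^sub>E i\<in>I. carrier (Hs i))" "z \<in> (\<Pi>\<^sub>E i\<in>I. carrier (Hs i))"
    show "(\<Sum>i\<in>I. ip (Hs i) ((\<lambda>i\<in>I. a \<odot>\<^bsub>Hs i\<^esub> x i) i) (z i)) = a * (\<Sum>i\<in>I. ip (Hs i) (x i) (z i))"
      by (simp add: PiE_mem[OF xz(1)] PiE_mem[OF xz(2)] semi_inner_space.ip_smult[OF assms] sum_distrib_left)
  qed
qed

lemma hsum_minus:
  assumes "\<And>i. i \<in> I \<Longrightarrow> semi_inner_space (Hs i)"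
    and x: "x \<in> carrier (hsum I Hs)" and y: "y \<in> carrier (hsum I Hs)"
  shows "x \<ominus>\<^bsub>hsum I Hs\<^esub> y = (\<lambda>i\<in>I. x i \<ominus>\<^bsub>Hs i\<^esub> y i)"
proof -
  interpret S: semi_inner_space "hsum I Hs" by (rule semi_inner_space_hsum) (rule assms(1))
  have m: "x i \<in> carrier (Hs i)" "y i \<in> carrier (Hs i)" if "i \<in> I" for i
    using x y that by auto
  show ?thesis unfolding S.minus_eq_scale[OF x y] hsum_simps
    by (intro restrict_ext) (simp add: m semi_inner_space.minus_eq_scale[OF assms(1)])
qed

lemma hsum_finsum:
  assumes "\<And>i. i \<in> I \<Longrightarrow> semi_inner_space (Hs i)"
    and "finite A" and g: "\<And>a. a \<in> A \<Longrightarrow> g a \<in> carrier (hsum I Hs)"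
  shows "finsum (hsum I Hs) g A = (\<lambda>i\<in>I. finsum (Hs i) (\<lambda>a. g a i) A)"
proof -
  interpret S: semi_inner_space "hsum I Hs" by (rule semi_inner_space_hsum) (rule assms(1))
  show ?thesis using assms(2) g
  proof (induction A rule: finite_induct)
    case empty
    have "finsum (Hs i) (\<lambda>a. g a i) {} = \<zero>\<^bsub>Hs i\<^esub>" if "i \<in> I" for i
    proof -
      interpret semi_inner_space "Hs i" by (rule assms(1)[OF that])
      show ?thesis by simp
    qed
    then show ?case unfolding S.finsum_empty hsum_simps by (intro restrict_ext) simp
  next
    case (insert a F)
    have "finsum (hsum I Hs) g (insert a F) = g a \<oplus>\<^bsub>hsum I Hs\<^esub> finsum (hsum I Hs) g F"
      by (rule S.finsum_insert) (use insert in blast)+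
    also have "\<dots> = g a \<oplus>\<^bsub>hsum I Hs\<^esub> (\<lambda>i\<in>I. finsum (Hs i) (\<lambda>a. g a i) F)"
      by (subst insert.IH) (use insert.prems in blast)+
    also have "\<dots> = (\<lambda>i\<in>I. finsum (Hs i) (\<lambda>a. g a i) (insert a F))"
      unfolding hsum_simps
    proof (rule restrict_ext)
      fix i assume i: "i \<in> I"
      interpret semi_inner_space "Hs i" by (rule assms(1)[OF i])
      have "g b i \<in> carrier (Hs i)" if "b \<in> insert a F" for b
        using insert.prems[OF that] i by auto
      then show "g a i \<oplus>\<^bsub>Hs i\<^esub> (\<lambda>i\<in>I. finsum (Hs i) (\<lambda>a. g a i) F) i = finsum (Hs i) (\<lambda>a. g a i) (insert a F)"
        using i insert.hyps by (subst finsum_insert) auto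
    qed
    finally show ?case .
  qed
qed

lemma hsum_hnorm_sq:
  assumes "\<And>i. i \<in> I \<Longrightarrow> semi_inner_space (Hs i)" and x: "x \<in> carrier (hsum I Hs)"
  shows "(hnorm (hsum I Hs) x)\<^sup>2 = (\<Sum>i\<in>I. (hnorm (Hs i) (x i))\<^sup>2)"
proof -
  interpret S: semi_inner_space "hsum I Hs" by (rule semi_inner_space_hsum) (rule assms(1))
  show ?thesis
    unfolding S.hnorm_sq[OF x] hsum_simps Re_sum
    by (intro sum.cong refl semi_inner_space.hnorm_sq[OF assms(1), symmetric]) (use x in auto)
qed

lemma hsum_hnorm_component_le:
  assumes "finite I" "\<And>i. i \<in> I \<Longrightarrow> semi_inner_space (Hs i)" and x: "x \<in> carrier (hsum I Hs)" and i: "i \<in> I"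
  shows "hnorm (Hs i) (x i) \<le> hnorm (hsum I Hs) x"
proof -
  have "(hnorm (Hs i) (x i))\<^sup>2 \<le> (\<Sum>i\<in>I. (hnorm (Hs i) (x i))\<^sup>2)"
    by (rule member_le_sum) (use assms in auto)
  then have "(hnorm (Hs i) (x i))\<^sup>2 \<le> (hnorm (hsum I Hs) x)\<^sup>2"
    by (simp only: hsum_hnorm_sq[OF assms(2) x])
  then show ?thesis
    by (rule power2_le_imp_le)
      (intro semi_inner_space.hnorm_nonneg[OF semi_inner_space_hsum x] assms(2))
qed

lemma hsum_tendsto:
  assumes "finite I" "\<And>i. i \<in> I \<Longrightarrow> semi_inner_space (Hs i)"
    and s: "\<And>n. s n \<in> carrier (hsum I Hs)" and x: "x \<in> carrier (hsum I Hs)"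
    and lim: "\<And>i. i \<in> I \<Longrightarrow> (\<lambda>n. hnorm (Hs i) (s n i \<ominus>\<^bsub>Hs i\<^esub> x i)) \<longlonglongrightarrow> 0"
  shows "(\<lambda>n. hnorm (hsum I Hs) (s n \<ominus>\<^bsub>hsum I Hs\<^esub> x)) \<longlonglongrightarrow> 0"
proof -
  interpret S: semi_inner_space "hsum I Hs" by (rule semi_inner_space_hsum) (rule assms(2))
  have "hnorm (hsum I Hs) (s n \<ominus>\<^bsub>hsum I Hs\<^esub> x) = sqrt (\<Sum>i\<in>I. (hnorm (Hs i) (s n i \<ominus>\<^bsub>Hs i\<^esub> x i))\<^sup>2)" for n
  proof -
    have "(hnorm (hsum I Hs) (s n \<ominus>\<^bsub>hsum I Hs\<^esub> x))\<^sup>2 = (\<Sum>i\<in>I. (hnorm (Hs i) (s n i \<ominus>\<^bsub>Hs i\<^esub> x i))\<^sup>2)"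
      using hsum_hnorm_sq[of I Hs, OF assms(2) S.minus_closed[OF s x], of n]
      by (simp add: hsum_minus[OF assms(2) s x])
    then show ?thesis using S.hnorm_nonneg[OF S.minus_closed[OF s x], of n] real_sqrt_unique by metis
  qed
  moreover have "(\<lambda>n. sqrt (\<Sum>i\<in>I. (hnorm (Hs i) (s n i \<ominus>\<^bsub>Hs i\<^esub> x i))\<^sup>2)) \<longlonglongrightarrow> sqrt (\<Sum>i\<in>I. 0\<^sup>2)"
    by (intro tendsto_intros lim)
  ultimately show ?thesis by simp
qed

lemma hilbert_space_hsum:
  assumes fin: "finite I" and "\<And>i. i \<in> I \<Longrightarrow> hilbert_space (Hs i)"
  shows "hilbert_space (hsum I Hs)"
proof -
  have si: "semi_inner_space (Hs i)" if "i \<in> I" for i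
    using assms(2)[OF that] by (rule hilbert_space.axioms)
  interpret S: semi_inner_space "hsum I Hs" by (rule semi_inner_space_hsum) (rule si)
  show ?thesis
  proof
    fix x assume x: "x \<in> carrier (hsum I Hs)" and "ip (hsum I Hs) x x = 0"
    then have n0: "hnorm (hsum I Hs) x = 0" by (simp only: hnorm_def zero_complex.sel real_sqrt_zero)
    have "x i = \<zero>\<^bsub>Hs i\<^esub>" if i: "i \<in> I" for i
    proof (rule hilbert_space.hnorm_eq_zero[OF assms(2)[OF i]])
      show xi: "x i \<in> carrier (Hs i)" using x i by auto
      show "hnorm (Hs i) (x i) = 0"
        using hsum_hnorm_component_le[OF fin si x i] n0
          semi_inner_space.hnorm_nonneg[OF si[OF i] xi] by simp
    qed
    then have "(\<lambda>i\<in>I. x i) = (\<lambda>i\<in>I. \<zero>\<^bsub>Hs i\<^esub>)" by (intro restrict_ext)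
    then show "x = \<zero>\<^bsub>hsum I Hs\<^esub>" using x by (simp add: PiE_restrict)
  next
    fix s assume s: "hcauchy (hsum I Hs) s"
    then have sc: "s n \<in> carrier (hsum I Hs)" for n by (rule S.hcauchy_carrier)
    have "\<exists>y. y \<in> carrier (Hs i) \<and> (\<lambda>n. hnorm (Hs i) (s n i \<ominus>\<^bsub>Hs i\<^esub> y)) \<longlonglongrightarrow> 0" if i: "i \<in> I" for i
    proof -
      have "hcauchy (Hs i) (\<lambda>n. s n i)"
        unfolding hcauchy_def
      proof (intro conjI allI impI)
        show "range (\<lambda>n. s n i) \<subseteq> carrier (Hs i)" using sc i by auto
        fix e :: real assume "e > 0"
        then obtain N where N: "\<And>m n. m \<ge> N \<Longrightarrow> n \<ge> N \<Longrightarrow> hnorm (hsum I Hs) (s m \<ominus>\<^bsub>hsum I Hs\<^esub> s n) < e"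
          using s[unfolded hcauchy_def, THEN conjunct2, rule_format, OF \<open>e > 0\<close>] by blast
        have "hnorm (Hs i) (s m i \<ominus>\<^bsub>Hs i\<^esub> s n i) < e" if "m \<ge> N" "n \<ge> N" for m n
          using hsum_hnorm_component_le[OF fin si S.minus_closed[OF sc sc] i, of m n] N[OF that] i
          by (simp add: hsum_minus[OF si sc sc])
        then show "\<exists>N. \<forall>m\<ge>N. \<forall>n\<ge>N. hnorm (Hs i) (s m i \<ominus>\<^bsub>Hs i\<^esub> s n i) < e" by blast
      qed
      then show ?thesis using hilbert_space.complete[OF assms(2)[OF i]] by blast
    qed
    then have "\<exists>y. \<forall>i\<in>I. y i \<in> carrier (Hs i) \<and> (\<lambda>n. hnorm (Hs i) (s n i \<ominus>\<^bsub>Hs i\<^esub> y i)) \<longlonglongrightarrow> 0"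
      by (intro bchoice ballI)
    then obtain y where y: "\<And>i. i \<in> I \<Longrightarrow> y i \<in> carrier (Hs i)"
      "\<And>i. i \<in> I \<Longrightarrow> (\<lambda>n. hnorm (Hs i) (s n i \<ominus>\<^bsub>Hs i\<^esub> y i)) \<longlonglongrightarrow> 0" by blast
    show "\<exists>x\<in>carrier (hsum I Hs). (\<lambda>n. hnorm (hsum I Hs) (s n \<ominus>\<^bsub>hsum I Hs\<^esub> x)) \<longlonglongrightarrow> 0"
    proof (rule bexI)
      show yc: "restrict y I \<in> carrier (hsum I Hs)" using y(1) by simp
      show "(\<lambda>n. hnorm (hsum I Hs) (s n \<ominus>\<^bsub>hsum I Hs\<^esub> restrict y I)) \<longlonglongrightarrow> 0"
        by (rule hsum_tendsto[OF fin si sc yc]) (use y(2) in auto)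
    qed
  qed
qed

lemma semi_inner_space_amp: "semi_inner_space H \<Longrightarrow> semi_inner_space (amp n H)"
  unfolding amp_def by (rule semi_inner_space_hsum)

lemma hilbert_space_amp: "hilbert_space H \<Longrightarrow> hilbert_space (amp n H)"
  unfolding amp_def by (rule hilbert_space_hsum) auto

lemma amp_simps:
  "carrier (amp n H) = ({..<n} \<rightarrow>\<^sub>E carrier H)"
  "ip (amp n H) x y = (\<Sum>i<n. ip H (x i) (y i))"
  "x \<oplus>\<^bsub>amp n H\<^esub> y = (\<lambda>i\<in>{..<n}. x i \<oplus>\<^bsub>H\<^esub> y i)"
  "a \<odot>\<^bsub>amp n H\<^esub> x = (\<lambda>i\<in>{..<n}. a \<odot>\<^bsub>H\<^esub> x i)"
  by (simp_all add: amp_def)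

lemma amp_minus: "semi_inner_space H \<Longrightarrow> x \<in> carrier (amp n H) \<Longrightarrow> y \<in> carrier (amp n H) \<Longrightarrow>
    x \<ominus>\<^bsub>amp n H\<^esub> y = (\<lambda>i\<in>{..<n}. x i \<ominus>\<^bsub>H\<^esub> y i)"
  unfolding amp_def by (rule hsum_minus)

lemma amp_finsum: "semi_inner_space H \<Longrightarrow> finite A \<Longrightarrow> (\<And>a. a \<in> A \<Longrightarrow> g a \<in> carrier (amp n H)) \<Longrightarrow>
    finsum (amp n H) g A = (\<lambda>i\<in>{..<n}. finsum H (\<lambda>a. g a i) A)"
  unfolding amp_def by (rule hsum_finsum)

lemma amp_hnorm_sq: "semi_inner_space H \<Longrightarrow> x \<in> carrier (amp n H) \<Longrightarrow>
    (hnorm (amp n H) x)\<^sup>2 = (\<Sum>i<n. (hnorm H (x i))\<^sup>2)"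
  unfolding amp_def by (rule hsum_hnorm_sq)

section \<open>The Hausdorff completion\<close>

context semi_inner_space
begin

lemma null_trans:
  assumes s: "\<And>n. s n \<in> carrier H" and t: "\<And>n. t n \<in> carrier H" and u: "\<And>n. u n \<in> carrier H"
    and st: "(\<lambda>n. hnorm H (s n \<ominus>\<^bsub>H\<^esub> t n)) \<longlonglongrightarrow> 0" and tu: "(\<lambda>n. hnorm H (t n \<ominus>\<^bsub>H\<^esub> u n)) \<longlonglongrightarrow> 0"
  shows "(\<lambda>n. hnorm H (s n \<ominus>\<^bsub>H\<^esub> u n)) \<longlonglongrightarrow> 0"
proof (rule tendsto_sandwich[OF always_eventually always_eventually tendsto_const])
  show "(\<lambda>n. hnorm H (s n \<ominus>\<^bsub>H\<^esub> t n) + hnorm H (t n \<ominus>\<^bsub>H\<^esub> u n)) \<longlonglongrightarrow> 0"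
    using tendsto_add[OF st tu] by simp
  show "\<forall>n. 0 \<le> hnorm H (s n \<ominus>\<^bsub>H\<^esub> u n)" using s u by simp
  show "\<forall>n. hnorm H (s n \<ominus>\<^bsub>H\<^esub> u n) \<le> hnorm H (s n \<ominus>\<^bsub>H\<^esub> t n) + hnorm H (t n \<ominus>\<^bsub>H\<^esub> u n)"
    using hnorm_minus_triangle[OF s t u] by simp
qed

lemma null_sym:
  assumes s: "\<And>n. s n \<in> carrier H" and t: "\<And>n. t n \<in> carrier H"
    and st: "(\<lambda>n. hnorm H (s n \<ominus>\<^bsub>H\<^esub> t n)) \<longlonglongrightarrow> 0"
  shows "(\<lambda>n. hnorm H (t n \<ominus>\<^bsub>H\<^esub> s n)) \<longlonglongrightarrow> 0"
  using st by (simp only: hnorm_minus_commute[OF s t])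

lemma hnorm_minus_self [simp]: "x \<in> carrier H \<Longrightarrow> hnorm H (x \<ominus>\<^bsub>H\<^esub> x) = 0"
  by (simp add: hnorm_def ip_minus_left)

lemma hcauchy_const [simp, intro]: "x \<in> carrier H \<Longrightarrow> hcauchy H (\<lambda>_. x)"
  by (auto simp: hcauchy_def)

lemma hcauchyD:
  assumes "hcauchy H s" "0 < (e::real)"
  obtains N where "\<And>m n. m \<ge> N \<Longrightarrow> n \<ge> N \<Longrightarrow> hnorm H (s m \<ominus>\<^bsub>H\<^esub> s n) < e"
  using assms(1)[unfolded hcauchy_def, THEN conjunct2, rule_format, OF assms(2)] by blast

lemma hcauchy_criterion:
  assumes "\<And>n. s n \<in> carrier H"
    and "\<And>e. e > 0 \<Longrightarrow> \<exists>N. \<forall>m\<ge>N. \<forall>n\<ge>N. hnorm H (s m \<ominus>\<^bsub>H\<^esub> s n) < e"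
  shows "hcauchy H s"
  unfolding hcauchy_def using assms by blast

lemma hcauchy_add:
  assumes s: "hcauchy H s" and t: "hcauchy H t"
  shows "hcauchy H (\<lambda>n. s n \<oplus>\<^bsub>H\<^esub> t n)"
proof (rule hcauchy_criterion)
  note c = hcauchy_carrier[OF s] hcauchy_carrier[OF t]
  show "s n \<oplus>\<^bsub>H\<^esub> t n \<in> carrier H" for n by (simp add: c)
  fix e :: real assume "e > 0"
  then have e2: "e / 2 > 0" by simp
  obtain M where M: "\<And>m n. m \<ge> M \<Longrightarrow> n \<ge> M \<Longrightarrow> hnorm H (s m \<ominus>\<^bsub>H\<^esub> s n) < e / 2"
    using hcauchyD[OF s e2] by blast
  obtain N where N: "\<And>m n. m \<ge> N \<Longrightarrow> n \<ge> N \<Longrightarrow> hnorm H (t m \<ominus>\<^bsub>H\<^esub> t n) < e / 2"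
    using hcauchyD[OF t e2] by blast
  show "\<exists>N. \<forall>m\<ge>N. \<forall>n\<ge>N. hnorm H (s m \<oplus>\<^bsub>H\<^esub> t m \<ominus>\<^bsub>H\<^esub> (s n \<oplus>\<^bsub>H\<^esub> t n)) < e"
  proof (intro exI[of _ "max M N"] allI impI)
    fix m n assume "max M N \<le> m" "max M N \<le> n"
    then show "hnorm H (s m \<oplus>\<^bsub>H\<^esub> t m \<ominus>\<^bsub>H\<^esub> (s n \<oplus>\<^bsub>H\<^esub> t n)) < e"
      using hnorm_diff_add_le[of "s m" "s n" "t m" "t n", OF c(1) c(1) c(2) c(2)] M[of m n] N[of m n]
      by linarith
  qed
qed

lemma hcauchy_smult:
  assumes s: "hcauchy H s"
  shows "hcauchy H (\<lambda>n. a \<odot>\<^bsub>H\<^esub> s n)"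
proof (rule hcauchy_criterion)
  note c = hcauchy_carrier[OF s]
  show "a \<odot>\<^bsub>H\<^esub> s n \<in> carrier H" for n by (simp add: c)
  fix e :: real assume "e > 0"
  then have e2: "e / (cmod a + 1) > 0" using norm_ge_zero[of a] by (intro divide_pos_pos) linarith+
  obtain N where N: "\<And>m n. m \<ge> N \<Longrightarrow> n \<ge> N \<Longrightarrow> hnorm H (s m \<ominus>\<^bsub>H\<^esub> s n) < e / (cmod a + 1)"
    using hcauchyD[OF s e2] by blast
  show "\<exists>N. \<forall>m\<ge>N. \<forall>n\<ge>N. hnorm H (a \<odot>\<^bsub>H\<^esub> s m \<ominus>\<^bsub>H\<^esub> a \<odot>\<^bsub>H\<^esub> s n) < e"
  proof (intro exI[of _ N] allI impI)
    fix m n assume "N \<le> m" "N \<le> n"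
    then have "hnorm H (s m \<ominus>\<^bsub>H\<^esub> s n) * (cmod a + 1) < e"
      using N[of m n] norm_ge_zero[of a] by (simp add: pos_less_divide_eq)
    moreover have "0 \<le> hnorm H (s m \<ominus>\<^bsub>H\<^esub> s n)" using c by simp
    ultimately show "hnorm H (a \<odot>\<^bsub>H\<^esub> s m \<ominus>\<^bsub>H\<^esub> a \<odot>\<^bsub>H\<^esub> s n) < e"
      unfolding hnorm_diff_smult[OF c c] by (simp add: algebra_simps)
  qed
qed

lemma hcauchy_bounded:
  assumes s: "hcauchy H s"
  obtains B where "\<And>n. hnorm H (s n) \<le> B"
proof -
  note c = hcauchy_carrier[OF s]
  have "(0 :: real) < 1" by simp
  then obtain N where N: "\<And>m n. m \<ge> N \<Longrightarrow> n \<ge> N \<Longrightarrow> hnorm H (s m \<ominus>\<^bsub>H\<^esub> s n) < 1"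
    using hcauchyD[OF s] by blast
  have "hnorm H (s n) \<le> (\<Sum>k\<le>N. hnorm H (s k)) + 1" for n
  proof (cases "n \<le> N")
    case True
    have "hnorm H (s n) \<le> (\<Sum>k\<le>N. hnorm H (s k))"
      by (rule member_le_sum[of n "{..N}" "\<lambda>k. hnorm H (s k)"]) (use True c in auto)
    then show ?thesis by simp
  next
    case False
    have "hnorm H (s N) \<le> (\<Sum>k\<le>N. hnorm H (s k))"
      by (rule member_le_sum[of N "{..N}" "\<lambda>k. hnorm H (s k)"]) (use c in auto)
    then show ?thesis using N[of n N] False hnorm_abs_diff_le[OF c c, of n N] by linarith
  qed
  then show ?thesis by (rule that)
qed

lemma ip_null:
  assumes s: "hcauchy H s" and s': "hcauchy H s'" and t: "hcauchy H t" and t': "hcauchy H t'"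
    and ss: "(\<lambda>n. hnorm H (s n \<ominus>\<^bsub>H\<^esub> s' n)) \<longlonglongrightarrow> 0" and tt: "(\<lambda>n. hnorm H (t n \<ominus>\<^bsub>H\<^esub> t' n)) \<longlonglongrightarrow> 0"
  shows "(\<lambda>n. ip H (s n) (t n) - ip H (s' n) (t' n)) \<longlonglongrightarrow> 0"
proof -
  note c = hcauchy_carrier[OF s] hcauchy_carrier[OF s'] hcauchy_carrier[OF t] hcauchy_carrier[OF t']
  obtain B where B: "\<And>n. hnorm H (s' n) \<le> B" using hcauchy_bounded[OF s'] by blast
  obtain C where C: "\<And>n. hnorm H (t n) \<le> C" using hcauchy_bounded[OF t] by blast
  have lim: "(\<lambda>n. hnorm H (s n \<ominus>\<^bsub>H\<^esub> s' n) * C + B * hnorm H (t n \<ominus>\<^bsub>H\<^esub> t' n)) \<longlonglongrightarrow> 0 * C + B * 0"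
    by (intro tendsto_intros ss tt)
  have bound: "cmod (ip H (s n) (t n) - ip H (s' n) (t' n)) \<le>
      hnorm H (s n \<ominus>\<^bsub>H\<^esub> s' n) * C + B * hnorm H (t n \<ominus>\<^bsub>H\<^esub> t' n)" for n
  proof -
    have "hnorm H (s n \<ominus>\<^bsub>H\<^esub> s' n) * hnorm H (t n) \<le> hnorm H (s n \<ominus>\<^bsub>H\<^esub> s' n) * C"
      by (rule mult_left_mono[OF C]) (simp add: c)
    moreover have "hnorm H (s' n) * hnorm H (t n \<ominus>\<^bsub>H\<^esub> t' n) \<le> B * hnorm H (t n \<ominus>\<^bsub>H\<^esub> t' n)"
      by (rule mult_right_mono[OF B]) (simp add: c)
    ultimately show ?thesis using ip_diff_le[OF c(1) c(2) c(3) c(4), of n n n n] by linarith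
  qed
  show ?thesis
    by (rule tendsto_norm_zero_cancel,
        rule tendsto_sandwich[OF always_eventually always_eventually tendsto_const])
      (use bound lim in auto)
qed

lemma ip_convergent:
  assumes s: "hcauchy H s" and t: "hcauchy H t"
  shows "convergent (\<lambda>n. ip H (s n) (t n))"
proof -
  note c = hcauchy_carrier[OF s] hcauchy_carrier[OF t]
  obtain B where B: "\<And>n. hnorm H (s n) \<le> B" using hcauchy_bounded[OF s] by blast
  obtain C where C: "\<And>n. hnorm H (t n) \<le> C" using hcauchy_bounded[OF t] by blast
  have B0: "0 \<le> B" using order_trans[OF hnorm_nonneg[OF c(1)] B] .
  have C0: "0 \<le> C" using order_trans[OF hnorm_nonneg[OF c(2)] C] .
  have "Cauchy (\<lambda>n. ip H (s n) (t n))"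
  proof (rule CauchyI)
    fix e :: real assume "e > 0"
    define d where "d = e / (B + C + 1)"
    have d: "d > 0" using \<open>e > 0\<close> B0 C0 by (simp add: d_def)
    obtain M where M: "\<And>m n. m \<ge> M \<Longrightarrow> n \<ge> M \<Longrightarrow> hnorm H (s m \<ominus>\<^bsub>H\<^esub> s n) < d"
      using hcauchyD[OF s d] by blast
    obtain N where N: "\<And>m n. m \<ge> N \<Longrightarrow> n \<ge> N \<Longrightarrow> hnorm H (t m \<ominus>\<^bsub>H\<^esub> t n) < d"
      using hcauchyD[OF t d] by blast
    have "cmod (ip H (s m) (t m) - ip H (s n) (t n)) < e" if "m \<ge> max M N" "n \<ge> max M N" for m n
    proof -
      have "hnorm H (s m \<ominus>\<^bsub>H\<^esub> s n) * hnorm H (t m) \<le> d * C"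
        by (rule mult_mono) (use M[of m n] that C d c in \<open>auto intro: less_imp_le\<close>)
      moreover have "hnorm H (s n) * hnorm H (t m \<ominus>\<^bsub>H\<^esub> t n) \<le> B * d"
        by (rule mult_mono) (use N[of m n] that B B0 d c in \<open>auto intro: less_imp_le\<close>)
      moreover have "d * C + B * d < e"
      proof -
        have "d * (B + C + 1) = e" using B0 C0 by (simp add: d_def)
        then show ?thesis using d by (simp add: algebra_simps)
      qed
      ultimately show ?thesis
        using ip_diff_le[OF c(1) c(1) c(2) c(2), of m m n n] by linarith
    qed
    then show "\<exists>M. \<forall>m\<ge>M. \<forall>n\<ge>M. cmod (ip H (s m) (t m) - ip H (s n) (t n)) < e" by blast
  qed
  then show ?thesis by (rule Cauchy_convergent)
qed

lemma hclass_eqI: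
  assumes s: "hcauchy H s" and t: "hcauchy H t" and st: "(\<lambda>n. hnorm H (s n \<ominus>\<^bsub>H\<^esub> t n)) \<longlonglongrightarrow> 0"
  shows "hclass H s = hclass H t"
proof -
  note c = hcauchy_carrier[OF s] hcauchy_carrier[OF t]
  have ts: "(\<lambda>n. hnorm H (t n \<ominus>\<^bsub>H\<^esub> s n)) \<longlonglongrightarrow> 0" by (rule null_sym[OF c st])
  show ?thesis
    unfolding hclass_def
  proof (intro Collect_cong conj_cong refl iffI)
    fix u assume u: "hcauchy H u"
    show "(\<lambda>n. hnorm H (t n \<ominus>\<^bsub>H\<^esub> u n)) \<longlonglongrightarrow> 0" if "(\<lambda>n. hnorm H (s n \<ominus>\<^bsub>H\<^esub> u n)) \<longlonglongrightarrow> 0"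
      by (rule null_trans[OF c(2) c(1) hcauchy_carrier[OF u] ts that])
    show "(\<lambda>n. hnorm H (s n \<ominus>\<^bsub>H\<^esub> u n)) \<longlonglongrightarrow> 0" if "(\<lambda>n. hnorm H (t n \<ominus>\<^bsub>H\<^esub> u n)) \<longlonglongrightarrow> 0"
      by (rule null_trans[OF c(1) c(2) hcauchy_carrier[OF u] st that])
  qed
qed

lemma hclass_refl: "hcauchy H s \<Longrightarrow> s \<in> hclass H s"
  by (auto simp: hclass_def hcauchy_carrier)

lemma hrep:
  assumes s: "hcauchy H s"
  shows "hcauchy H (hrep (hclass H s))" "(\<lambda>n. hnorm H (s n \<ominus>\<^bsub>H\<^esub> hrep (hclass H s) n)) \<longlonglongrightarrow> 0"
proof -
  have "hrep (hclass H s) \<in> hclass H s" 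
    unfolding hrep_def by (rule someI[of "\<lambda>s'. s' \<in> hclass H s", OF hclass_refl[OF s]])
  then show "hcauchy H (hrep (hclass H s))" "(\<lambda>n. hnorm H (s n \<ominus>\<^bsub>H\<^esub> hrep (hclass H s) n)) \<longlonglongrightarrow> 0"
    by (auto simp: hclass_def)
qed

lemma hcompletion_carrier: "carrier (hcompletion H) = hclass H ` {s. hcauchy H s}"
  by (simp add: hcompletion_def)

lemma hcompletion_zero: "\<zero>\<^bsub>hcompletion H\<^esub> = hclass H (\<lambda>_. \<zero>\<^bsub>H\<^esub>)"
  by (simp add: hcompletion_def)

text \<open>The operations on classes go through chosen representatives. Since equivalent sequences have
  equivalent sums, multiples and inner products, any other representatives give the same result.\<close>

lemma hcompletion_add:
  assumes s: "hcauchy H s" and t: "hcauchy H t"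
  shows "hclass H s \<oplus>\<^bsub>hcompletion H\<^esub> hclass H t = hclass H (\<lambda>n. s n \<oplus>\<^bsub>H\<^esub> t n)"
proof -
  note r = hrep[OF s] hrep[OF t]
  note c = hcauchy_carrier[OF s] hcauchy_carrier[OF t] hcauchy_carrier[OF r(1)] hcauchy_carrier[OF r(3)]
  have "hclass H (\<lambda>n. s n \<oplus>\<^bsub>H\<^esub> t n) = hclass H (\<lambda>n. hrep (hclass H s) n \<oplus>\<^bsub>H\<^esub> hrep (hclass H t) n)"
  proof (rule hclass_eqI)
    show "(\<lambda>n. hnorm H (s n \<oplus>\<^bsub>H\<^esub> t n \<ominus>\<^bsub>H\<^esub> (hrep (hclass H s) n \<oplus>\<^bsub>H\<^esub> hrep (hclass H t) n))) \<longlonglongrightarrow> 0"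
    proof (rule tendsto_sandwich[OF always_eventually always_eventually tendsto_const])
      show "(\<lambda>n. hnorm H (s n \<ominus>\<^bsub>H\<^esub> hrep (hclass H s) n) + hnorm H (t n \<ominus>\<^bsub>H\<^esub> hrep (hclass H t) n)) \<longlonglongrightarrow> 0"
        using tendsto_add[OF r(2) r(4)] by simp
    qed (use c hnorm_diff_add_le[OF c(1) c(3) c(2) c(4)] in auto)
  qed (intro hcauchy_add r s t)+
  then show ?thesis by (simp add: hcompletion_def)
qed

lemma hcompletion_smult:
  assumes s: "hcauchy H s"
  shows "a \<odot>\<^bsub>hcompletion H\<^esub> hclass H s = hclass H (\<lambda>n. a \<odot>\<^bsub>H\<^esub> s n)"
proof -
  note r = hrep[OF s]
  note c = hcauchy_carrier[OF s] hcauchy_carrier[OF r(1)]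
  have "hclass H (\<lambda>n. a \<odot>\<^bsub>H\<^esub> s n) = hclass H (\<lambda>n. a \<odot>\<^bsub>H\<^esub> hrep (hclass H s) n)"
  proof (rule hclass_eqI)
    show "(\<lambda>n. hnorm H (a \<odot>\<^bsub>H\<^esub> s n \<ominus>\<^bsub>H\<^esub> a \<odot>\<^bsub>H\<^esub> hrep (hclass H s) n)) \<longlonglongrightarrow> 0"
      unfolding hnorm_diff_smult[OF c] using tendsto_mult_left[OF r(2), of "cmod a"] by simp
  qed (intro hcauchy_smult r s)+
  then show ?thesis by (simp add: hcompletion_def)
qed

lemma hcompletion_ip:
  assumes s: "hcauchy H s" and t: "hcauchy H t"
  shows "(\<lambda>n. ip H (s n) (t n)) \<longlonglongrightarrow> ip (hcompletion H) (hclass H s) (hclass H t)"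
proof -
  note r = hrep[OF s] hrep[OF t]
  have "(\<lambda>n. ip H (hrep (hclass H s) n) (hrep (hclass H t) n)) \<longlonglongrightarrow> ip (hcompletion H) (hclass H s) (hclass H t)"
    using ip_convergent[OF r(1,3)] by (simp add: hcompletion_def convergent_LIMSEQ_iff)
  from tendsto_add[OF ip_null[OF s r(1) t r(3) r(2) r(4)] this] show ?thesis by simp
qed

lemma semi_inner_space_hcompletion: "semi_inner_space (hcompletion H)"
proof (rule semi_inner_spaceI, unfold hcompletion_carrier)
  fix X Y assume "X \<in> hclass H ` {s. hcauchy H s}" "Y \<in> hclass H ` {s. hcauchy H s}"
  then obtain s t where st: "X = hclass H s" "Y = hclass H t" "hcauchy H s" "hcauchy H t" by blast
  note c = hcauchy_carrier[OF st(3)] hcauchy_carrier[OF st(4)]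
  show "X \<oplus>\<^bsub>hcompletion H\<^esub> Y \<in> hclass H ` {s. hcauchy H s}"
    unfolding st hcompletion_add[OF st(3,4)] using hcauchy_add[OF st(3,4)] by blast
  show "X \<oplus>\<^bsub>hcompletion H\<^esub> Y = Y \<oplus>\<^bsub>hcompletion H\<^esub> X"
    unfolding st hcompletion_add[OF st(3,4)] hcompletion_add[OF st(4,3)] by (simp add: a_comm c)
  show "a \<odot>\<^bsub>hcompletion H\<^esub> (X \<oplus>\<^bsub>hcompletion H\<^esub> Y) =
      a \<odot>\<^bsub>hcompletion H\<^esub> X \<oplus>\<^bsub>hcompletion H\<^esub> a \<odot>\<^bsub>hcompletion H\<^esub> Y" for a
    using st(3,4) by (simp add: st hcompletion_add hcompletion_smult hcauchy_add hcauchy_smult scale_add_right c)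
  show "ip (hcompletion H) Y X = cnj (ip (hcompletion H) X Y)"
  proof (rule LIMSEQ_unique)
    show "(\<lambda>n. ip H (t n) (s n)) \<longlonglongrightarrow> ip (hcompletion H) Y X" unfolding st by (rule hcompletion_ip[OF st(4,3)])
    show "(\<lambda>n. ip H (t n) (s n)) \<longlonglongrightarrow> cnj (ip (hcompletion H) X Y)"
      unfolding st ip_cnj[OF c] by (intro tendsto_cnj hcompletion_ip st(3,4))
  qed
next
  show "\<zero>\<^bsub>hcompletion H\<^esub> \<in> hclass H ` {s. hcauchy H s}"
    unfolding hcompletion_zero by (intro imageI CollectI hcauchy_const) simp
next
  fix X Y Z assume "X \<in> hclass H ` {s. hcauchy H s}" "Y \<in> hclass H ` {s. hcauchy H s}" "Z \<in> hclass H ` {s. hcauchy H s}"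
  then obtain s t u where st: "X = hclass H s" "Y = hclass H t" "Z = hclass H u"
      "hcauchy H s" "hcauchy H t" "hcauchy H u" by blast
  note c = hcauchy_carrier[OF st(4)] hcauchy_carrier[OF st(5)] hcauchy_carrier[OF st(6)]
  show "X \<oplus>\<^bsub>hcompletion H\<^esub> Y \<oplus>\<^bsub>hcompletion H\<^esub> Z = X \<oplus>\<^bsub>hcompletion H\<^esub> (Y \<oplus>\<^bsub>hcompletion H\<^esub> Z)"
    using st(4-6) by (simp add: st hcompletion_add hcauchy_add a_assoc c)
  show "ip (hcompletion H) (X \<oplus>\<^bsub>hcompletion H\<^esub> Y) Z = ip (hcompletion H) X Z + ip (hcompletion H) Y Z"
  proof (rule LIMSEQ_unique)
    show "(\<lambda>n. ip H (s n \<oplus>\<^bsub>H\<^esub> t n) (u n)) \<longlonglongrightarrow> ip (hcompletion H) (X \<oplus>\<^bsub>hcompletion H\<^esub> Y) Z"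
      unfolding st hcompletion_add[OF st(4,5)] by (intro hcompletion_ip hcauchy_add st(4-6))
    show "(\<lambda>n. ip H (s n \<oplus>\<^bsub>H\<^esub> t n) (u n)) \<longlonglongrightarrow> ip (hcompletion H) X Z + ip (hcompletion H) Y Z"
      unfolding st ip_add[OF c] by (intro tendsto_add hcompletion_ip st(4-6))
  qed
next
  fix X assume "X \<in> hclass H ` {s. hcauchy H s}"
  then obtain s where st: "X = hclass H s" "hcauchy H s" by blast
  note c = hcauchy_carrier[OF st(2)]
  have z: "hcauchy H (\<lambda>_. \<zero>\<^bsub>H\<^esub>)" by (intro hcauchy_const) simp
  show "\<zero>\<^bsub>hcompletion H\<^esub> \<oplus>\<^bsub>hcompletion H\<^esub> X = X"
    unfolding st hcompletion_zero hcompletion_add[OF z st(2)] by (simp add: c)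
  show "a \<odot>\<^bsub>hcompletion H\<^esub> X \<in> hclass H ` {s. hcauchy H s}" for a
    unfolding st hcompletion_smult[OF st(2)] by (intro imageI CollectI hcauchy_smult st)
  show "(a + b) \<odot>\<^bsub>hcompletion H\<^esub> X = a \<odot>\<^bsub>hcompletion H\<^esub> X \<oplus>\<^bsub>hcompletion H\<^esub> b \<odot>\<^bsub>hcompletion H\<^esub> X" for a b
    using st(2) by (simp add: st hcompletion_add hcompletion_smult hcauchy_smult scale_add_left c)
  show "(a * b) \<odot>\<^bsub>hcompletion H\<^esub> X = a \<odot>\<^bsub>hcompletion H\<^esub> (b \<odot>\<^bsub>hcompletion H\<^esub> X)" for a b
    using st(2) by (simp add: st hcompletion_smult hcauchy_smult scale_scale c)
  show "1 \<odot>\<^bsub>hcompletion H\<^esub> X = X" using st(2) by (simp add: st hcompletion_smult c)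
  show "0 \<odot>\<^bsub>hcompletion H\<^esub> X = \<zero>\<^bsub>hcompletion H\<^esub>"
    using st(2) by (simp add: st hcompletion_smult hcompletion_zero c)
  show "0 \<le> Re (ip (hcompletion H) X X)"
    unfolding st by (rule LIMSEQ_le_const[OF tendsto_Re[OF hcompletion_ip[OF st(2) st(2)]]])
      (simp add: ip_nonneg c)
next
  fix X Z a assume "X \<in> hclass H ` {s. hcauchy H s}" "Z \<in> hclass H ` {s. hcauchy H s}"
  then obtain s u where st: "X = hclass H s" "Z = hclass H u" "hcauchy H s" "hcauchy H u" by blast
  note c = hcauchy_carrier[OF st(3)] hcauchy_carrier[OF st(4)]
  show "ip (hcompletion H) (a \<odot>\<^bsub>hcompletion H\<^esub> X) Z = a * ip (hcompletion H) X Z"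
  proof (rule LIMSEQ_unique)
    show "(\<lambda>n. ip H (a \<odot>\<^bsub>H\<^esub> s n) (u n)) \<longlonglongrightarrow> ip (hcompletion H) (a \<odot>\<^bsub>hcompletion H\<^esub> X) Z"
      unfolding st hcompletion_smult[OF st(3)] by (intro hcompletion_ip hcauchy_smult st(3,4))
    show "(\<lambda>n. ip H (a \<odot>\<^bsub>H\<^esub> s n) (u n)) \<longlonglongrightarrow> a * ip (hcompletion H) X Z"
      unfolding st ip_smult[OF c] by (intro tendsto_mult tendsto_const hcompletion_ip st(3,4))
  qed
qed

lemma hembed_closed: "x \<in> carrier H \<Longrightarrow> hembed H x \<in> carrier (hcompletion H)"
  unfolding hembed_def hcompletion_carrier by (intro imageI CollectI hcauchy_const)

lemma hembed_add: "x \<in> carrier H \<Longrightarrow> y \<in> carrier H \<Longrightarrow>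
    hembed H (x \<oplus>\<^bsub>H\<^esub> y) = hembed H x \<oplus>\<^bsub>hcompletion H\<^esub> hembed H y"
  unfolding hembed_def by (simp add: hcompletion_add)

lemma hembed_smult: "x \<in> carrier H \<Longrightarrow> hembed H (a \<odot>\<^bsub>H\<^esub> x) = a \<odot>\<^bsub>hcompletion H\<^esub> hembed H x"
  unfolding hembed_def by (simp add: hcompletion_smult)

lemma hembed_zero: "hembed H \<zero>\<^bsub>H\<^esub> = \<zero>\<^bsub>hcompletion H\<^esub>"
  by (simp add: hembed_def hcompletion_zero)

lemma hembed_ip: "x \<in> carrier H \<Longrightarrow> y \<in> carrier H \<Longrightarrow> ip (hcompletion H) (hembed H x) (hembed H y) = ip H x y"
  unfolding hembed_def
  using LIMSEQ_unique[OF hcompletion_ip[OF hcauchy_const hcauchy_const] tendsto_const] by metis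

lemma hembed_minus: "x \<in> carrier H \<Longrightarrow> y \<in> carrier H \<Longrightarrow>
    hembed H (x \<ominus>\<^bsub>H\<^esub> y) = hembed H x \<ominus>\<^bsub>hcompletion H\<^esub> hembed H y"
  by (simp add: minus_eq_scale semi_inner_space.minus_eq_scale[OF semi_inner_space_hcompletion]
      hembed_closed hembed_add hembed_smult)

lemma hembed_hnorm: "x \<in> carrier H \<Longrightarrow> hnorm (hcompletion H) (hembed H x) = hnorm H x"
  by (simp add: hnorm_def hembed_ip)

text \<open>The distance from the class of the constant \<open>s k\<close> to the class of \<open>s\<close> is the limit over \<open>n\<close> of the
  distances from \<open>s k\<close> to \<open>s n\<close>, which the Cauchy property makes small.\<close>

lemma hembed_tendsto_hclass:
  assumes s: "hcauchy H s"
  shows "(\<lambda>k. hnorm (hcompletion H) (hembed H (s k) \<ominus>\<^bsub>hcompletion H\<^esub> hclass H s)) \<longlonglongrightarrow> 0"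
proof (rule LIMSEQ_I)
  interpret C: semi_inner_space "hcompletion H" by (rule semi_inner_space_hcompletion)
  note c = hcauchy_carrier[OF s]
  fix e :: real assume "e > 0"
  then have "e / 2 > 0" by simp
  then obtain N where N: "\<And>m n. m \<ge> N \<Longrightarrow> n \<ge> N \<Longrightarrow> hnorm H (s m \<ominus>\<^bsub>H\<^esub> s n) < e / 2"
    using hcauchyD[OF s] by blast
  have cl: "hclass H s \<in> carrier (hcompletion H)" using s by (auto simp: hcompletion_carrier)
  have "hnorm (hcompletion H) (hembed H (s k) \<ominus>\<^bsub>hcompletion H\<^esub> hclass H s) \<le> e / 2" if k: "k \<ge> N" for k
  proof -
    have d: "hcauchy H (\<lambda>n. s k \<oplus>\<^bsub>H\<^esub> (-1) \<odot>\<^bsub>H\<^esub> s n)"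
      by (intro hcauchy_add hcauchy_smult hcauchy_const s c)
    have e: "hembed H (s k) \<ominus>\<^bsub>hcompletion H\<^esub> hclass H s = hclass H (\<lambda>n. s k \<oplus>\<^bsub>H\<^esub> (-1) \<odot>\<^bsub>H\<^esub> s n)"
      using s by (simp add: C.minus_eq_scale cl hembed_closed c)
        (simp add: hembed_def hcompletion_add hcompletion_smult hcauchy_smult c)
    have "(\<lambda>n. hnorm H (s k \<oplus>\<^bsub>H\<^esub> (-1) \<odot>\<^bsub>H\<^esub> s n)) \<longlonglongrightarrow> hnorm (hcompletion H) (hembed H (s k) \<ominus>\<^bsub>hcompletion H\<^esub> hclass H s)"
      unfolding e hnorm_def by (intro tendsto_intros hcompletion_ip d)
    then show ?thesis
    proof (rule LIMSEQ_le_const2, intro exI[of _ N] allI impI)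
      fix n assume "n \<ge> N"
      then show "hnorm H (s k \<oplus>\<^bsub>H\<^esub> (-1) \<odot>\<^bsub>H\<^esub> s n) \<le> e / 2"
        using N[OF k, of n] by (simp only: minus_eq_scale[OF c c] less_imp_le)
    qed
  qed
  then show "\<exists>N. \<forall>k\<ge>N. norm (hnorm (hcompletion H) (hembed H (s k) \<ominus>\<^bsub>hcompletion H\<^esub> hclass H s) - 0) < e"
    using \<open>e > 0\<close> C.hnorm_nonneg[OF C.minus_closed[OF hembed_closed[OF c] cl]]
    by (intro exI[of _ N]) fastforce
qed

lemma hembed_dense:
  assumes X: "X \<in> carrier (hcompletion H)" and e: "e > 0"
  obtains x where "x \<in> carrier H" "hnorm (hcompletion H) (X \<ominus>\<^bsub>hcompletion H\<^esub> hembed H x) < e"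
proof -
  interpret C: semi_inner_space "hcompletion H" by (rule semi_inner_space_hcompletion)
  obtain s where s: "X = hclass H s" "hcauchy H s" using X by (auto simp: hcompletion_carrier)
  note c = hcauchy_carrier[OF s(2)]
  obtain N where "\<And>k. k \<ge> N \<Longrightarrow> norm (hnorm (hcompletion H) (hembed H (s k) \<ominus>\<^bsub>hcompletion H\<^esub> hclass H s) - 0) < e"
    using LIMSEQ_D[OF hembed_tendsto_hclass[OF s(2)] e] by blast
  from this[of N] have "hnorm (hcompletion H) (hembed H (s N) \<ominus>\<^bsub>hcompletion H\<^esub> X) < e"
    by (simp add: s)
  then show ?thesis
    using that[OF c] C.hnorm_minus_commute[OF X hembed_closed[OF c]] by metis
qed

text \<open>A Cauchy sequence of classes is approximated term by term by embedded vectors, the \<open>k\<close>-th one up to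
  \<open>1 / (k + 1)\<close>. These vectors form a Cauchy sequence, and its class is the limit.\<close>

lemma hilbert_space_hcompletion: "hilbert_space (hcompletion H)"
proof -
  interpret C: semi_inner_space "hcompletion H" by (rule semi_inner_space_hcompletion)
  show ?thesis
  proof
    fix X assume X: "X \<in> carrier (hcompletion H)" and 0: "ip (hcompletion H) X X = 0"
    obtain s where s: "X = hclass H s" "hcauchy H s" using X by (auto simp: hcompletion_carrier)
    note c = hcauchy_carrier[OF s(2)]
    have "(\<lambda>n. hnorm H (s n)) \<longlonglongrightarrow> sqrt (Re 0)"
      unfolding hnorm_def 0[symmetric] s by (intro tendsto_intros hcompletion_ip s(2))
    then have "(\<lambda>n. hnorm H (s n \<ominus>\<^bsub>H\<^esub> \<zero>\<^bsub>H\<^esub>)) \<longlonglongrightarrow> 0" by (simp add: hnorm_minus_zero c)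
    then show "X = \<zero>\<^bsub>hcompletion H\<^esub>"
      unfolding s hcompletion_zero by (intro hclass_eqI s hcauchy_const) auto
  next
    fix X assume hc: "hcauchy (hcompletion H) X"
    note XC = C.hcauchy_carrier[OF hc]
    have "\<exists>v. \<forall>k. v k \<in> carrier H \<and>
        hnorm (hcompletion H) (X k \<ominus>\<^bsub>hcompletion H\<^esub> hembed H (v k)) < inverse (real (Suc k))"
    proof (intro choice allI)
      fix k
      have "inverse (real (Suc k)) > 0" by simp
      from hembed_dense[OF XC this] show "\<exists>x. x \<in> carrier H \<and>
          hnorm (hcompletion H) (X k \<ominus>\<^bsub>hcompletion H\<^esub> hembed H x) < inverse (real (Suc k))" by blast
    qed
    then obtain v where v: "\<And>k. v k \<in> carrier H"
      and vX: "\<And>k. hnorm (hcompletion H) (X k \<ominus>\<^bsub>hcompletion H\<^esub> hembed H (v k)) < inverse (real (Suc k))"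
      by blast
    note vC = hembed_closed[OF v]
    have Xv: "(\<lambda>k. hnorm (hcompletion H) (X k \<ominus>\<^bsub>hcompletion H\<^esub> hembed H (v k))) \<longlonglongrightarrow> 0"
      by (rule tendsto_sandwich[OF always_eventually always_eventually tendsto_const LIMSEQ_inverse_real_of_nat])
        (use C.hnorm_nonneg[OF C.minus_closed[OF XC vC]] less_imp_le[OF vX] in auto)
    have hv: "hcauchy H v"
    proof (rule hcauchy_criterion[OF v])
      fix e :: real assume "e > 0"
      then have e3: "e / 3 > 0" by simp
      obtain M where M: "\<And>m n. m \<ge> M \<Longrightarrow> n \<ge> M \<Longrightarrow> hnorm (hcompletion H) (X m \<ominus>\<^bsub>hcompletion H\<^esub> X n) < e / 3"
        using C.hcauchyD[OF hc e3] by blast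
      obtain N where N: "\<And>k. k \<ge> N \<Longrightarrow> hnorm (hcompletion H) (X k \<ominus>\<^bsub>hcompletion H\<^esub> hembed H (v k)) < e / 3"
        using LIMSEQ_D[OF Xv e3] C.hnorm_nonneg[OF C.minus_closed[OF XC vC]]
        by (metis abs_of_nonneg diff_zero real_norm_def)
      have "hnorm H (v m \<ominus>\<^bsub>H\<^esub> v n) < e" if "m \<ge> max M N" "n \<ge> max M N" for m n
      proof -
        have "hnorm H (v m \<ominus>\<^bsub>H\<^esub> v n) = hnorm (hcompletion H) (hembed H (v m) \<ominus>\<^bsub>hcompletion H\<^esub> hembed H (v n))"
          using hembed_hnorm[of "v m \<ominus>\<^bsub>H\<^esub> v n"] v by (simp add: hembed_minus)
        also have "\<dots> < e"
          using C.hnorm_minus_triangle[OF vC XC vC, of m n m] C.hnorm_minus_triangle[OF XC XC vC, of m n n]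
            C.hnorm_minus_commute[OF vC XC, of m m] N[of m] N[of n] M[of m n] that by simp
        finally show ?thesis .
      qed
      then show "\<exists>N. \<forall>m\<ge>N. \<forall>n\<ge>N. hnorm H (v m \<ominus>\<^bsub>H\<^esub> v n) < e" by blast
    qed
    from hv have cl: "hclass H v \<in> carrier (hcompletion H)" by (auto simp: hcompletion_carrier)
    show "\<exists>Y\<in>carrier (hcompletion H). (\<lambda>n. hnorm (hcompletion H) (X n \<ominus>\<^bsub>hcompletion H\<^esub> Y)) \<longlonglongrightarrow> 0"
      using C.null_trans[OF XC vC cl Xv hembed_tendsto_hclass[OF hv]] cl by blast
  qed
qed

end

section \<open>Bounded operators\<close>

lemma bounded_opsI:
  assumes "\<And>x. x \<in> carrier H \<Longrightarrow> T x \<in> carrier L"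
    and "\<And>x. x \<notin> carrier H \<Longrightarrow> T x = undefined"
    and "\<And>x y. x \<in> carrier H \<Longrightarrow> y \<in> carrier H \<Longrightarrow> T (x \<oplus>\<^bsub>H\<^esub> y) = T x \<oplus>\<^bsub>L\<^esub> T y"
    and "\<And>a x. x \<in> carrier H \<Longrightarrow> T (a \<odot>\<^bsub>H\<^esub> x) = a \<odot>\<^bsub>L\<^esub> T x"
    and "\<And>x. x \<in> carrier H \<Longrightarrow> hnorm L (T x) \<le> C * hnorm H x"
  shows "T \<in> bounded_ops H L"
  unfolding bounded_ops_def using assms by blast

lemma bounded_ops_closed: "T \<in> bounded_ops H L \<Longrightarrow> x \<in> carrier H \<Longrightarrow> T x \<in> carrier L"
  by (auto simp: bounded_ops_def)

lemma bounded_ops_undefined: "T \<in> bounded_ops H L \<Longrightarrow> x \<notin> carrier H \<Longrightarrow> T x = undefined"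
  by (auto simp: bounded_ops_def)

lemma bounded_ops_add: "T \<in> bounded_ops H L \<Longrightarrow> x \<in> carrier H \<Longrightarrow> y \<in> carrier H \<Longrightarrow>
    T (x \<oplus>\<^bsub>H\<^esub> y) = T x \<oplus>\<^bsub>L\<^esub> T y"
  by (auto simp: bounded_ops_def)

lemma bounded_ops_smult: "T \<in> bounded_ops H L \<Longrightarrow> x \<in> carrier H \<Longrightarrow> T (a \<odot>\<^bsub>H\<^esub> x) = a \<odot>\<^bsub>L\<^esub> T x"
  by (auto simp: bounded_ops_def)

lemma bounded_ops_bound:
  assumes "T \<in> bounded_ops H L" "semi_inner_space H"
  obtains C where "0 \<le> C" "\<And>x. x \<in> carrier H \<Longrightarrow> hnorm L (T x) \<le> C * hnorm H x"
proof -
  obtain C where C: "\<And>x. x \<in> carrier H \<Longrightarrow> hnorm L (T x) \<le> C * hnorm H x"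
    using assms(1) unfolding bounded_ops_def by blast
  show ?thesis
  proof
    fix x assume x: "x \<in> carrier H"
    have "C * hnorm H x \<le> \<bar>C\<bar> * hnorm H x"
      by (rule mult_right_mono) (use semi_inner_space.hnorm_nonneg[OF assms(2) x] in auto)
    then show "hnorm L (T x) \<le> \<bar>C\<bar> * hnorm H x" using C[OF x] by simp
  qed simp
qed

lemma bounded_ops_minus:
  assumes T: "T \<in> bounded_ops H L" and H: "semi_inner_space H" and L: "semi_inner_space L"
    and x: "x \<in> carrier H" and y: "y \<in> carrier H"
  shows "T (x \<ominus>\<^bsub>H\<^esub> y) = T x \<ominus>\<^bsub>L\<^esub> T y"
proof -
  interpret H: semi_inner_space H by (rule H)
  interpret L: semi_inner_space L by (rule L)
  show ?thesis
    by (simp add: H.minus_eq_scale[OF x y] bounded_ops_add[OF T x] bounded_ops_smult[OF T y] y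
        L.minus_eq_scale bounded_ops_closed[OF T] x)
qed

lemma bounded_ops_zero:
  assumes T: "T \<in> bounded_ops H L" and H: "semi_inner_space H" and L: "semi_inner_space L"
  shows "T \<zero>\<^bsub>H\<^esub> = \<zero>\<^bsub>L\<^esub>"
proof -
  interpret H: semi_inner_space H by (rule H)
  interpret L: semi_inner_space L by (rule L)
  have "T (0 \<odot>\<^bsub>H\<^esub> \<zero>\<^bsub>H\<^esub>) = 0 \<odot>\<^bsub>L\<^esub> T \<zero>\<^bsub>H\<^esub>" by (intro bounded_ops_smult[OF T]) simp
  then show ?thesis using bounded_ops_closed[OF T H.zero_closed] by simp
qed

lemma bounded_ops_finsum:
  assumes T: "T \<in> bounded_ops H L" and H: "semi_inner_space H" and L: "semi_inner_space L"
    and fin: "finite A" and g: "\<And>a. a \<in> A \<Longrightarrow> g a \<in> carrier H"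
  shows "T (finsum H g A) = finsum L (\<lambda>a. T (g a)) A"
proof -
  interpret H: semi_inner_space H by (rule H)
  interpret L: semi_inner_space L by (rule L)
  show ?thesis using fin g
  proof (induction A rule: finite_induct)
    case empty
    show ?case by (simp add: bounded_ops_zero[OF T H L])
  next
    case (insert a F)
    have "T (finsum H g (insert a F)) = T (g a \<oplus>\<^bsub>H\<^esub> finsum H g F)"
      using insert by (subst H.finsum_insert) auto
    also have "\<dots> = T (g a) \<oplus>\<^bsub>L\<^esub> finsum L (\<lambda>a. T (g a)) F"
      using insert by (subst bounded_ops_add[OF T]) (auto intro!: H.finsum_closed)
    also have "\<dots> = finsum L (\<lambda>a. T (g a)) (insert a F)"
      using insert by (subst L.finsum_insert) (auto intro!: bounded_ops_closed[OF T])
    finally show ?case .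
  qed
qed

lemma opnorm_le:
  assumes "0 \<le> C" "\<And>x. x \<in> carrier H \<Longrightarrow> hnorm L (T x) \<le> C * hnorm H x"
  shows "opnorm H L T \<le> C"
  unfolding opnorm_def by (rule cInf_lower) (use assms in \<open>auto intro!: bdd_belowI[of _ 0]\<close>)

lemma opnorm_bound:
  assumes H: "semi_inner_space H" and C: "0 \<le> C" "\<And>x. x \<in> carrier H \<Longrightarrow> hnorm L (T x) \<le> C * hnorm H x"
    and x: "x \<in> carrier H"
  shows "hnorm L (T x) \<le> opnorm H L T * hnorm H x"
proof -
  let ?S = "{C. 0 \<le> C \<and> (\<forall>x\<in>carrier H. hnorm L (T x) \<le> C * hnorm H x)}"
  have nx: "0 \<le> hnorm H x" by (rule semi_inner_space.hnorm_nonneg[OF H x])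
  have ne: "?S \<noteq> {}" using C by blast
  show ?thesis
  proof (cases "hnorm H x = 0")
    case True
    then show ?thesis using C(2)[OF x] by simp
  next
    case False
    with nx have pos: "0 < hnorm H x" by simp
    have "hnorm L (T x) / hnorm H x \<le> opnorm H L T"
      unfolding opnorm_def
      by (rule cInf_greatest[OF ne]) (use pos x in \<open>auto simp: pos_divide_le_eq\<close>)
    then show ?thesis using pos by (simp add: pos_divide_le_eq)
  qed
qed

lemma opnorm_nonneg:
  assumes "0 \<le> C" "\<And>x. x \<in> carrier H \<Longrightarrow> hnorm L (T x) \<le> C * hnorm H x"
  shows "0 \<le> opnorm H L T"
proof -
  have "{C. 0 \<le> C \<and> (\<forall>x\<in>carrier H. hnorm L (T x) \<le> C * hnorm H x)} \<noteq> {}" using assms by blast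
  then show ?thesis unfolding opnorm_def by (rule cInf_greatest) simp
qed

lemma bounded_ops_opnorm:
  assumes T: "T \<in> bounded_ops H L" and H: "semi_inner_space H" and x: "x \<in> carrier H"
  shows "hnorm L (T x) \<le> opnorm H L T * hnorm H x"
proof -
  obtain C where "0 \<le> C" "\<And>x. x \<in> carrier H \<Longrightarrow> hnorm L (T x) \<le> C * hnorm H x"
    using bounded_ops_bound[OF T H] by blast
  then show ?thesis by (rule opnorm_bound[OF H _ _ x])
qed

lemma bounded_ops_opnorm_nonneg:
  assumes T: "T \<in> bounded_ops H L" and H: "semi_inner_space H"
  shows "0 \<le> opnorm H L T"
proof -
  obtain C where "0 \<le> C" "\<And>x. x \<in> carrier H \<Longrightarrow> hnorm L (T x) \<le> C * hnorm H x"
    using bounded_ops_bound[OF T H] by blast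
  then show ?thesis by (rule opnorm_nonneg)
qed

lemma bounded_op_tendsto:
  assumes T: "T \<in> bounded_ops H L" and H: "semi_inner_space H" and L: "semi_inner_space L"
    and s: "\<And>n. s n \<in> carrier H" and x: "x \<in> carrier H"
    and lim: "(\<lambda>n. hnorm H (s n \<ominus>\<^bsub>H\<^esub> x)) \<longlonglongrightarrow> 0"
  shows "(\<lambda>n. hnorm L (T (s n) \<ominus>\<^bsub>L\<^esub> T x)) \<longlonglongrightarrow> 0"
proof -
  interpret H: semi_inner_space H by (rule H)
  interpret L: semi_inner_space L by (rule L)
  obtain C where C: "\<And>x. x \<in> carrier H \<Longrightarrow> hnorm L (T x) \<le> C * hnorm H x"
    using bounded_ops_bound[OF T H] by blast
  show ?thesis
  proof (rule tendsto_sandwich[OF always_eventually always_eventually tendsto_const])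
    show "(\<lambda>n. C * hnorm H (s n \<ominus>\<^bsub>H\<^esub> x)) \<longlonglongrightarrow> 0" using tendsto_mult_left[OF lim, of C] by simp
    show "\<forall>n. 0 \<le> hnorm L (T (s n) \<ominus>\<^bsub>L\<^esub> T x)" using bounded_ops_closed[OF T] s x by simp
    show "\<forall>n. hnorm L (T (s n) \<ominus>\<^bsub>L\<^esub> T x) \<le> C * hnorm H (s n \<ominus>\<^bsub>H\<^esub> x)"
      using C[OF H.minus_closed[OF s x]] by (simp add: bounded_ops_minus[OF T H L s x])
  qed
qed

lemma dense_sequence:
  assumes dense: "\<And>x e. x \<in> carrier H \<Longrightarrow> 0 < (e::real) \<Longrightarrow> \<exists>w\<in>D. hnorm H (x \<ominus>\<^bsub>H\<^esub> J w) < e"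
    and H: "semi_inner_space H" and J: "\<And>w. w \<in> D \<Longrightarrow> J w \<in> carrier H" and x: "x \<in> carrier H"
  obtains w where "\<And>n::nat. w n \<in> D" "(\<lambda>n. hnorm H (J (w n) \<ominus>\<^bsub>H\<^esub> x)) \<longlonglongrightarrow> 0"
proof -
  interpret H: semi_inner_space H by (rule H)
  have "\<exists>w. \<forall>n. w n \<in> D \<and> hnorm H (x \<ominus>\<^bsub>H\<^esub> J (w n)) < inverse (real (Suc n))"
  proof (intro choice allI)
    fix n
    show "\<exists>w. w \<in> D \<and> hnorm H (x \<ominus>\<^bsub>H\<^esub> J w) < inverse (real (Suc n))"
      using dense[OF x, of "inverse (real (Suc n))"] by auto
  qed
  then obtain w where w: "\<And>n. w n \<in> D" "\<And>n. hnorm H (x \<ominus>\<^bsub>H\<^esub> J (w n)) < inverse (real (Suc n))"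
    by blast
  have wc: "J (w n) \<in> carrier H" for n by (rule J[OF w(1)])
  have "(\<lambda>n. hnorm H (x \<ominus>\<^bsub>H\<^esub> J (w n))) \<longlonglongrightarrow> 0"
    by (rule tendsto_sandwich[OF always_eventually always_eventually tendsto_const LIMSEQ_inverse_real_of_nat])
      (use H.hnorm_nonneg[OF H.minus_closed[OF x wc]] less_imp_le[OF w(2)] in auto)
  then have "(\<lambda>n. hnorm H (J (w n) \<ominus>\<^bsub>H\<^esub> x)) \<longlonglongrightarrow> 0" by (rule H.null_sym[OF x wc])
  with w(1) show ?thesis by (rule that)
qed

text \<open>The value at \<open>x\<close> is the limit of \<open>T w\<close> along any \<open>w\<close> with \<open>J w\<close> tending to \<open>x\<close>. The bound on \<open>T\<close> and
  the isometry \<open>J\<close> make these images Cauchy and their limit independent of the choice. \<open>J\<close> is a map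
  rather than an inclusion because vectors of \<open>W\<close> and of its completion have different types.\<close>

lemma dense_extension:
  fixes W :: "'w hspace" and H :: "'h hspace" and L :: "'l hspace"
  assumes W: "semi_inner_space W" and H: "hilbert_space H" and L: "hilbert_space L"
    and J: "\<And>w. w \<in> carrier W \<Longrightarrow> J w \<in> carrier H"
    and J_add: "\<And>v w. v \<in> carrier W \<Longrightarrow> w \<in> carrier W \<Longrightarrow> J (v \<oplus>\<^bsub>W\<^esub> w) = J v \<oplus>\<^bsub>H\<^esub> J w"
    and J_smult: "\<And>a w. w \<in> carrier W \<Longrightarrow> J (a \<odot>\<^bsub>W\<^esub> w) = a \<odot>\<^bsub>H\<^esub> J w"
    and J_norm: "\<And>w. w \<in> carrier W \<Longrightarrow> hnorm H (J w) = hnorm W w"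
    and dense: "\<And>x e. x \<in> carrier H \<Longrightarrow> 0 < (e::real) \<Longrightarrow> \<exists>w\<in>carrier W. hnorm H (x \<ominus>\<^bsub>H\<^esub> J w) < e"
    and T: "\<And>w. w \<in> carrier W \<Longrightarrow> T w \<in> carrier L"
    and T_add: "\<And>v w. v \<in> carrier W \<Longrightarrow> w \<in> carrier W \<Longrightarrow> T (v \<oplus>\<^bsub>W\<^esub> w) = T v \<oplus>\<^bsub>L\<^esub> T w"
    and T_smult: "\<And>a w. w \<in> carrier W \<Longrightarrow> T (a \<odot>\<^bsub>W\<^esub> w) = a \<odot>\<^bsub>L\<^esub> T w"
    and T_norm: "\<And>w. w \<in> carrier W \<Longrightarrow> hnorm L (T w) \<le> C * hnorm W w"
  obtains S where "S \<in> bounded_ops H L" "\<And>w. w \<in> carrier W \<Longrightarrow> S (J w) = T w"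
    "\<And>x. x \<in> carrier H \<Longrightarrow> hnorm L (S x) \<le> C * hnorm H x"
proof -
  interpret W: semi_inner_space W by (rule W)
  interpret H: hilbert_space H by (rule H)
  interpret L: hilbert_space L by (rule L)
  note Hs = H.semi_inner_space_axioms and Ls = L.semi_inner_space_axioms
  have J_minus: "J (v \<ominus>\<^bsub>W\<^esub> w) = J v \<ominus>\<^bsub>H\<^esub> J w" if "v \<in> carrier W" "w \<in> carrier W" for v w
    using that by (simp add: W.minus_eq_scale H.minus_eq_scale J J_add J_smult)
  have T_minus: "T (v \<ominus>\<^bsub>W\<^esub> w) = T v \<ominus>\<^bsub>L\<^esub> T w" if "v \<in> carrier W" "w \<in> carrier W" for v w
    using that by (simp add: W.minus_eq_scale L.minus_eq_scale T T_add T_smult)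
  have diff: "hnorm L (T v \<ominus>\<^bsub>L\<^esub> T w) \<le> C * hnorm H (J v \<ominus>\<^bsub>H\<^esub> J w)" if "v \<in> carrier W" "w \<in> carrier W" for v w
    using T_norm[OF W.minus_closed[OF that]] J_norm[OF W.minus_closed[OF that]] that
    by (simp add: J_minus T_minus)
  let ?lim = "\<lambda>w x. (\<forall>n::nat. w n \<in> carrier W) \<and> (\<lambda>n. hnorm H (J (w n) \<ominus>\<^bsub>H\<^esub> x)) \<longlonglongrightarrow> 0"
  let ?P = "\<lambda>x z. z \<in> carrier L \<and> (\<forall>w. ?lim w x \<longrightarrow> (\<lambda>n. hnorm L (T (w n) \<ominus>\<^bsub>L\<^esub> z)) \<longlonglongrightarrow> 0)"
  have null: "(\<lambda>n. hnorm L (T (w n) \<ominus>\<^bsub>L\<^esub> T (v n))) \<longlonglongrightarrow> 0"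
    if v: "?lim v x" and w: "?lim w x" and x: "x \<in> carrier H" for v w :: "nat \<Rightarrow> 'w" and x
  proof (rule tendsto_sandwich[OF always_eventually always_eventually tendsto_const])
    have c: "w n \<in> carrier W" "v n \<in> carrier W" for n using v w by auto
    have "(\<lambda>n. hnorm H (J (w n) \<ominus>\<^bsub>H\<^esub> J (v n))) \<longlonglongrightarrow> 0"
      by (rule H.null_trans[OF J[OF c(1)] x J[OF c(2)] _ H.null_sym[OF J[OF c(2)] x]]) (use v w in auto)
    from tendsto_mult_left[OF this, of C] show "(\<lambda>n. C * hnorm H (J (w n) \<ominus>\<^bsub>H\<^esub> J (v n))) \<longlonglongrightarrow> 0" by simp
    show "\<forall>n. 0 \<le> hnorm L (T (w n) \<ominus>\<^bsub>L\<^esub> T (v n))" using T c by simp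
    show "\<forall>n. hnorm L (T (w n) \<ominus>\<^bsub>L\<^esub> T (v n)) \<le> C * hnorm H (J (w n) \<ominus>\<^bsub>H\<^esub> J (v n))"
      using diff[OF c] by simp
  qed
  have ex: "\<exists>z. ?P x z" if x: "x \<in> carrier H" for x
  proof -
    obtain w where w: "\<And>n::nat. w n \<in> carrier W" "(\<lambda>n. hnorm H (J (w n) \<ominus>\<^bsub>H\<^esub> x)) \<longlonglongrightarrow> 0"
      using dense_sequence[OF dense Hs J x] by blast
    have "hcauchy L (\<lambda>n. T (w n))"
    proof (rule L.hcauchy_criterion[OF T[OF w(1)]])
      fix e :: real assume "e > 0"
      then have "e / (\<bar>C\<bar> + 1) > 0" by (intro divide_pos_pos) auto
      with H.hcauchyD[OF H.hcauchyI[OF J[OF w(1)] x w(2)]]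
      obtain N where N: "\<And>m n. m \<ge> N \<Longrightarrow> n \<ge> N \<Longrightarrow> hnorm H (J (w m) \<ominus>\<^bsub>H\<^esub> J (w n)) < e / (\<bar>C\<bar> + 1)"
        by blast
      have "hnorm L (T (w m) \<ominus>\<^bsub>L\<^esub> T (w n)) < e" if "m \<ge> N" "n \<ge> N" for m n
      proof -
        let ?d = "hnorm H (J (w m) \<ominus>\<^bsub>H\<^esub> J (w n))"
        have d0: "0 \<le> ?d" using J w by simp
        have "?d * (\<bar>C\<bar> + 1) < e" using N[OF that] by (simp add: pos_less_divide_eq)
        moreover have "C * ?d \<le> \<bar>C\<bar> * ?d" using d0 by (intro mult_right_mono) auto
        ultimately show ?thesis
          using diff[OF w(1) w(1), of m n] d0 by (simp add: algebra_simps)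
      qed
      then show "\<exists>N. \<forall>m\<ge>N. \<forall>n\<ge>N. hnorm L (T (w m) \<ominus>\<^bsub>L\<^esub> T (w n)) < e" by blast
    qed
    from L.complete[OF this] obtain z where z: "z \<in> carrier L" "(\<lambda>n. hnorm L (T (w n) \<ominus>\<^bsub>L\<^esub> z)) \<longlonglongrightarrow> 0"
      by blast
    have "(\<lambda>n. hnorm L (T (v n) \<ominus>\<^bsub>L\<^esub> z)) \<longlonglongrightarrow> 0" if v: "?lim v x" for v
      by (rule L.null_trans[OF T T[OF w(1)] z(1) null[of w x v] z(2)]) (use v w x in auto)
    with z(1) show ?thesis by blast
  qed
  define S where "S = (\<lambda>x\<in>carrier H. SOME z. ?P x z)"
  have SP: "?P x (S x)" if x: "x \<in> carrier H" for x
    using someI_ex[OF ex[OF x]] x by (simp add: S_def)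
  have Sc: "S x \<in> carrier L" if "x \<in> carrier H" for x using SP[OF that] by blast
  have Slim: "(\<lambda>n. hnorm L (T (w n) \<ominus>\<^bsub>L\<^esub> S x)) \<longlonglongrightarrow> 0"
    if "x \<in> carrier H" "\<And>n. w n \<in> carrier W" "(\<lambda>n. hnorm H (J (w n) \<ominus>\<^bsub>H\<^esub> x)) \<longlonglongrightarrow> 0" for x w
    using SP[OF that(1)] that(2,3) by blast
  have Sbound: "hnorm L (S x) \<le> C * hnorm H x" if x: "x \<in> carrier H" for x
  proof -
    obtain w where w: "\<And>n::nat. w n \<in> carrier W" "(\<lambda>n. hnorm H (J (w n) \<ominus>\<^bsub>H\<^esub> x)) \<longlonglongrightarrow> 0"
      using dense_sequence[OF dense Hs J x] by blast
    show ?thesis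
    proof (rule LIMSEQ_le)
      show "(\<lambda>n. hnorm L (T (w n))) \<longlonglongrightarrow> hnorm L (S x)"
        by (rule L.hnorm_tendsto[OF T[OF w(1)] Sc[OF x] Slim[OF x w]])
      show "(\<lambda>n. C * hnorm H (J (w n))) \<longlonglongrightarrow> C * hnorm H x"
        by (intro tendsto_mult_left H.hnorm_tendsto[OF J[OF w(1)] x w(2)])
      show "\<exists>N. \<forall>n\<ge>N. hnorm L (T (w n)) \<le> C * hnorm H (J (w n))"
        using T_norm[OF w(1)] J_norm[OF w(1)] by auto
    qed
  qed
  have "S \<in> bounded_ops H L"
  proof (rule bounded_opsI)
    fix x y assume x: "x \<in> carrier H" and y: "y \<in> carrier H"
    obtain v where v: "\<And>n::nat. v n \<in> carrier W" "(\<lambda>n. hnorm H (J (v n) \<ominus>\<^bsub>H\<^esub> x)) \<longlonglongrightarrow> 0"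
      using dense_sequence[OF dense Hs J x] by blast
    obtain w where w: "\<And>n::nat. w n \<in> carrier W" "(\<lambda>n. hnorm H (J (w n) \<ominus>\<^bsub>H\<^esub> y)) \<longlonglongrightarrow> 0"
      using dense_sequence[OF dense Hs J y] by blast
    have "(\<lambda>n. hnorm H (J (v n \<oplus>\<^bsub>W\<^esub> w n) \<ominus>\<^bsub>H\<^esub> (x \<oplus>\<^bsub>H\<^esub> y))) \<longlonglongrightarrow> 0"
      unfolding J_add[OF v(1) w(1)]
      by (rule tendsto_sandwich[OF always_eventually always_eventually tendsto_const
            tendsto_add_zero[OF v(2) w(2)]])
        (use H.hnorm_diff_add_le[OF J[OF v(1)] x J[OF w(1)] y] J v w x y in auto)
    then have 1: "(\<lambda>n. hnorm L (T (v n \<oplus>\<^bsub>W\<^esub> w n) \<ominus>\<^bsub>L\<^esub> S (x \<oplus>\<^bsub>H\<^esub> y))) \<longlonglongrightarrow> 0"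
      by (intro Slim) (use x y v w in auto)
    have 2: "(\<lambda>n. hnorm L (T (v n \<oplus>\<^bsub>W\<^esub> w n) \<ominus>\<^bsub>L\<^esub> (S x \<oplus>\<^bsub>L\<^esub> S y))) \<longlonglongrightarrow> 0"
      unfolding T_add[OF v(1) w(1)]
      by (rule tendsto_sandwich[OF always_eventually always_eventually tendsto_const
            tendsto_add_zero[OF Slim[OF x v] Slim[OF y w]]])
        (use L.hnorm_diff_add_le[OF T[OF v(1)] Sc[OF x] T[OF w(1)] Sc[OF y]] T v w Sc x y in auto)
    show "S (x \<oplus>\<^bsub>H\<^esub> y) = S x \<oplus>\<^bsub>L\<^esub> S y"
      by (rule L.limit_unique[OF _ _ _ 1 2]) (use T v w Sc x y in auto)
  next
    fix a x assume x: "x \<in> carrier H"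
    obtain v where v: "\<And>n::nat. v n \<in> carrier W" "(\<lambda>n. hnorm H (J (v n) \<ominus>\<^bsub>H\<^esub> x)) \<longlonglongrightarrow> 0"
      using dense_sequence[OF dense Hs J x] by blast
    have "(\<lambda>n. hnorm H (J (a \<odot>\<^bsub>W\<^esub> v n) \<ominus>\<^bsub>H\<^esub> (a \<odot>\<^bsub>H\<^esub> x))) \<longlonglongrightarrow> 0"
      unfolding J_smult[OF v(1)] H.hnorm_diff_smult[OF J[OF v(1)] x]
      using tendsto_mult_left[OF v(2), of "cmod a"] by simp
    then have 1: "(\<lambda>n. hnorm L (T (a \<odot>\<^bsub>W\<^esub> v n) \<ominus>\<^bsub>L\<^esub> S (a \<odot>\<^bsub>H\<^esub> x))) \<longlonglongrightarrow> 0"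
      by (intro Slim) (use x v in auto)
    have 2: "(\<lambda>n. hnorm L (T (a \<odot>\<^bsub>W\<^esub> v n) \<ominus>\<^bsub>L\<^esub> (a \<odot>\<^bsub>L\<^esub> S x))) \<longlonglongrightarrow> 0"
      unfolding T_smult[OF v(1)] L.hnorm_diff_smult[OF T[OF v(1)] Sc[OF x]]
      using tendsto_mult_left[OF Slim[OF x v], of "cmod a"] by simp
    show "S (a \<odot>\<^bsub>H\<^esub> x) = a \<odot>\<^bsub>L\<^esub> S x"
      by (rule L.limit_unique[OF _ _ _ 1 2]) (use T v Sc x in auto)
  qed (use Sc Sbound in \<open>auto simp: S_def\<close>)
  moreover have "S (J w) = T w" if w: "w \<in> carrier W" for w
  proof (rule L.limit_unique[of "\<lambda>_. T w"])
    have n: "(\<lambda>n::nat. hnorm H (J w \<ominus>\<^bsub>H\<^esub> J w)) \<longlonglongrightarrow> 0" using J[OF w] by simp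
    show "(\<lambda>n. hnorm L (T w \<ominus>\<^bsub>L\<^esub> S (J w))) \<longlonglongrightarrow> 0" by (rule Slim[OF J[OF w] w n])
    show "(\<lambda>n. hnorm L (T w \<ominus>\<^bsub>L\<^esub> T w)) \<longlonglongrightarrow> 0" using T[OF w] by simp
  qed (use T Sc J w in auto)
  ultimately show ?thesis using Sbound by (rule that)
qed

lemma bounded_ops_eqI_dense:
  assumes H: "semi_inner_space H" and L: "hilbert_space L"
    and S: "S \<in> bounded_ops H L" and T: "T \<in> bounded_ops H L"
    and J: "\<And>w. w \<in> D \<Longrightarrow> J w \<in> carrier H"
    and dense: "\<And>x e. x \<in> carrier H \<Longrightarrow> 0 < (e::real) \<Longrightarrow> \<exists>w\<in>D. hnorm H (x \<ominus>\<^bsub>H\<^esub> J w) < e"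
    and eq: "\<And>w. w \<in> D \<Longrightarrow> S (J w) = T (J w)"
  shows "S = T"
proof
  fix x
  interpret L: hilbert_space L by (rule L)
  show "S x = T x"
  proof (cases "x \<in> carrier H")
    case True
    obtain w where w: "\<And>n::nat. w n \<in> D" "(\<lambda>n. hnorm H (J (w n) \<ominus>\<^bsub>H\<^esub> x)) \<longlonglongrightarrow> 0"
      using dense_sequence[OF dense H J True] by blast
    note l = bounded_op_tendsto[OF _ H L.semi_inner_space_axioms J[OF w(1)] True w(2)]
    show ?thesis
      by (rule L.limit_unique[OF _ _ _ l[OF S] l[OF T, folded eq[OF w(1)]]])
        (intro bounded_ops_closed[OF S] bounded_ops_closed[OF T] J w True)+
  next
    case False
    then show ?thesis using bounded_ops_undefined[OF S] bounded_ops_undefined[OF T] by metis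
  qed
qed

text \<open>The iterates of \<open>y \<mapsto> h + T y\<close> from \<open>0\<close> are the partial sums of the Neumann series, and consecutive
  ones differ by at most \<open>q ^ n \<parallel>h\<parallel>\<close>.\<close>

lemma neumann_solution:
  assumes H: "hilbert_space H" and T: "T \<in> bounded_ops H H"
    and q: "0 \<le> q" "q < 1" and Tq: "\<And>x. x \<in> carrier H \<Longrightarrow> hnorm H (T x) \<le> q * hnorm H x"
    and h: "h \<in> carrier H"
  obtains y where "y \<in> carrier H" "y = h \<oplus>\<^bsub>H\<^esub> T y"
proof -
  interpret H: hilbert_space H by (rule H)
  note Hs = H.semi_inner_space_axioms
  note Tc = bounded_ops_closed[OF T]
  define F where "F = (\<lambda>y. h \<oplus>\<^bsub>H\<^esub> T y)"
  define s where "s n = (F ^^ n) \<zero>\<^bsub>H\<^esub>" for n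
  have Fc: "F y \<in> carrier H" if "y \<in> carrier H" for y using that h Tc by (simp add: F_def)
  have sc: "s n \<in> carrier H" for n by (induction n) (auto simp: s_def Fc)
  have Fdiff: "hnorm H (F x \<ominus>\<^bsub>H\<^esub> F y) \<le> q * hnorm H (x \<ominus>\<^bsub>H\<^esub> y)" if x: "x \<in> carrier H" and y: "y \<in> carrier H" for x y
  proof -
    have "hnorm H (F x \<ominus>\<^bsub>H\<^esub> F y) \<le> hnorm H (h \<ominus>\<^bsub>H\<^esub> h) + hnorm H (T x \<ominus>\<^bsub>H\<^esub> T y)"
      unfolding F_def by (intro H.hnorm_diff_add_le h Tc x y)
    also have "\<dots> = hnorm H (T (x \<ominus>\<^bsub>H\<^esub> y))" using h by (simp add: bounded_ops_minus[OF T Hs Hs x y])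
    also have "\<dots> \<le> q * hnorm H (x \<ominus>\<^bsub>H\<^esub> y)" by (rule Tq[OF H.minus_closed[OF x y]])
    finally show ?thesis .
  qed
  have step: "hnorm H (s (Suc n) \<ominus>\<^bsub>H\<^esub> s n) \<le> q ^ n * hnorm H h" for n
  proof (induction n)
    case 0
    have "s (Suc 0) = h" using h bounded_ops_zero[OF T Hs Hs] by (simp add: s_def F_def)
    then show ?case using h by (simp add: s_def H.hnorm_minus_zero)
  next
    case (Suc n)
    have "hnorm H (s (Suc (Suc n)) \<ominus>\<^bsub>H\<^esub> s (Suc n)) \<le> q * hnorm H (s (Suc n) \<ominus>\<^bsub>H\<^esub> s n)"
      using Fdiff[OF sc sc, of "Suc n" n] by (simp add: s_def)
    also have "\<dots> \<le> q * (q ^ n * hnorm H h)" by (rule mult_left_mono[OF Suc q(1)])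
    finally show ?case by simp
  qed
  have tele: "hnorm H (s (n + k) \<ominus>\<^bsub>H\<^esub> s n) \<le> (\<Sum>i<k. q ^ (n + i)) * hnorm H h" for n k
  proof (induction k)
    case 0
    show ?case using sc by simp
  next
    case (Suc k)
    have "hnorm H (s (n + Suc k) \<ominus>\<^bsub>H\<^esub> s n) \<le> hnorm H (s (Suc (n + k)) \<ominus>\<^bsub>H\<^esub> s (n + k)) + hnorm H (s (n + k) \<ominus>\<^bsub>H\<^esub> s n)"
      using H.hnorm_minus_triangle[OF sc[of "Suc (n + k)"] sc[of "n + k"] sc[of n]] by simp
    also have "\<dots> \<le> q ^ (n + k) * hnorm H h + (\<Sum>i<k. q ^ (n + i)) * hnorm H h"
      by (intro add_mono step Suc)
    finally show ?case by (simp add: algebra_simps)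
  qed
  have geo: "(\<Sum>i<k. q ^ (n + i)) \<le> q ^ n / (1 - q)" for n k
  proof -
    have "(\<Sum>i<k. q ^ (n + i)) = q ^ n * (\<Sum>i<k. q ^ i)" by (simp add: power_add sum_distrib_left)
    also have "(\<Sum>i<k. q ^ i) \<le> 1 / (1 - q)"
      using q by (simp add: sum_gp_strict divide_right_mono)
    then have "q ^ n * (\<Sum>i<k. q ^ i) \<le> q ^ n * (1 / (1 - q))" using q by (intro mult_left_mono) auto
    finally show ?thesis by simp
  qed
  have bound: "hnorm H (s m \<ominus>\<^bsub>H\<^esub> s n) \<le> q ^ n / (1 - q) * hnorm H h" if "n \<le> m" for m n
  proof -
    have "hnorm H (s m \<ominus>\<^bsub>H\<^esub> s n) \<le> (\<Sum>i<m - n. q ^ (n + i)) * hnorm H h"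
      using tele[of n "m - n"] that by simp
    also have "\<dots> \<le> q ^ n / (1 - q) * hnorm H h"
      by (rule mult_right_mono[OF geo]) (use h in simp)
    finally show ?thesis .
  qed
  have "(\<lambda>n. q ^ n / (1 - q) * hnorm H h) \<longlonglongrightarrow> 0 / (1 - q) * hnorm H h"
    by (intro tendsto_intros LIMSEQ_realpow_zero q) (use q in simp)
  then have qlim: "(\<lambda>n. q ^ n / (1 - q) * hnorm H h) \<longlonglongrightarrow> 0" by simp
  have "hcauchy H s"
  proof (rule H.hcauchy_criterion[OF sc])
    fix e :: real assume "e > 0"
    then obtain N where N: "\<And>n. n \<ge> N \<Longrightarrow> norm (q ^ n / (1 - q) * hnorm H h - 0) < e"
      using LIMSEQ_D[OF qlim] by blast
    have "hnorm H (s m \<ominus>\<^bsub>H\<^esub> s n) < e" if mn: "m \<ge> N" "n \<ge> N" for m n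
    proof (cases "n \<le> m")
      case True
      then show ?thesis using bound[OF True] N[OF mn(2)] unfolding real_norm_def diff_zero by linarith
    next
      case False
      then show ?thesis using bound[of m n] N[OF mn(1)] H.hnorm_minus_commute[OF sc sc, of m n]
        unfolding real_norm_def diff_zero by linarith
    qed
    then show "\<exists>N. \<forall>m\<ge>N. \<forall>n\<ge>N. hnorm H (s m \<ominus>\<^bsub>H\<^esub> s n) < e" by blast
  qed
  from H.complete[OF this] obtain y where y: "y \<in> carrier H" "(\<lambda>n. hnorm H (s n \<ominus>\<^bsub>H\<^esub> y)) \<longlonglongrightarrow> 0"
    by blast
  have "(\<lambda>n. hnorm H (F (s n) \<ominus>\<^bsub>H\<^esub> F y)) \<longlonglongrightarrow> 0"
  proof (rule tendsto_sandwich[OF always_eventually always_eventually tendsto_const])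
    show "(\<lambda>n. q * hnorm H (s n \<ominus>\<^bsub>H\<^esub> y)) \<longlonglongrightarrow> 0" using tendsto_mult_left[OF y(2), of q] by simp
  qed (use Fdiff[OF sc y(1)] Fc sc y in auto)
  moreover have "F (s n) = s (Suc n)" for n by (simp add: s_def)
  ultimately have "(\<lambda>n. hnorm H (s (Suc n) \<ominus>\<^bsub>H\<^esub> F y)) \<longlonglongrightarrow> 0" by simp
  moreover have "(\<lambda>n. hnorm H (s (Suc n) \<ominus>\<^bsub>H\<^esub> y)) \<longlonglongrightarrow> 0" using LIMSEQ_Suc[OF y(2)] .
  ultimately have "F y = y" using H.limit_unique[of "\<lambda>n. s (Suc n)"] sc Fc y(1) by blast
  then show ?thesis using that[of y] y(1) by (simp add: F_def)
qed

text \<open>The inverse of a linear bijection is linear, so only its bound has to be supplied.\<close>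

lemma op_invertibleI:
  assumes H: "semi_inner_space H" and T: "T \<in> bounded_ops H H"
    and R: "\<And>y. y \<in> carrier H \<Longrightarrow> R y \<in> carrier H"
    and TR: "\<And>y. y \<in> carrier H \<Longrightarrow> T (R y) = y"
    and RT: "\<And>x. x \<in> carrier H \<Longrightarrow> R (T x) = x"
    and bound: "\<And>y. y \<in> carrier H \<Longrightarrow> hnorm H (R y) \<le> C * hnorm H y"
  shows "op_invertible H T" and "\<And>y. y \<in> carrier H \<Longrightarrow> op_inverse H T y = R y"
proof -
  interpret H: semi_inner_space H by (rule H)
  note Tc = bounded_ops_closed[OF T]
  have inj: "inj_on T (carrier H)" using RT by (metis inj_onI)
  have bij: "bij_betw T (carrier H) (carrier H)"
    by (rule bij_betwI[where g = R]) (use Tc R TR RT in auto)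
  show inv: "op_inverse H T y = R y" if y: "y \<in> carrier H" for y
    using inv_into_f_f[OF inj R[OF y]] y by (simp add: op_inverse_def TR[OF y])
  have lin: "R (x \<oplus>\<^bsub>H\<^esub> y) = R x \<oplus>\<^bsub>H\<^esub> R y" if "x \<in> carrier H" "y \<in> carrier H" for x y
  proof -
    have "R (T (R x \<oplus>\<^bsub>H\<^esub> R y)) = R x \<oplus>\<^bsub>H\<^esub> R y" using that R by (intro RT) simp
    then show ?thesis using that R by (simp add: bounded_ops_add[OF T] TR)
  qed
  have smult: "R (a \<odot>\<^bsub>H\<^esub> x) = a \<odot>\<^bsub>H\<^esub> R x" if "x \<in> carrier H" for a x
  proof -
    have "R (T (a \<odot>\<^bsub>H\<^esub> R x)) = a \<odot>\<^bsub>H\<^esub> R x" using that R by (intro RT) simp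
    then show ?thesis using that R by (simp add: bounded_ops_smult[OF T] TR)
  qed
  have "op_inverse H T \<in> bounded_ops H H"
    by (rule bounded_opsI[where C = C]) (simp_all add: inv R lin smult bound, simp add: op_inverse_def)
  then show "op_invertible H T" unfolding op_invertible_def using T bij by blast
qed

section \<open>Matrices acting on tuples of vectors\<close>

lemma (in semi_inner_space) hnorm_zero_ip:
  assumes "y \<in> carrier H" "z \<in> carrier H" "hnorm H y = 0"
  shows "ip H y z = 0"
  using cauchy_schwarz[OF assms(1,2)] assms(3) by simp

text \<open>Gram-Schmidt orthonormalization in which remainders of norm zero are dropped, so that the form may
  be degenerate. Inner products of finitely many vectors thereby become sums of products of scalars,
  which reduces inequalities for vectors to inequalities for complex tuples.\<close>

lemma (in semi_inner_space) gram_factorization: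
  fixes n :: nat
  assumes x: "\<And>l. l < n \<Longrightarrow> x l \<in> carrier H"
  shows "\<exists>(r::nat) a. \<forall>l<n. \<forall>m<n. ip H (x l) (x m) = (\<Sum>s<r. a l s * cnj (a m s))"
proof -
  have "\<exists>(r::nat) e. (\<forall>s<r. e s \<in> carrier H) \<and> (\<forall>s<r. \<forall>t<r. ip H (e s) (e t) = (if s = t then 1 else 0)) \<and>
      (\<forall>l<n. \<forall>z\<in>carrier H. ip H (x l) z = (\<Sum>s<r. ip H (x l) (e s) * ip H (e s) z))"
    using x
  proof (induction n)
    case 0
    show ?case by (rule exI[of _ 0]) simp
  next
    case (Suc n)
    have "\<exists>(r::nat) e. (\<forall>s<r. e s \<in> carrier H) \<and> (\<forall>s<r. \<forall>t<r. ip H (e s) (e t) = (if s = t then 1 else 0)) \<and>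
        (\<forall>l<n. \<forall>z\<in>carrier H. ip H (x l) z = (\<Sum>s<r. ip H (x l) (e s) * ip H (e s) z))"
      by (rule Suc.IH) (use Suc.prems in simp)
    then obtain r :: nat and e where ec: "\<And>s. s < r \<Longrightarrow> e s \<in> carrier H"
      and on: "\<And>s t. s < r \<Longrightarrow> t < r \<Longrightarrow> ip H (e s) (e t) = (if s = t then 1 else 0)"
      and ex: "\<And>l z. l < n \<Longrightarrow> z \<in> carrier H \<Longrightarrow> ip H (x l) z = (\<Sum>s<r. ip H (x l) (e s) * ip H (e s) z)"
      by blast
    have xn: "x n \<in> carrier H" using Suc.prems by simp
    define y where "y = x n \<ominus>\<^bsub>H\<^esub> finsum H (\<lambda>s. ip H (x n) (e s) \<odot>\<^bsub>H\<^esub> e s) {..<r}"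
    have pc: "finsum H (\<lambda>s. ip H (x n) (e s) \<odot>\<^bsub>H\<^esub> e s) {..<r} \<in> carrier H"
      using ec by (intro finsum_closed) auto
    have yc: "y \<in> carrier H" unfolding y_def using xn pc by (rule minus_closed)
    have yz: "ip H y z = ip H (x n) z - (\<Sum>s<r. ip H (x n) (e s) * ip H (e s) z)" if z: "z \<in> carrier H" for z
    proof -
      have "ip H (finsum H (\<lambda>s. ip H (x n) (e s) \<odot>\<^bsub>H\<^esub> e s) {..<r}) z = (\<Sum>s<r. ip H (x n) (e s) * ip H (e s) z)"
        using ec z by (subst ip_finsum_left) (auto simp: ip_smult)
      then show ?thesis unfolding y_def using xn pc z by (simp add: ip_minus_left)
    qed
    show ?case
    proof (cases "hnorm H y = 0")
      case True
      have "ip H (x l) z = (\<Sum>s<r. ip H (x l) (e s) * ip H (e s) z)" if "l < Suc n" "z \<in> carrier H" for l z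
        using ex[of l z] yz[OF that(2)] hnorm_zero_ip[OF yc that(2) True] that by (cases "l = n") auto
      then show ?thesis
        by (intro exI[of _ r] exI[of _ e] conjI allI impI ballI ec on)
    next
      case False
      \<comment> \<open>The remainder, normalized, is the next orthonormal vector.\<close>
      let ?v = "complex_of_real (1 / hnorm H y) \<odot>\<^bsub>H\<^esub> y"
      let ?e = "\<lambda>s. if s < r then e s else ?v"
      have vc: "?v \<in> carrier H" using yc by simp
      have ye: "ip H y (e t) = 0" if t: "t < r" for t
      proof -
        have "(\<Sum>s<r. ip H (x n) (e s) * ip H (e s) (e t)) = (\<Sum>s<r. if s = t then ip H (x n) (e s) else 0)"
          by (intro sum.cong refl) (use on t in auto)
        also have "\<dots> = ip H (x n) (e t)" using t by simp
        finally show ?thesis using yz[OF ec[OF t]] by simp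
      qed
      have ve: "ip H ?v (e t) = 0" if t: "t < r" for t
        using yc ec[OF t] ye[OF t] by (simp add: ip_smult)
      have ev: "ip H (e t) ?v = 0" if t: "t < r" for t
        using ip_cnj[OF vc ec[OF t]] ve[OF t] by (simp only: complex_cnj_zero)
      have yv: "ip H y ?v = hnorm H y"
        using yc False by (simp add: ip_smult_right ip_self power2_eq_square)
      have vv: "ip H ?v ?v = 1"
        using yc vc False by (simp only: ip_smult yv) simp
      have on': "ip H (?e s) (?e t) = (if s = t then 1 else 0)" if "s < Suc r" "t < Suc r" for s t
      proof (cases "s < r")
        case True
        then show ?thesis using on[of s t] ev[OF True] by (cases "t < r") simp_all
      next
        case False
        then show ?thesis using ve[of t] vv that by (cases "t < r") simp_all
      qed
      have S: "(\<Sum>s<Suc r. ip H u (?e s) * ip H (?e s) z) =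
          (\<Sum>s<r. ip H u (e s) * ip H (e s) z) + ip H u ?v * ip H ?v z" for u z by simp
      have ex': "ip H (x l) z = (\<Sum>s<Suc r. ip H (x l) (?e s) * ip H (?e s) z)"
        if l: "l < Suc n" and z: "z \<in> carrier H" for l z
      proof (cases "l = n")
        case True
        have "ip H (x n) ?v = ip H y ?v"
          using yz[OF vc] ev by simp
        moreover have "ip H ?v z * hnorm H y = ip H y z" using yc z False by (simp add: ip_smult)
        ultimately show ?thesis unfolding S True using yz[OF z] yv by (simp add: mult.commute)
      next
        case False
        then have l': "l < n" using l by simp
        have "ip H (x l) ?v = 0" using ex[OF l' vc] ev by simp
        then show ?thesis unfolding S using ex[OF l' z] by simp
      qed
      show ?thesis
        by (intro exI[of _ "Suc r"] exI[of _ ?e] conjI allI impI ballI on' ex') (use ec vc in auto)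
    qed
  qed
  then obtain r :: nat and e where ec: "\<And>s. s < r \<Longrightarrow> e s \<in> carrier H"
    and ex: "\<And>l z. l < n \<Longrightarrow> z \<in> carrier H \<Longrightarrow> ip H (x l) z = (\<Sum>s<r. ip H (x l) (e s) * ip H (e s) z)"
    by blast
  show ?thesis
  proof (intro exI[of _ r] exI[of _ "\<lambda>l s. ip H (x l) (e s)"] allI impI)
    fix l m assume lm: "l < n" "m < n"
    show "ip H (x l) (x m) = (\<Sum>s<r. ip H (x l) (e s) * cnj (ip H (x m) (e s)))"
      unfolding ex[OF lm(1) x[OF lm(2)]]
      by (intro sum.cong refl arg_cong2[where f = "(*)"] ip_cnj x lm) (use ec in auto)
  qed
qed

lemma semi_inner_space_hcomplex: "semi_inner_space hcomplex"
  by (rule semi_inner_spaceI) (auto simp: hcomplex_def algebra_simps)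

lemma hcomplex_simps: "carrier hcomplex = UNIV" "ip hcomplex z w = z * cnj w" "a \<odot>\<^bsub>hcomplex\<^esub> z = a * z"
  "z \<oplus>\<^bsub>hcomplex\<^esub> w = z + w" "hnorm hcomplex z = cmod z"
  by (simp_all add: hcomplex_def hnorm_def cmod_def power2_eq_square)

lemma hcomplex_finsum: "finite A \<Longrightarrow> finsum hcomplex g A = sum g A"
proof (induction A rule: finite_induct)
  interpret semi_inner_space hcomplex by (rule semi_inner_space_hcomplex)
  case empty
  show ?case unfolding finsum_empty by (simp add: hcomplex_def)
next
  interpret semi_inner_space hcomplex by (rule semi_inner_space_hcomplex)
  case (insert a F)
  then show ?case by (subst finsum_insert) (auto simp: hcomplex_simps)
qed

lemma hcomplex_minus: "z \<ominus>\<^bsub>hcomplex\<^esub> w = z - w"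
  using semi_inner_space.minus_eq_scale[OF semi_inner_space_hcomplex, of z w]
  by (simp add: hcomplex_simps)

lemma mat_op_apply: "z \<in> carrier (amp n hcomplex) \<Longrightarrow> mat_op n M z = (\<lambda>i\<in>{..<n}. \<Sum>j<n. M $$ (i, j) * z j)"
  by (simp add: mat_op_def tensor_def hcomplex_finsum hcomplex_simps)

lemma mat_op_closed: "z \<in> carrier (amp n hcomplex) \<Longrightarrow> mat_op n M z \<in> carrier (amp n hcomplex)"
  by (simp add: mat_op_apply) (simp add: amp_simps hcomplex_simps)

lemma mat_op_hnorm_sq:
  assumes z: "z \<in> carrier (amp n hcomplex)"
  shows "(hnorm (amp n hcomplex) (mat_op n M z))\<^sup>2 = (\<Sum>i<n. (cmod (\<Sum>j<n. M $$ (i, j) * z j))\<^sup>2)"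
  unfolding amp_hnorm_sq[OF semi_inner_space_hcomplex mat_op_closed[OF z]]
  by (simp add: mat_op_apply[OF z] hcomplex_simps)

lemma cmod_sum_prod_le: "(cmod (\<Sum>j<n. a j * z j))\<^sup>2 \<le> (\<Sum>j<n. (cmod (a j))\<^sup>2) * (\<Sum>j<n. (cmod (z j))\<^sup>2)"
  for a z :: "nat \<Rightarrow> complex"
proof -
  interpret S: semi_inner_space "amp n hcomplex" by (intro semi_inner_space_amp semi_inner_space_hcomplex)
  let ?a = "restrict a {..<n}" and ?z = "restrict (\<lambda>j. cnj (z j)) {..<n}"
  have c: "?a \<in> carrier (amp n hcomplex)" "?z \<in> carrier (amp n hcomplex)"
    by (simp_all add: amp_simps hcomplex_simps)
  have "(cmod (ip (amp n hcomplex) ?a ?z))\<^sup>2 \<le> (hnorm (amp n hcomplex) ?a * hnorm (amp n hcomplex) ?z)\<^sup>2"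
    by (rule power_mono[OF S.cauchy_schwarz[OF c]]) simp
  then show ?thesis
    unfolding power_mult_distrib amp_hnorm_sq[OF semi_inner_space_hcomplex c(1)]
      amp_hnorm_sq[OF semi_inner_space_hcomplex c(2)]
    by (simp add: amp_simps(2) hcomplex_simps)
qed

lemma mat_op_bound:
  assumes z: "z \<in> carrier (amp n hcomplex)"
  shows "hnorm (amp n hcomplex) (mat_op n M z) \<le> sqrt (\<Sum>i<n. \<Sum>j<n. (cmod (M $$ (i, j)))\<^sup>2) * hnorm (amp n hcomplex) z"
proof (rule power2_le_imp_le)
  have S: "semi_inner_space (amp n hcomplex)" by (intro semi_inner_space_amp semi_inner_space_hcomplex)
  show "0 \<le> sqrt (\<Sum>i<n. \<Sum>j<n. (cmod (M $$ (i, j)))\<^sup>2) * hnorm (amp n hcomplex) z"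
    by (intro mult_nonneg_nonneg real_sqrt_ge_zero sum_nonneg semi_inner_space.hnorm_nonneg[OF S z]) auto
  have "(\<Sum>i<n. (cmod (\<Sum>j<n. M $$ (i, j) * z j))\<^sup>2) \<le>
      (\<Sum>i<n. (\<Sum>j<n. (cmod (M $$ (i, j)))\<^sup>2) * (\<Sum>j<n. (cmod (z j))\<^sup>2))"
    by (intro sum_mono cmod_sum_prod_le)
  then show "(hnorm (amp n hcomplex) (mat_op n M z))\<^sup>2 \<le>
      (sqrt (\<Sum>i<n. \<Sum>j<n. (cmod (M $$ (i, j)))\<^sup>2) * hnorm (amp n hcomplex) z)\<^sup>2"
    unfolding mat_op_hnorm_sq[OF z] power_mult_distrib amp_hnorm_sq[OF semi_inner_space_hcomplex z]
    by (simp add: sum_nonneg hcomplex_simps sum_distrib_right)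
qed

lemma mat_norm_le: "mat_norm n M \<le> sqrt (\<Sum>i<n. \<Sum>j<n. (cmod (M $$ (i, j)))\<^sup>2)"
  unfolding mat_norm_def by (rule opnorm_le) (auto intro!: mat_op_bound sum_nonneg)

lemma mat_norm_nonneg: "0 \<le> mat_norm n M"
  unfolding mat_norm_def by (rule opnorm_nonneg[OF _ mat_op_bound]) (auto intro!: sum_nonneg)

lemma mat_norm_bound:
  "(\<Sum>i<n. (cmod (\<Sum>j<n. M $$ (i, j) * z j))\<^sup>2) \<le> (mat_norm n M)\<^sup>2 * (\<Sum>j<n. (cmod (z j))\<^sup>2)"
proof -
  let ?z = "restrict z {..<n}"
  have z: "?z \<in> carrier (amp n hcomplex)" by (simp add: amp_simps hcomplex_simps)
  have S: "semi_inner_space (amp n hcomplex)" by (intro semi_inner_space_amp semi_inner_space_hcomplex)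
  have "hnorm (amp n hcomplex) (mat_op n M ?z) \<le> mat_norm n M * hnorm (amp n hcomplex) ?z"
    unfolding mat_norm_def by (rule opnorm_bound[OF S _ mat_op_bound z]) (auto intro!: sum_nonneg)
  then have "(hnorm (amp n hcomplex) (mat_op n M ?z))\<^sup>2 \<le> (mat_norm n M * hnorm (amp n hcomplex) ?z)\<^sup>2"
    by (rule power_mono) (rule semi_inner_space.hnorm_nonneg[OF S mat_op_closed[OF z]])
  then show ?thesis
    unfolding mat_op_hnorm_sq[OF z] power_mult_distrib amp_hnorm_sq[OF semi_inner_space_hcomplex z]
    by (simp add: hcomplex_simps)
qed

text \<open>The operator \<open>1 \<otimes> M\<close> has norm at most that of \<open>M\<close>: in the coordinates of \<open>gram_factorization\<close> the
  tuple \<open>x\<close> splits into \<open>r\<close> scalar tuples, on each of which \<open>M\<close> acts separately.\<close>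

lemma (in semi_inner_space) matrix_action_bound:
  assumes x: "\<And>l. l < n \<Longrightarrow> x l \<in> carrier H"
  shows "(\<Sum>k<n. (hnorm H (finsum H (\<lambda>l. M $$ (k, l) \<odot>\<^bsub>H\<^esub> x l) {..<n}))\<^sup>2) \<le>
    (mat_norm n M)\<^sup>2 * (\<Sum>l<n. (hnorm H (x l))\<^sup>2)"
proof -
  have "\<exists>(r::nat) a. \<forall>l<n. \<forall>m<n. ip H (x l) (x m) = (\<Sum>s<r. a l s * cnj (a m s))"
    by (rule gram_factorization[OF x])
  then obtain r :: nat and a where a': "\<forall>l<n. \<forall>m<n. ip H (x l) (x m) = (\<Sum>s<r. a l s * cnj (a m s))"
    by (elim exE)
  note a = a'[rule_format]
  have sc: "finsum H (\<lambda>l. b l \<odot>\<^bsub>H\<^esub> x l) {..<n} \<in> carrier H" for b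
    by (intro finsum_closed funcsetI scale_closed x) simp
  have *: "(hnorm H (finsum H (\<lambda>l. b l \<odot>\<^bsub>H\<^esub> x l) {..<n}))\<^sup>2 = (\<Sum>s<r. (cmod (\<Sum>l<n. b l * a l s))\<^sup>2)" for b
  proof -
    have "ip H (finsum H (\<lambda>l. b l \<odot>\<^bsub>H\<^esub> x l) {..<n}) (finsum H (\<lambda>l. b l \<odot>\<^bsub>H\<^esub> x l) {..<n}) =
        (\<Sum>l<n. ip H (b l \<odot>\<^bsub>H\<^esub> x l) (finsum H (\<lambda>l. b l \<odot>\<^bsub>H\<^esub> x l) {..<n}))"
      by (rule ip_finsum_left) (simp, simp add: x, rule sc)
    also have "\<dots> = (\<Sum>l<n. \<Sum>m<n. b l * cnj (b m) * ip H (x l) (x m))"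
    proof (rule sum.cong[OF refl])
      fix l assume "l \<in> {..<n}"
      then have l: "x l \<in> carrier H" using x by simp
      have "ip H (b l \<odot>\<^bsub>H\<^esub> x l) (finsum H (\<lambda>l. b l \<odot>\<^bsub>H\<^esub> x l) {..<n}) =
          (\<Sum>m<n. ip H (b l \<odot>\<^bsub>H\<^esub> x l) (b m \<odot>\<^bsub>H\<^esub> x m))"
        by (rule ip_finsum_right) (use x l in auto)
      also have "\<dots> = (\<Sum>m<n. b l * cnj (b m) * ip H (x l) (x m))"
        by (intro sum.cong refl) (use x l in \<open>simp add: ip_smult ip_smult_right\<close>)
      finally show "ip H (b l \<odot>\<^bsub>H\<^esub> x l) (finsum H (\<lambda>l. b l \<odot>\<^bsub>H\<^esub> x l) {..<n}) =
          (\<Sum>m<n. b l * cnj (b m) * ip H (x l) (x m))" .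
    qed
    also have "\<dots> = (\<Sum>l<n. \<Sum>m<n. \<Sum>s<r. (b l * a l s) * cnj (b m * a m s))"
      by (intro sum.cong refl) (simp add: a sum_distrib_left mult_ac)
    also have "\<dots> = (\<Sum>l<n. \<Sum>s<r. \<Sum>m<n. (b l * a l s) * cnj (b m * a m s))"
      by (intro sum.cong refl sum.swap)
    also have "\<dots> = (\<Sum>s<r. \<Sum>l<n. \<Sum>m<n. (b l * a l s) * cnj (b m * a m s))"
      by (rule sum.swap)
    also have "\<dots> = (\<Sum>s<r. (\<Sum>l<n. b l * a l s) * cnj (\<Sum>m<n. b m * a m s))"
      by (simp only: sum_product cnj_sum)
    also have "\<dots> = complex_of_real (\<Sum>s<r. (cmod (\<Sum>l<n. b l * a l s))\<^sup>2)"
      by (simp only: complex_norm_square of_real_sum)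
    finally show ?thesis using hnorm_sq[OF sc[of b]] by (simp only: Re_complex_of_real)
  qed
  have "(\<Sum>k<n. (hnorm H (finsum H (\<lambda>l. M $$ (k, l) \<odot>\<^bsub>H\<^esub> x l) {..<n}))\<^sup>2) =
      (\<Sum>s<r. \<Sum>k<n. (cmod (\<Sum>l<n. M $$ (k, l) * a l s))\<^sup>2)"
    unfolding * by (rule sum.swap)
  also have "\<dots> \<le> (\<Sum>s<r. (mat_norm n M)\<^sup>2 * (\<Sum>l<n. (cmod (a l s))\<^sup>2))"
    by (intro sum_mono mat_norm_bound)
  also have "\<dots> = (mat_norm n M)\<^sup>2 * (\<Sum>l<n. \<Sum>s<r. (cmod (a l s))\<^sup>2)"
    unfolding sum_distrib_left[symmetric] by (rule arg_cong[OF sum.swap])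
  also have "(\<Sum>l<n. \<Sum>s<r. (cmod (a l s))\<^sup>2) = (\<Sum>l<n. (hnorm H (x l))\<^sup>2)"
  proof (rule sum.cong[OF refl])
    fix l assume "l \<in> {..<n}"
    then have l: "l < n" by simp
    have "complex_of_real ((hnorm H (x l))\<^sup>2) = complex_of_real (\<Sum>s<r. (cmod (a l s))\<^sup>2)"
      using ip_self[OF x[OF l]] a[OF l l] by (simp only: complex_norm_square of_real_sum)
    then show "(\<Sum>s<r. (cmod (a l s))\<^sup>2) = (hnorm H (x l))\<^sup>2" by (simp only: of_real_eq_iff)
  qed
  finally show ?thesis .
qed

lemma tensor_apply:
  "\<xi> \<in> carrier (amp n H) \<Longrightarrow> k < n \<Longrightarrow>
    tensor H L n T M \<xi> k = finsum L (\<lambda>l. M $$ (k, l) \<odot>\<^bsub>L\<^esub> T (\<xi> l)) {..<n}"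
  by (simp add: tensor_def)

lemma amp_component: "\<xi> \<in> carrier (amp n H) \<Longrightarrow> k < n \<Longrightarrow> \<xi> k \<in> carrier H"
  by (auto simp: amp_simps)

lemma tensor_bounded:
  assumes H: "semi_inner_space H" and L: "semi_inner_space L" and T: "T \<in> bounded_ops H L"
    and C: "0 \<le> C" "\<And>x. x \<in> carrier H \<Longrightarrow> hnorm L (T x) \<le> C * hnorm H x"
  shows "tensor H L n T M \<in> bounded_ops (amp n H) (amp n L)"
    and "\<And>\<xi>. \<xi> \<in> carrier (amp n H) \<Longrightarrow>
      hnorm (amp n L) (tensor H L n T M \<xi>) \<le> (C * mat_norm n M) * hnorm (amp n H) \<xi>"
proof -
  interpret H: semi_inner_space H by (rule H)
  interpret L: semi_inner_space L by (rule L)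
  interpret HA: semi_inner_space "amp n H" by (rule semi_inner_space_amp[OF H])
  interpret LA: semi_inner_space "amp n L" by (rule semi_inner_space_amp[OF L])
  note Tc = bounded_ops_closed[OF T]
  have closed: "tensor H L n T M \<xi> \<in> carrier (amp n L)" if x: "\<xi> \<in> carrier (amp n H)" for \<xi>
  proof -
    have "finsum L (\<lambda>l. M $$ (k, l) \<odot>\<^bsub>L\<^esub> T (\<xi> l)) {..<n} \<in> carrier L" for k
      by (intro L.finsum_closed) (auto intro!: Tc amp_component[OF x])
    then show ?thesis unfolding tensor_def using x by (simp add: amp_simps)
  qed
  show bound: "hnorm (amp n L) (tensor H L n T M \<xi>) \<le> (C * mat_norm n M) * hnorm (amp n H) \<xi>"
    if x: "\<xi> \<in> carrier (amp n H)" for \<xi>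
  proof (rule power2_le_imp_le)
    have "(hnorm (amp n L) (tensor H L n T M \<xi>))\<^sup>2 =
        (\<Sum>k<n. (hnorm L (finsum L (\<lambda>l. M $$ (k, l) \<odot>\<^bsub>L\<^esub> T (\<xi> l)) {..<n}))\<^sup>2)"
      unfolding amp_hnorm_sq[OF L closed[OF x]] by (intro sum.cong refl) (simp add: tensor_apply[OF x])
    also have "\<dots> \<le> (mat_norm n M)\<^sup>2 * (\<Sum>l<n. (hnorm L (T (\<xi> l)))\<^sup>2)"
      by (rule L.matrix_action_bound) (intro Tc amp_component[OF x])
    also have "\<dots> \<le> (mat_norm n M)\<^sup>2 * (\<Sum>l<n. (C * hnorm H (\<xi> l))\<^sup>2)"
      by (intro mult_left_mono sum_mono power_mono C(2) L.hnorm_nonneg Tc amp_component[OF x]) auto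
    also have "\<dots> = ((C * mat_norm n M) * hnorm (amp n H) \<xi>)\<^sup>2"
      unfolding power_mult_distrib amp_hnorm_sq[OF H x] by (simp only: sum_distrib_left[symmetric] mult_ac)
    finally show "(hnorm (amp n L) (tensor H L n T M \<xi>))\<^sup>2 \<le> ((C * mat_norm n M) * hnorm (amp n H) \<xi>)\<^sup>2" .
    show "0 \<le> (C * mat_norm n M) * hnorm (amp n H) \<xi>"
      by (intro mult_nonneg_nonneg C mat_norm_nonneg HA.hnorm_nonneg x)
  qed
  show "tensor H L n T M \<in> bounded_ops (amp n H) (amp n L)"
  proof (rule bounded_opsI[OF closed _ _ _ bound])
    fix x y assume x: "x \<in> carrier (amp n H)" and y: "y \<in> carrier (amp n H)"
    have xy: "x \<oplus>\<^bsub>amp n H\<^esub> y \<in> carrier (amp n H)" using x y by simp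
    have Ty: "T (y l) \<in> carrier L" "T (x l) \<in> carrier L" if "l < n" for l
      using that by (auto intro!: Tc amp_component[OF y] amp_component[OF x])
    have "finsum L (\<lambda>l. M $$ (k, l) \<odot>\<^bsub>L\<^esub> T ((x \<oplus>\<^bsub>amp n H\<^esub> y) l)) {..<n} =
        finsum L (\<lambda>l. M $$ (k, l) \<odot>\<^bsub>L\<^esub> T (x l)) {..<n} \<oplus>\<^bsub>L\<^esub> finsum L (\<lambda>l. M $$ (k, l) \<odot>\<^bsub>L\<^esub> T (y l)) {..<n}" for k
    proof -
      have "finsum L (\<lambda>l. M $$ (k, l) \<odot>\<^bsub>L\<^esub> T ((x \<oplus>\<^bsub>amp n H\<^esub> y) l)) {..<n} =
          finsum L (\<lambda>l. M $$ (k, l) \<odot>\<^bsub>L\<^esub> T (x l) \<oplus>\<^bsub>L\<^esub> M $$ (k, l) \<odot>\<^bsub>L\<^esub> T (y l)) {..<n}"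
        by (rule L.finsum_cong'[OF refl])
          (use Ty in \<open>auto simp: amp_simps(3) bounded_ops_add[OF T] amp_component[OF x] amp_component[OF y] L.scale_add_right\<close>)
      also have "\<dots> = finsum L (\<lambda>l. M $$ (k, l) \<odot>\<^bsub>L\<^esub> T (x l)) {..<n} \<oplus>\<^bsub>L\<^esub> finsum L (\<lambda>l. M $$ (k, l) \<odot>\<^bsub>L\<^esub> T (y l)) {..<n}"
        by (rule L.finsum_addf) (use Ty in auto)
      finally show ?thesis .
    qed
    then show "tensor H L n T M (x \<oplus>\<^bsub>amp n H\<^esub> y) = tensor H L n T M x \<oplus>\<^bsub>amp n L\<^esub> tensor H L n T M y"
      unfolding amp_simps(3)[of n L] tensor_def using x y xy by (auto intro!: restrict_ext)
  next
    fix a x assume x: "x \<in> carrier (amp n H)"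
    have ax: "a \<odot>\<^bsub>amp n H\<^esub> x \<in> carrier (amp n H)" using x by simp
    have Tx: "T (x l) \<in> carrier L" if "l < n" for l
      using that by (auto intro!: Tc amp_component[OF x])
    have "finsum L (\<lambda>l. M $$ (k, l) \<odot>\<^bsub>L\<^esub> T ((a \<odot>\<^bsub>amp n H\<^esub> x) l)) {..<n} =
        a \<odot>\<^bsub>L\<^esub> finsum L (\<lambda>l. M $$ (k, l) \<odot>\<^bsub>L\<^esub> T (x l)) {..<n}" for k
    proof -
      have "a \<odot>\<^bsub>L\<^esub> finsum L (\<lambda>l. M $$ (k, l) \<odot>\<^bsub>L\<^esub> T (x l)) {..<n} =
          finsum L (\<lambda>l. a \<odot>\<^bsub>L\<^esub> (M $$ (k, l) \<odot>\<^bsub>L\<^esub> T (x l))) {..<n}"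
        by (rule L.finsum_smult_ldistr) (use Tx in \<open>auto simp: class_ring_simps\<close>)
      also have "\<dots> = finsum L (\<lambda>l. M $$ (k, l) \<odot>\<^bsub>L\<^esub> T ((a \<odot>\<^bsub>amp n H\<^esub> x) l)) {..<n}"
        by (rule L.finsum_cong'[OF refl])
          (use Tx in \<open>auto simp: amp_simps(4) bounded_ops_smult[OF T] amp_component[OF x] L.scale_scale mult.commute\<close>)
      finally show ?thesis by simp
    qed
    then show "tensor H L n T M (a \<odot>\<^bsub>amp n H\<^esub> x) = a \<odot>\<^bsub>amp n L\<^esub> tensor H L n T M x"
      unfolding amp_simps(4)[of n L] tensor_def using x ax by (auto intro!: restrict_ext)
  qed (auto simp: tensor_def)
qed

lemma tensor_ip:
  assumes L: "semi_inner_space L" and T: "T \<in> bounded_ops H L"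
    and x: "\<xi> \<in> carrier (amp n H)" and y: "\<eta> \<in> carrier (amp n L)"
  shows "ip (amp n L) (tensor H L n T M \<xi>) \<eta> = (\<Sum>k<n. \<Sum>l<n. M $$ (k, l) * ip L (T (\<xi> l)) (\<eta> k))"
proof -
  interpret L: semi_inner_space L by (rule L)
  note Tc = bounded_ops_closed[OF T amp_component[OF x]]
  show ?thesis
    unfolding amp_simps(2)
  proof (rule sum.cong[OF refl])
    fix k assume "k \<in> {..<n}"
    then have k: "k < n" by simp
    note yk = amp_component[OF y k]
    have "ip L (finsum L (\<lambda>l. M $$ (k, l) \<odot>\<^bsub>L\<^esub> T (\<xi> l)) {..<n}) (\<eta> k) =
        (\<Sum>l<n. ip L (M $$ (k, l) \<odot>\<^bsub>L\<^esub> T (\<xi> l)) (\<eta> k))"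
      by (rule L.ip_finsum_left) (use Tc yk in auto)
    also have "\<dots> = (\<Sum>l<n. M $$ (k, l) * ip L (T (\<xi> l)) (\<eta> k))"
      by (intro sum.cong refl L.ip_smult Tc yk) simp
    finally show "ip L (tensor H L n T M \<xi> k) (\<eta> k) = (\<Sum>l<n. M $$ (k, l) * ip L (T (\<xi> l)) (\<eta> k))"
      by (simp only: tensor_apply[OF x k])
  qed
qed

lemma tensor_one_apply:
  assumes L: "semi_inner_space L" and T: "T \<in> bounded_ops H L"
    and x: "\<xi> \<in> carrier (amp n H)" and k: "k < n"
  shows "tensor H L n T (1\<^sub>m n) \<xi> k = T (\<xi> k)"
proof -
  interpret L: semi_inner_space L by (rule L)
  note Tc = bounded_ops_closed[OF T amp_component[OF x]]
  have "finsum L (\<lambda>l. 1\<^sub>m n $$ (k, l) \<odot>\<^bsub>L\<^esub> T (\<xi> l)) {..<n} = finsum L (\<lambda>l. if k = l then T (\<xi> l) else \<zero>\<^bsub>L\<^esub>) {..<n}"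
    by (rule L.finsum_cong'[OF refl]) (use Tc k in auto)
  also have "\<dots> = T (\<xi> k)" by (rule L.finsum_singleton[of k "{..<n}"]) (use Tc k in auto)
  finally show ?thesis by (simp only: tensor_apply[OF x k])
qed

lemma mat_leI:
  assumes "\<And>z. Im (\<Sum>k<n. \<Sum>l<n. (Y $$ (k, l) - X $$ (k, l)) * (z l * cnj (z k))) = 0"
    and "\<And>z. 0 \<le> Re (\<Sum>k<n. \<Sum>l<n. (Y $$ (k, l) - X $$ (k, l)) * (z l * cnj (z k)))"
  shows "mat_le n X Y"
proof -
  have "ip (amp n hcomplex) (mat_op n Y z \<ominus>\<^bsub>amp n hcomplex\<^esub> mat_op n X z) z =
      (\<Sum>k<n. \<Sum>l<n. (Y $$ (k, l) - X $$ (k, l)) * (z l * cnj (z k)))" if z: "z \<in> carrier (amp n hcomplex)" for z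
    unfolding amp_minus[OF semi_inner_space_hcomplex mat_op_closed[OF z] mat_op_closed[OF z]] amp_simps(2)
    by (intro sum.cong refl)
      (simp add: mat_op_apply[OF z] hcomplex_minus hcomplex_simps sum_distrib_right
        left_diff_distrib sum_subtractf mult.assoc)
  then show ?thesis unfolding mat_le_def op_le_def using assms by simp
qed

section \<open>Power series on the ball\<close>

lemma mat_norm_le_tuple_norm: "mat_norm n (Z i) \<le> tuple_norm n Z"
  unfolding tuple_norm_def by (rule Max_ge) auto

lemma ball_CI:
  assumes "\<And>i. Z i \<in> carrier_mat n n" "\<And>i. mat_norm n (Z i) < r"
  shows "Z \<in> ball_C n r"
proof -
  have "tuple_norm n Z \<in> range (\<lambda>i. mat_norm n (Z i))"
    unfolding tuple_norm_def by (rule Max_in) auto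
  then show ?thesis using assms by (auto simp: ball_C_def)
qed

lemma ball_CD: "Z \<in> ball_C n r \<Longrightarrow> Z i \<in> carrier_mat n n"
  by (simp add: ball_C_def)

lemma word_pow_simps [simp]:
  "word_pow n Z [] = 1\<^sub>m n"
  "word_pow n Z (i # \<alpha>) = Z i * word_pow n Z \<alpha>"
  by (simp_all add: word_pow_def)

lemma word_pow_carrier:
  assumes "\<And>i. Z i \<in> carrier_mat n n"
  shows "word_pow n Z \<alpha> \<in> carrier_mat n n"
  by (induction \<alpha>) (use assms in \<open>auto intro: mult_carrier_mat\<close>)

lemma word_pow_Cons_index:
  assumes Z: "\<And>i. Z i \<in> carrier_mat n n" and kl: "k < n" "l < n"
  shows "word_pow n Z (i # \<alpha>) $$ (k, l) = (\<Sum>m<n. Z i $$ (k, m) * word_pow n Z \<alpha> $$ (m, l))"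
  using Z[of i] word_pow_carrier[of Z n \<alpha>, OF Z] kl
  by (auto simp: scalar_prod_def atLeast0LessThan intro!: sum.cong)

text \<open>All letters may be evaluated at the same scalar \<open>s\<close>, a tuple of \<open>1 \<times> 1\<close> matrices in the ball, where the
  term of the word \<open>\<alpha>\<close> is \<open>s ^ length \<alpha>\<close> times \<open>c \<alpha>\<close>.\<close>

lemma coefficient_norms_summable:
  fixes c :: "'d::finite list \<Rightarrow> 'k \<Rightarrow> 'k"
  assumes K: "hilbert_space K" and c: "\<And>\<alpha>. c \<alpha> \<in> bounded_ops K K"
    and ps: "power_series_on_ball K r c f" and s: "0 < s" "s < r"
  shows "(\<lambda>\<alpha>. opnorm K K (c \<alpha>) * s ^ length \<alpha>) summable_on UNIV"
proof -
  interpret K: hilbert_space K by (rule K)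
  note Ks = K.semi_inner_space_axioms
  define Z :: "'d \<Rightarrow> complex mat" where "Z = (\<lambda>_. mat 1 1 (\<lambda>_. complex_of_real s))"
  have Zc: "Z i \<in> carrier_mat 1 1" for i by (simp add: Z_def)
  have "mat_norm 1 (Z i) < r" for i
    using mat_norm_le[of 1 "Z i"] s by (simp add: Z_def)
  then have Z: "Z \<in> ball_C 1 r" by (intro ball_CI Zc)
  have wp: "word_pow 1 Z \<alpha> $$ (0, 0) = complex_of_real (s ^ length \<alpha>)" for \<alpha>
  proof (induction \<alpha>)
    case (Cons i \<alpha>)
    then show ?case using word_pow_Cons_index[of Z 1 0 0 i \<alpha>, OF Zc] by (simp add: Z_def)
  qed simp
  let ?N = "\<lambda>\<alpha>. opnorm (amp 1 K) (amp 1 K) (tensor K K 1 (c \<alpha>) (word_pow 1 Z \<alpha>))"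
  have sum: "?N summable_on UNIV" using ps Z by (auto simp: power_series_on_ball_def)
  have op: "opnorm K K (c \<alpha>) * s ^ length \<alpha> \<le> ?N \<alpha>" for \<alpha>
  proof -
    note C = bounded_ops_opnorm_nonneg[OF c Ks] bounded_ops_opnorm[OF c Ks]
    note tb = tensor_bounded(1)[OF Ks Ks c C] tensor_bounded(2)[OF Ks Ks c C]
    have less: "(0::nat) < 1" by simp
    have A1: "semi_inner_space (amp 1 K)" by (rule semi_inner_space_amp[OF Ks])
    have N0: "0 \<le> ?N \<alpha>" by (rule opnorm_nonneg[OF _ tb(2)]) (use C mat_norm_nonneg in simp)
    have "opnorm K K (c \<alpha>) \<le> ?N \<alpha> / s ^ length \<alpha>"
    proof (rule opnorm_le)
      show "0 \<le> ?N \<alpha> / s ^ length \<alpha>" using N0 s by simp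
      fix v assume v: "v \<in> carrier K"
      let ?x = "\<lambda>l\<in>{..<1::nat}. v"
      have x: "?x \<in> carrier (amp 1 K)" using v by (simp add: amp_simps)
      have cv: "c \<alpha> v \<in> carrier K" by (rule bounded_ops_closed[OF c v])
      have "tensor K K 1 (c \<alpha>) (word_pow 1 Z \<alpha>) ?x 0 = complex_of_real (s ^ length \<alpha>) \<odot>\<^bsub>K\<^esub> c \<alpha> v"
      proof -
        have "finsum K (\<lambda>l. word_pow 1 Z \<alpha> $$ (0, l) \<odot>\<^bsub>K\<^esub> c \<alpha> (?x l)) {..<1} =
            finsum K (\<lambda>l. if 0 = l then complex_of_real (s ^ length \<alpha>) \<odot>\<^bsub>K\<^esub> c \<alpha> v else \<zero>\<^bsub>K\<^esub>) {..<1::nat}"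
          by (rule K.finsum_cong'[OF refl]) (use cv wp in auto)
        also have "\<dots> = complex_of_real (s ^ length \<alpha>) \<odot>\<^bsub>K\<^esub> c \<alpha> v"
          by (rule K.finsum_singleton) (use cv in auto)
        finally show ?thesis by (simp only: tensor_apply[OF x less])
      qed
      moreover have one: "hnorm (amp 1 K) y = hnorm K (y 0)" if "y \<in> carrier (amp 1 K)" for y
      proof (rule power2_eq_imp_eq)
        show "(hnorm (amp 1 K) y)\<^sup>2 = (hnorm K (y 0))\<^sup>2" using amp_hnorm_sq[OF Ks that] by simp
        show "0 \<le> hnorm (amp 1 K) y" by (rule semi_inner_space.hnorm_nonneg[OF A1 that])
        show "0 \<le> hnorm K (y 0)" by (rule K.hnorm_nonneg[OF amp_component[OF that less]])
      qed
      ultimately have "hnorm (amp 1 K) (tensor K K 1 (c \<alpha>) (word_pow 1 Z \<alpha>) ?x) = s ^ length \<alpha> * hnorm K (c \<alpha> v)"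
        using one[OF bounded_ops_closed[OF tb(1) x]] s K.hnorm_smult[OF cv, of "complex_of_real (s ^ length \<alpha>)"]
        by (simp add: norm_power)
      moreover have "hnorm (amp 1 K) (tensor K K 1 (c \<alpha>) (word_pow 1 Z \<alpha>) ?x) \<le> ?N \<alpha> * hnorm (amp 1 K) ?x"
        by (rule bounded_ops_opnorm[OF tb(1) A1 x])
      ultimately show "hnorm K (c \<alpha> v) \<le> ?N \<alpha> / s ^ length \<alpha> * hnorm K v"
        using one[OF x] s by (simp add: pos_le_divide_eq mult.commute)
    qed
    then show ?thesis using s by (simp add: pos_le_divide_eq)
  qed
  have on: "0 \<le> opnorm K K (c \<alpha>)" for \<alpha> by (rule bounded_ops_opnorm_nonneg[OF c Ks])
  show ?thesis
    by (rule summable_on_comparison_test[OF sum op]) (use on s in simp)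
qed

text \<open>All later arguments test \<open>f\<close> against vectors, so convergence is needed for matrix elements only.\<close>

lemma power_series_has_sum:
  fixes c :: "'d::finite list \<Rightarrow> 'k \<Rightarrow> 'k"
  assumes K: "hilbert_space K" and c: "\<And>\<alpha>. c \<alpha> \<in> bounded_ops K K"
    and ps: "power_series_on_ball K r c f" and Z: "Z \<in> ball_C n r"
    and x: "\<xi> \<in> carrier (amp n K)" and y: "\<eta> \<in> carrier (amp n K)"
  shows "((\<lambda>\<alpha>. ip (amp n K) (tensor K K n (c \<alpha>) (word_pow n Z \<alpha>) \<xi>) \<eta>) has_sum
    ip (amp n K) (f n Z \<xi>) \<eta>) UNIV"
proof -
  interpret K: hilbert_space K by (rule K)
  note Ks = K.semi_inner_space_axioms
  interpret A: semi_inner_space "amp n K" by (rule semi_inner_space_amp[OF Ks])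
  note As = A.semi_inner_space_axioms
  let ?T = "\<lambda>\<alpha>. tensor K K n (c \<alpha>) (word_pow n Z \<alpha>)"
  have T: "?T \<alpha> \<in> bounded_ops (amp n K) (amp n K)" for \<alpha>
    by (rule tensor_bounded(1)[OF Ks Ks c bounded_ops_opnorm_nonneg[OF c Ks] bounded_ops_opnorm[OF c Ks]])
  have f: "f n Z \<in> bounded_ops (amp n K) (amp n K)" using ps Z by (auto simp: power_series_on_ball_def)
  let ?D = "\<lambda>F. \<lambda>\<xi>\<in>carrier (amp n K). f n Z \<xi> \<ominus>\<^bsub>amp n K\<^esub> finsum (amp n K) (\<lambda>\<alpha>. ?T \<alpha> \<xi>) F"
  note Tc = bounded_ops_closed[OF T] and fc = bounded_ops_closed[OF f]
  have Sc: "finsum (amp n K) (\<lambda>\<alpha>. ?T \<alpha> \<xi>) F \<in> carrier (amp n K)" if "\<xi> \<in> carrier (amp n K)" for \<xi> F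
    by (intro A.finsum_closed funcsetI Tc that)
  have Dbound: "hnorm (amp n K) (?D F x) \<le>
      (opnorm (amp n K) (amp n K) (f n Z) + (\<Sum>\<alpha>\<in>F. opnorm (amp n K) (amp n K) (?T \<alpha>))) * hnorm (amp n K) x"
    if F: "finite F" and x: "x \<in> carrier (amp n K)" for F x
  proof -
    have "hnorm (amp n K) (finsum (amp n K) (\<lambda>\<alpha>. ?T \<alpha> x) F) \<le> (\<Sum>\<alpha>\<in>F. hnorm (amp n K) (?T \<alpha> x))"
      by (intro A.hnorm_finsum_le F Tc x)
    also have "\<dots> \<le> (\<Sum>\<alpha>\<in>F. opnorm (amp n K) (amp n K) (?T \<alpha>) * hnorm (amp n K) x)"
      by (intro sum_mono bounded_ops_opnorm[OF T As x])
    finally have "hnorm (amp n K) (finsum (amp n K) (\<lambda>\<alpha>. ?T \<alpha> x) F) \<le>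
        (\<Sum>\<alpha>\<in>F. opnorm (amp n K) (amp n K) (?T \<alpha>)) * hnorm (amp n K) x" by (simp only: sum_distrib_right)
    then show ?thesis
      using A.hnorm_minus_le[OF fc[OF x] Sc[OF x], of F] bounded_ops_opnorm[OF f As x] x
      by (simp add: distrib_right)
  qed
  have key: "hnorm (amp n K) (?D F \<xi>) \<le> opnorm (amp n K) (amp n K) (?D F) * hnorm (amp n K) \<xi>"
    if F: "finite F" for F
  proof (rule opnorm_bound[OF As _ Dbound[OF F] x])
    show "0 \<le> opnorm (amp n K) (amp n K) (f n Z) + (\<Sum>\<alpha>\<in>F. opnorm (amp n K) (amp n K) (?T \<alpha>))"
      by (intro add_nonneg_nonneg sum_nonneg bounded_ops_opnorm_nonneg[OF f As] bounded_ops_opnorm_nonneg[OF T As])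
  qed
  show ?thesis
    unfolding has_sum_def
  proof (rule tendstoI)
    fix e :: real assume e: "e > 0"
    define d where "d = e / (hnorm (amp n K) \<xi> * hnorm (amp n K) \<eta> + 1)"
    have p: "0 \<le> hnorm (amp n K) \<xi> * hnorm (amp n K) \<eta>" using x y by simp
    have d: "d > 0" using e p by (simp add: d_def)
    have dm: "d * (hnorm (amp n K) \<xi> * hnorm (amp n K) \<eta>) < e"
    proof -
      have "d * (hnorm (amp n K) \<xi> * hnorm (amp n K) \<eta> + 1) = e" using p by (simp add: d_def)
      then show ?thesis using d by (simp add: distrib_left)
    qed
    have ev: "\<forall>\<^sub>F F in finite_subsets_at_top UNIV. \<forall>n. \<forall>Z\<in>ball_C n r.
        opnorm (amp n K) (amp n K) (\<lambda>\<xi>\<in>carrier (amp n K). f n Z \<xi> \<ominus>\<^bsub>amp n K\<^esub>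
             finsum (amp n K) (\<lambda>\<alpha>. tensor K K n (c \<alpha>) (word_pow n Z \<alpha>) \<xi>) F) < d"
      using ps d by (auto simp: power_series_on_ball_def)
    have fin: "\<forall>\<^sub>F F in finite_subsets_at_top (UNIV :: 'd list set). finite F"
      by (rule eventually_finite_subsets_at_top_weakI) simp
    show "\<forall>\<^sub>F F in finite_subsets_at_top UNIV.
        dist (\<Sum>\<alpha>\<in>F. ip (amp n K) (?T \<alpha> \<xi>) \<eta>) (ip (amp n K) (f n Z \<xi>) \<eta>) < e"
      using ev fin
    proof eventually_elim
      case (elim F)
      then have F: "finite F" and op: "opnorm (amp n K) (amp n K) (?D F) < d" using Z by blast+
      have "(\<Sum>\<alpha>\<in>F. ip (amp n K) (?T \<alpha> \<xi>) \<eta>) = ip (amp n K) (finsum (amp n K) (\<lambda>\<alpha>. ?T \<alpha> \<xi>) F) \<eta>"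
        by (intro A.ip_finsum_left[symmetric] F Tc x y)
      then have "dist (\<Sum>\<alpha>\<in>F. ip (amp n K) (?T \<alpha> \<xi>) \<eta>) (ip (amp n K) (f n Z \<xi>) \<eta>) =
          cmod (ip (amp n K) (?D F \<xi>) \<eta>)"
        using x by (simp add: dist_norm norm_minus_commute A.ip_minus_left[OF fc[OF x] Sc[OF x] y])
      also have "\<dots> \<le> hnorm (amp n K) (?D F \<xi>) * hnorm (amp n K) \<eta>"
        by (rule A.cauchy_schwarz[OF _ y]) (use x fc Sc in simp)
      also have "\<dots> \<le> (opnorm (amp n K) (amp n K) (?D F) * hnorm (amp n K) \<xi>) * hnorm (amp n K) \<eta>"
        by (rule mult_right_mono[OF key[OF F]]) (use y in simp)
      also have "\<dots> \<le> d * (hnorm (amp n K) \<xi> * hnorm (amp n K) \<eta>)"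
        unfolding mult.assoc by (rule mult_right_mono[OF less_imp_le[OF op] p])
      also note dm
      finally show ?case .
    qed
  qed
qed

section \<open>Truncated Fock space matrices\<close>

definition short_words :: "nat \<Rightarrow> 'd::finite list set" where
  "short_words N = {w. length w \<le> N}"

lemma finite_short_words [simp]: "finite (short_words N :: 'd::finite list set)"
proof -
  have "short_words N = {w :: 'd list. set w \<subseteq> UNIV \<and> length w \<le> N}" by (simp add: short_words_def)
  then show ?thesis using finite_lists_length_le[of "UNIV :: 'd set" N] by simp
qed

text \<open>The entries, in the basis of words, of \<open>L\<^sub>j + L\<^sub>j\<^sup>*\<close>, where \<open>L\<^sub>j\<close> prepends the letter \<open>j\<close> (the creation
  operator of the full Fock space). If \<open>h\<close> holds, the projection onto the empty word is added to the
  \<open>i\<close>-th operator of this tuple.\<close>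

definition fock :: "bool \<Rightarrow> 'd \<Rightarrow> 'd \<Rightarrow> 'd list \<Rightarrow> 'd list \<Rightarrow> real" where
  "fock h i j a b = of_bool (b = j # a) + of_bool (a = j # b) + of_bool (h \<and> j = i \<and> a = [] \<and> b = [])"

text \<open>The entries of the monomial with word \<open>\<alpha>\<close> in this tuple, compressed to the words of length at
  most \<open>N\<close>. An entry counts the paths from \<open>a\<close> to \<open>b\<close> that follow the letters of \<open>\<alpha>\<close>.\<close>

primrec fock_pow :: "nat \<Rightarrow> bool \<Rightarrow> 'd \<Rightarrow> 'd::finite list \<Rightarrow> 'd list \<Rightarrow> 'd list \<Rightarrow> real" where
  "fock_pow N h i [] a b = of_bool (a = b)"
| "fock_pow N h i (j # \<alpha>) a b = (\<Sum>d\<in>short_words N. fock h i j a d * fock_pow N h i \<alpha> d b)"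

declare fock_pow.simps(2) [simp del]

lemma fock_sum:
  fixes a :: "'d::finite list"
  assumes a: "a \<in> short_words N"
  shows "(\<Sum>d\<in>short_words N. fock h i j a d * g d) =
    (if length a < N then g (j # a) else 0) + (if a \<noteq> [] \<and> hd a = j then g (tl a) else 0) +
    (if h \<and> j = i \<and> a = [] then g [] else 0)"
proof -
  have 1: "(\<Sum>d\<in>short_words N. of_bool (d = j # a) * g d) = (if length a < N then g (j # a) else 0)"
  proof -
    have "(\<Sum>d\<in>short_words N. of_bool (d = j # a) * g d) = (\<Sum>d\<in>short_words N. if d = j # a then g d else 0)"
      by (intro sum.cong refl) auto
    also have "\<dots> = (if j # a \<in> short_words N then g (j # a) else 0)"
      by (rule sum.delta[OF finite_short_words])
    also have "\<dots> = (if length a < N then g (j # a) else 0)" by (auto simp: short_words_def)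
    finally show ?thesis .
  qed
  have 2: "(\<Sum>d\<in>short_words N. of_bool (a = j # d) * g d) = (if a \<noteq> [] \<and> hd a = j then g (tl a) else 0)"
  proof (cases a)
    case Nil
    then show ?thesis by simp
  next
    case (Cons k a')
    have "a' \<in> short_words N" using a Cons by (simp add: short_words_def)
    moreover have "(\<Sum>d\<in>short_words N. of_bool (a = j # d) * g d) =
        (\<Sum>d\<in>short_words N. if d = a' then of_bool (k = j) * g d else 0)"
      by (intro sum.cong refl) (auto simp: Cons)
    ultimately show ?thesis by (simp add: Cons)
  qed
  have 3: "(\<Sum>d\<in>short_words N. of_bool (h \<and> j = i \<and> a = [] \<and> d = []) * g d) = (if h \<and> j = i \<and> a = [] then g [] else 0)"
  proof -
    have "(\<Sum>d\<in>short_words N. of_bool (h \<and> j = i \<and> a = [] \<and> d = []) * g d) =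
        (\<Sum>d\<in>short_words N. if d = [] then of_bool (h \<and> j = i \<and> a = []) * g d else 0)"
      by (intro sum.cong refl) auto
    also have "\<dots> = (if ([] :: 'd list) \<in> short_words N then of_bool (h \<and> j = i \<and> a = []) * g [] else 0)"
      by (rule sum.delta[OF finite_short_words])
    also have "\<dots> = (if h \<and> j = i \<and> a = [] then g [] else 0)" by (auto simp: short_words_def)
    finally show ?thesis .
  qed
  show ?thesis
    unfolding fock_def distrib_right sum.distrib 1 2 3 ..
qed

lemma fock_pow_Cons:
  assumes "a \<in> short_words N"
  shows "fock_pow N h i (j # \<alpha>) a b =
    (if length a < N then fock_pow N h i \<alpha> (j # a) b else 0) +
    (if a \<noteq> [] \<and> hd a = j then fock_pow N h i \<alpha> (tl a) b else 0) +
    (if h \<and> j = i \<and> a = [] then fock_pow N h i \<alpha> [] b else 0)"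
  unfolding fock_pow.simps(2) by (rule fock_sum[OF assms])

text \<open>At most two steps lead away from a word: one prepends the letter; the other removes it or, at the
  empty word, stays there.\<close>

lemma fock_pow_bound: "a \<in> short_words N \<Longrightarrow> \<bar>fock_pow N h i \<alpha> a b\<bar> \<le> 2 ^ length \<alpha>"
proof (induction \<alpha> arbitrary: a)
  case (Cons j \<alpha>)
  have up: "\<bar>if length a < N then fock_pow N h i \<alpha> (j # a) b else 0\<bar> \<le> 2 ^ length \<alpha>"
    using Cons.IH[of "j # a"] by (auto simp: short_words_def)
  show ?case
  proof (cases a)
    case Nil
    have "\<bar>if h \<and> j = i \<and> a = [] then fock_pow N h i \<alpha> [] b else 0\<bar> \<le> 2 ^ length \<alpha>"
      using Cons.IH[of "[]"] by (auto simp: short_words_def)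
    then show ?thesis unfolding fock_pow_Cons[OF Cons.prems] using up Nil by auto
  next
    case (Cons k a')
    have "\<bar>if a \<noteq> [] \<and> hd a = j then fock_pow N h i \<alpha> (tl a) b else 0\<bar> \<le> 2 ^ length \<alpha>"
      using Cons.IH[of a'] Cons.prems Cons by (auto simp: short_words_def)
    then show ?thesis unfolding fock_pow_Cons[OF Cons.prems] using up Cons by auto
  qed
qed simp

text \<open>Each letter changes the length of the current word by at most one. Hence \<open>b\<close> is not reached from a
  word \<open>a\<close> that is too short, and when the number of letters is just enough, every step has to
  prepend its letter.\<close>

lemma fock_pow_up:
  fixes a b :: "'d::finite list"
  assumes b: "b \<in> short_words N"
  shows "a \<in> short_words N \<Longrightarrow> length \<alpha> + length a < length b \<Longrightarrow> fock_pow N h i \<alpha> a b = 0"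
    and "a \<in> short_words N \<Longrightarrow> length \<alpha> + length a = length b \<Longrightarrow> fock_pow N h i \<alpha> a b = of_bool (b = rev \<alpha> @ a)"
proof (induction \<alpha> arbitrary: a)
  case Nil
  { case 1 then show ?case by auto }
  { case 2 then show ?case by auto }
next
  case (Cons j \<alpha>)
  have tl: "tl a \<in> short_words N" "[] \<in> short_words N" if "a \<in> short_words N" for a :: "'d list"
    using that by (auto simp: short_words_def)
  have up: "j # a \<in> short_words N" if "length a < N" for a using that by (simp add: short_words_def)
  { case 1
    have t: "fock_pow N h i \<alpha> (tl a) b = 0" "fock_pow N h i \<alpha> [] b = 0"
      using 1 tl by (intro Cons.IH(1); simp)+
    have "(if length a < N then fock_pow N h i \<alpha> (j # a) b else 0) = 0"
      using 1 Cons.IH(1)[OF up, of a] by simp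
    then show ?case unfolding fock_pow_Cons[OF 1(1)] t by simp }
  { case 2
    have t1: "(if a \<noteq> [] \<and> hd a = j then fock_pow N h i \<alpha> (tl a) b else 0) = 0"
      using 2 Cons.IH(1)[OF tl(1)[OF 2(1)]] by (cases a) auto
    have t2: "fock_pow N h i \<alpha> [] b = 0"
      using 2 tl(2) by (intro Cons.IH(1)) simp_all
    have lN: "length a < N" using 2 b by (simp add: short_words_def)
    have t3: "fock_pow N h i \<alpha> (j # a) b = of_bool (b = rev \<alpha> @ j # a)"
      using 2 up[OF lN] by (intro Cons.IH(2)) simp_all
    show ?case unfolding fock_pow_Cons[OF 2(1)] t1 t2 t3 using lN by simp }
qed

text \<open>The same argument for descending paths, whose steps all have to remove their letter.\<close>

lemma fock_pow_down:
  fixes a b :: "'d::finite list"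
  assumes b: "b \<in> short_words N"
  shows "a \<in> short_words N \<Longrightarrow> length \<alpha> + length b < length a \<Longrightarrow> fock_pow N h i \<alpha> a b = 0"
    and "a \<in> short_words N \<Longrightarrow> length \<alpha> + length b = length a \<Longrightarrow> fock_pow N h i \<alpha> a b = of_bool (a = \<alpha> @ b)"
proof (induction \<alpha> arbitrary: a)
  case Nil
  { case 1 then show ?case by auto }
  { case 2 then show ?case by auto }
next
  case (Cons j \<alpha>)
  have tl: "tl a \<in> short_words N" if "a \<in> short_words N" for a :: "'d list" using that by (auto simp: short_words_def)
  have up: "j # a \<in> short_words N" if "length a < N" for a using that by (simp add: short_words_def)
  have up0: "fock_pow N h i \<alpha> (j # a) b = 0" if "length a < N" "length (j # \<alpha>) + length b \<le> length a" for a
    using that up by (intro Cons.IH(1)) simp_all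
  { case 1
    then have "a \<noteq> []" by auto
    moreover have "fock_pow N h i \<alpha> (tl a) b = 0" using 1 tl by (intro Cons.IH(1)) simp_all
    moreover have "(if length a < N then fock_pow N h i \<alpha> (j # a) b else 0) = 0"
      using up0[of a] 1 by simp
    ultimately show ?case unfolding fock_pow_Cons[OF 1(1)] by simp }
  { case 2
    then have ne: "a \<noteq> []" by auto
    moreover have "fock_pow N h i \<alpha> (tl a) b = of_bool (tl a = \<alpha> @ b)"
      using 2 tl by (intro Cons.IH(2)) simp_all
    moreover have "(if length a < N then fock_pow N h i \<alpha> (j # a) b else 0) = 0"
      using up0[of a] 2 by simp
    ultimately show ?case unfolding fock_pow_Cons[OF 2(1)]
      by (cases a) auto }
qed

text \<open>A difference of two products telescopes into products with a single factor replaced by a difference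
  of factors. Here that difference is the projection onto the empty word at the letter \<open>i\<close> and zero at
  all other letters, so the terms factor through the empty word.\<close>

lemma fock_pow_telescope:
  fixes a b :: "'d::finite list"
  assumes "a \<in> short_words N"
  shows "fock_pow N True i w a b - fock_pow N False i w a b =
    (\<Sum>k<length w. if w ! k = i then fock_pow N True i (take k w) a [] * fock_pow N False i (drop (Suc k) w) [] b else 0)"
  using assms
proof (induction w arbitrary: a)
  case (Cons j w)
  let ?T = "fock_pow N True i" and ?F = "fock_pow N False i"
  let ?g = "\<lambda>k. if w ! k = i then ?F (drop (Suc k) w) [] b else 0"
  have split: "fock True i j a d = fock False i j a d + of_bool (j = i \<and> a = [] \<and> d = [])" for d
    by (simp add: fock_def)
  have "?T (j # w) a b - ?F (j # w) a b =
      (\<Sum>d\<in>short_words N. fock True i j a d * (?T w d b - ?F w d b)) +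
      (\<Sum>d\<in>short_words N. of_bool (j = i \<and> a = [] \<and> d = []) * ?F w d b)"
  proof -
    have alg: "(p + q) * x - p * y = (p + q) * (x - y) + q * y" for p q x y :: real
      by (simp add: algebra_simps)
    show ?thesis
      unfolding fock_pow.simps(2) sum_subtractf[symmetric] sum.distrib[symmetric] split alg ..
  qed
  also have "(\<Sum>d\<in>short_words N. of_bool (j = i \<and> a = [] \<and> d = []) * ?F w d b) = (if j = i \<and> a = [] then ?F w [] b else 0)"
  proof -
    have "(\<Sum>d\<in>short_words N. of_bool (j = i \<and> a = [] \<and> d = []) * ?F w d b) =
        (\<Sum>d\<in>short_words N. if d = [] then of_bool (j = i \<and> a = []) * ?F w d b else 0)"
      by (intro sum.cong refl) auto
    also have "\<dots> = (if ([] :: 'd list) \<in> short_words N then of_bool (j = i \<and> a = []) * ?F w [] b else 0)"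
      by (rule sum.delta[OF finite_short_words])
    also have "\<dots> = (if j = i \<and> a = [] then ?F w [] b else 0)" by (auto simp: short_words_def)
    finally show ?thesis .
  qed
  also have "(\<Sum>d\<in>short_words N. fock True i j a d * (?T w d b - ?F w d b)) =
      (\<Sum>d\<in>short_words N. \<Sum>k<length w. ?g k * (fock True i j a d * ?T (take k w) d []))"
  proof (intro sum.cong refl)
    fix d :: "'d list" assume d: "d \<in> short_words N"
    show "fock True i j a d * (?T w d b - ?F w d b) = (\<Sum>k<length w. ?g k * (fock True i j a d * ?T (take k w) d []))"
      unfolding Cons.IH[OF d] sum_distrib_left by (intro sum.cong refl) simp
  qed
  also have "\<dots> = (\<Sum>k<length w. ?g k * ?T (j # take k w) a [])"
    by (subst sum.swap) (simp only: fock_pow.simps(2) sum_distrib_left)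
  finally have "?T (j # w) a b - ?F (j # w) a b =
      (\<Sum>k<length w. ?g k * ?T (j # take k w) a []) + (if j = i \<and> a = [] then ?F w [] b else 0)" .
  moreover have "(\<Sum>k<length (j # w). if (j # w) ! k = i then ?T (take k (j # w)) a [] * ?F (drop (Suc k) (j # w)) [] b else 0) =
      (if j = i \<and> a = [] then ?F w [] b else 0) + (\<Sum>k<length w. ?g k * ?T (j # take k w) a [])"
    unfolding length_Cons sum.lessThan_Suc_shift
    by (intro arg_cong2[where f = "(+)"] sum.cong refl) simp_all
  ultimately show ?case by simp
qed simp

text \<open>After division by \<open>t ^ l\<close>, paths of length \<open>l\<close> count unchanged, shorter ones do not exist, and longer
  ones retain at least one factor \<open>t\<close>.\<close>

lemma scaled_path_bound:
  fixes t p :: real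
  assumes t: "0 < t" "t \<le> 1 / 2" and p: "\<bar>p\<bar> \<le> 2 ^ m" and l: "l \<le> N"
    and short: "m < l \<Longrightarrow> p = 0" and exact: "m = l \<Longrightarrow> p = of_bool P" and P: "P \<Longrightarrow> m = l"
  shows "\<bar>t ^ m * p / t ^ l - of_bool P\<bar> \<le> 2 ^ Suc N * t"
proof -
  consider "m < l" | "m = l" | "m > l" by linarith
  then show ?thesis
  proof cases
    case 1
    then have "\<not> P" "p = 0" using P short by auto
    then show ?thesis using t by simp
  next
    case 2
    then show ?thesis using exact[OF 2] t by simp
  next
    case 3
    define d where "d = m - l - 1"
    have m: "m = l + Suc d" using 3 by (simp add: d_def)
    have "\<bar>t ^ m * p / t ^ l\<bar> = t ^ Suc d * \<bar>p\<bar>" using t by (simp add: m power_add abs_mult)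
    also have "\<dots> \<le> t ^ Suc d * 2 ^ m" using t by (intro mult_left_mono p) simp
    also have "\<dots> = 2 ^ Suc l * t * (2 * t) ^ d" by (simp add: m power_add power_mult_distrib)
    also have "\<dots> \<le> 2 ^ Suc l * t * 1" using t by (intro mult_left_mono power_le_one) auto
    also have "\<dots> \<le> 2 ^ Suc N * t" using t l by (simp add: power_increasing)
    finally have "\<bar>t ^ m * p / t ^ l\<bar> \<le> 2 ^ Suc N * t" .
    moreover have "\<not> P" using P 3 by auto
    ultimately show ?thesis by simp
  qed
qed

text \<open>The enumeration \<open>e\<close> of words turns the scaled Fock operators into ordinary matrices.\<close>

definition fock_mat :: "bool \<Rightarrow> 'd::finite \<Rightarrow> real \<Rightarrow> nat \<Rightarrow> (nat \<Rightarrow> 'd list) \<Rightarrow> 'd \<Rightarrow> complex mat" where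
  "fock_mat h i t n e = (\<lambda>j. mat n n (\<lambda>(k, l). complex_of_real (t * fock h i j (e k) (e l))))"

lemma fock_mat_carrier: "fock_mat h i t n e j \<in> carrier_mat n n"
  by (simp add: fock_mat_def)

lemma fock_mat_word_pow:
  assumes e: "bij_betw e {..<n} (short_words N)" and kl: "k < n" "l < n"
  shows "word_pow n (fock_mat h i t n e) \<alpha> $$ (k, l) = complex_of_real (t ^ length \<alpha> * fock_pow N h i \<alpha> (e k) (e l))"
  using kl
proof (induction \<alpha> arbitrary: k)
  case Nil
  then show ?case using e by (auto simp: bij_betw_def inj_on_def)
next
  case (Cons j \<alpha>)
  have "word_pow n (fock_mat h i t n e) (j # \<alpha>) $$ (k, l) =
      (\<Sum>m<n. fock_mat h i t n e j $$ (k, m) * word_pow n (fock_mat h i t n e) \<alpha> $$ (m, l))"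
    by (rule word_pow_Cons_index[OF fock_mat_carrier Cons.prems])
  also have "\<dots> = (\<Sum>m<n. complex_of_real (t * t ^ length \<alpha> * (fock h i j (e k) (e m) * fock_pow N h i \<alpha> (e m) (e l))))"
    by (intro sum.cong refl) (use Cons in \<open>simp add: fock_mat_def\<close>)
  also have "\<dots> = (\<Sum>d\<in>short_words N. complex_of_real (t * t ^ length \<alpha> * (fock h i j (e k) d * fock_pow N h i \<alpha> d (e l))))"
    by (rule sum.reindex_bij_betw[OF e])
  finally show ?case by (simp only: of_real_sum[symmetric] sum_distrib_left[symmetric] fock_pow.simps(2) length_Cons power_Suc)
qed

lemma fock_mat_ball_R:
  assumes t: "0 < t" and r: "3 * t * real n < r"
  shows "fock_mat h i t n e \<in> ball_R n r"
proof -
  \<comment> \<open>A crude bound suffices, since \<open>t\<close> will tend to \<open>0\<close>: an entry is \<open>t\<close> times a sum of three indicators.\<close>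
  have ent: "cmod (fock_mat h i t n e j $$ (k, l)) \<le> 3 * t" if "k < n" "l < n" for j k l
  proof -
    have "fock h i j (e k) (e l) \<le> 3" "0 \<le> fock h i j (e k) (e l)" by (simp_all add: fock_def of_bool_def)
    then show ?thesis using that t by (simp add: fock_mat_def norm_mult)
  qed
  have "mat_norm n (fock_mat h i t n e j) < r" for j
  proof -
    have "mat_norm n (fock_mat h i t n e j) \<le> sqrt (\<Sum>k<n. \<Sum>l<n. (cmod (fock_mat h i t n e j $$ (k, l)))\<^sup>2)"
      by (rule mat_norm_le)
    also have "\<dots> \<le> sqrt (\<Sum>k<n. \<Sum>l<n. (3 * t)\<^sup>2)"
      by (intro real_sqrt_le_mono sum_mono power_mono ent) auto
    also have "\<dots> = sqrt ((3 * t * real n)\<^sup>2)" by (simp add: power2_eq_square)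
    also have "\<dots> = 3 * t * real n" using t by (simp only: real_sqrt_abs) simp
    also note r
    finally show ?thesis .
  qed
  then have "fock_mat h i t n e \<in> ball_C n r" by (intro ball_CI fock_mat_carrier)
  moreover have "mat_adjoint (fock_mat h i t n e j) = fock_mat h i t n e j" for j
  proof (rule eq_matI)
    fix k l assume "k < dim_row (fock_mat h i t n e j)" "l < dim_col (fock_mat h i t n e j)"
    then have kl: "k < n" "l < n" by (simp_all add: fock_mat_def)
    then show "mat_adjoint (fock_mat h i t n e j) $$ (k, l) = fock_mat h i t n e j $$ (k, l)"
      by (simp add: mat_adjoint_def mat_of_rows_index fock_mat_def fock_def add.commute conj_commute)
  qed (simp_all add: mat_adjoint_def fock_mat_def)
  ultimately show ?thesis by (simp add: ball_R_def)
qed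

text \<open>The two tuples differ by \<open>t\<close> times the projection onto the empty word in the \<open>i\<close>-th coordinate, and
  agree in the others.\<close>

lemma fock_mat_le:
  assumes t: "0 < t" and e: "bij_betw e {..<n} (short_words N)"
  shows "mat_le n (fock_mat False i t n e j) (fock_mat True i t n e j)"
proof -
  have "(\<Sum>k<n. \<Sum>l<n. (fock_mat True i t n e j $$ (k, l) - fock_mat False i t n e j $$ (k, l)) * (z l * cnj (z k))) =
      complex_of_real (\<Sum>k<n. if j = i \<and> e k = [] then t * (cmod (z k))\<^sup>2 else 0)" for z
  proof -
    have inj: "e k = e l \<Longrightarrow> k < n \<Longrightarrow> l < n \<Longrightarrow> k = l" for k l
      using e by (auto simp: bij_betw_def inj_on_def)
    have "(\<Sum>l<n. (fock_mat True i t n e j $$ (k, l) - fock_mat False i t n e j $$ (k, l)) * (z l * cnj (z k))) =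
        complex_of_real (if j = i \<and> e k = [] then t * (cmod (z k))\<^sup>2 else 0)" if k: "k < n" for k
    proof -
      have "(\<Sum>l<n. (fock_mat True i t n e j $$ (k, l) - fock_mat False i t n e j $$ (k, l)) * (z l * cnj (z k))) =
          (\<Sum>l<n. if l = k then (if j = i \<and> e k = [] then complex_of_real t * (z k * cnj (z k)) else 0) else 0)"
        by (intro sum.cong refl) (use k inj in \<open>auto simp: fock_mat_def fock_def algebra_simps\<close>)
      also have "\<dots> = (if j = i \<and> e k = [] then complex_of_real t * (z k * cnj (z k)) else 0)"
        using k by simp
      also have "\<dots> = complex_of_real (if j = i \<and> e k = [] then t * (cmod (z k))\<^sup>2 else 0)"
        by (simp add: complex_norm_square[symmetric])
      finally show ?thesis .
    qed
    then show ?thesis unfolding of_real_sum by (intro sum.cong refl) simp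
  qed
  note eq = this
  show ?thesis
  proof (rule mat_leI)
    show "Im (\<Sum>k<n. \<Sum>l<n. (fock_mat True i t n e j $$ (k, l) - fock_mat False i t n e j $$ (k, l)) * (z l * cnj (z k))) = 0" for z
      unfolding eq by (rule Im_complex_of_real)
    show "0 \<le> Re (\<Sum>k<n. \<Sum>l<n. (fock_mat True i t n e j $$ (k, l) - fock_mat False i t n e j $$ (k, l)) * (z l * cnj (z k)))" for z
      unfolding eq Re_complex_of_real using t by (intro sum_nonneg) auto
  qed
qed

section \<open>Positivity of the forms\<close>

text \<open>For a given \<open>w\<close> the two conditions on \<open>k\<close> say that \<open>w\<close> consists of \<open>a\<close>, the letter \<open>i\<close> at position
  \<open>k\<close>, and the reverse of \<open>b\<close>. This is possible only for \<open>k = length a\<close>.\<close>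

lemma fock_path_split:
  "(\<Sum>k<length w. if w ! k = i then of_bool (a = take k w) * of_bool (b = rev (drop (Suc k) w)) else 0) =
    (of_bool (w = a @ i # rev b) :: real)"
proof (cases "w = a @ i # rev b")
  case True
  have "(\<Sum>k<length w. if w ! k = i then of_bool (a = take k w) * of_bool (b = rev (drop (Suc k) w)) else 0) =
      (\<Sum>k<length w. if k = length a then 1 else 0 :: real)"
  proof (intro sum.cong refl)
    fix k assume "k \<in> {..<length w}"
    then have k: "k < length w" by simp
    show "(if w ! k = i then of_bool (a = take k w) * of_bool (b = rev (drop (Suc k) w)) else 0) =
        (if k = length a then 1 else 0 :: real)"
    proof (cases "k = length a")
      case True': True
      then show ?thesis by (simp add: True)
    next
      case False
      then have "a \<noteq> take k w" using k by auto
      then show ?thesis using False by simp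
    qed
  qed
  then show ?thesis using True by simp
next
  case False
  have "(if w ! k = i then of_bool (a = take k w) * of_bool (b = rev (drop (Suc k) w)) else 0) = (0::real)"
    if "k < length w" for k
    using id_take_nth_drop[OF that] False by auto
  then show ?thesis using False by simp
qed

lemma le_zero_if_le_linear:
  fixes x C t\<^sub>0 :: real
  assumes "0 < t\<^sub>0" "\<And>t. 0 < t \<Longrightarrow> t \<le> t\<^sub>0 \<Longrightarrow> x \<le> C * t"
  shows "x \<le> 0"
proof (rule ccontr)
  assume "\<not> x \<le> 0"
  then have x: "x > 0" by simp
  define d where "d = \<bar>C\<bar> + 1"
  have d: "0 < d" "C \<le> d" by (simp_all add: d_def)
  define t where "t = min t\<^sub>0 (x / (2 * d))"
  have t: "0 < t" "t \<le> t\<^sub>0" using assms(1) x d by (auto simp: t_def)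
  have "C * t \<le> d * t" using t d by (intro mult_right_mono) auto
  also have "\<dots> \<le> d * (x / (2 * d))"
    by (intro mult_left_mono) (use d in \<open>auto simp: t_def\<close>)
  also have "\<dots> = x / 2" using d by simp
  finally show False using assms(2)[OF t] x by simp
qed

lemma has_sum_finite_combination:
  fixes g :: "'i \<Rightarrow> 'x \<Rightarrow> complex"
  assumes "finite A" "\<And>i. i \<in> A \<Longrightarrow> (g i has_sum s i) X"
  shows "((\<lambda>x. \<Sum>i\<in>A. g i x) has_sum (\<Sum>i\<in>A. s i)) X"
  using assms by (induction A rule: finite_induct) (auto intro: has_sum_add)

lemma has_sum_minus_complex:
  fixes g h :: "'x \<Rightarrow> complex"
  assumes "(g has_sum s) X" "(h has_sum t) X"
  shows "((\<lambda>x. g x - h x) has_sum (s - t)) X"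
  using has_sum_add[OF assms(1) has_sum_cmult_right[OF assms(2), of "-1"]] by simp

text \<open>The weight \<open>length \<alpha>\<close> is the number of terms in \<open>fock_pow_telescope\<close>. By Bernoulli's inequality it is
  at most a multiple of \<open>s ^ length \<alpha>\<close>.\<close>

lemma length_coefficient_norms_summable:
  fixes c :: "'d::finite list \<Rightarrow> 'k \<Rightarrow> 'k"
  assumes K: "hilbert_space K" and c: "\<And>\<alpha>. c \<alpha> \<in> bounded_ops K K"
    and ps: "power_series_on_ball K r c f" and r: "1 < r"
  shows "(\<lambda>\<alpha>. opnorm K K (c \<alpha>) * real (length \<alpha>)) summable_on UNIV"
proof -
  have Ks: "semi_inner_space K" using K by (rule hilbert_space.axioms)
  define s where "s = (1 + r) / 2"
  have s: "1 < s" "s < r" using r by (auto simp: s_def)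
  have len: "real m \<le> s ^ m / (s - 1)" for m
  proof -
    \<comment> \<open>Any exponential weight above \<open>1\<close> dominates the linear one.\<close>
    have "1 + real m * (s - 1) \<le> (1 + (s - 1)) ^ m" by (rule Bernoulli_inequality) (use s in simp)
    then have "real m * (s - 1) \<le> s ^ m" by simp
    then show ?thesis using s by (simp add: pos_le_divide_eq)
  qed
  have sum: "(\<lambda>\<alpha>. opnorm K K (c \<alpha>) * s ^ length \<alpha> * (1 / (s - 1))) summable_on UNIV"
    by (rule summable_on_cmult_left[OF coefficient_norms_summable[OF K c ps]]) (use s in auto)
  show ?thesis
  proof (rule summable_on_comparison_test[OF sum])
    fix \<alpha>
    have o: "0 \<le> opnorm K K (c \<alpha>)" by (rule bounded_ops_opnorm_nonneg[OF c Ks])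
    show "0 \<le> opnorm K K (c \<alpha>) * real (length \<alpha>)" using o by simp
    show "opnorm K K (c \<alpha>) * real (length \<alpha>) \<le> opnorm K K (c \<alpha>) * s ^ length \<alpha> * (1 / (s - 1))"
      using mult_left_mono[OF len[of "length \<alpha>"] o] by simp
  qed
qed

text \<open>Monotonicity is applied to the two tuples of \<open>fock_mat_le\<close>, tested on the vector \<open>\<xi>\<close> whose component
  at the word \<open>a\<close> is \<open>v a\<close> divided by \<open>t ^ length a\<close>. By \<open>fock_pow_telescope\<close>, the coefficient of
  \<open>\<langle>c w (v b), v a\<rangle>\<close> in the difference divided by \<open>t\<close> is a sum over the occurrences of \<open>i\<close> in \<open>w\<close> of
  products of two rescaled path counts. By \<open>scaled_path_bound\<close> each of these is an indicator up to a
  multiple of \<open>t\<close>, and by \<open>fock_path_split\<close> the indicators single out the word \<open>a @ i # rev b\<close>. The total error is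
  at most \<open>t\<close> times a multiple of \<open>\<Sum>w. \<parallel>c w\<parallel> length w\<close>. Hence the form is a limit of nonnegative
  numbers.\<close>

lemma monotone_form_nonneg:
  fixes c :: "'d::finite list \<Rightarrow> 'k \<Rightarrow> 'k"
  assumes K: "hilbert_space K" and c: "\<And>\<alpha>. c \<alpha> \<in> bounded_ops K K"
    and ps: "power_series_on_ball K r c f" and r: "1 < r" and mono: "matrix_monotone K r f"
    and v: "\<And>b. v b \<in> carrier K"
  shows "Im (\<Sum>a\<in>short_words N. \<Sum>b\<in>short_words N. ip K (c (a @ i # rev b) (v b)) (v a)) = 0"
    and "0 \<le> Re (\<Sum>a\<in>short_words N. \<Sum>b\<in>short_words N. ip K (c (a @ i # rev b) (v b)) (v a))"
proof -
  interpret K: hilbert_space K by (rule K)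
  note Ks = K.semi_inner_space_axioms
  let ?S = "short_words N :: 'd list set"
  define G where "G w a b = ip K (c w (v b)) (v a)" for w a b
  define q where "q = (\<Sum>a\<in>?S. \<Sum>b\<in>?S. G (a @ i # rev b) a b)"
  obtain e where e0: "bij_betw e {0..<card ?S} ?S" using ex_bij_betw_nat_finite[OF finite_short_words] by blast
  define n where "n = card ?S"
  have e: "bij_betw e {..<n} ?S" using e0 by (simp add: n_def atLeast0LessThan)
  define V where "V = (\<Sum>a\<in>?S. hnorm K (v a))"
  have V: "hnorm K (v a) \<le> V" if "a \<in> ?S" for a
    unfolding V_def by (rule member_le_sum[OF that]) (use v in auto)
  have V0: "0 \<le> V" unfolding V_def by (intro sum_nonneg K.hnorm_nonneg v)
  have G: "cmod (G w a b) \<le> opnorm K K (c w) * V\<^sup>2" if "a \<in> ?S" "b \<in> ?S" for w a b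
  proof -
    have "cmod (G w a b) \<le> hnorm K (c w (v b)) * hnorm K (v a)"
      unfolding G_def by (intro K.cauchy_schwarz bounded_ops_closed[OF c] v)
    also have "\<dots> \<le> (opnorm K K (c w) * hnorm K (v b)) * hnorm K (v a)"
      by (intro mult_right_mono bounded_ops_opnorm[OF c Ks] K.hnorm_nonneg v)
    also have "\<dots> \<le> (opnorm K K (c w) * V) * V"
      by (intro mult_mono mult_left_mono V that mult_nonneg_nonneg V0 bounded_ops_opnorm_nonneg[OF c Ks] K.hnorm_nonneg v order_refl)
    finally show ?thesis by (simp add: power2_eq_square)
  qed
  define B :: real where "B = 2 ^ Suc N"
  have B: "0 < B" by (simp add: B_def)
  \<comment> \<open>The number of pairs \<open>(a, b)\<close>, the size of the vectors, and the error of a product of two factors,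
    each of which is an indicator up to \<open>B * t\<close>.\<close>
  define C where "C = (real (card ?S))\<^sup>2 * V\<^sup>2 * (B * (2 + B))"
  obtain M where M: "((\<lambda>w. opnorm K K (c w) * real (length w)) has_sum M) UNIV"
    using length_coefficient_norms_summable[OF K c ps r] by (auto simp: summable_on_def)
  \<comment> \<open>Small enough for \<open>scaled_path_bound\<close> and for both tuples, whose entries are at most \<open>3 * t\<close>, to lie
    in the ball.\<close>
  define t\<^sub>0 where "t\<^sub>0 = min (1 / 2) (r / (3 * real n + 1) / 2)"
  have n0: "0 < 3 * real n + 1" by linarith
  have t0: "0 < t\<^sub>0" using r n0 by (simp add: t\<^sub>0_def)

  \<comment> \<open>Up to the factor \<open>1 / t\<close>, \<open>D\<close> is the value of \<open>f(Y) - f(X)\<close> on \<open>\<xi>\<close>.\<close>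
  have main: "\<exists>D. Im D = 0 \<and> 0 \<le> Re D \<and> cmod (D - q) \<le> M * C * t" if t: "0 < t" "t \<le> t\<^sub>0" for t
  proof -
    have th: "t \<le> 1 / 2" using t by (simp add: t\<^sub>0_def)
    have tn: "3 * t * real n < r"
    proof -
      have "t \<le> r / (3 * real n + 1) / 2" using t by (simp add: t\<^sub>0_def)
      then have "t * (6 * real n + 2) \<le> r" using n0 by (simp add: pos_le_divide_eq)
      then have "6 * (t * real n) + 2 * t \<le> r" by (simp add: algebra_simps)
      moreover have "0 \<le> t * real n" using t by simp
      ultimately have "3 * (t * real n) < r" using t by linarith
      then show ?thesis by (simp add: mult.assoc)
    qed
    let ?PT = "fock_pow N True i" and ?PF = "fock_pow N False i"
    let ?X = "fock_mat False i t n e" and ?Y = "fock_mat True i t n e"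
    have XR: "?X \<in> ball_R n r" and YR: "?Y \<in> ball_R n r" by (rule fock_mat_ball_R[OF t(1) tn])+
    then have XC: "?X \<in> ball_C n r" and YC: "?Y \<in> ball_C n r" by (simp_all add: ball_R_def)
    have opX: "f n ?X \<in> bounded_ops (amp n K) (amp n K)" and opY: "f n ?Y \<in> bounded_ops (amp n K) (amp n K)"
      using ps XC YC by (auto simp: power_series_on_ball_def)
    define \<xi> where "\<xi> = (\<lambda>k\<in>{..<n}. complex_of_real (1 / t ^ length (e k)) \<odot>\<^bsub>K\<^esub> v (e k))"
    have x: "\<xi> \<in> carrier (amp n K)" using v by (simp add: \<xi>_def amp_simps)
    define D where "D = ip (amp n K) (f n ?Y \<xi>) \<xi> - ip (amp n K) (f n ?X \<xi>) \<xi>"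
    have ole: "op_le (amp n K) (f n ?X) (f n ?Y)"
      using mono XR YR fock_mat_le[OF t(1) e] unfolding matrix_monotone_def by blast
    have Deq: "D = ip (amp n K) (f n ?Y \<xi> \<ominus>\<^bsub>amp n K\<^esub> f n ?X \<xi>) \<xi>"
      unfolding D_def
      by (intro semi_inner_space.ip_minus_left[symmetric] semi_inner_space_amp Ks x
          bounded_ops_closed[OF opX] bounded_ops_closed[OF opY])
    have D: "Im D = 0" "0 \<le> Re D"
      using ole x unfolding op_le_def Deq by blast+
    \<comment> \<open>The coefficient of \<open>G w a b\<close>. The descent from \<open>a\<close> takes the letters before position \<open>k\<close>, the climb to
      \<open>b\<close> those after it.\<close>
    define h where "h w a b = (\<Sum>k<length w. if w ! k = i then
        (t ^ length (take k w) * ?PT (take k w) a [] / t ^ length a) *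
        (t ^ length (drop (Suc k) w) * ?PF (drop (Suc k) w) [] b / t ^ length b) else 0)" for w a b
    have hT: "t ^ length w * (?PT w a b - ?PF w a b) / (t ^ length a * t ^ length b) = t * h w a b" if "a \<in> ?S" for w a b
    proof -
      have "t ^ length w * (?PT w a b - ?PF w a b) / (t ^ length a * t ^ length b) =
          (\<Sum>k<length w. t ^ length w * (if w ! k = i then ?PT (take k w) a [] * ?PF (drop (Suc k) w) [] b else 0) /
            (t ^ length a * t ^ length b))"
        unfolding fock_pow_telescope[OF that] sum_distrib_left sum_divide_distrib ..
      also have "\<dots> = t * h w a b"
        unfolding h_def sum_distrib_left
      proof (intro sum.cong refl)
        fix k assume "k \<in> {..<length w}"
        then have k: "k < length w" by simp
        have "length w = Suc k + (length w - Suc k)" using k by simp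
        then have "t ^ length w = t ^ (Suc k + (length w - Suc k))" by (rule arg_cong)
        also have "\<dots> = t * t ^ k * t ^ (length w - Suc k)" by (simp only: power_add power_Suc)
        finally have "t ^ length w = t * t ^ length (take k w) * t ^ length (drop (Suc k) w)"
          using k by simp
        then show "t ^ length w * (if w ! k = i then ?PT (take k w) a [] * ?PF (drop (Suc k) w) [] b else 0) /
            (t ^ length a * t ^ length b) = t * (if w ! k = i then
            (t ^ length (take k w) * ?PT (take k w) a [] / t ^ length a) *
            (t ^ length (drop (Suc k) w) * ?PF (drop (Suc k) w) [] b / t ^ length b) else 0)"
          by simp
      qed
      finally show ?thesis .
    qed
    have hbound: "\<bar>h w a b - of_bool (w = a @ i # rev b)\<bar> \<le> real (length w) * (B * (2 + B) * t)"
      if a: "a \<in> ?S" and b: "b \<in> ?S" for w a b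
    proof -
      have e0: "[] \<in> ?S" by (simp add: short_words_def)
      have la: "length a \<le> N" "length b \<le> N" using a b by (auto simp: short_words_def)
      have phi: "\<bar>t ^ length \<alpha> * ?PT \<alpha> a [] / t ^ length a - of_bool (a = \<alpha>)\<bar> \<le> B * t" for \<alpha>
        unfolding B_def
        by (rule scaled_path_bound[OF t(1) th fock_pow_bound[OF a] la(1)])
          (use fock_pow_down[OF e0 a, of \<alpha>] in auto)
      have psi: "\<bar>t ^ length \<alpha> * ?PF \<alpha> [] b / t ^ length b - of_bool (b = rev \<alpha>)\<bar> \<le> B * t" for \<alpha>
        unfolding B_def
        by (rule scaled_path_bound[OF t(1) th fock_pow_bound[OF e0] la(2)])
          (use fock_pow_up[OF b e0, of \<alpha>] in auto)
      have prod: "\<bar>p * s - p0 * s0\<bar> \<le> B * (2 + B) * t"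
        if p: "\<bar>p - p0\<bar> \<le> B * t" and s: "\<bar>s - s0\<bar> \<le> B * t" and o: "\<bar>p0\<bar> \<le> 1" "\<bar>s0\<bar> \<le> 1" for p s p0 s0 :: real
      proof -
        have "p * s - p0 * s0 = (p - p0) * s + p0 * (s - s0)" by (simp add: algebra_simps)
        then have "\<bar>p * s - p0 * s0\<bar> \<le> \<bar>p - p0\<bar> * \<bar>s\<bar> + \<bar>p0\<bar> * \<bar>s - s0\<bar>"
          by (metis abs_mult abs_triangle_ineq)
        also have "\<dots> \<le> (B * t) * (1 + B) + 1 * (B * t)"
        proof (intro add_mono mult_mono p s o)
          have "B * t \<le> B" using B t th by simp
          then show "\<bar>s\<bar> \<le> 1 + B" using s o by linarith
        qed (use B t in auto)
        also have "\<dots> = B * (2 + B) * t" by (simp add: algebra_simps)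
        finally show ?thesis .
      qed
      have "\<bar>h w a b - of_bool (w = a @ i # rev b)\<bar> \<le> (\<Sum>k<length w. B * (2 + B) * t)"
        unfolding fock_path_split[symmetric] h_def sum_subtractf[symmetric]
      proof (rule order_trans[OF sum_abs], rule sum_mono)
        fix k
        show "\<bar>(if w ! k = i then (t ^ length (take k w) * ?PT (take k w) a [] / t ^ length a) *
            (t ^ length (drop (Suc k) w) * ?PF (drop (Suc k) w) [] b / t ^ length b) else 0) -
            (if w ! k = i then of_bool (a = take k w) * of_bool (b = rev (drop (Suc k) w)) else 0)\<bar> \<le> B * (2 + B) * t"
        proof (cases "w ! k = i")
          case True
          show ?thesis unfolding if_P[OF True] by (rule prod[OF phi psi]) simp_all
        next
          case False
          then show ?thesis using B t by simp
        qed
      qed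
      then show ?thesis by simp
    qed
    define qt where "qt w = (\<Sum>a\<in>?S. \<Sum>b\<in>?S. complex_of_real (h w a b) * G w a b)" for w
    \<comment> \<open>The same sum with \<open>h\<close> replaced by its limit; it has \<open>q\<close> as its total.\<close>
    define q0 where "q0 w = (\<Sum>a\<in>?S. \<Sum>b\<in>?S. complex_of_real (of_bool (w = a @ i # rev b)) * G w a b)" for w
    have "((\<lambda>w. ip (amp n K) (tensor K K n (c w) (word_pow n ?Y w) \<xi>) \<xi> -
        ip (amp n K) (tensor K K n (c w) (word_pow n ?X w) \<xi>) \<xi>) has_sum D) UNIV"
      unfolding D_def
      by (intro has_sum_minus_complex power_series_has_sum[OF K c ps _ x x] XC YC)
    moreover have "ip (amp n K) (tensor K K n (c w) (word_pow n ?Y w) \<xi>) \<xi> -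
        ip (amp n K) (tensor K K n (c w) (word_pow n ?X w) \<xi>) \<xi> = complex_of_real t * qt w" for w
    proof -
      have "ip (amp n K) (tensor K K n (c w) (word_pow n ?Y w) \<xi>) \<xi> -
          ip (amp n K) (tensor K K n (c w) (word_pow n ?X w) \<xi>) \<xi> =
          (\<Sum>k<n. \<Sum>l<n. (word_pow n ?Y w $$ (k, l) - word_pow n ?X w $$ (k, l)) * ip K (c w (\<xi> l)) (\<xi> k))"
        unfolding tensor_ip[OF Ks c x x] sum_subtractf[symmetric] left_diff_distrib ..
      also have "\<dots> = (\<Sum>k<n. \<Sum>l<n. complex_of_real t * (complex_of_real (h w (e k) (e l)) * G w (e k) (e l)))"
      proof (intro sum.cong refl)
        fix k l assume "k \<in> {..<n}" "l \<in> {..<n}"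
        then have kl: "k < n" "l < n" by auto
        have eS: "e k \<in> ?S" using e kl by (auto simp: bij_betw_def)
        have "ip K (c w (\<xi> l)) (\<xi> k) = complex_of_real (1 / (t ^ length (e k) * t ^ length (e l))) * G w (e k) (e l)"
          using kl v bounded_ops_closed[OF c v]
          by (simp add: \<xi>_def bounded_ops_smult[OF c v] K.ip_smult K.ip_smult_right G_def)
        moreover have "word_pow n ?Y w $$ (k, l) - word_pow n ?X w $$ (k, l) =
            complex_of_real (t ^ length w * (?PT w (e k) (e l) - ?PF w (e k) (e l)))"
          unfolding fock_mat_word_pow[OF e kl] by (simp add: right_diff_distrib)
        ultimately have "(word_pow n ?Y w $$ (k, l) - word_pow n ?X w $$ (k, l)) * ip K (c w (\<xi> l)) (\<xi> k) =
            complex_of_real (t ^ length w * (?PT w (e k) (e l) - ?PF w (e k) (e l)) / (t ^ length (e k) * t ^ length (e l))) *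
            G w (e k) (e l)" by simp
        then show "(word_pow n ?Y w $$ (k, l) - word_pow n ?X w $$ (k, l)) * ip K (c w (\<xi> l)) (\<xi> k) =
            complex_of_real t * (complex_of_real (h w (e k) (e l)) * G w (e k) (e l))"
          unfolding hT[OF eS] by simp
      qed
      also have "\<dots> = (\<Sum>k<n. \<Sum>b\<in>?S. complex_of_real t * (complex_of_real (h w (e k) b) * G w (e k) b))"
        by (intro sum.cong refl sum.reindex_bij_betw[OF e])
      also have "\<dots> = (\<Sum>a\<in>?S. \<Sum>b\<in>?S. complex_of_real t * (complex_of_real (h w a b) * G w a b))"
        by (rule sum.reindex_bij_betw[OF e])
      finally show ?thesis by (simp only: qt_def sum_distrib_left)
    qed
    ultimately have "((\<lambda>w. complex_of_real t * qt w) has_sum D) UNIV" by simp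
    then have "((\<lambda>w. complex_of_real (1 / t) * (complex_of_real t * qt w)) has_sum (complex_of_real (1 / t) * D)) UNIV"
      by (rule has_sum_cmult_right)
    then have sumt: "(qt has_sum (complex_of_real (1 / t) * D)) UNIV" using t by simp
    have sum0: "(q0 has_sum q) UNIV"
      unfolding q0_def q_def
    proof (intro has_sum_finite_combination finite_short_words)
      fix a b
      have "((\<lambda>w. complex_of_real (of_bool (w = a @ i # rev b)) * G w a b) has_sum
          (\<Sum>w\<in>{a @ i # rev b}. complex_of_real (of_bool (w = a @ i # rev b)) * G w a b)) {a @ i # rev b}"
        by (rule has_sum_finite) simp
      then have "((\<lambda>w. complex_of_real (of_bool (w = a @ i # rev b)) * G w a b) has_sum G (a @ i # rev b) a b) {a @ i # rev b}"
        by simp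
      then show "((\<lambda>w. complex_of_real (of_bool (w = a @ i # rev b)) * G w a b) has_sum G (a @ i # rev b) a b) UNIV"
        by (subst has_sum_cong_neutral[where S = UNIV and T = "{a @ i # rev b}"]) auto
    qed
    have "cmod (complex_of_real (1 / t) * D - q) \<le> M * (C * t)"
    proof (rule norm_infsum_le[OF has_sum_minus_complex[OF sumt sum0] has_sum_cmult_left[OF M]])
      fix w
      have "qt w - q0 w = (\<Sum>a\<in>?S. \<Sum>b\<in>?S. complex_of_real (h w a b - of_bool (w = a @ i # rev b)) * G w a b)"
        unfolding qt_def q0_def sum_subtractf[symmetric] of_real_diff left_diff_distrib ..
      also have "cmod \<dots> \<le> (\<Sum>a\<in>?S. \<Sum>b\<in>?S. (real (length w) * (B * (2 + B) * t)) * (opnorm K K (c w) * V\<^sup>2))"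
      proof (intro order_trans[OF norm_sum] sum_mono)
        fix a b assume a: "a \<in> ?S" and b: "b \<in> ?S"
        show "cmod (complex_of_real (h w a b - of_bool (w = a @ i # rev b)) * G w a b) \<le>
            (real (length w) * (B * (2 + B) * t)) * (opnorm K K (c w) * V\<^sup>2)"
          unfolding norm_mult norm_of_real
          by (intro mult_mono hbound G a b mult_nonneg_nonneg) (use B t in auto)
      qed
      also have "\<dots> = opnorm K K (c w) * real (length w) * (C * t)"
        by (simp add: C_def power2_eq_square mult_ac)
      finally show "cmod (qt w - q0 w) \<le> opnorm K K (c w) * real (length w) * (C * t)" .
    qed
    moreover have "Im (complex_of_real (1 / t) * D) = 0" "0 \<le> Re (complex_of_real (1 / t) * D)"
      using D t by (simp_all add: complex_eq_iff)
    ultimately show ?thesis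
      by (intro exI[of _ "complex_of_real (1 / t) * D"]) (simp add: mult.assoc)
  qed
  have "\<bar>Im q\<bar> \<le> M * C * t" "- Re q \<le> M * C * t" if t: "0 < t" "t \<le> t\<^sub>0" for t
  proof -
    obtain D where D: "Im D = 0" "0 \<le> Re D" "cmod (D - q) \<le> M * C * t" using main[OF t] by blast
    show "\<bar>Im q\<bar> \<le> M * C * t" using abs_Im_le_cmod[of "D - q"] D by simp
    show "- Re q \<le> M * C * t" using abs_Re_le_cmod[of "D - q"] D by simp
  qed
  note bounds = this
  have "\<bar>Im q\<bar> \<le> 0" by (rule le_zero_if_le_linear[OF t0 bounds(1)])
  moreover have "- Re q \<le> 0" by (rule le_zero_if_le_linear[OF t0 bounds(2)])
  ultimately have "Im q = 0" "0 \<le> Re q" by simp_all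
  then show "Im (\<Sum>a\<in>?S. \<Sum>b\<in>?S. ip K (c (a @ i # rev b) (v b)) (v a)) = 0"
    and "0 \<le> Re (\<Sum>a\<in>?S. \<Sum>b\<in>?S. ip K (c (a @ i # rev b) (v b)) (v a))"
    by (simp_all add: q_def G_def)
qed

section \<open>The word spaces\<close>

lemma word_space_simps [simp]:
  "carrier (word_space K c i) = {u. range u \<subseteq> carrier K \<and> finite {\<alpha>. u \<alpha> \<noteq> \<zero>\<^bsub>K\<^esub>}}"
  "\<zero>\<^bsub>word_space K c i\<^esub> = (\<lambda>_. \<zero>\<^bsub>K\<^esub>)"
  "u \<oplus>\<^bsub>word_space K c i\<^esub> w = (\<lambda>\<alpha>. u \<alpha> \<oplus>\<^bsub>K\<^esub> w \<alpha>)"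
  "a \<odot>\<^bsub>word_space K c i\<^esub> u = (\<lambda>\<alpha>. a \<odot>\<^bsub>K\<^esub> u \<alpha>)"
  by (simp_all add: word_space_def)

text \<open>Enlarging the ranges of summation beyond the supports changes nothing, so elements with different
  supports can share one index set.\<close>

lemma word_space_ip:
  assumes K: "semi_inner_space K" and c: "\<And>\<alpha>. c \<alpha> \<in> bounded_ops K K"
    and u: "u \<in> carrier (word_space K c i)" and w: "w \<in> carrier (word_space K c i)"
    and A: "finite A" "{\<alpha>. u \<alpha> \<noteq> \<zero>\<^bsub>K\<^esub>} \<subseteq> A" and B: "finite B" "{\<beta>. w \<beta> \<noteq> \<zero>\<^bsub>K\<^esub>} \<subseteq> B"
  shows "ip (word_space K c i) u w = (\<Sum>\<alpha>\<in>A. \<Sum>\<beta>\<in>B. ip K (c (rev \<beta> @ i # \<alpha>) (u \<alpha>)) (w \<beta>))"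
proof -
  interpret K: semi_inner_space K by (rule K)
  have uc: "u \<alpha> \<in> carrier K" and wc: "w \<alpha> \<in> carrier K" for \<alpha> using u w by auto
  have "(\<Sum>\<alpha>\<in>A. \<Sum>\<beta>\<in>B. ip K (c (rev \<beta> @ i # \<alpha>) (u \<alpha>)) (w \<beta>)) =
      (\<Sum>\<alpha> | u \<alpha> \<noteq> \<zero>\<^bsub>K\<^esub>. \<Sum>\<beta>\<in>B. ip K (c (rev \<beta> @ i # \<alpha>) (u \<alpha>)) (w \<beta>))"
    by (rule sum.mono_neutral_right[OF A])
      (auto intro!: sum.neutral simp: bounded_ops_zero[OF c K K] wc)
  also have "\<dots> = (\<Sum>\<alpha> | u \<alpha> \<noteq> \<zero>\<^bsub>K\<^esub>. \<Sum>\<beta> | w \<beta> \<noteq> \<zero>\<^bsub>K\<^esub>. ip K (c (rev \<beta> @ i # \<alpha>) (u \<alpha>)) (w \<beta>))"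
    by (intro sum.cong refl sum.mono_neutral_right[OF B]) (auto simp: bounded_ops_closed[OF c uc])
  finally show ?thesis by (simp add: word_space_def)
qed

text \<open>Complex polarization. The four numbers are the values of a sesquilinear form on the pairs of \<open>u\<close> and
  \<open>w\<close>, and the first two premises say that the form is real at \<open>u + w\<close> and at \<open>u + \<i> w\<close>.\<close>

lemma sesquilinear_real_imp_hermitian:
  fixes Buu Buw Bwu Bww :: complex
  assumes "Im (Buu + Buw + Bwu + Bww) = 0" "Im (Buu - \<i> * Buw + \<i> * Bwu + Bww) = 0" "Im Buu = 0" "Im Bww = 0"
  shows "Bwu = cnj Buw"
  using assms by (simp add: complex_eq_iff)

locale monotone_series =
  fixes K :: "'k hspace" and c :: "'d::finite list \<Rightarrow> 'k \<Rightarrow> 'k"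
    and f :: "nat \<Rightarrow> ('d \<Rightarrow> complex mat) \<Rightarrow> (nat \<Rightarrow> 'k) \<Rightarrow> (nat \<Rightarrow> 'k)" and r :: real
  assumes K: "hilbert_space K" and c: "\<And>\<alpha>. c \<alpha> \<in> bounded_ops K K"
    and series: "power_series_on_ball K r c f" and mono: "matrix_monotone K r f" and radius: "1 < r"
begin

sublocale K: hilbert_space K by (rule K)

lemma Ks: "semi_inner_space K" by (rule K.semi_inner_space_axioms)

lemma word_space_value: "u \<in> carrier (word_space K c i) \<Longrightarrow> u \<alpha> \<in> carrier K"
  by auto

lemma support_short:
  assumes "u \<in> carrier (word_space K c i)"
  obtains N where "{\<alpha>. u \<alpha> \<noteq> \<zero>\<^bsub>K\<^esub>} \<subseteq> short_words N"
proof -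
  have "finite (length ` {\<alpha>. u \<alpha> \<noteq> \<zero>\<^bsub>K\<^esub>})" using assms by auto
  then obtain N where "\<forall>m\<in>length ` {\<alpha>. u \<alpha> \<noteq> \<zero>\<^bsub>K\<^esub>}. m \<le> N"
    using finite_nat_set_iff_bounded_le by blast
  then show ?thesis using that[of N] by (auto simp: short_words_def)
qed

lemma short_words_mono: "M \<le> N \<Longrightarrow> short_words M \<subseteq> short_words N"
  by (auto simp: short_words_def)

text \<open>Reversing the words that index the components of \<open>u\<close> turns the form into that of
  \<open>monotone_form_nonneg\<close>.\<close>

lemma word_form_real:
  assumes u: "u \<in> carrier (word_space K c i)"
  shows "Im (ip (word_space K c i) u u) = 0" "0 \<le> Re (ip (word_space K c i) u u)"
proof -
  obtain N where N: "{\<alpha>. u \<alpha> \<noteq> \<zero>\<^bsub>K\<^esub>} \<subseteq> short_words N" using support_short[OF u] by blast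
  have bij: "bij_betw rev (short_words N :: 'd list set) (short_words N)"
    by (rule bij_betwI[where g = rev]) (auto simp: short_words_def)
  have "ip (word_space K c i) u u =
      (\<Sum>\<beta>\<in>short_words N. \<Sum>\<alpha>\<in>short_words N. ip K (c (rev \<beta> @ i # \<alpha>) (u \<alpha>)) (u \<beta>))"
    unfolding word_space_ip[OF Ks c u u finite_short_words N finite_short_words N] by (rule sum.swap)
  also have "\<dots> = (\<Sum>\<beta>\<in>short_words N. \<Sum>b\<in>short_words N. ip K (c (rev \<beta> @ i # rev b) (u (rev b))) (u \<beta>))"
    by (intro sum.cong refl sum.reindex_bij_betw[OF bij, symmetric])
  also have "\<dots> = (\<Sum>a\<in>short_words N. \<Sum>b\<in>short_words N. ip K (c (rev (rev a) @ i # rev b) (u (rev b))) (u (rev a)))"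
    by (rule sum.reindex_bij_betw[OF bij, symmetric])
  finally have eq: "ip (word_space K c i) u u =
      (\<Sum>a\<in>short_words N. \<Sum>b\<in>short_words N. ip K (c (a @ i # rev b) (u (rev b))) (u (rev a)))"
    by (simp only: rev_rev_ident)
  show "Im (ip (word_space K c i) u u) = 0" "0 \<le> Re (ip (word_space K c i) u u)"
    unfolding eq
    by (rule monotone_form_nonneg[OF K c series radius mono], rule word_space_value[OF u])+
qed

lemma word_space_closed:
  assumes u: "u \<in> carrier (word_space K c i)" and w: "w \<in> carrier (word_space K c i)"
  shows "u \<oplus>\<^bsub>word_space K c i\<^esub> w \<in> carrier (word_space K c i)"
    and "a \<odot>\<^bsub>word_space K c i\<^esub> u \<in> carrier (word_space K c i)"
proof -
  have "finite ({\<alpha>. u \<alpha> \<noteq> \<zero>\<^bsub>K\<^esub>} \<union> {\<alpha>. w \<alpha> \<noteq> \<zero>\<^bsub>K\<^esub>})" using u w by simp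
  moreover have "{\<alpha>. u \<alpha> \<oplus>\<^bsub>K\<^esub> w \<alpha> \<noteq> \<zero>\<^bsub>K\<^esub>} \<subseteq> {\<alpha>. u \<alpha> \<noteq> \<zero>\<^bsub>K\<^esub>} \<union> {\<alpha>. w \<alpha> \<noteq> \<zero>\<^bsub>K\<^esub>}" by auto
  ultimately have "finite {\<alpha>. u \<alpha> \<oplus>\<^bsub>K\<^esub> w \<alpha> \<noteq> \<zero>\<^bsub>K\<^esub>}" by (rule finite_subset[rotated])
  then show "u \<oplus>\<^bsub>word_space K c i\<^esub> w \<in> carrier (word_space K c i)"
    using word_space_value[OF u] word_space_value[OF w] by auto
  have "{\<alpha>. a \<odot>\<^bsub>K\<^esub> u \<alpha> \<noteq> \<zero>\<^bsub>K\<^esub>} \<subseteq> {\<alpha>. u \<alpha> \<noteq> \<zero>\<^bsub>K\<^esub>}" by auto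
  then have "finite {\<alpha>. a \<odot>\<^bsub>K\<^esub> u \<alpha> \<noteq> \<zero>\<^bsub>K\<^esub>}" by (rule finite_subset) (use u in simp)
  then show "a \<odot>\<^bsub>word_space K c i\<^esub> u \<in> carrier (word_space K c i)"
    using word_space_value[OF u] by auto
qed

lemma common_support:
  assumes "u \<in> carrier (word_space K c i)" "w \<in> carrier (word_space K c i)" "z \<in> carrier (word_space K c i)"
  obtains N where "{\<alpha>. u \<alpha> \<noteq> \<zero>\<^bsub>K\<^esub>} \<subseteq> short_words N" "{\<alpha>. w \<alpha> \<noteq> \<zero>\<^bsub>K\<^esub>} \<subseteq> short_words N"
    "{\<alpha>. z \<alpha> \<noteq> \<zero>\<^bsub>K\<^esub>} \<subseteq> short_words N"
proof -
  obtain M1 where 1: "{\<alpha>. u \<alpha> \<noteq> \<zero>\<^bsub>K\<^esub>} \<subseteq> short_words M1" using support_short[OF assms(1)] by blast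
  obtain M2 where 2: "{\<alpha>. w \<alpha> \<noteq> \<zero>\<^bsub>K\<^esub>} \<subseteq> short_words M2" using support_short[OF assms(2)] by blast
  obtain M3 where 3: "{\<alpha>. z \<alpha> \<noteq> \<zero>\<^bsub>K\<^esub>} \<subseteq> short_words M3" using support_short[OF assms(3)] by blast
  let ?N = "max M1 (max M2 M3)"
  have "short_words M1 \<subseteq> short_words ?N" "short_words M2 \<subseteq> short_words ?N" "short_words M3 \<subseteq> short_words ?N"
    by (intro short_words_mono; simp)+
  then show ?thesis using that[of ?N] 1 2 3 by blast
qed

lemma word_form_add:
  assumes u: "u \<in> carrier (word_space K c i)" and w: "w \<in> carrier (word_space K c i)"
    and z: "z \<in> carrier (word_space K c i)"
  shows "ip (word_space K c i) (u \<oplus>\<^bsub>word_space K c i\<^esub> w) z = ip (word_space K c i) u z + ip (word_space K c i) w z"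
    and "ip (word_space K c i) z (u \<oplus>\<^bsub>word_space K c i\<^esub> w) = ip (word_space K c i) z u + ip (word_space K c i) z w"
proof -
  obtain N where N: "{\<alpha>. u \<alpha> \<noteq> \<zero>\<^bsub>K\<^esub>} \<subseteq> short_words N" "{\<alpha>. w \<alpha> \<noteq> \<zero>\<^bsub>K\<^esub>} \<subseteq> short_words N"
    "{\<alpha>. z \<alpha> \<noteq> \<zero>\<^bsub>K\<^esub>} \<subseteq> short_words N" by (rule common_support[OF u w z], rule that)
  have S: "{\<alpha>. (u \<oplus>\<^bsub>word_space K c i\<^esub> w) \<alpha> \<noteq> \<zero>\<^bsub>K\<^esub>} \<subseteq> short_words N"
  proof (rule subsetI, rule ccontr)
    fix \<alpha> assume m: "\<alpha> \<in> {\<alpha>. (u \<oplus>\<^bsub>word_space K c i\<^esub> w) \<alpha> \<noteq> \<zero>\<^bsub>K\<^esub>}" and "\<alpha> \<notin> short_words N"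
    then have "u \<alpha> = \<zero>\<^bsub>K\<^esub>" "w \<alpha> = \<zero>\<^bsub>K\<^esub>" using N(1,2) by blast+
    then show False using m by simp
  qed
  note v = word_space_value[OF u] word_space_value[OF w] word_space_value[OF z]
  note fin = finite_short_words[of N]
  show "ip (word_space K c i) (u \<oplus>\<^bsub>word_space K c i\<^esub> w) z = ip (word_space K c i) u z + ip (word_space K c i) w z"
    unfolding word_space_ip[OF Ks c word_space_closed(1)[OF u w] z fin S fin N(3)]
      word_space_ip[OF Ks c u z fin N(1) fin N(3)] word_space_ip[OF Ks c w z fin N(2) fin N(3)]
      sum.distrib[symmetric]
    by (intro sum.cong refl) (simp add: bounded_ops_add[OF c] K.ip_add bounded_ops_closed[OF c] v)
  show "ip (word_space K c i) z (u \<oplus>\<^bsub>word_space K c i\<^esub> w) = ip (word_space K c i) z u + ip (word_space K c i) z w"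
    unfolding word_space_ip[OF Ks c z word_space_closed(1)[OF u w] fin N(3) fin S]
      word_space_ip[OF Ks c z u fin N(3) fin N(1)] word_space_ip[OF Ks c z w fin N(3) fin N(2)]
      sum.distrib[symmetric]
    by (intro sum.cong refl) (simp add: K.ip_add_right bounded_ops_closed[OF c] v)
qed

lemma word_form_smult:
  assumes u: "u \<in> carrier (word_space K c i)" and z: "z \<in> carrier (word_space K c i)"
  shows "ip (word_space K c i) (a \<odot>\<^bsub>word_space K c i\<^esub> u) z = a * ip (word_space K c i) u z"
    and "ip (word_space K c i) z (a \<odot>\<^bsub>word_space K c i\<^esub> u) = cnj a * ip (word_space K c i) z u"
proof -
  obtain N where N: "{\<alpha>. u \<alpha> \<noteq> \<zero>\<^bsub>K\<^esub>} \<subseteq> short_words N"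
    "{\<alpha>. z \<alpha> \<noteq> \<zero>\<^bsub>K\<^esub>} \<subseteq> short_words N" by (rule common_support[OF u u z], rule that)
  have S: "{\<alpha>. (a \<odot>\<^bsub>word_space K c i\<^esub> u) \<alpha> \<noteq> \<zero>\<^bsub>K\<^esub>} \<subseteq> short_words N"
  proof (rule subsetI, rule ccontr)
    fix \<alpha> assume m: "\<alpha> \<in> {\<alpha>. (a \<odot>\<^bsub>word_space K c i\<^esub> u) \<alpha> \<noteq> \<zero>\<^bsub>K\<^esub>}" and "\<alpha> \<notin> short_words N"
    then have "u \<alpha> = \<zero>\<^bsub>K\<^esub>" using N(1) by blast
    then show False using m by simp
  qed
  note v = word_space_value[OF u] word_space_value[OF z]
  note fin = finite_short_words[of N]
  show "ip (word_space K c i) (a \<odot>\<^bsub>word_space K c i\<^esub> u) z = a * ip (word_space K c i) u z"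
    unfolding word_space_ip[OF Ks c word_space_closed(2)[OF u u] z fin S fin N(2)]
      word_space_ip[OF Ks c u z fin N(1) fin N(2)] sum_distrib_left
    by (intro sum.cong refl) (simp add: bounded_ops_smult[OF c] K.ip_smult bounded_ops_closed[OF c] v)
  show "ip (word_space K c i) z (a \<odot>\<^bsub>word_space K c i\<^esub> u) = cnj a * ip (word_space K c i) z u"
    unfolding word_space_ip[OF Ks c z word_space_closed(2)[OF u u] fin N(2) fin S]
      word_space_ip[OF Ks c z u fin N(2) fin N(1)] sum_distrib_left
    by (intro sum.cong refl) (simp add: K.ip_smult_right bounded_ops_closed[OF c] v)
qed

lemma semi_inner_space_word_space: "semi_inner_space (word_space K c i)"
proof (rule semi_inner_spaceI)
  fix u w assume u: "u \<in> carrier (word_space K c i)" and w: "w \<in> carrier (word_space K c i)"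
  note v = word_space_value[OF u] word_space_value[OF w]
  show "u \<oplus>\<^bsub>word_space K c i\<^esub> w \<in> carrier (word_space K c i)" by (rule word_space_closed(1)[OF u w])
  show "u \<oplus>\<^bsub>word_space K c i\<^esub> w = w \<oplus>\<^bsub>word_space K c i\<^esub> u" by (simp add: K.a_comm v)
  show "a \<odot>\<^bsub>word_space K c i\<^esub> (u \<oplus>\<^bsub>word_space K c i\<^esub> w) =
      a \<odot>\<^bsub>word_space K c i\<^esub> u \<oplus>\<^bsub>word_space K c i\<^esub> a \<odot>\<^bsub>word_space K c i\<^esub> w" for a
    by (simp add: K.scale_add_right v)
  show "ip (word_space K c i) w u = cnj (ip (word_space K c i) u w)"
  proof (rule sesquilinear_real_imp_hermitian)
    have iw: "\<i> \<odot>\<^bsub>word_space K c i\<^esub> w \<in> carrier (word_space K c i)" by (rule word_space_closed(2)[OF w w])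
    show "Im (ip (word_space K c i) u u + ip (word_space K c i) u w + ip (word_space K c i) w u + ip (word_space K c i) w w) = 0"
      using word_form_real(1)[OF word_space_closed(1)[OF u w]]
      unfolding word_form_add(1)[OF u w word_space_closed(1)[OF u w]] word_form_add(2)[OF u w u] word_form_add(2)[OF u w w]
      by (simp only: add.assoc)
    show "Im (ip (word_space K c i) u u - \<i> * ip (word_space K c i) u w + \<i> * ip (word_space K c i) w u + ip (word_space K c i) w w) = 0"
      using word_form_real(1)[OF word_space_closed(1)[OF u iw]]
      unfolding word_form_add(1)[OF u iw word_space_closed(1)[OF u iw]] word_form_add(2)[OF u iw u] word_form_add(2)[OF u iw iw]
        word_form_smult(1)[OF w u] word_form_smult(1)[OF w iw] word_form_smult(2)[OF w u] word_form_smult(2)[OF w w]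
      by simp
  qed (intro word_form_real u w)+
next
  fix u w z assume u: "u \<in> carrier (word_space K c i)" and w: "w \<in> carrier (word_space K c i)"
    and z: "z \<in> carrier (word_space K c i)"
  note v = word_space_value[OF u] word_space_value[OF w] word_space_value[OF z]
  show "u \<oplus>\<^bsub>word_space K c i\<^esub> w \<oplus>\<^bsub>word_space K c i\<^esub> z = u \<oplus>\<^bsub>word_space K c i\<^esub> (w \<oplus>\<^bsub>word_space K c i\<^esub> z)"
    by (simp add: K.a_assoc v)
  show "ip (word_space K c i) (u \<oplus>\<^bsub>word_space K c i\<^esub> w) z = ip (word_space K c i) u z + ip (word_space K c i) w z"
    by (rule word_form_add(1)[OF u w z])
next
  fix u assume u: "u \<in> carrier (word_space K c i)"
  note v = word_space_value[OF u]
  show "\<zero>\<^bsub>word_space K c i\<^esub> \<oplus>\<^bsub>word_space K c i\<^esub> u = u" by (simp add: v)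
  show "a \<odot>\<^bsub>word_space K c i\<^esub> u \<in> carrier (word_space K c i)" for a by (rule word_space_closed(2)[OF u u])
  show "(a + b) \<odot>\<^bsub>word_space K c i\<^esub> u = a \<odot>\<^bsub>word_space K c i\<^esub> u \<oplus>\<^bsub>word_space K c i\<^esub> b \<odot>\<^bsub>word_space K c i\<^esub> u" for a b
    by (simp add: K.scale_add_left v)
  show "(a * b) \<odot>\<^bsub>word_space K c i\<^esub> u = a \<odot>\<^bsub>word_space K c i\<^esub> (b \<odot>\<^bsub>word_space K c i\<^esub> u)" for a b
    by (simp add: K.scale_scale v)
  show "1 \<odot>\<^bsub>word_space K c i\<^esub> u = u" by (simp add: v)
  show "0 \<odot>\<^bsub>word_space K c i\<^esub> u = \<zero>\<^bsub>word_space K c i\<^esub>" by (simp add: v)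
  show "0 \<le> Re (ip (word_space K c i) u u)" by (rule word_form_real(2)[OF u])
next
  show "ip (word_space K c i) (a \<odot>\<^bsub>word_space K c i\<^esub> u) z = a * ip (word_space K c i) u z"
    if "u \<in> carrier (word_space K c i)" "z \<in> carrier (word_space K c i)" for a u z
    by (rule word_form_smult(1)[OF that])
qed simp

end

section \<open>Norm bounds for symmetric operators\<close>

text \<open>Put \<open>a k = \<parallel>T\<^sup>k x\<parallel>\<close>. Symmetry and the Cauchy-Schwarz inequality give \<open>(a k)\<^sup>2 \<le> a (2 k) a 0\<close>. Iterated
  along powers of two this says that \<open>a (2 ^ m) / a 0\<close> is at least the \<open>2 ^ m\<close>-th power of
  \<open>a 1 / a 0\<close>, while the hypothesis bounds \<open>a (2 ^ m)\<close> by a constant times the same power of \<open>\<rho>\<close>. So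
  \<open>a 1 / a 0\<close> cannot exceed \<open>\<rho>\<close>. The point is that \<open>T\<close> is not known to be bounded beforehand.\<close>

lemma (in semi_inner_space) symmetric_power_bound:
  assumes T: "\<And>x. x \<in> carrier H \<Longrightarrow> T x \<in> carrier H"
    and sym: "\<And>x y. x \<in> carrier H \<Longrightarrow> y \<in> carrier H \<Longrightarrow> ip H (T x) y = ip H x (T y)"
    and x: "x \<in> carrier H" and \<rho>: "0 < \<rho>"
    and bound: "\<And>m. cmod (ip H ((T ^^ m) x) x) \<le> C * \<rho> ^ m"
  shows "hnorm H (T x) \<le> \<rho> * hnorm H x"
proof -
  define a where "a k = hnorm H ((T ^^ k) x)" for k
  have Tk: "(T ^^ k) y \<in> carrier H" if "y \<in> carrier H" for k y using that by (induction k) (auto simp: T)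
  have a0: "0 \<le> a k" for k unfolding a_def by (rule hnorm_nonneg[OF Tk[OF x]])
  have symk: "ip H ((T ^^ k) y) z = ip H y ((T ^^ k) z)" if "y \<in> carrier H" "z \<in> carrier H" for k y z
    using that
  proof (induction k arbitrary: z)
    case (Suc k)
    have "ip H ((T ^^ Suc k) y) z = ip H ((T ^^ k) y) (T z)"
      using sym[OF Tk[OF Suc.prems(1)] Suc.prems(2)] by simp
    also have "\<dots> = ip H y ((T ^^ k) (T z))" by (rule Suc.IH[OF Suc.prems(1) T[OF Suc.prems(2)]])
    finally show ?case by (simp add: funpow_swap1)
  qed simp
  have sq: "complex_of_real ((a k)\<^sup>2) = ip H ((T ^^ (k + k)) x) x" for k
  proof -
    have "ip H ((T ^^ (k + k)) x) x = ip H ((T ^^ k) x) ((T ^^ k) x)"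
      using symk[OF Tk[OF x] x, of k k] by (simp add: funpow_add)
    then show ?thesis unfolding a_def by (simp only: ip_self[OF Tk[OF x]])
  qed
  have sq_bound: "(a k)\<^sup>2 \<le> C * \<rho> ^ (k + k)" for k
  proof -
    have "cmod (complex_of_real ((a k)\<^sup>2)) \<le> C * \<rho> ^ (k + k)" unfolding sq by (rule bound)
    then show ?thesis by (simp only: norm_of_real abs_power2)
  qed
  have sq_cs: "(a k)\<^sup>2 \<le> a (k + k) * a 0" for k
  proof -
    have "cmod (complex_of_real ((a k)\<^sup>2)) \<le> a (k + k) * a 0"
      unfolding sq unfolding a_def using cauchy_schwarz[OF Tk[OF x, of "k + k"] x] by (simp only: funpow_0)
    then show ?thesis by (simp only: norm_of_real abs_power2)
  qed
  have doubling: "a 1 ^ 2 ^ m \<le> a (2 ^ m) * a 0 ^ (2 ^ m - 1)" for m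
  proof (induction m)
    case (Suc m)
    have p: "(2::nat) ^ Suc m - 1 = 1 + 2 * (2 ^ m - 1)"
    proof -
      have "(1::nat) \<le> 2 ^ m" by simp
      then show ?thesis by (simp only: power_Suc)
    qed
    have "a 1 ^ 2 ^ Suc m = (a 1 ^ 2 ^ m)\<^sup>2" by (simp add: power_mult[symmetric] mult.commute)
    also have "\<dots> \<le> (a (2 ^ m) * a 0 ^ (2 ^ m - 1))\<^sup>2" by (rule power_mono[OF Suc]) (simp add: a0)
    also have "\<dots> = (a (2 ^ m))\<^sup>2 * a 0 ^ (2 * (2 ^ m - 1))"
      by (simp add: power_mult_distrib power_mult[symmetric] mult.commute)
    also have "\<dots> \<le> (a (2 ^ m + 2 ^ m) * a 0) * a 0 ^ (2 * (2 ^ m - 1))"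
      by (rule mult_right_mono[OF sq_cs]) (simp add: a0)
    also have "\<dots> = a (2 ^ Suc m) * a 0 ^ (2 ^ Suc m - 1)"
      unfolding p by (simp add: mult_2[symmetric])
    finally show ?case .
  qed simp
  have "a 1 \<le> \<rho> * a 0"
  proof (cases "a 0 = 0")
    case True
    then have "(a 1)\<^sup>2 \<le> 0" using sq_cs[of 1] by simp
    then show ?thesis using True by simp
  next
    case False
    then have pos: "0 < a 0" using a0[of 0] by simp
    show ?thesis
    proof (rule ccontr)
      assume "\<not> a 1 \<le> \<rho> * a 0"
      then have q: "1 < a 1 / (\<rho> * a 0)" using pos \<rho> by (simp add: pos_less_divide_eq)
      have C0: "0 \<le> C" using order_trans[OF norm_ge_zero bound[of 0]] by simp
      have "(a 1 / (\<rho> * a 0)) ^ m \<le> sqrt C / a 0" for m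
      proof -
        have am: "a (2 ^ m) \<le> sqrt C * \<rho> ^ 2 ^ m"
        proof (rule power2_le_imp_le)
          show "(a (2 ^ m))\<^sup>2 \<le> (sqrt C * \<rho> ^ 2 ^ m)\<^sup>2"
            using sq_bound[of "2 ^ m"] C0
            by (simp only: power_mult_distrib real_sqrt_pow2 power_add power2_eq_square[of "\<rho> ^ 2 ^ m"])
        qed (use C0 \<rho> in simp)
        have e: "a 0 ^ 2 ^ m = a 0 * a 0 ^ (2 ^ m - 1)"
          by (metis power_eq_if power_not_zero zero_neq_numeral)
        have "m \<le> 2 ^ m" by (rule less_imp_le[OF less_exp])
        then have "(a 1 / (\<rho> * a 0)) ^ m \<le> (a 1 / (\<rho> * a 0)) ^ 2 ^ m" using q by (intro power_increasing) auto
        also have "\<dots> = a 1 ^ 2 ^ m / (\<rho> ^ 2 ^ m * a 0 ^ 2 ^ m)"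
          by (simp add: power_divide power_mult_distrib)
        also have "\<dots> \<le> ((sqrt C * \<rho> ^ 2 ^ m) * a 0 ^ (2 ^ m - 1)) / (\<rho> ^ 2 ^ m * a 0 ^ 2 ^ m)"
        proof (rule divide_right_mono)
          show "a 1 ^ 2 ^ m \<le> (sqrt C * \<rho> ^ 2 ^ m) * a 0 ^ (2 ^ m - 1)"
            by (rule order_trans[OF doubling mult_right_mono[OF am]]) (simp add: a0)
        qed (use pos \<rho> in simp)
        also have "\<dots> = sqrt C / a 0" unfolding e using pos \<rho> by simp
        finally show ?thesis .
      qed
      moreover obtain m where "sqrt C / a 0 < (a 1 / (\<rho> * a 0)) ^ m" using real_arch_pow[OF q] by blast
      ultimately show False by (simp add: not_less[symmetric])
    qed
  qed
  then show ?thesis by (simp add: a_def)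
qed

section \<open>The shift on the direct sum of the word spaces\<close>

lemma sum_short_words_Suc:
  "(\<Sum>\<beta>\<in>short_words (Suc N). g \<beta>) = g [] + (\<Sum>i\<in>UNIV. \<Sum>\<alpha>\<in>short_words N. g (i # \<alpha>))"
  for g :: "'d::finite list \<Rightarrow> 'b::comm_monoid_add"
proof -
  let ?C = "\<lambda>(i, \<alpha>). i # \<alpha>"
  have eq: "(short_words (Suc N) :: 'd list set) = insert [] (?C ` (UNIV \<times> short_words N))"
  proof (intro equalityI subsetI)
    fix \<beta> :: "'d list" assume "\<beta> \<in> short_words (Suc N)"
    then show "\<beta> \<in> insert [] (?C ` (UNIV \<times> short_words N))"
      by (cases \<beta>) (auto simp: short_words_def image_iff)
  qed (auto simp: short_words_def)
  have "(\<Sum>\<beta>\<in>short_words (Suc N). g \<beta>) = g [] + (\<Sum>\<beta>\<in>?C ` (UNIV \<times> short_words N). g \<beta>)"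
    unfolding eq by (rule sum.insert) auto
  also have "(\<Sum>\<beta>\<in>?C ` (UNIV \<times> short_words N). g \<beta>) = (\<Sum>p\<in>UNIV \<times> short_words N. g (?C p))"
    by (rule sum.reindex[unfolded comp_def]) (auto simp: inj_on_def)
  also have "\<dots> = (\<Sum>i\<in>UNIV. \<Sum>\<alpha>\<in>short_words N. g (i # \<alpha>))"
    by (simp add: sum.cartesian_product case_prod_beta)
  finally show ?thesis .
qed

context monotone_series
begin

abbreviation W :: "('d \<Rightarrow> 'd list \<Rightarrow> 'k) hspace" where
  "W \<equiv> hsum UNIV (word_space K c)"

lemma Ws: "semi_inner_space W"
  by (rule semi_inner_space_hsum) (rule semi_inner_space_word_space)

sublocale W: semi_inner_space W by (rule Ws)

lemma W_iff: "u \<in> carrier W \<longleftrightarrow> (\<forall>i. u i \<in> carrier (word_space K c i))"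
  unfolding hsum_simps by (simp only: PiE_UNIV_domain Pi_iff UNIV_I) simp

lemma W_component: "u \<in> carrier W \<Longrightarrow> u i \<in> carrier (word_space K c i)"
  by (simp only: W_iff)

lemma W_value: "u \<in> carrier W \<Longrightarrow> u i \<alpha> \<in> carrier K"
  by (rule word_space_value[OF W_component])

lemma W_add: "(u \<oplus>\<^bsub>W\<^esub> w) i \<alpha> = u i \<alpha> \<oplus>\<^bsub>K\<^esub> w i \<alpha>"
  and W_smult: "(a \<odot>\<^bsub>W\<^esub> u) i \<alpha> = a \<odot>\<^bsub>K\<^esub> u i \<alpha>"
  and W_zero: "\<zero>\<^bsub>W\<^esub> i \<alpha> = \<zero>\<^bsub>K\<^esub>"
  by simp_all

lemma W_support:
  assumes u: "u \<in> carrier W"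
  obtains N where "\<And>i. {\<alpha>. u i \<alpha> \<noteq> \<zero>\<^bsub>K\<^esub>} \<subseteq> short_words N"
proof -
  have "\<exists>N. \<forall>i. {\<alpha>. u i \<alpha> \<noteq> \<zero>\<^bsub>K\<^esub>} \<subseteq> short_words (N i)"
  proof (intro choice allI)
    fix i
    obtain N where "{\<alpha>. u i \<alpha> \<noteq> \<zero>\<^bsub>K\<^esub>} \<subseteq> short_words N" by (rule support_short[OF W_component[OF u]])
    then show "\<exists>N. {\<alpha>. u i \<alpha> \<noteq> \<zero>\<^bsub>K\<^esub>} \<subseteq> short_words N" by (rule exI)
  qed
  then obtain N :: "'d \<Rightarrow> nat" where N: "\<And>i. {\<alpha>. u i \<alpha> \<noteq> \<zero>\<^bsub>K\<^esub>} \<subseteq> short_words (N i)" by blast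
  show ?thesis
  proof (rule that[of "Max (range N)"])
    fix i
    have "short_words (N i) \<subseteq> short_words (Max (range N))" by (intro short_words_mono Max_ge) auto
    with N[of i] show "{\<alpha>. u i \<alpha> \<noteq> \<zero>\<^bsub>K\<^esub>} \<subseteq> short_words (Max (range N))" by (rule order_trans)
  qed
qed

lemma W_ip:
  assumes u: "u \<in> carrier W" and w: "w \<in> carrier W"
    and M: "\<And>i. {\<alpha>. u i \<alpha> \<noteq> \<zero>\<^bsub>K\<^esub>} \<subseteq> short_words M" and N: "\<And>i. {\<alpha>. w i \<alpha> \<noteq> \<zero>\<^bsub>K\<^esub>} \<subseteq> short_words N"
  shows "ip W u w = (\<Sum>i\<in>UNIV. \<Sum>\<alpha>\<in>short_words M. \<Sum>\<beta>\<in>short_words N. ip K (c (rev \<beta> @ i # \<alpha>) (u i \<alpha>)) (w i \<beta>))"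
  unfolding hsum_simps
  by (intro sum.cong refl word_space_ip[OF Ks c W_component[OF u] W_component[OF w] finite_short_words M finite_short_words N])

text \<open>The operator \<open>A\<close> before completion: it prepends \<open>i\<close> to the words of the \<open>i\<close>-th component and copies the
  result into every component, so its value does not depend on \<open>j\<close>.\<close>

definition shift :: "('d \<Rightarrow> 'd list \<Rightarrow> 'k) \<Rightarrow> 'd \<Rightarrow> 'd list \<Rightarrow> 'k" where
  "shift u j \<beta> = (case \<beta> of [] \<Rightarrow> \<zero>\<^bsub>K\<^esub> | i # \<alpha> \<Rightarrow> u i \<alpha>)"

lemma shift_simps [simp]: "shift u j [] = \<zero>\<^bsub>K\<^esub>" "shift u j (i # \<alpha>) = u i \<alpha>"
  by (simp_all add: shift_def)

lemma shift_support:
  assumes N: "\<And>i. {\<alpha>. u i \<alpha> \<noteq> \<zero>\<^bsub>K\<^esub>} \<subseteq> short_words N"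
  shows "{\<beta>. shift u j \<beta> \<noteq> \<zero>\<^bsub>K\<^esub>} \<subseteq> short_words (Suc N)"
proof
  fix \<beta> assume b: "\<beta> \<in> {\<beta>. shift u j \<beta> \<noteq> \<zero>\<^bsub>K\<^esub>}"
  show "\<beta> \<in> short_words (Suc N)"
  proof (cases \<beta>)
    case (Cons i \<alpha>)
    then have "\<alpha> \<in> short_words N" using b N[of i] by auto
    then show ?thesis by (simp add: Cons short_words_def)
  qed (simp add: short_words_def)
qed

lemma W_I:
  assumes "\<And>i \<alpha>. u i \<alpha> \<in> carrier K" and N: "\<And>i. {\<alpha>. u i \<alpha> \<noteq> \<zero>\<^bsub>K\<^esub>} \<subseteq> short_words N"
  shows "u \<in> carrier W"
  unfolding W_iff word_space_simps
  using assms(1) finite_subset[OF N finite_short_words] by auto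

lemma shift_closed:
  assumes u: "u \<in> carrier W"
  shows "shift u \<in> carrier W"
proof -
  obtain N where N: "\<And>i. {\<alpha>. u i \<alpha> \<noteq> \<zero>\<^bsub>K\<^esub>} \<subseteq> short_words N" using W_support[OF u] by blast
  show ?thesis
  proof (rule W_I[OF _ shift_support[OF N]])
    show "shift u i \<alpha> \<in> carrier K" for i \<alpha> by (cases \<alpha>) (simp_all add: W_value[OF u])
  qed
qed

lemma shift_add: "shift (u \<oplus>\<^bsub>W\<^esub> w) = shift u \<oplus>\<^bsub>W\<^esub> shift w"
proof (intro ext)
  show "shift (u \<oplus>\<^bsub>W\<^esub> w) j \<beta> = (shift u \<oplus>\<^bsub>W\<^esub> shift w) j \<beta>" for j \<beta>
    unfolding W_add by (cases \<beta>) (simp_all only: shift_simps W_add, simp)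
qed

lemma shift_smult: "shift (a \<odot>\<^bsub>W\<^esub> u) = a \<odot>\<^bsub>W\<^esub> shift u"
proof (intro ext)
  show "shift (a \<odot>\<^bsub>W\<^esub> u) j \<beta> = (a \<odot>\<^bsub>W\<^esub> shift u) j \<beta>" for j \<beta>
    unfolding W_smult by (cases \<beta>) (simp_all only: shift_simps W_smult, simp)
qed

text \<open>The word \<open>rev \<gamma> @ j # i # \<alpha>\<close> arises on the left from \<open>i # \<alpha>\<close>, \<open>\<gamma>\<close> and the form of \<open>j\<close>, and on the right
  from \<open>\<alpha>\<close>, \<open>j # \<gamma>\<close> and the form of \<open>i\<close>.\<close>

lemma shift_symmetric:
  assumes u: "u \<in> carrier W" and w: "w \<in> carrier W"
  shows "ip W (shift u) w = ip W u (shift w)"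
proof -
  obtain M where M: "\<And>i. {\<alpha>. u i \<alpha> \<noteq> \<zero>\<^bsub>K\<^esub>} \<subseteq> short_words M" using W_support[OF u] by blast
  obtain N where N: "\<And>i. {\<alpha>. w i \<alpha> \<noteq> \<zero>\<^bsub>K\<^esub>} \<subseteq> short_words N" using W_support[OF w] by blast
  let ?g = "\<lambda>j i \<alpha> \<gamma>. ip K (c (rev \<gamma> @ j # i # \<alpha>) (u i \<alpha>)) (w j \<gamma>)"
  have "ip W (shift u) w = (\<Sum>j\<in>UNIV. \<Sum>i\<in>UNIV. \<Sum>\<alpha>\<in>short_words M. \<Sum>\<gamma>\<in>short_words N. ?g j i \<alpha> \<gamma>)"
    unfolding W_ip[OF shift_closed[OF u] w shift_support[OF M] N] sum_short_words_Suc
    by (intro sum.cong refl) (simp add: bounded_ops_zero[OF c Ks Ks] W_value[OF w])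
  also have "\<dots> = (\<Sum>i\<in>UNIV. \<Sum>j\<in>UNIV. \<Sum>\<alpha>\<in>short_words M. \<Sum>\<gamma>\<in>short_words N. ?g j i \<alpha> \<gamma>)"
    by (rule sum.swap)
  also have "\<dots> = (\<Sum>i\<in>UNIV. \<Sum>\<alpha>\<in>short_words M. \<Sum>j\<in>UNIV. \<Sum>\<gamma>\<in>short_words N. ?g j i \<alpha> \<gamma>)"
    by (intro sum.cong refl sum.swap)
  also have "\<dots> = ip W u (shift w)"
    unfolding W_ip[OF u shift_closed[OF w] M shift_support[OF N]] sum_short_words_Suc
    by (intro sum.cong refl) (simp add: bounded_ops_closed[OF c] W_value[OF u])
  finally show ?thesis .
qed

lemma shift_power:
  "(shift ^^ Suc m) u j \<beta> = (if length \<beta> \<le> m then \<zero>\<^bsub>K\<^esub> else u (\<beta> ! m) (drop (Suc m) \<beta>))"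
proof (induction m arbitrary: j \<beta>)
  case 0
  show ?case by (cases \<beta>) simp_all
next
  case (Suc m)
  show ?case
  proof (cases \<beta>)
    case (Cons i \<alpha>)
    have "(shift ^^ Suc (Suc m)) u j \<beta> = (shift ^^ Suc m) u i \<alpha>" by (simp add: Cons)
    also have "\<dots> = (if length \<alpha> \<le> m then \<zero>\<^bsub>K\<^esub> else u (\<alpha> ! m) (drop (Suc m) \<alpha>))" by (rule Suc.IH)
    finally show ?thesis by (simp add: Cons)
  qed simp
qed

lemma shift_power_support:
  assumes N: "\<And>i. {\<alpha>. u i \<alpha> \<noteq> \<zero>\<^bsub>K\<^esub>} \<subseteq> short_words N"
  shows "{\<beta>. (shift ^^ m) u j \<beta> \<noteq> \<zero>\<^bsub>K\<^esub>} \<subseteq> short_words (N + m)"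
proof (induction m arbitrary: j)
  case (Suc m)
  show ?case using shift_support[OF Suc.IH] by simp
qed (use N in simp)

text \<open>The words occurring in the form have length greater than \<open>m\<close>, so their coefficients are at most
  \<open>(1 / s) ^ m\<close> times the terms of the convergent series \<open>\<Sum>w. \<parallel>c w\<parallel> s ^ length w\<close>. For fixed \<open>\<gamma>\<close> and \<open>j\<close>
  different \<open>\<beta>\<close> give different words \<open>rev \<gamma> @ j # \<beta>\<close>, so the sum over \<open>\<beta>\<close> does not exceed that of the series.\<close>

lemma shift_power_form_bound:
  assumes u: "u \<in> carrier W" and s: "1 < s" "s < r"
  obtains C where "\<And>m. cmod (ip W ((shift ^^ m) u) u) \<le> C * (1 / s) ^ m"
proof -
  obtain N where N: "\<And>i. {\<alpha>. u i \<alpha> \<noteq> \<zero>\<^bsub>K\<^esub>} \<subseteq> short_words N" using W_support[OF u] by blast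
  let ?S = "short_words N :: 'd list set"
  define U where "U = (\<Sum>i\<in>UNIV. \<Sum>\<alpha>\<in>?S. hnorm K (u i \<alpha>))"
  note uv = W_value[OF u]
  have U0: "0 \<le> U" unfolding U_def by (intro sum_nonneg K.hnorm_nonneg uv)
  have U: "hnorm K (u i \<alpha>) \<le> U" for i \<alpha>
  proof (cases "\<alpha> \<in> ?S")
    case True
    have "hnorm K (u i \<alpha>) \<le> (\<Sum>\<alpha>\<in>?S. hnorm K (u i \<alpha>))"
      by (rule member_le_sum[OF True]) (simp_all add: uv)
    also have "\<dots> \<le> U" unfolding U_def
      by (rule member_le_sum[of i UNIV "\<lambda>i. \<Sum>\<alpha>\<in>?S. hnorm K (u i \<alpha>)"]) (simp_all add: sum_nonneg uv)
    finally show ?thesis .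
  next
    case False
    then have "u i \<alpha> = \<zero>\<^bsub>K\<^esub>" using N[of i] by blast
    then show ?thesis using U0 by simp
  qed
  define g where "g w = opnorm K K (c w) * s ^ length w" for w
  have g0: "0 \<le> g w" for w unfolding g_def using bounded_ops_opnorm_nonneg[OF c Ks] s by simp
  have "g summable_on UNIV" unfolding g_def by (rule coefficient_norms_summable[OF K c series]) (use s in auto)
  then obtain G where G: "(g has_sum G) UNIV" by (auto simp: summable_on_def)
  have gsum: "(\<Sum>\<beta>\<in>short_words M. g (rev \<gamma> @ j # \<beta>)) \<le> G" for M j \<gamma>
  proof -
    have "(\<Sum>\<beta>\<in>short_words M. g (rev \<gamma> @ j # \<beta>)) = (\<Sum>w\<in>(\<lambda>\<beta>. rev \<gamma> @ j # \<beta>) ` short_words M. g w)"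
      by (subst sum.reindex) (auto simp: inj_on_def)
    also have "\<dots> \<le> G" by (rule finite_sum_le_has_sum[OF G]) (auto simp: g0)
    finally show ?thesis .
  qed
  show ?thesis
  proof (rule that[of "(\<Sum>j\<in>(UNIV::'d set). \<Sum>\<gamma>\<in>?S. G) * U\<^sup>2"])
    fix m
    let ?x = "(shift ^^ m) u"
    have xc: "?x \<in> carrier W" by (induction m) (simp_all only: funpow.simps id_apply comp_apply u shift_closed)
    note xv = W_value[OF xc]
    \<comment> \<open>Only words with at least \<open>m\<close> letters carry a nonzero value after \<open>m\<close> shifts.\<close>
    have x0: "?x j \<beta> = \<zero>\<^bsub>K\<^esub>" if "length \<beta> < m" for j \<beta>
      using that shift_power[of "m - 1" u j \<beta>] by (cases m) auto
    have xU: "hnorm K (?x j \<beta>) \<le> U" for j \<beta>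
    proof (cases m)
      case 0
      then show ?thesis by (simp add: U)
    next
      case (Suc k)
      show ?thesis unfolding Suc shift_power using U U0 by simp
    qed
    have entry: "cmod (ip K (c (rev \<gamma> @ j # \<beta>) (?x j \<beta>)) (u j \<gamma>)) \<le> g (rev \<gamma> @ j # \<beta>) * ((1 / s) ^ m * U\<^sup>2)" for j \<beta> \<gamma>
    proof (cases "length \<beta> < m")
      case True
      show ?thesis unfolding x0[OF True] bounded_ops_zero[OF c Ks Ks]
        using g0[of "rev \<gamma> @ j # \<beta>"] s by (simp add: uv)
    next
      case False
      let ?w = "rev \<gamma> @ j # \<beta>"
      have "cmod (ip K (c ?w (?x j \<beta>)) (u j \<gamma>)) \<le> hnorm K (c ?w (?x j \<beta>)) * hnorm K (u j \<gamma>)"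
        by (intro K.cauchy_schwarz bounded_ops_closed[OF c] xv uv)
      also have "\<dots> \<le> (opnorm K K (c ?w) * U) * U"
      proof (intro mult_mono U K.hnorm_nonneg uv mult_nonneg_nonneg U0 bounded_ops_opnorm_nonneg[OF c Ks])
        show "hnorm K (c ?w (?x j \<beta>)) \<le> opnorm K K (c ?w) * U"
          by (rule order_trans[OF bounded_ops_opnorm[OF c Ks xv] mult_left_mono[OF xU bounded_ops_opnorm_nonneg[OF c Ks]]])
      qed
      also have "\<dots> = opnorm K K (c ?w) * 1 * U\<^sup>2" by (simp add: power2_eq_square)
      also have "\<dots> \<le> opnorm K K (c ?w) * (s ^ length ?w * (1 / s) ^ m) * U\<^sup>2"
      proof (intro mult_right_mono mult_left_mono bounded_ops_opnorm_nonneg[OF c Ks])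
        have "s ^ m \<le> s ^ length ?w" using False s by (intro power_increasing) auto
        then show "1 \<le> s ^ length ?w * (1 / s) ^ m" using s by (simp add: power_divide)
      qed simp
      also have "\<dots> = g ?w * ((1 / s) ^ m * U\<^sup>2)" by (simp only: g_def mult_ac)
      finally show ?thesis .
    qed
    have p0: "0 \<le> (1 / s) ^ m * U\<^sup>2" using s by simp
    have "ip W ?x u = (\<Sum>j\<in>UNIV. \<Sum>\<gamma>\<in>?S. \<Sum>\<beta>\<in>short_words (N + m). ip K (c (rev \<gamma> @ j # \<beta>) (?x j \<beta>)) (u j \<gamma>))"
      unfolding W_ip[OF xc u shift_power_support[OF N] N] by (intro sum.cong refl sum.swap)
    also have "cmod \<dots> \<le> (\<Sum>j\<in>UNIV. cmod (\<Sum>\<gamma>\<in>?S. \<Sum>\<beta>\<in>short_words (N + m). ip K (c (rev \<gamma> @ j # \<beta>) (?x j \<beta>)) (u j \<gamma>)))"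
      by (rule norm_sum)
    also have "\<dots> \<le> (\<Sum>j\<in>(UNIV::'d set). \<Sum>\<gamma>\<in>?S. G * ((1 / s) ^ m * U\<^sup>2))"
    proof (rule sum_mono, rule order_trans[OF norm_sum], rule sum_mono)
      fix j \<gamma>
      have "cmod (\<Sum>\<beta>\<in>short_words (N + m). ip K (c (rev \<gamma> @ j # \<beta>) (?x j \<beta>)) (u j \<gamma>)) \<le>
          (\<Sum>\<beta>\<in>short_words (N + m). g (rev \<gamma> @ j # \<beta>) * ((1 / s) ^ m * U\<^sup>2))"
        by (rule order_trans[OF norm_sum], rule sum_mono) (rule entry)
      also have "\<dots> \<le> G * ((1 / s) ^ m * U\<^sup>2)"
        unfolding sum_distrib_right[symmetric] by (rule mult_right_mono[OF gsum p0])
      finally show "cmod (\<Sum>\<beta>\<in>short_words (N + m). ip K (c (rev \<gamma> @ j # \<beta>) (?x j \<beta>)) (u j \<gamma>)) \<le> G * ((1 / s) ^ m * U\<^sup>2)" .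
    qed
    also have "\<dots> = (\<Sum>j\<in>(UNIV::'d set). \<Sum>\<gamma>\<in>?S. G) * U\<^sup>2 * (1 / s) ^ m"
      unfolding sum_distrib_right[symmetric] by (simp only: mult_ac)
    finally show "cmod (ip W ?x u) \<le> (\<Sum>j\<in>(UNIV::'d set). \<Sum>\<gamma>\<in>?S. G) * U\<^sup>2 * (1 / s) ^ m" .
  qed
qed

lemma shift_contraction:
  assumes u: "u \<in> carrier W" and s: "1 < s" "s < r"
  shows "hnorm W (shift u) \<le> (1 / s) * hnorm W u"
proof -
  obtain C where C: "\<And>m. cmod (ip W ((shift ^^ m) u) u) \<le> C * (1 / s) ^ m"
    using shift_power_form_bound[OF u s] by blast
  have s0: "0 < 1 / s" using s by simp
  show ?thesis
    by (rule W.symmetric_power_bound[OF shift_closed shift_symmetric u s0 C])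
qed

end

section \<open>The realization space and the operator\<close>

context monotone_series
begin

abbreviation H where "H \<equiv> H_space K c"

lemma H_def: "H = hsum UNIV (H_comp K c)"
  by (simp add: H_space_def)

lemma hilbert_space_H_comp: "hilbert_space (H_comp K c i)"
  unfolding H_comp_def by (rule semi_inner_space.hilbert_space_hcompletion[OF semi_inner_space_word_space])

lemma semi_inner_space_H_comp: "semi_inner_space (H_comp K c i)"
  using hilbert_space_H_comp by (rule hilbert_space.axioms)

lemma hilbert_space_H: "hilbert_space H"
  unfolding H_def by (rule hilbert_space_hsum) (auto intro: hilbert_space_H_comp)

sublocale H: hilbert_space H by (rule hilbert_space_H)

lemma Hs: "semi_inner_space H" by (rule H.semi_inner_space_axioms)

lemma H_iff: "x \<in> carrier H \<longleftrightarrow> (\<forall>i. x i \<in> carrier (H_comp K c i))"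
  unfolding H_def hsum_simps by (simp only: PiE_UNIV_domain Pi_iff UNIV_I) simp

lemma H_component: "x \<in> carrier H \<Longrightarrow> x i \<in> carrier (H_comp K c i)"
  by (simp only: H_iff)

lemma H_add: "(x \<oplus>\<^bsub>H\<^esub> y) i = x i \<oplus>\<^bsub>H_comp K c i\<^esub> y i"
  and H_smult: "(a \<odot>\<^bsub>H\<^esub> x) i = a \<odot>\<^bsub>H_comp K c i\<^esub> x i"
  and H_ip: "ip H x y = (\<Sum>i\<in>UNIV. ip (H_comp K c i) (x i) (y i))"
  and H_zero: "\<zero>\<^bsub>H\<^esub> i = \<zero>\<^bsub>H_comp K c i\<^esub>"
  by (simp_all add: H_def)

lemma H_finsum: "finite A \<Longrightarrow> (\<And>a. a \<in> A \<Longrightarrow> g a \<in> carrier H) \<Longrightarrow>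
    finsum H g A i = finsum (H_comp K c i) (\<lambda>a. g a i) A"
  using hsum_finsum[of UNIV "H_comp K c" A g, OF semi_inner_space_H_comp] by (simp add: H_def)

definition emb :: "('d \<Rightarrow> 'd list \<Rightarrow> 'k) \<Rightarrow> 'd \<Rightarrow> (nat \<Rightarrow> 'd list \<Rightarrow> 'k) set" where
  "emb u = (\<lambda>i. hembed (word_space K c i) (u i))"

lemma emb_component: "u \<in> carrier (word_space K c i) \<Longrightarrow> hembed (word_space K c i) u \<in> carrier (H_comp K c i)"
  unfolding H_comp_def by (rule semi_inner_space.hembed_closed[OF semi_inner_space_word_space])

lemma emb_closed: "u \<in> carrier W \<Longrightarrow> emb u \<in> carrier H"
  unfolding H_iff emb_def by (intro allI emb_component W_component)

lemma emb_add:
  assumes u: "u \<in> carrier W" and w: "w \<in> carrier W"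
  shows "emb (u \<oplus>\<^bsub>W\<^esub> w) = emb u \<oplus>\<^bsub>H\<^esub> emb w"
proof
  fix i
  have "(u \<oplus>\<^bsub>W\<^esub> w) i = u i \<oplus>\<^bsub>word_space K c i\<^esub> w i" by (simp only: hsum_simps restrict_apply) simp
  then show "emb (u \<oplus>\<^bsub>W\<^esub> w) i = (emb u \<oplus>\<^bsub>H\<^esub> emb w) i"
    unfolding H_add unfolding emb_def H_comp_def
    by (simp only: semi_inner_space.hembed_add[OF semi_inner_space_word_space W_component[OF u] W_component[OF w]])
qed

lemma emb_smult:
  assumes u: "u \<in> carrier W"
  shows "emb (a \<odot>\<^bsub>W\<^esub> u) = a \<odot>\<^bsub>H\<^esub> emb u"
proof
  fix i
  have "(a \<odot>\<^bsub>W\<^esub> u) i = a \<odot>\<^bsub>word_space K c i\<^esub> u i" by (simp only: hsum_simps restrict_apply) simp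
  then show "emb (a \<odot>\<^bsub>W\<^esub> u) i = (a \<odot>\<^bsub>H\<^esub> emb u) i"
    unfolding H_smult unfolding emb_def H_comp_def
    by (simp only: semi_inner_space.hembed_smult[OF semi_inner_space_word_space W_component[OF u]])
qed

lemma emb_ip:
  assumes u: "u \<in> carrier W" and w: "w \<in> carrier W"
  shows "ip H (emb u) (emb w) = ip W u w"
  unfolding H_ip hsum_simps unfolding emb_def H_comp_def
  by (intro sum.cong refl semi_inner_space.hembed_ip[OF semi_inner_space_word_space] W_component u w)

lemma emb_hnorm: "u \<in> carrier W \<Longrightarrow> hnorm H (emb u) = hnorm W u"
  unfolding hnorm_def by (simp only: emb_ip)

lemma emb_dense:
  assumes x: "x \<in> carrier H" and e: "0 < (e::real)"
  shows "\<exists>u\<in>carrier W. hnorm H (x \<ominus>\<^bsub>H\<^esub> emb u) < e"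
proof -
  have "\<exists>u. \<forall>i. (\<forall>n::nat. u i n \<in> carrier (word_space K c i)) \<and>
      (\<lambda>n. hnorm (H_comp K c i) (hembed (word_space K c i) (u i n) \<ominus>\<^bsub>H_comp K c i\<^esub> x i)) \<longlonglongrightarrow> 0"
  proof (intro choice allI)
    fix i
    have dense: "\<exists>w\<in>carrier (word_space K c i). hnorm (H_comp K c i) (y \<ominus>\<^bsub>H_comp K c i\<^esub> hembed (word_space K c i) w) < d"
      if y: "y \<in> carrier (H_comp K c i)" and d: "0 < (d::real)" for y d
      using semi_inner_space.hembed_dense[OF semi_inner_space_word_space y[unfolded H_comp_def] d]
      unfolding H_comp_def by blast
    obtain u where "\<And>n::nat. u n \<in> carrier (word_space K c i)"
      "(\<lambda>n. hnorm (H_comp K c i) (hembed (word_space K c i) (u n) \<ominus>\<^bsub>H_comp K c i\<^esub> x i)) \<longlonglongrightarrow> 0"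
      using dense_sequence[OF dense semi_inner_space_H_comp emb_component H_component[OF x, of i]] by blast
    then show "\<exists>u. (\<forall>n::nat. u n \<in> carrier (word_space K c i)) \<and>
      (\<lambda>n. hnorm (H_comp K c i) (hembed (word_space K c i) (u n) \<ominus>\<^bsub>H_comp K c i\<^esub> x i)) \<longlonglongrightarrow> 0" by blast
  qed
  then obtain u where uc: "\<And>i (n::nat). u i n \<in> carrier (word_space K c i)"
    and ul: "\<And>i. (\<lambda>n. hnorm (H_comp K c i) (hembed (word_space K c i) (u i n) \<ominus>\<^bsub>H_comp K c i\<^esub> x i)) \<longlonglongrightarrow> 0"
    by blast
  let ?w = "\<lambda>n i. u i n"
  have wc: "?w n \<in> carrier W" for n unfolding W_iff using uc by blast
  have "(\<lambda>n. hnorm (hsum UNIV (H_comp K c)) (emb (?w n) \<ominus>\<^bsub>hsum UNIV (H_comp K c)\<^esub> x)) \<longlonglongrightarrow> 0"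
  proof (rule hsum_tendsto)
    show "emb (?w n) \<in> carrier (hsum UNIV (H_comp K c))" for n using emb_closed[OF wc] by (simp only: H_def)
    show "x \<in> carrier (hsum UNIV (H_comp K c))" using x by (simp only: H_def)
    show "(\<lambda>n. hnorm (H_comp K c i) (emb (?w n) i \<ominus>\<^bsub>H_comp K c i\<^esub> x i)) \<longlonglongrightarrow> 0" for i
      unfolding emb_def by (rule ul)
  qed (simp_all add: semi_inner_space_H_comp)
  then have lim: "(\<lambda>n. hnorm H (emb (?w n) \<ominus>\<^bsub>H\<^esub> x)) \<longlonglongrightarrow> 0" by (simp only: H_def)
  obtain n where "norm (hnorm H (emb (?w n) \<ominus>\<^bsub>H\<^esub> x) - 0) < e" using LIMSEQ_D[OF lim e] by blast
  then have "hnorm H (x \<ominus>\<^bsub>H\<^esub> emb (?w n)) < e"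
    using H.hnorm_minus_commute[OF x emb_closed[OF wc], of n] by simp
  with wc show ?thesis by blast
qed

text \<open>Representatives of \<open>\<alpha> \<otimes> v\<close> and, below, of its projection to the \<open>i\<close>-th summand.\<close>

definition tuple_symbol :: "'d list \<Rightarrow> 'k \<Rightarrow> 'd \<Rightarrow> 'd list \<Rightarrow> 'k" where
  "tuple_symbol \<alpha> v = (\<lambda>i. (\<lambda>_. \<zero>\<^bsub>K\<^esub>)(\<alpha> := v))"

definition component_symbol :: "'d \<Rightarrow> 'd list \<Rightarrow> 'k \<Rightarrow> 'd \<Rightarrow> 'd list \<Rightarrow> 'k" where
  "component_symbol i \<alpha> v = (\<lambda>j. if j = i then (\<lambda>_. \<zero>\<^bsub>K\<^esub>)(\<alpha> := v) else (\<lambda>_. \<zero>\<^bsub>K\<^esub>))"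

lemma tuple_symbol_closed: "v \<in> carrier K \<Longrightarrow> tuple_symbol \<alpha> v \<in> carrier W"
  by (rule W_I[where N = "length \<alpha>"]) (auto simp: tuple_symbol_def short_words_def)

lemma component_symbol_closed: "v \<in> carrier K \<Longrightarrow> component_symbol i \<alpha> v \<in> carrier W"
  by (rule W_I[where N = "length \<alpha>"]) (auto simp: component_symbol_def short_words_def)

lemma H_symbol_eq: "H_symbol K c \<alpha> v = emb (tuple_symbol \<alpha> v)"
  by (simp add: H_symbol_def emb_def tuple_symbol_def)

lemma H_symbol_closed: "v \<in> carrier K \<Longrightarrow> H_symbol K c \<alpha> v \<in> carrier H"
  unfolding H_symbol_eq by (intro emb_closed tuple_symbol_closed)

lemma H_proj_apply:
  "x \<in> carrier H \<Longrightarrow> H_proj K c i x = (\<lambda>j. if j = i then x j else \<zero>\<^bsub>H_comp K c j\<^esub>)"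
  by (simp add: H_proj_def hproj_def H_def fun_eq_iff)

lemma H_proj_symbol:
  assumes v: "v \<in> carrier K"
  shows "H_proj K c i (H_symbol K c \<alpha> v) = emb (component_symbol i \<alpha> v)"
proof
  fix j
  show "H_proj K c i (H_symbol K c \<alpha> v) j = emb (component_symbol i \<alpha> v) j"
    unfolding H_proj_apply[OF H_symbol_closed[OF v]]
    using semi_inner_space.hembed_zero[OF semi_inner_space_word_space, of j]
    by (simp add: H_symbol_def emb_def component_symbol_def H_comp_def)
qed

lemma shift_component_symbol: "shift (component_symbol i \<alpha> v) = tuple_symbol (i # \<alpha>) v"
proof (intro ext)
  show "shift (component_symbol i \<alpha> v) j \<beta> = tuple_symbol (i # \<alpha>) v j \<beta>" for j \<beta>
    by (cases \<beta>) (auto simp: component_symbol_def tuple_symbol_def)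
qed

text \<open>Induction on the number of nonzero values. It expresses that the projected symbols span \<open>W\<close>.\<close>

lemma W_induct [consumes 1, case_names zero step]:
  assumes u: "u \<in> carrier W"
    and zero: "P \<zero>\<^bsub>W\<^esub>"
    and step: "\<And>u i \<alpha> v. u \<in> carrier W \<Longrightarrow> v \<in> carrier K \<Longrightarrow> P u \<Longrightarrow> P (u \<oplus>\<^bsub>W\<^esub> component_symbol i \<alpha> v)"
  shows "P u"
proof -
  have fin: "finite {p. u (fst p) (snd p) \<noteq> \<zero>\<^bsub>K\<^esub>}" if u: "u \<in> carrier W" for u
  proof -
    obtain N where N: "\<And>i. {\<alpha>. u i \<alpha> \<noteq> \<zero>\<^bsub>K\<^esub>} \<subseteq> short_words N" using W_support[OF u] by blast
    have "{p. u (fst p) (snd p) \<noteq> \<zero>\<^bsub>K\<^esub>} \<subseteq> UNIV \<times> short_words N" using N by force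
    then show ?thesis by (rule finite_subset) simp
  qed
  show ?thesis using u
  proof (induction "card {p. u (fst p) (snd p) \<noteq> \<zero>\<^bsub>K\<^esub>}" arbitrary: u rule: less_induct)
    case less
    show ?case
    proof (cases "{p. u (fst p) (snd p) \<noteq> \<zero>\<^bsub>K\<^esub>} = {}")
      case True
      have "u = \<zero>\<^bsub>W\<^esub>"
      proof (intro ext)
        fix i \<alpha>
        have "(i, \<alpha>) \<notin> {p. u (fst p) (snd p) \<noteq> \<zero>\<^bsub>K\<^esub>}" unfolding True by simp
        then show "u i \<alpha> = \<zero>\<^bsub>W\<^esub> i \<alpha>" by (simp add: W_zero)
      qed
      then show ?thesis using zero by simp
    next
      case False
      then obtain i \<alpha> where nz: "u i \<alpha> \<noteq> \<zero>\<^bsub>K\<^esub>" by auto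
      define w where "w = u(i := (u i)(\<alpha> := \<zero>\<^bsub>K\<^esub>))"
      have wv: "w j \<beta> = (if j = i \<and> \<beta> = \<alpha> then \<zero>\<^bsub>K\<^esub> else u j \<beta>)" for j \<beta> by (simp add: w_def)
      obtain N where N: "\<And>i. {\<alpha>. u i \<alpha> \<noteq> \<zero>\<^bsub>K\<^esub>} \<subseteq> short_words N" using W_support[OF less.prems] by blast
      have wc: "w \<in> carrier W"
      proof (rule W_I)
        show "w j \<beta> \<in> carrier K" for j \<beta> unfolding wv using W_value[OF less.prems] by simp
        show "{\<beta>. w j \<beta> \<noteq> \<zero>\<^bsub>K\<^esub>} \<subseteq> short_words N" for j using N[of j] unfolding wv by auto
      qed
      have "{p. w (fst p) (snd p) \<noteq> \<zero>\<^bsub>K\<^esub>} \<subset> {p. u (fst p) (snd p) \<noteq> \<zero>\<^bsub>K\<^esub>}"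
      proof
        show "{p. w (fst p) (snd p) \<noteq> \<zero>\<^bsub>K\<^esub>} \<subseteq> {p. u (fst p) (snd p) \<noteq> \<zero>\<^bsub>K\<^esub>}" unfolding wv by auto
        have "(i, \<alpha>) \<in> {p. u (fst p) (snd p) \<noteq> \<zero>\<^bsub>K\<^esub>}" using nz by simp
        moreover have "(i, \<alpha>) \<notin> {p. w (fst p) (snd p) \<noteq> \<zero>\<^bsub>K\<^esub>}" by (simp add: wv)
        ultimately show "{p. w (fst p) (snd p) \<noteq> \<zero>\<^bsub>K\<^esub>} \<noteq> {p. u (fst p) (snd p) \<noteq> \<zero>\<^bsub>K\<^esub>}" by blast
      qed
      then have "P w" by (intro less.hyps psubset_card_mono fin less.prems wc)
      then have "P (w \<oplus>\<^bsub>W\<^esub> component_symbol i \<alpha> (u i \<alpha>))" by (intro step wc W_value[OF less.prems])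
      moreover have "w \<oplus>\<^bsub>W\<^esub> component_symbol i \<alpha> (u i \<alpha>) = u"
      proof (intro ext)
        show "(w \<oplus>\<^bsub>W\<^esub> component_symbol i \<alpha> (u i \<alpha>)) j \<beta> = u j \<beta>" for j \<beta>
          unfolding W_add wv component_symbol_def using W_value[OF less.prems] by auto
      qed
      ultimately show ?thesis by simp
    qed
  qed
qed

text \<open>The defining property of \<open>A\<close> prescribes its values on the projected symbols only; linearity gives them on
  their span.\<close>

lemma is_A_emb:
  assumes A: "is_A K c A" and u: "u \<in> carrier W"
  shows "A (emb u) = emb (shift u)"
proof -
  have Ab: "A \<in> bounded_ops H H"
    and Agen: "\<And>i \<alpha> v. v \<in> carrier K \<Longrightarrow> A (H_proj K c i (H_symbol K c \<alpha> v)) = H_symbol K c (i # \<alpha>) v"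
    using A unfolding is_A_def by blast+
  have emb0: "emb \<zero>\<^bsub>W\<^esub> = \<zero>\<^bsub>H\<^esub>"
    using emb_smult[OF W.zero_closed, of 0] emb_closed[OF W.zero_closed] by simp
  have shift0: "shift \<zero>\<^bsub>W\<^esub> = \<zero>\<^bsub>W\<^esub>"
    using shift_smult[of 0 "\<zero>\<^bsub>W\<^esub>"] shift_closed[OF W.zero_closed] by (simp only: W.scale_zero_left W.zero_closed)
  show ?thesis using u
  proof (induction u rule: W_induct)
    case zero
    show ?case unfolding shift0 emb0 by (rule bounded_ops_zero[OF Ab Hs Hs])
  next
    case (step u i \<alpha> v)
    note cs = component_symbol_closed[OF step(2), of i \<alpha>]
    have "A (emb (u \<oplus>\<^bsub>W\<^esub> component_symbol i \<alpha> v)) = A (emb u) \<oplus>\<^bsub>H\<^esub> A (emb (component_symbol i \<alpha> v))"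
      by (simp only: emb_add[OF step(1) cs] bounded_ops_add[OF Ab emb_closed[OF step(1)] emb_closed[OF cs]])
    also have "A (emb (component_symbol i \<alpha> v)) = emb (shift (component_symbol i \<alpha> v))"
      unfolding shift_component_symbol using Agen[OF step(2), of i \<alpha>] unfolding H_proj_symbol[OF step(2)] unfolding H_symbol_eq .
    also have "A (emb u) \<oplus>\<^bsub>H\<^esub> emb (shift (component_symbol i \<alpha> v)) = emb (shift (u \<oplus>\<^bsub>W\<^esub> component_symbol i \<alpha> v))"
      unfolding step(3) shift_add by (rule emb_add[OF shift_closed[OF step(1)] shift_closed[OF cs], symmetric])
    finally show ?case .
  qed
qed

lemma is_A_unique: "is_A K c A \<Longrightarrow> is_A K c B \<Longrightarrow> A = B"
  by (rule bounded_ops_eqI_dense[OF Hs hilbert_space_H, where J = emb and D = "carrier W"])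
    (simp_all only: is_A_emb emb_closed emb_dense, simp_all only: is_A_def)

lemma ex_A: "\<exists>A. is_A K c A"
proof -
  define s where "s = (1 + r) / 2"
  have s: "1 < s" "s < r" using radius by (auto simp: s_def)
  have sc: "emb (shift w) \<in> carrier H" if "w \<in> carrier W" for w by (intro emb_closed shift_closed that)
  have sa: "emb (shift (v \<oplus>\<^bsub>W\<^esub> w)) = emb (shift v) \<oplus>\<^bsub>H\<^esub> emb (shift w)" if "v \<in> carrier W" "w \<in> carrier W" for v w
    unfolding shift_add by (intro emb_add shift_closed that)
  have sm: "emb (shift (a \<odot>\<^bsub>W\<^esub> w)) = a \<odot>\<^bsub>H\<^esub> emb (shift w)" if "w \<in> carrier W" for a w
    unfolding shift_smult by (intro emb_smult shift_closed that)
  have sn: "hnorm H (emb (shift w)) \<le> (1 / s) * hnorm W w" if "w \<in> carrier W" for w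
    unfolding emb_hnorm[OF shift_closed[OF that]] by (rule shift_contraction[OF that s])
  have "\<exists>A. A \<in> bounded_ops H H \<and> (\<forall>w\<in>carrier W. A (emb w) = emb (shift w))"
  proof (rule dense_extension[OF Ws hilbert_space_H hilbert_space_H emb_closed emb_add emb_smult emb_hnorm emb_dense
        sc sa sm sn])
    fix S assume "S \<in> bounded_ops H H" "\<And>w. w \<in> carrier W \<Longrightarrow> S (emb w) = emb (shift w)"
    then show ?thesis by blast
  qed
  then obtain A where A: "A \<in> bounded_ops H H" "\<And>w. w \<in> carrier W \<Longrightarrow> A (emb w) = emb (shift w)"
    by blast
  have "is_A K c A"
    unfolding is_A_def
  proof (intro conjI allI ballI A(1))
    fix i \<alpha> v assume v: "v \<in> carrier K"
    show "A (H_proj K c i (H_symbol K c \<alpha> v)) = H_symbol K c (i # \<alpha>) v"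
      unfolding H_proj_symbol[OF v] unfolding A(2)[OF component_symbol_closed[OF v]] shift_component_symbol H_symbol_eq ..
  qed
  then show "\<exists>A. is_A K c A" by blast
qed

lemma is_A_symbol:
  assumes A: "is_A K c A" and v: "v \<in> carrier K"
  shows "A (H_symbol K c \<alpha> v) = finsum H (\<lambda>i. H_symbol K c (i # \<alpha>) v) UNIV"
proof -
  have Ab: "A \<in> bounded_ops H H"
    and Agen: "\<And>i \<alpha> v. v \<in> carrier K \<Longrightarrow> A (H_proj K c i (H_symbol K c \<alpha> v)) = H_symbol K c (i # \<alpha>) v"
    using A unfolding is_A_def by blast+
  have pc: "H_proj K c i (H_symbol K c \<alpha> v) \<in> carrier H" for i
    unfolding H_proj_symbol[OF v] by (intro emb_closed component_symbol_closed v)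
  have "H_symbol K c \<alpha> v = finsum H (\<lambda>i. H_proj K c i (H_symbol K c \<alpha> v)) UNIV"
  proof
    fix j
    interpret C: semi_inner_space "H_comp K c j" by (rule semi_inner_space_H_comp)
    note sj = H_component[OF H_symbol_closed[OF v]]
    have "finsum H (\<lambda>i. H_proj K c i (H_symbol K c \<alpha> v)) UNIV j =
        finsum (H_comp K c j) (\<lambda>i. H_proj K c i (H_symbol K c \<alpha> v) j) UNIV"
      by (rule H_finsum) (simp_all add: pc)
    also have "\<dots> = finsum (H_comp K c j) (\<lambda>i. if j = i then H_symbol K c \<alpha> v i else \<zero>\<^bsub>H_comp K c j\<^esub>) UNIV"
      unfolding H_proj_apply[OF H_symbol_closed[OF v]]
      by (rule C.finsum_cong'[OF refl]) (use sj[of \<alpha> j] in auto)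
    also have "\<dots> = H_symbol K c \<alpha> v j"
      using C.finsum_singleton[of j UNIV "\<lambda>_. H_symbol K c \<alpha> v j"] sj[of \<alpha> j] by (simp cong: if_cong)
    finally show "H_symbol K c \<alpha> v j = finsum H (\<lambda>i. H_proj K c i (H_symbol K c \<alpha> v)) UNIV j" ..
  qed
  then have "A (H_symbol K c \<alpha> v) = A (finsum H (\<lambda>i. H_proj K c i (H_symbol K c \<alpha> v)) UNIV)" by (rule arg_cong)
  also have "\<dots> = finsum H (\<lambda>i. A (H_proj K c i (H_symbol K c \<alpha> v))) UNIV"
    by (rule bounded_ops_finsum[OF Ab Hs Hs]) (simp_all add: pc)
  finally show ?thesis by (simp only: Agen[OF v])
qed

lemma emb_sequence:
  assumes x: "x \<in> carrier H"
  obtains w where "\<And>n::nat. w n \<in> carrier W" "(\<lambda>n. hnorm H (emb (w n) \<ominus>\<^bsub>H\<^esub> x)) \<longlonglongrightarrow> 0"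
  using dense_sequence[OF emb_dense Hs emb_closed x] by blast

lemma is_A_self_adjoint:
  assumes A: "is_A K c A"
  shows "self_adjoint H A"
  unfolding self_adjoint_def
proof (intro ballI)
  fix x y assume x: "x \<in> carrier H" and y: "y \<in> carrier H"
  have Ab: "A \<in> bounded_ops H H" using A unfolding is_A_def by blast
  note Ac = bounded_ops_closed[OF Ab]
  obtain v where v: "\<And>n::nat. v n \<in> carrier W" "(\<lambda>n. hnorm H (emb (v n) \<ominus>\<^bsub>H\<^esub> x)) \<longlonglongrightarrow> 0"
    using emb_sequence[OF x] by blast
  obtain w where w: "\<And>n::nat. w n \<in> carrier W" "(\<lambda>n. hnorm H (emb (w n) \<ominus>\<^bsub>H\<^esub> y)) \<longlonglongrightarrow> 0"
    using emb_sequence[OF y] by blast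
  have vc: "emb (v n) \<in> carrier H" and wc: "emb (w n) \<in> carrier H" for n by (intro emb_closed v w)+
  note Av = bounded_op_tendsto[OF Ab Hs Hs vc x v(2)] and Aw = bounded_op_tendsto[OF Ab Hs Hs wc y w(2)]
  have 1: "(\<lambda>n. ip H (A (emb (v n))) (emb (w n))) \<longlonglongrightarrow> ip H (A x) y"
    by (rule H.ip_tendsto[OF Ac[OF vc] wc Ac[OF x] y Av w(2)])
  have 2: "(\<lambda>n. ip H (emb (v n)) (A (emb (w n)))) \<longlonglongrightarrow> ip H x (A y)"
    by (rule H.ip_tendsto[OF vc Ac[OF wc] x Ac[OF y] v(2) Aw])
  have "ip H (A (emb (v n))) (emb (w n)) = ip H (emb (v n)) (A (emb (w n)))" for n
    unfolding is_A_emb[OF A v(1)] is_A_emb[OF A w(1)]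
      emb_ip[OF shift_closed[OF v(1)] w(1)] emb_ip[OF v(1) shift_closed[OF w(1)]]
    by (rule shift_symmetric[OF v(1) w(1)])
  with 1 have "(\<lambda>n. ip H (emb (v n)) (A (emb (w n)))) \<longlonglongrightarrow> ip H (A x) y" by simp
  then show "ip H (A x) y = ip H x (A y)" using 2 by (rule LIMSEQ_unique)
qed

text \<open>Sharper than contractivity: every \<open>s\<close> up to the radius is admitted, which makes the pencil
  invertible on the whole ball of radius \<open>r\<close> and not only on the unit ball.\<close>

lemma is_A_bound:
  assumes A: "is_A K c A" and x: "x \<in> carrier H" and s: "1 < s" "s < r"
  shows "hnorm H (A x) \<le> (1 / s) * hnorm H x"
proof -
  have Ab: "A \<in> bounded_ops H H" using A unfolding is_A_def by blast
  note Ac = bounded_ops_closed[OF Ab]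
  obtain v where v: "\<And>n::nat. v n \<in> carrier W" "(\<lambda>n. hnorm H (emb (v n) \<ominus>\<^bsub>H\<^esub> x)) \<longlonglongrightarrow> 0"
    using emb_sequence[OF x] by blast
  have vc: "emb (v n) \<in> carrier H" for n by (intro emb_closed v)
  show ?thesis
  proof (rule LIMSEQ_le)
    show "(\<lambda>n. hnorm H (A (emb (v n)))) \<longlonglongrightarrow> hnorm H (A x)"
      by (rule H.hnorm_tendsto[OF Ac[OF vc] Ac[OF x] bounded_op_tendsto[OF Ab Hs Hs vc x v(2)]])
    show "(\<lambda>n. (1 / s) * hnorm H (emb (v n))) \<longlonglongrightarrow> (1 / s) * hnorm H x"
      by (intro tendsto_mult_left H.hnorm_tendsto[OF vc x v(2)])
    have "hnorm H (A (emb (v n))) \<le> (1 / s) * hnorm H (emb (v n))" for n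
      unfolding is_A_emb[OF A v(1)] emb_hnorm[OF shift_closed[OF v(1)]] emb_hnorm[OF v(1)]
      by (rule shift_contraction[OF v(1) s])
    then show "\<exists>N. \<forall>n\<ge>N. hnorm H (A (emb (v n))) \<le> (1 / s) * hnorm H (emb (v n))" by blast
  qed
qed

lemma is_A_opnorm:
  assumes A: "is_A K c A"
  shows "opnorm H H A \<le> 1"
proof (rule opnorm_le)
  fix x assume x: "x \<in> carrier H"
  define s where "s = (1 + r) / 2"
  have s: "1 < s" "s < r" using radius by (auto simp: s_def)
  have "hnorm H (A x) \<le> (1 / s) * hnorm H x" by (rule is_A_bound[OF A x s])
  also have "\<dots> \<le> 1 * hnorm H x" by (rule mult_right_mono) (use s x in auto)
  finally show "hnorm H (A x) \<le> 1 * hnorm H x" .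
qed simp

text \<open>The norm is controlled by the coefficients of the one-letter words, because
  \<open>\<parallel>1 \<otimes> k\<parallel>\<^sup>2 = \<Sum>i. \<langle>c [i] k, k\<rangle>\<close>.\<close>

lemma Q_bounded: "Q_op K c \<in> bounded_ops K H"
proof (rule bounded_opsI)
  show "Q_op K c x \<in> carrier H" if "x \<in> carrier K" for x
    using that by (simp add: Q_op_def H_symbol_closed)
  show "Q_op K c x = undefined" if "x \<notin> carrier K" for x using that by (simp add: Q_op_def)
  show "Q_op K c (x \<oplus>\<^bsub>K\<^esub> y) = Q_op K c x \<oplus>\<^bsub>H\<^esub> Q_op K c y" if x: "x \<in> carrier K" and y: "y \<in> carrier K" for x y
  proof -
    have "tuple_symbol [] (x \<oplus>\<^bsub>K\<^esub> y) = tuple_symbol [] x \<oplus>\<^bsub>W\<^esub> tuple_symbol [] y"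
      by (intro ext) (unfold W_add, simp add: tuple_symbol_def x y)
    then show ?thesis using x y by (simp add: Q_op_def H_symbol_eq emb_add tuple_symbol_closed del: hsum_simps)
  qed
  show "Q_op K c (a \<odot>\<^bsub>K\<^esub> x) = a \<odot>\<^bsub>H\<^esub> Q_op K c x" if x: "x \<in> carrier K" for a x
  proof -
    have "tuple_symbol [] (a \<odot>\<^bsub>K\<^esub> x) = a \<odot>\<^bsub>W\<^esub> tuple_symbol [] x"
      by (intro ext) (unfold W_smult, simp add: tuple_symbol_def x)
    then show ?thesis using x by (simp add: Q_op_def H_symbol_eq emb_smult tuple_symbol_closed del: hsum_simps)
  qed
  fix x assume x: "x \<in> carrier K"
  let ?M = "\<Sum>i\<in>UNIV. opnorm K K (c [i])"
  have M0: "0 \<le> ?M" by (intro sum_nonneg bounded_ops_opnorm_nonneg[OF c Ks])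
  have "ip W (tuple_symbol [] x) (tuple_symbol [] x) = (\<Sum>i\<in>UNIV. ip K (c [i] x) x)"
  proof -
    have S: "{\<alpha>. tuple_symbol [] x i \<alpha> \<noteq> \<zero>\<^bsub>K\<^esub>} \<subseteq> short_words 0" for i by (auto simp: tuple_symbol_def short_words_def)
    have s0: "short_words 0 = {[] :: 'd list}" by (auto simp: short_words_def)
    show ?thesis unfolding W_ip[OF tuple_symbol_closed[OF x] tuple_symbol_closed[OF x] S S] unfolding s0 by (simp add: tuple_symbol_def)
  qed
  then have "(hnorm W (tuple_symbol [] x))\<^sup>2 = (\<Sum>i\<in>UNIV. Re (ip K (c [i] x) x))"
    by (simp only: W.hnorm_sq[OF tuple_symbol_closed[OF x]] Re_sum)
  also have "\<dots> \<le> (\<Sum>i\<in>UNIV. opnorm K K (c [i]) * (hnorm K x)\<^sup>2)"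
  proof (rule sum_mono)
    fix i
    have "Re (ip K (c [i] x) x) \<le> hnorm K (c [i] x) * hnorm K x"
      by (rule order_trans[OF complex_Re_le_cmod K.cauchy_schwarz[OF bounded_ops_closed[OF c x] x]])
    also have "\<dots> \<le> opnorm K K (c [i]) * hnorm K x * hnorm K x"
      by (rule mult_right_mono[OF bounded_ops_opnorm[OF c Ks x]]) (simp add: x)
    finally show "Re (ip K (c [i] x) x) \<le> opnorm K K (c [i]) * (hnorm K x)\<^sup>2" by (simp add: power2_eq_square)
  qed
  also have "\<dots> = (sqrt ?M * hnorm K x)\<^sup>2"
    unfolding sum_distrib_right[symmetric] power_mult_distrib using M0 by simp
  finally have "hnorm W (tuple_symbol [] x) \<le> sqrt ?M * hnorm K x"
    by (rule power2_le_imp_le) (use M0 x in simp)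
  then show "hnorm H (Q_op K c x) \<le> sqrt ?M * hnorm K x"
    using x by (simp only: Q_op_def restrict_apply if_True H_symbol_eq emb_hnorm[OF tuple_symbol_closed[OF x]])
qed

end

section \<open>The realization formula\<close>

lemma bounded_ops_diff:
  assumes H: "semi_inner_space H" and L: "hilbert_space L" and S: "S \<in> bounded_ops H L" and T: "T \<in> bounded_ops H L"
  shows "(\<lambda>x\<in>carrier H. S x \<ominus>\<^bsub>L\<^esub> T x) \<in> bounded_ops H L"
proof -
  interpret H: semi_inner_space H by (rule H)
  interpret L: hilbert_space L by (rule L)
  note Sc = bounded_ops_closed[OF S] and Tc = bounded_ops_closed[OF T]
  show ?thesis
  proof (rule bounded_opsI)
    fix x y assume x: "x \<in> carrier H" and y: "y \<in> carrier H"
    have "S x \<oplus>\<^bsub>L\<^esub> S y \<ominus>\<^bsub>L\<^esub> (T x \<oplus>\<^bsub>L\<^esub> T y) = (S x \<ominus>\<^bsub>L\<^esub> T x) \<oplus>\<^bsub>L\<^esub> (S y \<ominus>\<^bsub>L\<^esub> T y)"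
      by (rule L.eqI_ip) (simp_all add: L.ip_linear Sc Tc x y)
    then show "(\<lambda>x\<in>carrier H. S x \<ominus>\<^bsub>L\<^esub> T x) (x \<oplus>\<^bsub>H\<^esub> y) =
        (\<lambda>x\<in>carrier H. S x \<ominus>\<^bsub>L\<^esub> T x) x \<oplus>\<^bsub>L\<^esub> (\<lambda>x\<in>carrier H. S x \<ominus>\<^bsub>L\<^esub> T x) y"
      using x y by (simp add: bounded_ops_add[OF S] bounded_ops_add[OF T])
  next
    fix a x assume x: "x \<in> carrier H"
    have "a \<odot>\<^bsub>L\<^esub> S x \<ominus>\<^bsub>L\<^esub> a \<odot>\<^bsub>L\<^esub> T x = a \<odot>\<^bsub>L\<^esub> (S x \<ominus>\<^bsub>L\<^esub> T x)"
      by (rule L.eqI_ip) (simp_all add: L.ip_linear Sc Tc x right_diff_distrib)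
    then show "(\<lambda>x\<in>carrier H. S x \<ominus>\<^bsub>L\<^esub> T x) (a \<odot>\<^bsub>H\<^esub> x) = a \<odot>\<^bsub>L\<^esub> (\<lambda>x\<in>carrier H. S x \<ominus>\<^bsub>L\<^esub> T x) x"
      using x by (simp add: bounded_ops_smult[OF S] bounded_ops_smult[OF T])
  next
    fix x assume x: "x \<in> carrier H"
    show "hnorm L ((\<lambda>x\<in>carrier H. S x \<ominus>\<^bsub>L\<^esub> T x) x) \<le> (opnorm H L S + opnorm H L T) * hnorm H x"
      using L.hnorm_minus_le[OF Sc[OF x] Tc[OF x]] bounded_ops_opnorm[OF S H x] bounded_ops_opnorm[OF T H x] x
      by (simp add: distrib_right)
  qed (use Sc Tc in auto)
qed

lemma bounded_ops_compose:
  assumes L: "semi_inner_space L" and H: "semi_inner_space H" and S: "S \<in> bounded_ops L M" and T: "T \<in> bounded_ops H L"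
  shows "(\<lambda>x\<in>carrier H. S (T x)) \<in> bounded_ops H M"
proof -
  interpret H: semi_inner_space H by (rule H)
  note Sc = bounded_ops_closed[OF S] and Tc = bounded_ops_closed[OF T]
  show ?thesis
  proof (rule bounded_opsI)
    fix x assume x: "x \<in> carrier H"
    have "hnorm M (S (T x)) \<le> opnorm L M S * hnorm L (T x)" by (rule bounded_ops_opnorm[OF S L Tc[OF x]])
    also have "\<dots> \<le> opnorm L M S * (opnorm H L T * hnorm H x)"
      by (rule mult_left_mono[OF bounded_ops_opnorm[OF T H x] bounded_ops_opnorm_nonneg[OF S L]])
    finally show "hnorm M ((\<lambda>x\<in>carrier H. S (T x)) x) \<le> opnorm L M S * opnorm H L T * hnorm H x"
      using x by (simp add: mult.assoc)
  qed (use Sc Tc in \<open>simp_all add: bounded_ops_add[OF S] bounded_ops_add[OF T] bounded_ops_smult[OF S] bounded_ops_smult[OF T]\<close>)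
qed

lemma mat_inverse_invertible:
  assumes Z: "Z \<in> carrier_mat n n" and inv: "invertible_mat (Z :: complex mat)"
  shows "the (mat_inverse Z) \<in> carrier_mat n n" "Z * the (mat_inverse Z) = 1\<^sub>m n" "the (mat_inverse Z) * Z = 1\<^sub>m n"
proof -
  obtain B where B: "Z * B = 1\<^sub>m (dim_row Z)" "B * Z = 1\<^sub>m (dim_row B)"
    using inv by (auto simp: invertible_mat_def inverts_mat_def)
  have "dim_row B = n"
    using arg_cong[OF B(2), of dim_col] Z by simp
  moreover have "dim_col B = n"
    using arg_cong[OF B(1), of dim_col] Z by simp
  ultimately have Bc: "B \<in> carrier_mat n n" by auto
  have "Z \<in> Units (ring_mat TYPE(complex) n ())"
    unfolding Units_def using B Z Bc by (auto simp: ring_mat_simps intro!: bexI[of _ B])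
  then have "mat_inverse Z \<noteq> None" using mat_inverse(1)[OF Z, where b = "()"] by blast
  then have some: "mat_inverse Z = Some (the (mat_inverse Z))" by simp
  show "the (mat_inverse Z) \<in> carrier_mat n n" "Z * the (mat_inverse Z) = 1\<^sub>m n" "the (mat_inverse Z) * Z = 1\<^sub>m n"
    using mat_inverse(2)[OF Z some] by blast+
qed

lemma mult_mat_index:
  assumes "M \<in> carrier_mat n n" "N \<in> carrier_mat n n" "k < n" "m < n"
  shows "(M * N) $$ (k, m) = (\<Sum>l<n. M $$ (k, l) * N $$ (l, m))"
  using assms by (auto simp: scalar_prod_def atLeast0LessThan intro!: sum.cong)

context monotone_series
begin

text \<open>The operator \<open>\<Sum>i. P\<^sub>i \<otimes> M\<^sub>i\<close>, written through components: \<open>M\<^sub>i\<close> acts on the \<open>n\<close> vectors in the \<open>i\<close>-th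
  summand. In this form it is visibly multiplicative in \<open>M\<close>.\<close>

definition tuple_action :: "nat \<Rightarrow> ('d \<Rightarrow> complex mat) \<Rightarrow> (nat \<Rightarrow> 'd \<Rightarrow> (nat \<Rightarrow> 'd list \<Rightarrow> 'k) set) \<Rightarrow>
    nat \<Rightarrow> 'd \<Rightarrow> (nat \<Rightarrow> 'd list \<Rightarrow> 'k) set" where
  "tuple_action n M = (\<lambda>\<xi>\<in>carrier (amp n H). \<lambda>k\<in>{..<n}. \<lambda>i.
     finsum (H_comp K c i) (\<lambda>l. M i $$ (k, l) \<odot>\<^bsub>H_comp K c i\<^esub> \<xi> l i) {..<n})"

lemma amp_H_value: "\<xi> \<in> carrier (amp n H) \<Longrightarrow> l < n \<Longrightarrow> \<xi> l i \<in> carrier (H_comp K c i)"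
  by (rule H_component[OF amp_component])

lemma amp_H_eqI:
  assumes x: "\<xi> \<in> carrier (amp n H)" and y: "\<eta> \<in> carrier (amp n H)"
    and eq: "\<And>k i z. k < n \<Longrightarrow> z \<in> carrier (H_comp K c i) \<Longrightarrow> ip (H_comp K c i) (\<xi> k i) z = ip (H_comp K c i) (\<eta> k i) z"
  shows "\<xi> = \<eta>"
proof (rule PiE_ext)
  show "\<xi> \<in> {..<n} \<rightarrow>\<^sub>E carrier H" "\<eta> \<in> {..<n} \<rightarrow>\<^sub>E carrier H" using x y by (simp_all only: amp_simps)
  fix k assume "k \<in> {..<n}"
  then have k: "k < n" by simp
  show "\<xi> k = \<eta> k"
  proof
    fix i
    show "\<xi> k i = \<eta> k i"
      by (rule hilbert_space.eqI_ip[OF hilbert_space_H_comp amp_H_value[OF x k] amp_H_value[OF y k] eq[OF k]])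
  qed
qed

lemma tuple_action_apply:
  "\<xi> \<in> carrier (amp n H) \<Longrightarrow> k < n \<Longrightarrow>
    tuple_action n M \<xi> k i = finsum (H_comp K c i) (\<lambda>l. M i $$ (k, l) \<odot>\<^bsub>H_comp K c i\<^esub> \<xi> l i) {..<n}"
  by (simp add: tuple_action_def)

lemma tuple_action_closed:
  assumes x: "\<xi> \<in> carrier (amp n H)"
  shows "tuple_action n M \<xi> \<in> carrier (amp n H)"
proof -
  have "(\<lambda>i. finsum (H_comp K c i) (\<lambda>l. M i $$ (k, l) \<odot>\<^bsub>H_comp K c i\<^esub> \<xi> l i) {..<n}) \<in> carrier H" for k
    unfolding H_iff
  proof
    fix i
    interpret C: semi_inner_space "H_comp K c i" by (rule semi_inner_space_H_comp)
    show "finsum (H_comp K c i) (\<lambda>l. M i $$ (k, l) \<odot>\<^bsub>H_comp K c i\<^esub> \<xi> l i) {..<n} \<in> carrier (H_comp K c i)"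
      by (intro C.finsum_closed funcsetI C.scale_closed amp_H_value[OF x]) simp
  qed
  then show ?thesis using x unfolding tuple_action_def by (simp add: amp_simps)
qed

lemma tuple_action_ip:
  assumes x: "\<xi> \<in> carrier (amp n H)" and k: "k < n" and z: "z \<in> carrier (H_comp K c i)"
  shows "ip (H_comp K c i) (tuple_action n M \<xi> k i) z = (\<Sum>l<n. M i $$ (k, l) * ip (H_comp K c i) (\<xi> l i) z)"
proof -
  interpret C: semi_inner_space "H_comp K c i" by (rule semi_inner_space_H_comp)
  have "ip (H_comp K c i) (finsum (H_comp K c i) (\<lambda>l. M i $$ (k, l) \<odot>\<^bsub>H_comp K c i\<^esub> \<xi> l i) {..<n}) z =
      (\<Sum>l<n. ip (H_comp K c i) (M i $$ (k, l) \<odot>\<^bsub>H_comp K c i\<^esub> \<xi> l i) z)"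
    by (rule C.ip_finsum_left) (simp_all add: amp_H_value[OF x] z)
  also have "\<dots> = (\<Sum>l<n. M i $$ (k, l) * ip (H_comp K c i) (\<xi> l i) z)"
    by (intro sum.cong refl C.ip_smult amp_H_value[OF x] z) simp
  finally show ?thesis by (simp only: tuple_action_apply[OF x k])
qed

lemma amp_H_add: "k < n \<Longrightarrow> (\<xi> \<oplus>\<^bsub>amp n H\<^esub> \<eta>) k i = \<xi> k i \<oplus>\<^bsub>H_comp K c i\<^esub> \<eta> k i"
  by (simp add: amp_simps H_add)

lemma amp_H_smult: "k < n \<Longrightarrow> (a \<odot>\<^bsub>amp n H\<^esub> \<xi>) k i = a \<odot>\<^bsub>H_comp K c i\<^esub> \<xi> k i"
  by (simp add: amp_simps H_smult)

lemma amp_Hs: "semi_inner_space (amp n H)" and hilbert_amp_H: "hilbert_space (amp n H)"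
  by (intro semi_inner_space_amp Hs) (intro hilbert_space_amp hilbert_space_H)

text \<open>The norm is the maximum and not the sum of the norms of the \<open>M\<^sub>i\<close>, since the summands are orthogonal.\<close>

lemma tuple_action_hnorm_le:
  assumes x: "\<xi> \<in> carrier (amp n H)"
  shows "hnorm (amp n H) (tuple_action n M \<xi>) \<le> tuple_norm n M * hnorm (amp n H) \<xi>"
proof (rule power2_le_imp_le)
  have sq: "(hnorm (amp n H) \<eta>)\<^sup>2 = (\<Sum>i\<in>UNIV. \<Sum>k<n. (hnorm (H_comp K c i) (\<eta> k i))\<^sup>2)" if e: "\<eta> \<in> carrier (amp n H)" for \<eta>
  proof -
    have "(hnorm (amp n H) \<eta>)\<^sup>2 = (\<Sum>k<n. (hnorm H (\<eta> k))\<^sup>2)" by (rule amp_hnorm_sq[OF Hs e])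
    also have "\<dots> = (\<Sum>k<n. \<Sum>i\<in>UNIV. (hnorm (H_comp K c i) (\<eta> k i))\<^sup>2)"
    proof (intro sum.cong refl)
      fix k assume "k \<in> {..<n}"
      then have "\<eta> k \<in> carrier (hsum UNIV (H_comp K c))" using amp_component[OF e] by (simp only: H_def lessThan_iff)
      then show "(hnorm H (\<eta> k))\<^sup>2 = (\<Sum>i\<in>UNIV. (hnorm (H_comp K c i) (\<eta> k i))\<^sup>2)"
        unfolding H_def by (rule hsum_hnorm_sq[OF semi_inner_space_H_comp])
    qed
    finally show ?thesis by (simp only: sum.swap[of _ UNIV])
  qed
  have t0: "0 \<le> tuple_norm n M" using order_trans[OF mat_norm_nonneg mat_norm_le_tuple_norm] .
  have "(hnorm (amp n H) (tuple_action n M \<xi>))\<^sup>2 = (\<Sum>i\<in>UNIV. \<Sum>k<n. (hnorm (H_comp K c i)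
      (finsum (H_comp K c i) (\<lambda>l. M i $$ (k, l) \<odot>\<^bsub>H_comp K c i\<^esub> \<xi> l i) {..<n}))\<^sup>2)"
    unfolding sq[OF tuple_action_closed[OF x]] by (intro sum.cong refl) (simp only: tuple_action_apply[OF x] lessThan_iff)
  also have "\<dots> \<le> (\<Sum>i\<in>UNIV. (mat_norm n (M i))\<^sup>2 * (\<Sum>l<n. (hnorm (H_comp K c i) (\<xi> l i))\<^sup>2))"
    by (intro sum_mono semi_inner_space.matrix_action_bound[OF semi_inner_space_H_comp] amp_H_value[OF x])
  also have "\<dots> \<le> (\<Sum>i\<in>UNIV. (tuple_norm n M)\<^sup>2 * (\<Sum>l<n. (hnorm (H_comp K c i) (\<xi> l i))\<^sup>2))"
    by (intro sum_mono mult_right_mono power_mono mat_norm_le_tuple_norm mat_norm_nonneg sum_nonneg) simp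
  also have "\<dots> = (tuple_norm n M * hnorm (amp n H) \<xi>)\<^sup>2"
    unfolding power_mult_distrib sq[OF x] sum_distrib_left ..
  finally show "(hnorm (amp n H) (tuple_action n M \<xi>))\<^sup>2 \<le> (tuple_norm n M * hnorm (amp n H) \<xi>)\<^sup>2" .
  show "0 \<le> tuple_norm n M * hnorm (amp n H) \<xi>"
    by (intro mult_nonneg_nonneg t0 semi_inner_space.hnorm_nonneg[OF amp_Hs x])
qed

lemma tuple_action_bounded: "tuple_action n M \<in> bounded_ops (amp n H) (amp n H)"
proof (rule bounded_opsI[OF tuple_action_closed _ _ _ tuple_action_hnorm_le])
  interpret A: semi_inner_space "amp n H" by (rule amp_Hs)
  show "tuple_action n M x = undefined" if "x \<notin> carrier (amp n H)" for x using that by (simp add: tuple_action_def)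
  show "tuple_action n M (x \<oplus>\<^bsub>amp n H\<^esub> y) = tuple_action n M x \<oplus>\<^bsub>amp n H\<^esub> tuple_action n M y"
    if x: "x \<in> carrier (amp n H)" and y: "y \<in> carrier (amp n H)" for x y
  proof (rule amp_H_eqI)
    fix k i z assume k: "k < n" and z: "z \<in> carrier (H_comp K c i)"
    interpret C: semi_inner_space "H_comp K c i" by (rule semi_inner_space_H_comp)
    have "ip (H_comp K c i) (tuple_action n M (x \<oplus>\<^bsub>amp n H\<^esub> y) k i) z =
        (\<Sum>l<n. M i $$ (k, l) * ip (H_comp K c i) ((x \<oplus>\<^bsub>amp n H\<^esub> y) l i) z)"
      by (rule tuple_action_ip[OF A.a_closed[OF x y] k z])
    also have "\<dots> = (\<Sum>l<n. M i $$ (k, l) * ip (H_comp K c i) (x l i) z + M i $$ (k, l) * ip (H_comp K c i) (y l i) z)"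
    proof (intro sum.cong refl)
      fix l assume "l \<in> {..<n}"
      then have l: "l < n" by simp
      show "M i $$ (k, l) * ip (H_comp K c i) ((x \<oplus>\<^bsub>amp n H\<^esub> y) l i) z =
          M i $$ (k, l) * ip (H_comp K c i) (x l i) z + M i $$ (k, l) * ip (H_comp K c i) (y l i) z"
        by (simp only: amp_H_add[OF l] C.ip_add[OF amp_H_value[OF x l] amp_H_value[OF y l] z] distrib_left)
    qed
    also have "\<dots> = ip (H_comp K c i) ((tuple_action n M x \<oplus>\<^bsub>amp n H\<^esub> tuple_action n M y) k i) z"
      unfolding sum.distrib amp_H_add[OF k]
        C.ip_add[OF amp_H_value[OF tuple_action_closed[OF x] k] amp_H_value[OF tuple_action_closed[OF y] k] z]
        tuple_action_ip[OF x k z] tuple_action_ip[OF y k z] ..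
    finally show "ip (H_comp K c i) (tuple_action n M (x \<oplus>\<^bsub>amp n H\<^esub> y) k i) z =
        ip (H_comp K c i) ((tuple_action n M x \<oplus>\<^bsub>amp n H\<^esub> tuple_action n M y) k i) z" .
  qed (intro tuple_action_closed A.a_closed x y)+
  show "tuple_action n M (a \<odot>\<^bsub>amp n H\<^esub> x) = a \<odot>\<^bsub>amp n H\<^esub> tuple_action n M x" if x: "x \<in> carrier (amp n H)" for a x
  proof (rule amp_H_eqI)
    fix k i z assume k: "k < n" and z: "z \<in> carrier (H_comp K c i)"
    interpret C: semi_inner_space "H_comp K c i" by (rule semi_inner_space_H_comp)
    have "ip (H_comp K c i) (tuple_action n M (a \<odot>\<^bsub>amp n H\<^esub> x) k i) z =
        (\<Sum>l<n. M i $$ (k, l) * ip (H_comp K c i) ((a \<odot>\<^bsub>amp n H\<^esub> x) l i) z)"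
      by (rule tuple_action_ip[OF A.scale_closed[OF x] k z])
    also have "\<dots> = (\<Sum>l<n. a * (M i $$ (k, l) * ip (H_comp K c i) (x l i) z))"
    proof (intro sum.cong refl)
      fix l assume "l \<in> {..<n}"
      then have l: "l < n" by simp
      show "M i $$ (k, l) * ip (H_comp K c i) ((a \<odot>\<^bsub>amp n H\<^esub> x) l i) z =
          a * (M i $$ (k, l) * ip (H_comp K c i) (x l i) z)"
        by (simp only: amp_H_smult[OF l] C.ip_smult[OF amp_H_value[OF x l] z] mult.left_commute)
    qed
    also have "\<dots> = ip (H_comp K c i) ((a \<odot>\<^bsub>amp n H\<^esub> tuple_action n M x) k i) z"
      unfolding sum_distrib_left[symmetric] amp_H_smult[OF k]
        C.ip_smult[OF amp_H_value[OF tuple_action_closed[OF x] k] z] tuple_action_ip[OF x k z] ..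
    finally show "ip (H_comp K c i) (tuple_action n M (a \<odot>\<^bsub>amp n H\<^esub> x) k i) z =
        ip (H_comp K c i) ((a \<odot>\<^bsub>amp n H\<^esub> tuple_action n M x) k i) z" .
  qed (intro tuple_action_closed A.scale_closed x)+
qed

lemma tuple_action_mult:
  assumes M: "\<And>i. M i \<in> carrier_mat n n" and N: "\<And>i. N i \<in> carrier_mat n n" and x: "\<xi> \<in> carrier (amp n H)"
  shows "tuple_action n M (tuple_action n N \<xi>) = tuple_action n (\<lambda>i. M i * N i) \<xi>"
proof (rule amp_H_eqI)
  fix k i z assume k: "k < n" and z: "z \<in> carrier (H_comp K c i)"
  have "ip (H_comp K c i) (tuple_action n M (tuple_action n N \<xi>) k i) z =
      (\<Sum>l<n. \<Sum>m<n. M i $$ (k, l) * (N i $$ (l, m) * ip (H_comp K c i) (\<xi> m i) z))"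
    unfolding tuple_action_ip[OF tuple_action_closed[OF x] k z]
    by (intro sum.cong refl) (simp only: tuple_action_ip[OF x _ z] lessThan_iff sum_distrib_left)
  also have "\<dots> = (\<Sum>m<n. \<Sum>l<n. M i $$ (k, l) * (N i $$ (l, m) * ip (H_comp K c i) (\<xi> m i) z))"
    by (rule sum.swap)
  also have "\<dots> = ip (H_comp K c i) (tuple_action n (\<lambda>i. M i * N i) \<xi> k i) z"
    unfolding tuple_action_ip[OF x k z]
    by (intro sum.cong refl) (simp only: mult_mat_index[OF M N k] lessThan_iff sum_distrib_right mult.assoc)
  finally show "ip (H_comp K c i) (tuple_action n M (tuple_action n N \<xi>) k i) z = ip (H_comp K c i) (tuple_action n (\<lambda>i. M i * N i) \<xi> k i) z" .
qed (intro tuple_action_closed x)+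

lemma tuple_action_one:
  assumes x: "\<xi> \<in> carrier (amp n H)"
  shows "tuple_action n (\<lambda>_. 1\<^sub>m n) \<xi> = \<xi>"
proof (rule amp_H_eqI)
  fix k i z assume k: "k < n" and z: "z \<in> carrier (H_comp K c i)"
  have "(\<Sum>l<n. 1\<^sub>m n $$ (k, l) * ip (H_comp K c i) (\<xi> l i) z) = (\<Sum>l<n. if l = k then ip (H_comp K c i) (\<xi> l i) z else 0)"
    by (intro sum.cong refl) (use k in auto)
  also have "\<dots> = ip (H_comp K c i) (\<xi> k i) z" using k by simp
  finally show "ip (H_comp K c i) (tuple_action n (\<lambda>_. 1\<^sub>m n) \<xi> k i) z = ip (H_comp K c i) (\<xi> k i) z"
    by (simp only: tuple_action_ip[OF x k z])
qed (intro tuple_action_closed x)+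

lemma H_proj_bounded: "H_proj K c i \<in> bounded_ops H H"
proof (rule bounded_opsI)
  have pc: "H_proj K c i x \<in> carrier H" if x: "x \<in> carrier H" for x
    unfolding H_proj_apply[OF x] H_iff
    using H_component[OF x] H_component[OF H.zero_closed] by (simp add: H_zero[symmetric])
  then show "x \<in> carrier H \<Longrightarrow> H_proj K c i x \<in> carrier H" for x .
  show "H_proj K c i x = undefined" if "x \<notin> carrier H" for x using that by (simp add: H_proj_def hproj_def H_def)
  show "H_proj K c i (x \<oplus>\<^bsub>H\<^esub> y) = H_proj K c i x \<oplus>\<^bsub>H\<^esub> H_proj K c i y"
    if x: "x \<in> carrier H" and y: "y \<in> carrier H" for x y
  proof
    fix j
    interpret C: semi_inner_space "H_comp K c j" by (rule semi_inner_space_H_comp)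
    show "H_proj K c i (x \<oplus>\<^bsub>H\<^esub> y) j = (H_proj K c i x \<oplus>\<^bsub>H\<^esub> H_proj K c i y) j"
      unfolding H_add H_proj_apply[OF x] H_proj_apply[OF y] H_proj_apply[OF H.a_closed[OF x y]] by simp
  qed
  show "H_proj K c i (a \<odot>\<^bsub>H\<^esub> x) = a \<odot>\<^bsub>H\<^esub> H_proj K c i x" if x: "x \<in> carrier H" for a x
  proof
    fix j
    interpret C: semi_inner_space "H_comp K c j" by (rule semi_inner_space_H_comp)
    show "H_proj K c i (a \<odot>\<^bsub>H\<^esub> x) j = (a \<odot>\<^bsub>H\<^esub> H_proj K c i x) j"
      unfolding H_smult H_proj_apply[OF x] H_proj_apply[OF H.scale_closed[OF x]] by simp
  qed
  fix x assume x: "x \<in> carrier H"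
  have "hnorm H (H_proj K c i x) \<le> hnorm H x"
  proof (rule power2_le_imp_le[OF _ H.hnorm_nonneg[OF x]])
    have sq: "(hnorm H y)\<^sup>2 = (\<Sum>j\<in>UNIV. (hnorm (H_comp K c j) (y j))\<^sup>2)" if y: "y \<in> carrier H" for y
      using hsum_hnorm_sq[of UNIV "H_comp K c" y, OF semi_inner_space_H_comp y[unfolded H_def]] by (simp only: H_def)
    show "(hnorm H (H_proj K c i x))\<^sup>2 \<le> (hnorm H x)\<^sup>2"
      unfolding sq[OF x] sq[OF pc[OF x]]
    proof (rule sum_mono)
      fix j
      interpret C: semi_inner_space "H_comp K c j" by (rule semi_inner_space_H_comp)
      show "(hnorm (H_comp K c j) (H_proj K c i x j))\<^sup>2 \<le> (hnorm (H_comp K c j) (x j))\<^sup>2"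
        unfolding H_proj_apply[OF x] by simp
    qed
  qed
  then show "hnorm H (H_proj K c i x) \<le> 1 * hnorm H x" by simp
qed

lemma sum_tensor_proj:
  assumes x: "\<xi> \<in> carrier (amp n H)"
  shows "finsum (amp n H) (\<lambda>i. tensor H H n (H_proj K c i) (M i) \<xi>) UNIV = tuple_action n M \<xi>"
proof (rule amp_H_eqI)
  interpret A: semi_inner_space "amp n H" by (rule amp_Hs)
  have T: "tensor H H n (H_proj K c i) (M i) \<in> bounded_ops (amp n H) (amp n H)" for i
    by (rule tensor_bounded(1)[OF Hs Hs H_proj_bounded bounded_ops_opnorm_nonneg[OF H_proj_bounded Hs]
          bounded_ops_opnorm[OF H_proj_bounded Hs]])
  note Tc = bounded_ops_closed[OF T x]
  show "finsum (amp n H) (\<lambda>i. tensor H H n (H_proj K c i) (M i) \<xi>) UNIV \<in> carrier (amp n H)"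
    by (intro A.finsum_closed funcsetI Tc)
  fix k j z assume k: "k < n" and z: "z \<in> carrier (H_comp K c j)"
  interpret C: semi_inner_space "H_comp K c j" by (rule semi_inner_space_H_comp)
  have pc: "H_proj K c i (\<xi> l) \<in> carrier H" if "l < n" for i l
    by (rule bounded_ops_closed[OF H_proj_bounded amp_component[OF x that]])
  have "finsum (amp n H) (\<lambda>i. tensor H H n (H_proj K c i) (M i) \<xi>) UNIV k j =
      finsum H (\<lambda>i. tensor H H n (H_proj K c i) (M i) \<xi> k) UNIV j"
    using k by (simp add: amp_finsum[OF Hs _ Tc])
  also have "\<dots> = finsum (H_comp K c j) (\<lambda>i. tensor H H n (H_proj K c i) (M i) \<xi> k j) UNIV"
    by (rule H_finsum) (simp_all add: amp_component[OF Tc k])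
  finally have e: "finsum (amp n H) (\<lambda>i. tensor H H n (H_proj K c i) (M i) \<xi>) UNIV k j =
      finsum (H_comp K c j) (\<lambda>i. tensor H H n (H_proj K c i) (M i) \<xi> k j) UNIV" .
  have "ip (H_comp K c j) (finsum (H_comp K c j) (\<lambda>i. tensor H H n (H_proj K c i) (M i) \<xi> k j) UNIV) z =
      (\<Sum>i\<in>UNIV. ip (H_comp K c j) (tensor H H n (H_proj K c i) (M i) \<xi> k j) z)"
    by (rule C.ip_finsum_left) (simp_all add: amp_H_value[OF Tc k] z)
  also have "\<dots> = (\<Sum>i\<in>UNIV. if i = j then (\<Sum>l<n. M j $$ (k, l) * ip (H_comp K c j) (\<xi> l j) z) else 0)"
  proof (intro sum.cong refl)
    fix i
    have "tensor H H n (H_proj K c i) (M i) \<xi> k j = finsum (H_comp K c j) (\<lambda>l. (M i $$ (k, l) \<odot>\<^bsub>H\<^esub> H_proj K c i (\<xi> l)) j) {..<n}"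
      unfolding tensor_apply[OF x k] by (rule H_finsum) (simp_all add: pc)
    then have "ip (H_comp K c j) (tensor H H n (H_proj K c i) (M i) \<xi> k j) z =
        (\<Sum>l<n. ip (H_comp K c j) ((M i $$ (k, l) \<odot>\<^bsub>H\<^esub> H_proj K c i (\<xi> l)) j) z)"
      by (simp only:) (rule C.ip_finsum_left, simp_all add: H_component[OF H.scale_closed[OF pc]] z)
    also have "\<dots> = (\<Sum>l<n. M i $$ (k, l) * ip (H_comp K c j) (H_proj K c i (\<xi> l) j) z)"
    proof (intro sum.cong refl)
      fix l assume "l \<in> {..<n}"
      then have l: "l < n" by simp
      show "ip (H_comp K c j) ((M i $$ (k, l) \<odot>\<^bsub>H\<^esub> H_proj K c i (\<xi> l)) j) z =
          M i $$ (k, l) * ip (H_comp K c j) (H_proj K c i (\<xi> l) j) z"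
        by (simp only: H_smult C.ip_smult[OF H_component[OF pc[OF l]] z])
    qed
    also have "\<dots> = (if i = j then (\<Sum>l<n. M j $$ (k, l) * ip (H_comp K c j) (\<xi> l j) z) else 0)"
    proof -
      have p: "H_proj K c i (\<xi> l) j = (if j = i then \<xi> l j else \<zero>\<^bsub>H_comp K c j\<^esub>)" if "l < n" for l
        by (simp only: H_proj_apply[OF amp_component[OF x that]])
      have "M i $$ (k, l) * ip (H_comp K c j) (H_proj K c i (\<xi> l) j) z =
          (if i = j then M j $$ (k, l) * ip (H_comp K c j) (\<xi> l j) z else 0)" if "l < n" for l
        unfolding p[OF that] using C.ip_zero_left[OF z] by simp
      then have "(\<Sum>l<n. M i $$ (k, l) * ip (H_comp K c j) (H_proj K c i (\<xi> l) j) z) =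
          (\<Sum>l<n. if i = j then M j $$ (k, l) * ip (H_comp K c j) (\<xi> l j) z else 0)"
        by (intro sum.cong refl) simp
      then show ?thesis by simp
    qed
    finally show "ip (H_comp K c j) (tensor H H n (H_proj K c i) (M i) \<xi> k j) z =
        (if i = j then (\<Sum>l<n. M j $$ (k, l) * ip (H_comp K c j) (\<xi> l j) z) else 0)" .
  qed
  finally have s: "ip (H_comp K c j) (finsum (H_comp K c j) (\<lambda>i. tensor H H n (H_proj K c i) (M i) \<xi> k j) UNIV) z =
      (\<Sum>i\<in>UNIV. if i = j then (\<Sum>l<n. M j $$ (k, l) * ip (H_comp K c j) (\<xi> l j) z) else 0)" .
  have d: "(\<Sum>i\<in>UNIV. if i = j then (\<Sum>l<n. M j $$ (k, l) * ip (H_comp K c j) (\<xi> l j) z) else 0) =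
      (\<Sum>l<n. M j $$ (k, l) * ip (H_comp K c j) (\<xi> l j) z)"
    using sum.delta[of UNIV j "\<lambda>_. \<Sum>l<n. M j $$ (k, l) * ip (H_comp K c j) (\<xi> l j) z"] by simp
  show "ip (H_comp K c j) (finsum (amp n H) (\<lambda>i. tensor H H n (H_proj K c i) (M i) \<xi>) UNIV k j) z =
      ip (H_comp K c j) (tuple_action n M \<xi> k j) z" unfolding e s d by (rule tuple_action_ip[OF x k z, symmetric])
qed (rule tuple_action_closed[OF x])

end

context monotone_series
begin

lemma tensor_A_bounded:
  assumes A: "is_A K c A"
  shows "tensor H H n A (1\<^sub>m n) \<in> bounded_ops (amp n H) (amp n H)"
proof -
  have Ab: "A \<in> bounded_ops H H" using A unfolding is_A_def by blast
  show ?thesis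
    by (rule tensor_bounded(1)[OF Hs Hs Ab bounded_ops_opnorm_nonneg[OF Ab Hs] bounded_ops_opnorm[OF Ab Hs]])
qed

lemma tensor_A_apply:
  assumes A: "is_A K c A" and x: "\<xi> \<in> carrier (amp n H)" and k: "k < n"
  shows "tensor H H n A (1\<^sub>m n) \<xi> k = A (\<xi> k)"
proof -
  have Ab: "A \<in> bounded_ops H H" using A unfolding is_A_def by blast
  show ?thesis by (rule tensor_one_apply[OF Hs Ab x k])
qed

lemma tensor_A_hnorm_le:
  assumes A: "is_A K c A" and x: "\<xi> \<in> carrier (amp n H)" and s: "1 < s" "s < r"
  shows "hnorm (amp n H) (tensor H H n A (1\<^sub>m n) \<xi>) \<le> (1 / s) * hnorm (amp n H) \<xi>"
proof (rule power2_le_imp_le)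
  have Ab: "A \<in> bounded_ops H H" using A unfolding is_A_def by blast
  have "(hnorm (amp n H) (tensor H H n A (1\<^sub>m n) \<xi>))\<^sup>2 = (\<Sum>k<n. (hnorm H (A (\<xi> k)))\<^sup>2)"
    unfolding amp_hnorm_sq[OF Hs bounded_ops_closed[OF tensor_A_bounded[OF A] x]]
    by (intro sum.cong refl) (simp only: tensor_A_apply[OF A x] lessThan_iff)
  also have "\<dots> \<le> (\<Sum>k<n. ((1 / s) * hnorm H (\<xi> k))\<^sup>2)"
    by (intro sum_mono power_mono is_A_bound[OF A _ s] H.hnorm_nonneg bounded_ops_closed[OF Ab] amp_component[OF x]) simp_all
  also have "\<dots> = ((1 / s) * hnorm (amp n H) \<xi>)\<^sup>2"
    unfolding power_mult_distrib amp_hnorm_sq[OF Hs x] sum_distrib_left ..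
  finally show "(hnorm (amp n H) (tensor H H n A (1\<^sub>m n) \<xi>))\<^sup>2 \<le> ((1 / s) * hnorm (amp n H) \<xi>)\<^sup>2" .
  show "0 \<le> (1 / s) * hnorm (amp n H) \<xi>"
    by (intro mult_nonneg_nonneg semi_inner_space.hnorm_nonneg[OF amp_Hs x]) (use s in simp)
qed

text \<open>With \<open>t = tuple_norm n Z < r\<close> the norm of \<open>Z A\<close> is at most \<open>t / s\<close> for every \<open>s\<close> with \<open>1 < s < r\<close>, and
  some such \<open>s\<close> exceeds \<open>t\<close>.\<close>

lemma tuple_action_A_contraction:
  assumes A: "is_A K c A" and Z: "Z \<in> ball_C n r"
  obtains q where "0 \<le> q" "q < 1"
    "\<And>\<xi>. \<xi> \<in> carrier (amp n H) \<Longrightarrow>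
      hnorm (amp n H) (tuple_action n Z (tensor H H n A (1\<^sub>m n) \<xi>)) \<le> q * hnorm (amp n H) \<xi>"
proof -
  define t where "t = tuple_norm n Z"
  have t0: "0 \<le> t" unfolding t_def using order_trans[OF mat_norm_nonneg mat_norm_le_tuple_norm] .
  have tr: "t < r" using Z by (simp add: ball_C_def t_def)
  \<comment> \<open>A number strictly between \<open>max 1 t\<close> and \<open>r\<close>.\<close>
  define s where "s = (max 1 t + r) / 2"
  have s: "1 < s" "s < r" "t < s" using tr radius by (auto simp: s_def)
  show ?thesis
  proof (rule that[of "t * (1 / s)"])
    show "0 \<le> t * (1 / s)" using t0 s by simp
    show "t * (1 / s) < 1" using s by simp
    fix \<xi> assume x: "\<xi> \<in> carrier (amp n H)"
    have "hnorm (amp n H) (tuple_action n Z (tensor H H n A (1\<^sub>m n) \<xi>)) \<le> t * hnorm (amp n H) (tensor H H n A (1\<^sub>m n) \<xi>)"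
      unfolding t_def by (rule tuple_action_hnorm_le[OF bounded_ops_closed[OF tensor_A_bounded[OF A] x]])
    also have "\<dots> \<le> t * ((1 / s) * hnorm (amp n H) \<xi>)"
      by (rule mult_left_mono[OF tensor_A_hnorm_le[OF A x s(1,2)] t0])
    finally show "hnorm (amp n H) (tuple_action n Z (tensor H H n A (1\<^sub>m n) \<xi>)) \<le> t * (1 / s) * hnorm (amp n H) \<xi>"
      by (simp only: mult.assoc)
  qed
qed

lemma pencil_apply:
  assumes "\<xi> \<in> carrier (amp n H)"
  shows "pencil n K c A Z \<xi> = tensor H H n A (1\<^sub>m n) \<xi> \<ominus>\<^bsub>amp n H\<^esub> tuple_action n (\<lambda>i. the (mat_inverse (Z i))) \<xi>"
  unfolding pencil_def Let_def using assms by (simp only: restrict_apply if_True sum_tensor_proj)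

text \<open>Applying \<open>Z = \<Sum>i. P\<^sub>i \<otimes> Z\<^sub>i\<close> to \<open>(A - Z\<^sup>-\<^sup>1) y = \<eta>\<close> gives the equivalent equation \<open>y = - Z \<eta> + Z A y\<close>,
  which \<open>neumann_solution\<close> solves. The last clause records this equation for later use.\<close>

lemma pencil_inverse:
  assumes A: "is_A K c A" and Z: "Z \<in> ball_C n r" and inv: "\<And>i. invertible_mat (Z i)"
  shows "op_invertible (amp n H) (pencil n K c A Z)"
    and "\<And>\<eta>. \<eta> \<in> carrier (amp n H) \<Longrightarrow> op_inverse (amp n H) (pencil n K c A Z) \<eta> \<in> carrier (amp n H)"
    and "\<And>\<eta>. \<eta> \<in> carrier (amp n H) \<Longrightarrow>
      op_inverse (amp n H) (pencil n K c A Z) \<eta> = (\<ominus>\<^bsub>amp n H\<^esub> tuple_action n Z \<eta>) \<oplus>\<^bsub>amp n H\<^esub>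
        tuple_action n Z (tensor H H n A (1\<^sub>m n) (op_inverse (amp n H) (pencil n K c A Z) \<eta>))"
proof -
  interpret L: hilbert_space "amp n H" by (rule hilbert_amp_H)
  note Ls = amp_Hs[of n]
  let ?L = "amp n H" and ?T = "tensor H H n A (1\<^sub>m n)" and ?Zi = "\<lambda>i. the (mat_inverse (Z i))"
  let ?G = "\<lambda>x\<in>carrier (amp n H). tuple_action n Z (?T x)"
  note T = tensor_A_bounded[OF A, of n]
  note Tc = bounded_ops_closed[OF T]
  note Zc = ball_CD[OF Z]
  note Zi = mat_inverse_invertible[OF Zc inv]
  have Gb: "?G \<in> bounded_ops ?L ?L" by (rule bounded_ops_compose[OF Ls Ls tuple_action_bounded T])
  obtain q where q: "0 \<le> q" "q < 1"
    and Gq: "\<And>\<xi>. \<xi> \<in> carrier ?L \<Longrightarrow> hnorm ?L (tuple_action n Z (?T \<xi>)) \<le> q * hnorm ?L \<xi>"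
    using tuple_action_A_contraction[OF A Z] by blast
  have ZZi: "tuple_action n Z (tuple_action n ?Zi x) = x" if x: "x \<in> carrier ?L" for x
    unfolding tuple_action_mult[of Z n ?Zi, OF Zc Zi(1) x] Zi(2) by (rule tuple_action_one[OF x])
  have ZiZ: "tuple_action n ?Zi (tuple_action n Z x) = x" if x: "x \<in> carrier ?L" for x
    unfolding tuple_action_mult[of ?Zi n Z, OF Zi(1) Zc x] Zi(3) by (rule tuple_action_one[OF x])
  have pb: "pencil n K c A Z \<in> bounded_ops ?L ?L"
  proof -
    have "pencil n K c A Z = (\<lambda>x\<in>carrier ?L. ?T x \<ominus>\<^bsub>?L\<^esub> tuple_action n ?Zi x)"
    proof (rule ext)
      fix x
      show "pencil n K c A Z x = (\<lambda>x\<in>carrier ?L. ?T x \<ominus>\<^bsub>?L\<^esub> tuple_action n ?Zi x) x"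
        using pencil_apply[of x n A Z] by (cases "x \<in> carrier ?L") (simp_all add: pencil_def Let_def)
    qed
    then show ?thesis using bounded_ops_diff[OF Ls hilbert_amp_H T tuple_action_bounded] by simp
  qed
  let ?P = "\<lambda>h y. y \<in> carrier ?L \<and> y = (\<ominus>\<^bsub>?L\<^esub> tuple_action n Z h) \<oplus>\<^bsub>?L\<^esub> tuple_action n Z (?T y)"
  have ex: "\<exists>y. ?P h y" if h: "h \<in> carrier ?L" for h
  proof -
    have "\<ominus>\<^bsub>?L\<^esub> tuple_action n Z h \<in> carrier ?L" by (intro L.a_inv_closed tuple_action_closed h)
    moreover have "hnorm ?L (?G x) \<le> q * hnorm ?L x" if "x \<in> carrier ?L" for x using Gq[OF that] that by simp
    ultimately obtain y where y: "y \<in> carrier ?L" "y = (\<ominus>\<^bsub>?L\<^esub> tuple_action n Z h) \<oplus>\<^bsub>?L\<^esub> ?G y"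
      using neumann_solution[OF hilbert_amp_H Gb q, of "\<ominus>\<^bsub>?L\<^esub> tuple_action n Z h"] by blast
    have "?G y = tuple_action n Z (?T y)" using y(1) by simp
    with y show ?thesis by metis
  qed
  define R where "R h = (SOME y. ?P h y)" for h
  have R: "?P h (R h)" if "h \<in> carrier ?L" for h
    unfolding R_def by (rule someI_ex[OF ex[OF that]])
  have Rc: "R h \<in> carrier ?L" if "h \<in> carrier ?L" for h using R[OF that] by blast
  have unique: "x = y" if h: "h \<in> carrier ?L" and x: "?P h x" and y: "?P h y" for h x y
  proof -
    have xc: "x \<in> carrier ?L" and yc: "y \<in> carrier ?L" using x y by blast+
    have hc: "\<ominus>\<^bsub>?L\<^esub> tuple_action n Z h \<in> carrier ?L" by (intro L.a_inv_closed tuple_action_closed h)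
    have ac: "tuple_action n Z (?T x) \<in> carrier ?L" "tuple_action n Z (?T y) \<in> carrier ?L" by (intro tuple_action_closed Tc xc yc)+
    have "x \<ominus>\<^bsub>?L\<^esub> y = ((\<ominus>\<^bsub>?L\<^esub> tuple_action n Z h) \<oplus>\<^bsub>?L\<^esub> tuple_action n Z (?T x)) \<ominus>\<^bsub>?L\<^esub> ((\<ominus>\<^bsub>?L\<^esub> tuple_action n Z h) \<oplus>\<^bsub>?L\<^esub> tuple_action n Z (?T y))"
      using x y by (intro arg_cong2[where f = "\<lambda>u v. u \<ominus>\<^bsub>?L\<^esub> v"]) blast+
    also have "\<dots> = tuple_action n Z (?T x) \<ominus>\<^bsub>?L\<^esub> tuple_action n Z (?T y)"
      by (rule L.eqI_ip) (simp_all only: L.ip_minus_left L.ip_add hc ac L.a_closed L.minus_closed, simp)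
    also have "\<dots> = ?G (x \<ominus>\<^bsub>?L\<^esub> y)"
      using bounded_ops_minus[OF Gb Ls Ls xc yc] xc yc by simp
    finally have "x \<ominus>\<^bsub>?L\<^esub> y = tuple_action n Z (?T (x \<ominus>\<^bsub>?L\<^esub> y))" using xc yc by simp
    then have "hnorm ?L (x \<ominus>\<^bsub>?L\<^esub> y) \<le> q * hnorm ?L (x \<ominus>\<^bsub>?L\<^esub> y)"
      using Gq[OF L.minus_closed[OF xc yc]] by simp
    then have "(1 - q) * hnorm ?L (x \<ominus>\<^bsub>?L\<^esub> y) \<le> 0" by (simp add: left_diff_distrib)
    then have "hnorm ?L (x \<ominus>\<^bsub>?L\<^esub> y) \<le> 0" using q by (simp add: mult_le_0_iff)
    then have "hnorm ?L (x \<ominus>\<^bsub>?L\<^esub> y) = 0"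
      using L.hnorm_nonneg[OF L.minus_closed[OF xc yc]] by simp
    then show ?thesis by (rule L.eqI_hnorm[OF xc yc])
  qed
  have PR: "pencil n K c A Z (R h) = h" if h: "h \<in> carrier ?L" for h
  proof -
    note rc = Rc[OF h]
    have tc: "?T (R h) \<in> carrier ?L" by (rule Tc[OF rc])
    have z1: "tuple_action n Z h \<in> carrier ?L" by (rule tuple_action_closed[OF h])
    have z2: "tuple_action n Z (?T (R h)) \<in> carrier ?L" by (rule tuple_action_closed[OF tc])
    have "tuple_action n ?Zi (R h) = tuple_action n ?Zi ((\<ominus>\<^bsub>?L\<^esub> tuple_action n Z h) \<oplus>\<^bsub>?L\<^esub> tuple_action n Z (?T (R h)))"
      using R[OF h] by (intro arg_cong[where f = "tuple_action n ?Zi"]) blast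
    also have "\<dots> = tuple_action n ?Zi (\<ominus>\<^bsub>?L\<^esub> tuple_action n Z h) \<oplus>\<^bsub>?L\<^esub> tuple_action n ?Zi (tuple_action n Z (?T (R h)))"
      by (rule bounded_ops_add[OF tuple_action_bounded L.a_inv_closed[OF z1] z2])
    also have "tuple_action n ?Zi (\<ominus>\<^bsub>?L\<^esub> tuple_action n Z h) = \<ominus>\<^bsub>?L\<^esub> h"
      unfolding L.uminus_eq_scale[OF z1] L.uminus_eq_scale[OF h] bounded_ops_smult[OF tuple_action_bounded z1] ZiZ[OF h] ..
    also have "tuple_action n ?Zi (tuple_action n Z (?T (R h))) = ?T (R h)" by (rule ZiZ[OF tc])
    finally have e: "tuple_action n ?Zi (R h) = (\<ominus>\<^bsub>?L\<^esub> h) \<oplus>\<^bsub>?L\<^esub> ?T (R h)" .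
    have "?T (R h) \<ominus>\<^bsub>?L\<^esub> ((\<ominus>\<^bsub>?L\<^esub> h) \<oplus>\<^bsub>?L\<^esub> ?T (R h)) = h"
      by (rule L.eqI_ip) (simp_all add: L.ip_minus_left L.ip_add L.ip_uminus_left tc h)
    then show ?thesis unfolding pencil_apply[OF rc] e .
  qed
  have pc: "pencil n K c A Z x \<in> carrier ?L" if "x \<in> carrier ?L" for x by (rule bounded_ops_closed[OF pb that])
  have RP: "R (pencil n K c A Z x) = x" if x: "x \<in> carrier ?L" for x
  proof (rule unique[OF pc[OF x] R[OF pc[OF x]]])
    have tc: "?T x \<in> carrier ?L" by (rule Tc[OF x])
    have ic: "tuple_action n ?Zi x \<in> carrier ?L" by (rule tuple_action_closed[OF x])
    have zc: "tuple_action n Z (?T x) \<in> carrier ?L" by (rule tuple_action_closed[OF tc])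
    have "tuple_action n Z (pencil n K c A Z x) = tuple_action n Z (?T x) \<ominus>\<^bsub>?L\<^esub> x"
      unfolding pencil_apply[OF x] bounded_ops_minus[OF tuple_action_bounded Ls Ls tc ic] ZZi[OF x] ..
    moreover have "x = (\<ominus>\<^bsub>?L\<^esub> (tuple_action n Z (?T x) \<ominus>\<^bsub>?L\<^esub> x)) \<oplus>\<^bsub>?L\<^esub> tuple_action n Z (?T x)"
      by (rule L.eqI_ip) (simp_all add: L.ip_minus_left L.ip_add L.ip_uminus_left zc x)
    ultimately show "?P (pencil n K c A Z x) x" using x by simp
  qed
  have bound: "hnorm ?L (R h) \<le> tuple_norm n Z / (1 - q) * hnorm ?L h" if h: "h \<in> carrier ?L" for h
  proof -
    note rc = Rc[OF h]
    have z1: "tuple_action n Z h \<in> carrier ?L" by (rule tuple_action_closed[OF h])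
    have z2: "tuple_action n Z (?T (R h)) \<in> carrier ?L" by (rule tuple_action_closed[OF Tc[OF rc]])
    have "hnorm ?L (R h) = hnorm ?L ((\<ominus>\<^bsub>?L\<^esub> tuple_action n Z h) \<oplus>\<^bsub>?L\<^esub> tuple_action n Z (?T (R h)))"
      using R[OF h] by (intro arg_cong[where f = "hnorm ?L"]) blast
    also have "\<dots> \<le> hnorm ?L (tuple_action n Z h) + hnorm ?L (tuple_action n Z (?T (R h)))"
      using L.hnorm_add_le[OF L.a_inv_closed[OF z1] z2] L.hnorm_uminus[OF z1] by simp
    also have "\<dots> \<le> tuple_norm n Z * hnorm ?L h + q * hnorm ?L (R h)"
      by (intro add_mono tuple_action_hnorm_le Gq h rc)
    finally have "(1 - q) * hnorm ?L (R h) \<le> tuple_norm n Z * hnorm ?L h" by (simp add: left_diff_distrib)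
    then show ?thesis using q by (simp add: pos_le_divide_eq mult.commute)
  qed
  show "op_invertible ?L (pencil n K c A Z)"
    by (rule op_invertibleI(1)[OF Ls pb Rc PR RP bound])
  have inv: "op_inverse ?L (pencil n K c A Z) h = R h" if "h \<in> carrier ?L" for h
    by (rule op_invertibleI(2)[OF Ls pb Rc PR RP bound that])
  show "op_inverse ?L (pencil n K c A Z) h \<in> carrier ?L" if "h \<in> carrier ?L" for h
    unfolding inv[OF that] by (rule Rc[OF that])
  show "op_inverse ?L (pencil n K c A Z) h = (\<ominus>\<^bsub>?L\<^esub> tuple_action n Z h) \<oplus>\<^bsub>?L\<^esub>
      tuple_action n Z (?T (op_inverse ?L (pencil n K c A Z) h))" if h: "h \<in> carrier ?L" for h
    unfolding inv[OF h] using R[OF h] by blast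
qed

end

lemma filterlim_short_words:
  "filterlim (short_words :: nat \<Rightarrow> 'd::finite list set) (finite_subsets_at_top UNIV) sequentially"
  unfolding filterlim_finite_subsets_at_top
proof (intro allI impI)
  fix X :: "'d list set" assume "finite X \<and> X \<subseteq> UNIV"
  then have "finite (length ` X)" by simp
  then obtain N where "\<forall>m\<in>length ` X. m \<le> N" using finite_nat_set_iff_bounded_le by blast
  then have "X \<subseteq> short_words M" if "M \<ge> N" for M using that by (force simp: short_words_def)
  then show "\<forall>\<^sub>F M in sequentially. finite (short_words M :: 'd list set) \<and> X \<subseteq> short_words M \<and> short_words M \<subseteq> UNIV"
    by (intro eventually_sequentiallyI[of N]) simp
qed

context monotone_series
begin

lemma hembed_combination:
  assumes "finite A" "\<And>l. l \<in> A \<Longrightarrow> u l \<in> carrier (word_space K c i)"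
  shows "(\<lambda>\<alpha>. finsum K (\<lambda>l. a l \<odot>\<^bsub>K\<^esub> u l \<alpha>) A) \<in> carrier (word_space K c i) \<and>
    finsum (H_comp K c i) (\<lambda>l. a l \<odot>\<^bsub>H_comp K c i\<^esub> hembed (word_space K c i) (u l)) A =
      hembed (word_space K c i) (\<lambda>\<alpha>. finsum K (\<lambda>l. a l \<odot>\<^bsub>K\<^esub> u l \<alpha>) A)"
  using assms
proof (induction A rule: finite_induct)
  case empty
  interpret V: semi_inner_space "word_space K c i" by (rule semi_inner_space_word_space)
  interpret C: semi_inner_space "H_comp K c i" by (rule semi_inner_space_H_comp)
  have "(\<lambda>_::'d list. \<zero>\<^bsub>K\<^esub>) = \<zero>\<^bsub>word_space K c i\<^esub>" by simp
  then show ?case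
    unfolding C.finsum_empty K.finsum_empty using V.zero_closed V.hembed_zero by (simp add: H_comp_def)
next
  case (insert m A)
  interpret V: semi_inner_space "word_space K c i" by (rule semi_inner_space_word_space)
  interpret C: semi_inner_space "H_comp K c i" by (rule semi_inner_space_H_comp)
  have um: "u m \<in> carrier (word_space K c i)" and ul: "\<And>l. l \<in> A \<Longrightarrow> u l \<in> carrier (word_space K c i)"
    using insert.prems by blast+
  let ?s = "\<lambda>\<alpha>. finsum K (\<lambda>l. a l \<odot>\<^bsub>K\<^esub> u l \<alpha>) A"
  have IH: "?s \<in> carrier (word_space K c i)"
    "finsum (H_comp K c i) (\<lambda>l. a l \<odot>\<^bsub>H_comp K c i\<^esub> hembed (word_space K c i) (u l)) A = hembed (word_space K c i) ?s"
    using insert.IH[OF ul] by blast+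
  have am: "a m \<odot>\<^bsub>word_space K c i\<^esub> u m \<in> carrier (word_space K c i)" by (rule V.scale_closed[OF um])
  have e: "(\<lambda>\<alpha>. finsum K (\<lambda>l. a l \<odot>\<^bsub>K\<^esub> u l \<alpha>) (insert m A)) = a m \<odot>\<^bsub>word_space K c i\<^esub> u m \<oplus>\<^bsub>word_space K c i\<^esub> ?s"
  proof
    fix \<alpha>
    have "finsum K (\<lambda>l. a l \<odot>\<^bsub>K\<^esub> u l \<alpha>) (insert m A) = a m \<odot>\<^bsub>K\<^esub> u m \<alpha> \<oplus>\<^bsub>K\<^esub> ?s \<alpha>"
      by (rule K.finsum_insert) (use insert.hyps word_space_value[OF um] word_space_value[OF ul] in auto)
    then show "finsum K (\<lambda>l. a l \<odot>\<^bsub>K\<^esub> u l \<alpha>) (insert m A) =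
        (a m \<odot>\<^bsub>word_space K c i\<^esub> u m \<oplus>\<^bsub>word_space K c i\<^esub> ?s) \<alpha>" by simp
  qed
  have "finsum (H_comp K c i) (\<lambda>l. a l \<odot>\<^bsub>H_comp K c i\<^esub> hembed (word_space K c i) (u l)) (insert m A) =
      a m \<odot>\<^bsub>H_comp K c i\<^esub> hembed (word_space K c i) (u m) \<oplus>\<^bsub>H_comp K c i\<^esub>
      finsum (H_comp K c i) (\<lambda>l. a l \<odot>\<^bsub>H_comp K c i\<^esub> hembed (word_space K c i) (u l)) A"
    by (rule C.finsum_insert) (use insert.hyps emb_component[OF um] emb_component[OF ul] in auto)
  also have "\<dots> = hembed (word_space K c i) (a m \<odot>\<^bsub>word_space K c i\<^esub> u m \<oplus>\<^bsub>word_space K c i\<^esub> ?s)"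
    unfolding IH(2) V.hembed_add[OF am IH(1)] V.hembed_smult[OF um] unfolding H_comp_def ..
  finally show ?case unfolding e using V.a_closed[OF am IH(1)] by blast
qed

text \<open>The coefficient vectors of \<open>\<Sum>m<M. (Z A)\<^sup>m Z Q \<xi>\<close>. Each factor \<open>Z A\<close> prepends one letter to all words and
  multiplies by its matrix, so the component in \<open>\<H>\<^sub>i\<close> is the sum of \<open>\<alpha> \<otimes> Z\<^sub>i Z\<^sup>\<alpha> \<xi>\<close> over the words \<open>\<alpha>\<close> shorter
  than \<open>M\<close>.\<close>

definition series_coeffs :: "nat \<Rightarrow> ('d \<Rightarrow> complex mat) \<Rightarrow> (nat \<Rightarrow> 'k) \<Rightarrow> nat \<Rightarrow> nat \<Rightarrow> 'd \<Rightarrow> 'd list \<Rightarrow> 'k" where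
  "series_coeffs n Z \<xi> M k i \<alpha> = (if length \<alpha> < M
     then finsum K (\<lambda>l. word_pow n Z (i # \<alpha>) $$ (k, l) \<odot>\<^bsub>K\<^esub> \<xi> l) {..<n} else \<zero>\<^bsub>K\<^esub>)"

lemma amp_combination_closed:
  assumes x: "\<xi> \<in> carrier (amp n K)"
  shows "finsum K (\<lambda>l. a l \<odot>\<^bsub>K\<^esub> \<xi> l) {..<n} \<in> carrier K"
  by (intro K.finsum_closed funcsetI K.scale_closed amp_component[OF x]) simp

lemma series_coeffs_support: "{\<alpha>. series_coeffs n Z \<xi> (Suc M) k i \<alpha> \<noteq> \<zero>\<^bsub>K\<^esub>} \<subseteq> short_words M"
  by (auto simp: series_coeffs_def short_words_def)

lemma series_coeffs_closed:
  assumes x: "\<xi> \<in> carrier (amp n K)"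
  shows "series_coeffs n Z \<xi> M k \<in> carrier W"
proof (rule W_I)
  show "series_coeffs n Z \<xi> M k i \<alpha> \<in> carrier K" for i \<alpha> by (simp add: series_coeffs_def amp_combination_closed[OF x])
  show "{\<alpha>. series_coeffs n Z \<xi> M k i \<alpha> \<noteq> \<zero>\<^bsub>K\<^esub>} \<subseteq> short_words M" for i by (auto simp: series_coeffs_def short_words_def)
qed

definition series_partial where
  "series_partial n Z \<xi> M = (\<lambda>k\<in>{..<n}. emb (series_coeffs n Z \<xi> M k))"

lemma series_partial_closed:
  assumes x: "\<xi> \<in> carrier (amp n K)"
  shows "series_partial n Z \<xi> M \<in> carrier (amp n H)"
  by (simp add: series_partial_def amp_simps emb_closed[OF series_coeffs_closed[OF x]])

lemma Q_amp_bounded: "Q_amp n K c \<in> bounded_ops (amp n K) (amp n H)"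
  unfolding Q_amp_def
  by (rule tensor_bounded(1)[OF Ks Hs Q_bounded bounded_ops_opnorm_nonneg[OF Q_bounded Ks] bounded_ops_opnorm[OF Q_bounded Ks]])

lemma Q_amp_apply:
  assumes x: "\<xi> \<in> carrier (amp n K)" and k: "k < n"
  shows "Q_amp n K c \<xi> k = emb (tuple_symbol [] (\<xi> k))"
  unfolding Q_amp_def tensor_one_apply[OF Hs Q_bounded x k]
  using amp_component[OF x k] by (simp add: Q_op_def H_symbol_eq)

text \<open>Horner's scheme: the words shorter than \<open>M + 1\<close> are the empty one, which comes from \<open>Q \<xi>\<close>, and the
  words \<open>j # \<gamma>\<close> with \<open>\<gamma>\<close> shorter than \<open>M\<close>, which come from applying \<open>A\<close>.\<close>

lemma series_partial_step:
  assumes A: "is_A K c A" and Z: "Z \<in> ball_C n r" and x: "\<xi> \<in> carrier (amp n K)"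
  shows "series_partial n Z \<xi> (Suc M) =
    tuple_action n Z (Q_amp n K c \<xi> \<oplus>\<^bsub>amp n H\<^esub> tensor H H n A (1\<^sub>m n) (series_partial n Z \<xi> M))"
proof -
  interpret L: hilbert_space "amp n H" by (rule hilbert_amp_H)
  note Zc = ball_CD[OF Z]
  let ?x = "Q_amp n K c \<xi> \<oplus>\<^bsub>amp n H\<^esub> tensor H H n A (1\<^sub>m n) (series_partial n Z \<xi> M)"
  have xc: "?x \<in> carrier (amp n H)"
    by (intro L.a_closed bounded_ops_closed[OF Q_amp_bounded x]
        bounded_ops_closed[OF tensor_A_bounded[OF A] series_partial_closed[OF x]])
  define v where "v l = tuple_symbol [] (\<xi> l) \<oplus>\<^bsub>W\<^esub> shift (series_coeffs n Z \<xi> M l)" for l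
  have vc: "v l \<in> carrier W" if "l < n" for l
    unfolding v_def by (intro W.a_closed tuple_symbol_closed shift_closed series_coeffs_closed[OF x] amp_component[OF x that])
  have xv: "?x l i = hembed (word_space K c i) (v l i)" if l: "l < n" for l i
  proof -
    have "?x l = Q_amp n K c \<xi> l \<oplus>\<^bsub>H\<^esub> tensor H H n A (1\<^sub>m n) (series_partial n Z \<xi> M) l"
      using l by (simp add: amp_simps(3))
    also have "\<dots> = emb (tuple_symbol [] (\<xi> l)) \<oplus>\<^bsub>H\<^esub> emb (shift (series_coeffs n Z \<xi> M l))"
      unfolding Q_amp_apply[OF x l] tensor_A_apply[OF A series_partial_closed[OF x] l]
      using l by (simp add: series_partial_def is_A_emb[OF A series_coeffs_closed[OF x]])
    also have "\<dots> = emb (v l)"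
      unfolding v_def
      by (rule emb_add[OF tuple_symbol_closed[OF amp_component[OF x l]] shift_closed[OF series_coeffs_closed[OF x]], symmetric])
    finally show ?thesis by (simp only: emb_def)
  qed
  have coef: "finsum K (\<lambda>l. Z i $$ (k, l) \<odot>\<^bsub>K\<^esub> v l i \<beta>) {..<n} = series_coeffs n Z \<xi> (Suc M) k i \<beta>"
    if k: "k < n" for k i \<beta>
  proof (cases \<beta>)
    case Nil
    have "Z i * 1\<^sub>m n = Z i" using Zc[of i] by (rule right_mult_one_mat)
    then have p: "series_coeffs n Z \<xi> (Suc M) k i \<beta> = finsum K (\<lambda>l. Z i $$ (k, l) \<odot>\<^bsub>K\<^esub> \<xi> l) {..<n}"
      by (simp add: series_coeffs_def Nil)
    show ?thesis
      unfolding p by (rule K.finsum_cong'[OF refl])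
        (use amp_component[OF x] in \<open>auto simp: v_def W_add Nil tuple_symbol_def simp del: hsum_simps\<close>)
  next
    case (Cons j \<gamma>)
    have vj: "v l i \<beta> = series_coeffs n Z \<xi> M l j \<gamma>" if l: "l < n" for l
      unfolding v_def W_add using W_value[OF series_coeffs_closed[OF x]] by (simp add: Cons tuple_symbol_def)
    show ?thesis
    proof (cases "length \<gamma> < M")
      case False
      have "finsum K (\<lambda>l. Z i $$ (k, l) \<odot>\<^bsub>K\<^esub> v l i \<beta>) {..<n} = finsum K (\<lambda>l. \<zero>\<^bsub>K\<^esub>) {..<n}"
        by (rule K.finsum_cong'[OF refl]) (use False in \<open>auto simp: vj series_coeffs_def\<close>)
      also have "\<dots> = \<zero>\<^bsub>K\<^esub>" by (rule K.finsum_zero)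
      finally show ?thesis using False by (simp add: series_coeffs_def Cons)
    next
      case True
      have p: "series_coeffs n Z \<xi> (Suc M) k i \<beta> = finsum K (\<lambda>m. word_pow n Z (i # j # \<gamma>) $$ (k, m) \<odot>\<^bsub>K\<^esub> \<xi> m) {..<n}"
        using True by (simp add: series_coeffs_def Cons del: word_pow_simps)
      have pl: "series_coeffs n Z \<xi> M l j \<gamma> = finsum K (\<lambda>m. word_pow n Z (j # \<gamma>) $$ (l, m) \<odot>\<^bsub>K\<^esub> \<xi> m) {..<n}" for l
        using True by (simp add: series_coeffs_def del: word_pow_simps)
      have ip_comb: "ip K (finsum K (\<lambda>m. a m \<odot>\<^bsub>K\<^esub> \<xi> m) {..<n}) z = (\<Sum>m<n. a m * ip K (\<xi> m) z)"
        if z: "z \<in> carrier K" for a z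
      proof -
        have "ip K (finsum K (\<lambda>m. a m \<odot>\<^bsub>K\<^esub> \<xi> m) {..<n}) z = (\<Sum>m<n. ip K (a m \<odot>\<^bsub>K\<^esub> \<xi> m) z)"
          by (rule K.ip_finsum_left) (simp_all add: amp_component[OF x] z)
        also have "\<dots> = (\<Sum>m<n. a m * ip K (\<xi> m) z)"
          by (intro sum.cong refl K.ip_smult amp_component[OF x] z) simp
        finally show ?thesis .
      qed
      show ?thesis
      proof (rule K.eqI_ip)
        have vK: "v l i \<beta> \<in> carrier K" if "l < n" for l by (rule W_value[OF vc[OF that]])
        show "finsum K (\<lambda>l. Z i $$ (k, l) \<odot>\<^bsub>K\<^esub> v l i \<beta>) {..<n} \<in> carrier K"
          by (intro K.finsum_closed funcsetI K.scale_closed vK) simp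
        show "series_coeffs n Z \<xi> (Suc M) k i \<beta> \<in> carrier K" by (rule W_value[OF series_coeffs_closed[OF x]])
        fix z assume z: "z \<in> carrier K"
        have "ip K (finsum K (\<lambda>l. Z i $$ (k, l) \<odot>\<^bsub>K\<^esub> v l i \<beta>) {..<n}) z = (\<Sum>l<n. ip K (Z i $$ (k, l) \<odot>\<^bsub>K\<^esub> v l i \<beta>) z)"
          by (rule K.ip_finsum_left) (simp_all add: vK z)
        also have "\<dots> = (\<Sum>l<n. Z i $$ (k, l) * (\<Sum>m<n. word_pow n Z (j # \<gamma>) $$ (l, m) * ip K (\<xi> m) z))"
        proof (intro sum.cong refl)
          fix l assume "l \<in> {..<n}"
          then have l: "l < n" by simp
          show "ip K (Z i $$ (k, l) \<odot>\<^bsub>K\<^esub> v l i \<beta>) z = Z i $$ (k, l) * (\<Sum>m<n. word_pow n Z (j # \<gamma>) $$ (l, m) * ip K (\<xi> m) z)"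
            unfolding K.ip_smult[OF vK[OF l] z] unfolding vj[OF l] pl ip_comb[OF z] ..
        qed
        also have "\<dots> = (\<Sum>m<n. \<Sum>l<n. Z i $$ (k, l) * word_pow n Z (j # \<gamma>) $$ (l, m) * ip K (\<xi> m) z)"
          unfolding sum_distrib_left mult.assoc by (rule sum.swap)
        also have "\<dots> = (\<Sum>m<n. word_pow n Z (i # j # \<gamma>) $$ (k, m) * ip K (\<xi> m) z)"
          by (intro sum.cong refl) (simp only: word_pow_Cons_index[of Z n k, OF Zc k] lessThan_iff sum_distrib_right)
        also have "\<dots> = ip K (series_coeffs n Z \<xi> (Suc M) k i \<beta>) z" by (simp only: p ip_comb[OF z])
        finally show "ip K (finsum K (\<lambda>l. Z i $$ (k, l) \<odot>\<^bsub>K\<^esub> v l i \<beta>) {..<n}) z = ip K (series_coeffs n Z \<xi> (Suc M) k i \<beta>) z" .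
      qed
    qed
  qed
  show ?thesis
  proof (rule PiE_ext)
    show "series_partial n Z \<xi> (Suc M) \<in> {..<n} \<rightarrow>\<^sub>E carrier H" "tuple_action n Z ?x \<in> {..<n} \<rightarrow>\<^sub>E carrier H"
      using series_partial_closed[OF x, of Z "Suc M"] tuple_action_closed[OF xc, of Z] by (simp_all only: amp_simps)
    fix k assume "k \<in> {..<n}"
    then have k: "k < n" by simp
    show "series_partial n Z \<xi> (Suc M) k = tuple_action n Z ?x k"
    proof
      fix i
      interpret C: semi_inner_space "H_comp K c i" by (rule semi_inner_space_H_comp)
      have vi: "v l i \<in> carrier (word_space K c i)" if "l \<in> {..<n}" for l using vc that by (intro W_component) simp
      have "tuple_action n Z ?x k i = finsum (H_comp K c i) (\<lambda>l. Z i $$ (k, l) \<odot>\<^bsub>H_comp K c i\<^esub> ?x l i) {..<n}"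
        by (rule tuple_action_apply[OF xc k])
      also have "\<dots> = finsum (H_comp K c i) (\<lambda>l. Z i $$ (k, l) \<odot>\<^bsub>H_comp K c i\<^esub> hembed (word_space K c i) (v l i)) {..<n}"
        by (rule C.finsum_cong'[OF refl]) (use emb_component[OF vi] xv in auto)
      also have "\<dots> = hembed (word_space K c i) (\<lambda>\<beta>. finsum K (\<lambda>l. Z i $$ (k, l) \<odot>\<^bsub>K\<^esub> v l i \<beta>) {..<n})"
        using hembed_combination[of "{..<n}" "\<lambda>l. v l i" i "\<lambda>l. Z i $$ (k, l)", OF finite_lessThan vi] by blast
      also have "\<dots> = series_partial n Z \<xi> (Suc M) k i"
        unfolding coef[OF k] using k by (simp add: series_partial_def emb_def)
      finally show "series_partial n Z \<xi> (Suc M) k i = tuple_action n Z ?x k i" ..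
    qed
  qed
qed

text \<open>The inner product of \<open>\<alpha> \<otimes> v\<close> with \<open>1 \<otimes> k\<close> in \<open>\<H>\<^sub>i\<close> is \<open>\<langle>c (i # \<alpha>) v, k\<rangle>\<close>, and the words \<open>i # \<alpha>\<close> with
  \<open>length \<alpha> \<le> M\<close> are all nonempty words of length at most \<open>M + 1\<close>.\<close>

lemma Q_partial_ip:
  assumes Z: "Z \<in> ball_C n r" and x: "\<xi> \<in> carrier (amp n K)" and y: "\<eta> \<in> carrier (amp n K)"
  shows "ip (amp n H) (Q_amp n K c \<eta>) (series_partial n Z \<xi> (Suc M)) =
    cnj ((\<Sum>\<beta>\<in>short_words (Suc M). ip (amp n K) (tensor K K n (c \<beta>) (word_pow n Z \<beta>) \<xi>) \<eta>) -
      ip (amp n K) (tensor K K n (c []) (1\<^sub>m n) \<xi>) \<eta>)"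
proof -
  let ?g = "\<lambda>\<beta>. ip (amp n K) (tensor K K n (c \<beta>) (word_pow n Z \<beta>) \<xi>) \<eta>"
  have entry: "ip W (series_coeffs n Z \<xi> (Suc M) k) (tuple_symbol [] (\<eta> k)) =
      (\<Sum>i\<in>UNIV. \<Sum>\<alpha>\<in>short_words M. \<Sum>l<n. word_pow n Z (i # \<alpha>) $$ (k, l) * ip K (c (i # \<alpha>) (\<xi> l)) (\<eta> k))"
    if k: "k < n" for k
  proof -
    note yk = amp_component[OF y k]
    have S: "{\<alpha>. tuple_symbol [] (\<eta> k) i \<alpha> \<noteq> \<zero>\<^bsub>K\<^esub>} \<subseteq> short_words 0" for i by (auto simp: tuple_symbol_def short_words_def)
    have s0: "short_words 0 = {[] :: 'd list}" by (auto simp: short_words_def)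
    have "ip W (series_coeffs n Z \<xi> (Suc M) k) (tuple_symbol [] (\<eta> k)) =
        (\<Sum>i\<in>UNIV. \<Sum>\<alpha>\<in>short_words M. ip K (c (i # \<alpha>) (series_coeffs n Z \<xi> (Suc M) k i \<alpha>)) (\<eta> k))"
      unfolding W_ip[OF series_coeffs_closed[OF x] tuple_symbol_closed[OF yk] series_coeffs_support S] unfolding s0
      by (simp add: tuple_symbol_def)
    also have "\<dots> = (\<Sum>i\<in>UNIV. \<Sum>\<alpha>\<in>short_words M. \<Sum>l<n. word_pow n Z (i # \<alpha>) $$ (k, l) * ip K (c (i # \<alpha>) (\<xi> l)) (\<eta> k))"
    proof (intro sum.cong refl)
      fix i :: 'd and \<alpha> :: "'d list" assume a: "\<alpha> \<in> short_words M"
      let ?a = "\<lambda>l. word_pow n Z (i # \<alpha>) $$ (k, l)"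
      have p: "series_coeffs n Z \<xi> (Suc M) k i \<alpha> = finsum K (\<lambda>l. ?a l \<odot>\<^bsub>K\<^esub> \<xi> l) {..<n}"
        using a by (simp add: series_coeffs_def short_words_def del: word_pow_simps)
      have "c (i # \<alpha>) (finsum K (\<lambda>l. ?a l \<odot>\<^bsub>K\<^esub> \<xi> l) {..<n}) = finsum K (\<lambda>l. c (i # \<alpha>) (?a l \<odot>\<^bsub>K\<^esub> \<xi> l)) {..<n}"
        by (rule bounded_ops_finsum[OF c Ks Ks]) (simp_all add: amp_component[OF x])
      then have "ip K (c (i # \<alpha>) (series_coeffs n Z \<xi> (Suc M) k i \<alpha>)) (\<eta> k) =
          ip K (finsum K (\<lambda>l. c (i # \<alpha>) (?a l \<odot>\<^bsub>K\<^esub> \<xi> l)) {..<n}) (\<eta> k)" by (simp only: p)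
      also have "\<dots> = (\<Sum>l<n. ip K (c (i # \<alpha>) (?a l \<odot>\<^bsub>K\<^esub> \<xi> l)) (\<eta> k))"
        by (rule K.ip_finsum_left) (simp_all add: yk bounded_ops_closed[OF c] amp_component[OF x])
      also have "\<dots> = (\<Sum>l<n. ?a l * ip K (c (i # \<alpha>) (\<xi> l)) (\<eta> k))"
      proof (intro sum.cong refl)
        fix l assume "l \<in> {..<n}"
        then have l: "l < n" by simp
        show "ip K (c (i # \<alpha>) (?a l \<odot>\<^bsub>K\<^esub> \<xi> l)) (\<eta> k) = ?a l * ip K (c (i # \<alpha>) (\<xi> l)) (\<eta> k)"
          by (simp only: bounded_ops_smult[OF c amp_component[OF x l]] K.ip_smult[OF bounded_ops_closed[OF c amp_component[OF x l]] yk])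
      qed
      finally show "ip K (c (i # \<alpha>) (series_coeffs n Z \<xi> (Suc M) k i \<alpha>)) (\<eta> k) = (\<Sum>l<n. ?a l * ip K (c (i # \<alpha>) (\<xi> l)) (\<eta> k))" .
    qed
    finally show ?thesis .
  qed
  have "ip (amp n H) (Q_amp n K c \<eta>) (series_partial n Z \<xi> (Suc M)) =
      (\<Sum>k<n. cnj (ip W (series_coeffs n Z \<xi> (Suc M) k) (tuple_symbol [] (\<eta> k))))"
    unfolding amp_simps(2)
  proof (intro sum.cong refl)
    fix k assume "k \<in> {..<n}"
    then have k: "k < n" by simp
    note sc = tuple_symbol_closed[OF amp_component[OF y k], of "[]"] and pc = series_coeffs_closed[OF x, of Z "Suc M" k]
    have "ip H (Q_amp n K c \<eta> k) (series_partial n Z \<xi> (Suc M) k) = ip H (emb (tuple_symbol [] (\<eta> k))) (emb (series_coeffs n Z \<xi> (Suc M) k))"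
      unfolding Q_amp_apply[OF y k] using k by (simp add: series_partial_def)
    also have "\<dots> = ip W (tuple_symbol [] (\<eta> k)) (series_coeffs n Z \<xi> (Suc M) k)" by (rule emb_ip[OF sc pc])
    also have "\<dots> = cnj (ip W (series_coeffs n Z \<xi> (Suc M) k) (tuple_symbol [] (\<eta> k)))" by (rule W.ip_cnj[OF pc sc])
    finally show "ip H (Q_amp n K c \<eta> k) (series_partial n Z \<xi> (Suc M) k) =
        cnj (ip W (series_coeffs n Z \<xi> (Suc M) k) (tuple_symbol [] (\<eta> k)))" .
  qed
  also have "\<dots> = cnj (\<Sum>k<n. \<Sum>i\<in>UNIV. \<Sum>\<alpha>\<in>short_words M. \<Sum>l<n. word_pow n Z (i # \<alpha>) $$ (k, l) * ip K (c (i # \<alpha>) (\<xi> l)) (\<eta> k))"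
    unfolding cnj_sum[symmetric] by (intro arg_cong[where f = cnj] sum.cong refl entry) simp
  also have "(\<Sum>k<n. \<Sum>i\<in>UNIV. \<Sum>\<alpha>\<in>short_words M. \<Sum>l<n. word_pow n Z (i # \<alpha>) $$ (k, l) * ip K (c (i # \<alpha>) (\<xi> l)) (\<eta> k)) =
      (\<Sum>i\<in>UNIV. \<Sum>k<n. \<Sum>\<alpha>\<in>short_words M. \<Sum>l<n. word_pow n Z (i # \<alpha>) $$ (k, l) * ip K (c (i # \<alpha>) (\<xi> l)) (\<eta> k))"
    by (rule sum.swap)
  also have "\<dots> = (\<Sum>i\<in>UNIV. \<Sum>\<alpha>\<in>short_words M. \<Sum>k<n. \<Sum>l<n. word_pow n Z (i # \<alpha>) $$ (k, l) * ip K (c (i # \<alpha>) (\<xi> l)) (\<eta> k))"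
    by (intro sum.cong refl sum.swap)
  also have "\<dots> = (\<Sum>i\<in>UNIV. \<Sum>\<alpha>\<in>short_words M. ?g (i # \<alpha>))"
    by (intro sum.cong refl tensor_ip[OF Ks c x y, symmetric])
  also have "\<dots> = (\<Sum>\<beta>\<in>short_words (Suc M). ?g \<beta>) - ?g []"
    unfolding sum_short_words_Suc by simp
  finally show ?thesis by simp
qed

text \<open>Let \<open>y\<close> be the inverse of the pencil applied to \<open>Q \<xi>\<close>. The partial sums of the series tend to \<open>- y\<close>,
  because adding \<open>y\<close> to them leaves a quantity that \<open>Z A\<close> contracts at each step. Their pairings with
  \<open>Q \<eta>\<close> tend to those of \<open>f(Z) \<xi> - c\<^sub>1 \<xi>\<close> by \<open>Q_partial_ip\<close>, so \<open>Q\<^sup>* y = c\<^sub>1 \<xi> - f(Z) \<xi>\<close>.\<close>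

lemma realization_formula:
  assumes A: "is_A K c A" and Z: "Z \<in> ball_C n r" and inv: "\<And>i. invertible_mat (Z i)"
    and x: "\<xi> \<in> carrier (amp n K)"
  shows "f n Z \<xi> = tensor K K n (c []) (1\<^sub>m n) \<xi> \<ominus>\<^bsub>amp n K\<^esub>
    hadjoint (amp n K) (amp n H) (Q_amp n K c) (op_inverse (amp n H) (pencil n K c A Z) (Q_amp n K c \<xi>))"
proof -
  interpret L: hilbert_space "amp n H" by (rule hilbert_amp_H)
  interpret KA: hilbert_space "amp n K" by (rule hilbert_space_amp[OF K])
  note KAs = KA.semi_inner_space_axioms and Ls = L.semi_inner_space_axioms
  let ?T = "tensor H H n A (1\<^sub>m n)" and ?Q = "Q_amp n K c" and ?c0 = "tensor K K n (c []) (1\<^sub>m n) \<xi>"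
  note Tb = tensor_A_bounded[OF A, of n]
  note Tc = bounded_ops_closed[OF Tb] and Qc = bounded_ops_closed[OF Q_amp_bounded]
  define y where "y = op_inverse (amp n H) (pencil n K c A Z) (?Q \<xi>)"
  have yc: "y \<in> carrier (amp n H)" unfolding y_def by (rule pencil_inverse(2)[OF A Z inv Qc[OF x]])
  have ye: "y = (\<ominus>\<^bsub>amp n H\<^esub> tuple_action n Z (?Q \<xi>)) \<oplus>\<^bsub>amp n H\<^esub> tuple_action n Z (?T y)"
    unfolding y_def by (rule pencil_inverse(3)[OF A Z inv Qc[OF x]])
  let ?p = "series_partial n Z \<xi>"
  note pc = series_partial_closed[OF x, of Z]
  obtain q where q: "0 \<le> q" "q < 1"
    and Gq: "\<And>\<xi>. \<xi> \<in> carrier (amp n H) \<Longrightarrow> hnorm (amp n H) (tuple_action n Z (?T \<xi>)) \<le> q * hnorm (amp n H) \<xi>"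
    using tuple_action_A_contraction[OF A Z] by blast
  have step: "?p (Suc M) \<oplus>\<^bsub>amp n H\<^esub> y = tuple_action n Z (?T (?p M \<oplus>\<^bsub>amp n H\<^esub> y))" for M
  proof -
    have c1: "tuple_action n Z (?Q \<xi>) \<in> carrier (amp n H)" by (intro tuple_action_closed Qc x)
    have c2: "tuple_action n Z (?T (?p M)) \<in> carrier (amp n H)" by (intro tuple_action_closed Tc pc)
    have c3: "tuple_action n Z (?T y) \<in> carrier (amp n H)" by (intro tuple_action_closed Tc yc)
    have "?p (Suc M) = tuple_action n Z (?Q \<xi>) \<oplus>\<^bsub>amp n H\<^esub> tuple_action n Z (?T (?p M))"
      unfolding series_partial_step[OF A Z x] by (rule bounded_ops_add[OF tuple_action_bounded Qc[OF x] Tc[OF pc]])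
    then have "?p (Suc M) \<oplus>\<^bsub>amp n H\<^esub> y = (tuple_action n Z (?Q \<xi>) \<oplus>\<^bsub>amp n H\<^esub> tuple_action n Z (?T (?p M))) \<oplus>\<^bsub>amp n H\<^esub>
        ((\<ominus>\<^bsub>amp n H\<^esub> tuple_action n Z (?Q \<xi>)) \<oplus>\<^bsub>amp n H\<^esub> tuple_action n Z (?T y))"
      using ye by (rule arg_cong2)
    also have "\<dots> = tuple_action n Z (?T (?p M)) \<oplus>\<^bsub>amp n H\<^esub> tuple_action n Z (?T y)"
      by (rule L.eqI_ip) (simp_all add: L.ip_add L.ip_uminus_left c1 c2 c3)
    also have "\<dots> = tuple_action n Z (?T (?p M \<oplus>\<^bsub>amp n H\<^esub> y))"
      by (simp only: bounded_ops_add[OF Tb pc yc] bounded_ops_add[OF tuple_action_bounded Tc[OF pc] Tc[OF yc]])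
    finally show ?thesis .
  qed
  have pyc: "?p M \<oplus>\<^bsub>amp n H\<^esub> y \<in> carrier (amp n H)" for M by (intro L.a_closed pc yc)
  have decay: "hnorm (amp n H) (?p M \<oplus>\<^bsub>amp n H\<^esub> y) \<le> q ^ M * hnorm (amp n H) (?p 0 \<oplus>\<^bsub>amp n H\<^esub> y)" for M
  proof (induction M)
    case (Suc M)
    have "hnorm (amp n H) (?p (Suc M) \<oplus>\<^bsub>amp n H\<^esub> y) \<le> q * hnorm (amp n H) (?p M \<oplus>\<^bsub>amp n H\<^esub> y)"
      unfolding step by (rule Gq[OF pyc])
    also have "\<dots> \<le> q * (q ^ M * hnorm (amp n H) (?p 0 \<oplus>\<^bsub>amp n H\<^esub> y))"
      by (rule mult_left_mono[OF Suc q(1)])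
    finally show ?case by simp
  qed simp
  let ?z = "?c0 \<ominus>\<^bsub>amp n K\<^esub> f n Z \<xi>"
  have fb: "f n Z \<in> bounded_ops (amp n K) (amp n K)" using series Z by (auto simp: power_series_on_ball_def)
  have c0c: "?c0 \<in> carrier (amp n K)"
    by (rule bounded_ops_closed[OF tensor_bounded(1)[OF Ks Ks c bounded_ops_opnorm_nonneg[OF c Ks] bounded_ops_opnorm[OF c Ks]] x])
  have fc: "f n Z \<xi> \<in> carrier (amp n K)" by (rule bounded_ops_closed[OF fb x])
  have zc: "?z \<in> carrier (amp n K)" by (rule KA.minus_closed[OF c0c fc])
  have adj: "ip (amp n H) (?Q \<eta>) y = ip (amp n K) \<eta> ?z" if e: "\<eta> \<in> carrier (amp n K)" for \<eta>
  proof -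
    let ?g = "\<lambda>\<beta>. ip (amp n K) (tensor K K n (c \<beta>) (word_pow n Z \<beta>) \<xi>) \<eta>"
    have "((\<lambda>M. \<Sum>\<beta>\<in>short_words M. ?g \<beta>) \<longlongrightarrow> ip (amp n K) (f n Z \<xi>) \<eta>) sequentially"
      using power_series_has_sum[OF K c series Z x e] filterlim_short_words
      unfolding has_sum_def by (rule filterlim_compose)
    then have "(\<lambda>M. \<Sum>\<beta>\<in>short_words (Suc M). ?g \<beta>) \<longlonglongrightarrow> ip (amp n K) (f n Z \<xi>) \<eta>" by (rule LIMSEQ_Suc)
    then have "(\<lambda>M. cnj ((\<Sum>\<beta>\<in>short_words (Suc M). ?g \<beta>) - ip (amp n K) ?c0 \<eta>)) \<longlonglongrightarrow>
        cnj (ip (amp n K) (f n Z \<xi>) \<eta> - ip (amp n K) ?c0 \<eta>)"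
      by (intro tendsto_cnj tendsto_diff tendsto_const)
    then have 1: "(\<lambda>M. ip (amp n H) (?Q \<eta>) (?p (Suc M))) \<longlonglongrightarrow> cnj (ip (amp n K) (f n Z \<xi>) \<eta> - ip (amp n K) ?c0 \<eta>)"
      unfolding Q_partial_ip[OF Z x e] .
    have "(\<lambda>M. ip (amp n H) (?Q \<eta>) (?p M \<oplus>\<^bsub>amp n H\<^esub> y)) \<longlonglongrightarrow> 0"
    proof (rule tendsto_norm_zero_cancel, rule tendsto_sandwich[OF always_eventually always_eventually tendsto_const])
      let ?C = "hnorm (amp n H) (?p 0 \<oplus>\<^bsub>amp n H\<^esub> y)"
      have "(\<lambda>M. hnorm (amp n H) (?Q \<eta>) * (q ^ M * ?C)) \<longlonglongrightarrow> hnorm (amp n H) (?Q \<eta>) * (0 * ?C)"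
        by (intro tendsto_mult tendsto_const LIMSEQ_realpow_zero q)
      then show "(\<lambda>M. hnorm (amp n H) (?Q \<eta>) * (q ^ M * ?C)) \<longlonglongrightarrow> 0" by simp
      show "\<forall>M. norm (ip (amp n H) (?Q \<eta>) (?p M \<oplus>\<^bsub>amp n H\<^esub> y)) \<le> hnorm (amp n H) (?Q \<eta>) * (q ^ M * ?C)"
      proof
        fix M
        show "norm (ip (amp n H) (?Q \<eta>) (?p M \<oplus>\<^bsub>amp n H\<^esub> y)) \<le> hnorm (amp n H) (?Q \<eta>) * (q ^ M * ?C)"
          by (rule order_trans[OF L.cauchy_schwarz[OF Qc[OF e] pyc] mult_left_mono[OF decay L.hnorm_nonneg[OF Qc[OF e]]]])
      qed
    qed simp
    then have "(\<lambda>M. ip (amp n H) (?Q \<eta>) (?p (Suc M) \<oplus>\<^bsub>amp n H\<^esub> y)) \<longlonglongrightarrow> 0" by (rule LIMSEQ_Suc)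
    then have "(\<lambda>M. ip (amp n H) (?Q \<eta>) (?p (Suc M)) + ip (amp n H) (?Q \<eta>) y) \<longlonglongrightarrow> 0"
      unfolding L.ip_add_right[OF Qc[OF e] pc yc] .
    moreover have "(\<lambda>M. ip (amp n H) (?Q \<eta>) (?p (Suc M)) + ip (amp n H) (?Q \<eta>) y) \<longlonglongrightarrow>
        cnj (ip (amp n K) (f n Z \<xi>) \<eta> - ip (amp n K) ?c0 \<eta>) + ip (amp n H) (?Q \<eta>) y"
      by (intro tendsto_add 1 tendsto_const)
    ultimately have "cnj (ip (amp n K) (f n Z \<xi>) \<eta> - ip (amp n K) ?c0 \<eta>) + ip (amp n H) (?Q \<eta>) y = 0"
      using LIMSEQ_unique by blast
    then have "ip (amp n H) (?Q \<eta>) y = cnj (ip (amp n K) ?c0 \<eta> - ip (amp n K) (f n Z \<xi>) \<eta>)"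
      by (simp add: add_eq_0_iff2 eq_neg_iff_add_eq_0 algebra_simps)
    also have "\<dots> = cnj (ip (amp n K) ?z \<eta>)" by (simp only: KA.ip_minus_left[OF c0c fc e])
    also have "\<dots> = ip (amp n K) \<eta> ?z" by (rule KA.ip_cnj[OF zc e, symmetric])
    finally show ?thesis .
  qed
  \<comment> \<open>The adjoint is a definite description, so its value at \<open>y\<close> is found by exhibiting the unique
    vector that represents \<open>\<eta> \<mapsto> \<langle>Q \<eta>, y\<rangle>\<close>.\<close>
  have "hadjoint (amp n K) (amp n H) ?Q y = (THE z. z \<in> carrier (amp n K) \<and>
      (\<forall>\<eta>\<in>carrier (amp n K). ip (amp n H) (?Q \<eta>) y = ip (amp n K) \<eta> z))"
    unfolding hadjoint_def by (simp only: restrict_apply yc if_True)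
  also have "\<dots> = ?z"
  proof (rule the_equality)
    show "?z \<in> carrier (amp n K) \<and> (\<forall>\<eta>\<in>carrier (amp n K). ip (amp n H) (?Q \<eta>) y = ip (amp n K) \<eta> ?z)"
      using zc adj by blast
    fix z assume zz: "z \<in> carrier (amp n K) \<and> (\<forall>\<eta>\<in>carrier (amp n K). ip (amp n H) (?Q \<eta>) y = ip (amp n K) \<eta> z)"
    have z: "z \<in> carrier (amp n K)" by (rule conjunct1[OF zz])
    show "z = ?z"
    proof (rule KA.eqI_ip[OF z zc])
      fix \<eta> assume e: "\<eta> \<in> carrier (amp n K)"
      have "ip (amp n K) \<eta> z = ip (amp n K) \<eta> ?z"
        by (rule trans[OF bspec[OF conjunct2[OF zz] e, symmetric] adj[OF e]])
      then show "ip (amp n K) z \<eta> = ip (amp n K) ?z \<eta>"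
        unfolding KA.ip_cnj[OF e z] KA.ip_cnj[OF e zc] by (rule arg_cong)
    qed
  qed
  finally have h: "hadjoint (amp n K) (amp n H) ?Q y = ?z" .
  have "f n Z \<xi> = ?c0 \<ominus>\<^bsub>amp n K\<^esub> ?z"
    by (rule KA.eqI_ip) (simp_all add: KA.ip_minus_left c0c fc)
  then show ?thesis unfolding y_def[symmetric] h .
qed

end

theorem theorem4p2:
  fixes K :: "'k hspace"
    and R2 :: "('k \<Rightarrow> 'k) set"
    and c :: "'d::finite list \<Rightarrow> 'k \<Rightarrow> 'k"
    and f :: "nat \<Rightarrow> ('d \<Rightarrow> complex mat) \<Rightarrow> (nat \<Rightarrow> 'k) \<Rightarrow> (nat \<Rightarrow> 'k)"
    and \<epsilon> :: real
  assumes "\<epsilon> > 0"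
    and "hilbert_space K"
    and "real_operator_system K R2"
    and "\<And>\<alpha>. c \<alpha> \<in> bounded_ops K K"
    and "power_series_on_ball K (1 + \<epsilon>) c f"
    and "\<And>n X. X \<in> ball_R n (1 + \<epsilon>) \<Longrightarrow> f n X \<in> hermitian_over K R2 n"
    and "matrix_monotone K (1 + \<epsilon>) f"
  shows "(\<forall>i. semi_inner_space (word_space K c i)) \<and>
    (\<forall>i. hilbert_space (H_comp K c i)) \<and>
    hilbert_space (H_space K c) \<and>
    Q_op K c \<in> bounded_ops K (H_space K c) \<and>
    (\<exists>!A. is_A K c A) \<and>
    (\<forall>A. is_A K c A \<longrightarrow>
      (\<forall>\<alpha>. \<forall>v\<in>carrier K. A (H_symbol K c \<alpha> v) =
         finsum (H_space K c) (\<lambda>i. H_symbol K c (i # \<alpha>) v) UNIV) \<and>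
      self_adjoint (H_space K c) A \<and>
      opnorm (H_space K c) (H_space K c) A \<le> 1 \<and>
      (\<forall>n. \<forall>Z\<in>ball_C n (1 + \<epsilon>). (\<forall>i. invertible_mat (Z i)) \<longrightarrow>
         op_invertible (amp n (H_space K c)) (pencil n K c A Z) \<and>
         (\<forall>\<xi>\<in>carrier (amp n K).
            f n Z \<xi> = tensor K K n (c []) (1\<^sub>m n) \<xi> \<ominus>\<^bsub>amp n K\<^esub>
              hadjoint (amp n K) (amp n (H_space K c)) (Q_amp n K c)
                (op_inverse (amp n (H_space K c)) (pencil n K c A Z) (Q_amp n K c \<xi>)))))"
proof -
  interpret M: monotone_series K c f "1 + \<epsilon>"
    by (rule monotone_series.intro) (use assms in simp_all)
  show ?thesis
    apply (intro conjI allI impI ballI)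
    apply (rule M.semi_inner_space_word_space)
    apply (rule M.hilbert_space_H_comp)
    apply (rule M.hilbert_space_H)
    apply (rule M.Q_bounded)
    apply (rule ex_ex1I, rule M.ex_A, erule M.is_A_unique, assumption)
    apply (erule M.is_A_symbol, assumption)
    apply (erule M.is_A_self_adjoint)
    apply (erule M.is_A_opnorm)
    apply (rule M.pencil_inverse(1), assumption+, erule spec)
    apply (rule M.realization_formula, assumption+, erule spec, assumption)
    done
qed

end
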